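(* Let $f\in C^1(\mathbb{R})$ satisfy, for all $s\in\mathbb{R}$, $f'(s)\ge\kappa|s|^{p-2}-l$, $f(s)s\ge\alpha|s|^p-\beta$ and $|f(s)|\le\sigma|s|^{p-1}+\sigma$, where $p>2$ and $l,\kappa,\alpha,\beta,\sigma>0$ are constants with $\alpha\le\frac{\kappa}{p-1}$. Let $\alpha_1,l_2>0$ be the constants of the decomposition $f=f_1+f_2$ described in the context and let $\mu:=\max\{2(l_2-\lambda),1\}$. Let $T>0$. Define $$a_1=b_1=1,\qquad a_{k+1}=a_k+\frac{p-2}{p},\qquad b_{k+1}=\frac{a_kb_k}{a_{k+1}}+\frac{2}{p\,a_{k+1}},\qquad k\in\mathbb{N}.$$ Then there exists a family of positive constants $\{C_T^{(k)}\}_{k\in\mathbb{N}}$, where each $C_T^{(k)}$ depends (besides $k$) exclusively on $T$ and the parameters $\mu,\alpha_1,p$, such that for any initial data $u_{0,1},u_{0,2}\in L^2(D)$ the difference $\bar u=u_1-u_2$ of the corresponding weak solutions of the reaction-diffusion problem in the context, with $\bar u_0=u_{0,1}-u_{0,2}$, satisfies for every $k\in\mathbb{N}$ $$t\,\big\|t^{b_k}\bar u(t)\big\|_{pa_k}^{pa_k}\le C_T^{(k)}\|\bar u_0\|^2,\qquad t\in(0,T],$$ and $$\int_0^T\big\|s^{b_{k+1}}\bar u(s)\big\|_{pa_{k+1}}^{pa_{k+1}}\,ds\le C_T^{(k)}\|\bar u_0\|^2 .$$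
   Context: Let $D\subset\mathbb{R}^N$ be a bounded smooth domain, $N\in\mathbb{N}$ ($N\ge1$ arbitrary), $\lambda>0$ a fixed number and $g\in L^2(D)$. The problem is $$\frac{du}{dt}+\lambda u-\Delta u+f(u)=g(x),\qquad u(0)=u_0,\qquad u|_{\partial D}=0 .$$ Under the stated growth conditions on $f$, for each $u_0\in L^2(D)$ it has a unique weak solution $u\in C([0,\infty);L^2(D))\cap L^p_{loc}(0,\infty;L^p(D))\cap L^2_{loc}(0,\infty;H_0^1(D))$. Notation: $\|\cdot\|_\gamma$ is the norm of $L^\gamma(D)$ and $\|\cdot\|=\|\cdot\|_2$. Decomposition: any such $f$ can be written $f=f_1+f_2$ with $f_1,f_2\in C^1(\mathbb{R})$ and positive constants $\alpha_1,\sigma_1,\kappa_2,l_2,\alpha_2,\beta_2,\sigma_2$ such that for all $s,s_1,s_2\in\mathbb{R}$: $(f_1(s_1)-f_1(s_2))(s_1-s_2)\ge\alpha_1|s_1-s_2|^p$; $|f_1(s_1)-f_1(s_2)|\le\sigma_1|s_1-s_2|(1+|s_1|^{p-2}+|s_2|^{p-2})$; $f_2'(s)\ge\kappa_2|s|^{p-2}-l_2$; $f_2(s)s\ge\alpha_2|s|^p-\beta_2$; $|f_2(s)|\le\sigma_2|s|^{p-1}+\sigma_2$; $\alpha_2\le\frac{\kappa_2}{p-1}$. The constants $\alpha_1,l_2$ are those of one fixed such decomposition. *)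

theory Defs
  imports "HOL-Analysis.Analysis"
begin

section \<open>The space R^N, for a natural number N\<close>

text \<open>The constants in the theorem must not depend on the dimension, so N has to be a
  bound variable of the statement and cannot be encoded in a type. Points of R^N are the functions
  \<^term>\<open>x :: nat \<Rightarrow> real\<close> that are \<^const>\<open>undefined\<close> outside \<^term>\<open>{..<N}\<close>; this is the common
  carrier of the library's product topology and product measure over the index set \<^term>\<open>{..<N}\<close>.\<close>

abbreviation RN :: "nat \<Rightarrow> (nat \<Rightarrow> real) topology" where
  "RN N \<equiv> powertop_real {..<N}"

text \<open>N-dimensional Lebesgue measure on a subset.\<close>

definition leb :: "nat \<Rightarrow> (nat \<Rightarrow> real) set \<Rightarrow> (nat \<Rightarrow> real) measure" where
  "leb N D = restrict_space (completion (PiM {..<N} (\<lambda>_. lborel))) D"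

definition pd :: "nat \<Rightarrow> ((nat \<Rightarrow> real) \<Rightarrow> real) \<Rightarrow> (nat \<Rightarrow> real) \<Rightarrow> real" where
  "pd i \<phi> x = deriv (\<lambda>t. \<phi> (x(i := t))) (x i)"

primrec Ck :: "nat \<Rightarrow> nat \<Rightarrow> ((nat \<Rightarrow> real) \<Rightarrow> real) \<Rightarrow> bool" where
  "Ck N 0 \<phi> \<longleftrightarrow> continuous_map (RN N) euclideanreal \<phi>"
| "Ck N (Suc k) \<phi> \<longleftrightarrow> continuous_map (RN N) euclideanreal \<phi> \<and>
     (\<forall>i<N. (\<forall>x\<in>topspace (RN N). (\<lambda>t. \<phi> (x(i := t))) differentiable (at (x i))) \<and> Ck N k (pd i \<phi>))"

definition Cinfty :: "nat \<Rightarrow> ((nat \<Rightarrow> real) \<Rightarrow> real) \<Rightarrow> bool" where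
  "Cinfty N \<phi> \<longleftrightarrow> (\<forall>k. Ck N k \<phi>)"

text \<open>Near each boundary point, and up to the choice of a coordinate axis and its orientation
  \<^term>\<open>e\<close>, the set is the strict epigraph of a smooth function of the remaining coordinates.\<close>

definition smooth_boundary :: "nat \<Rightarrow> (nat \<Rightarrow> real) set \<Rightarrow> bool" where
  "smooth_boundary N D \<longleftrightarrow>
     (\<forall>x \<in> RN N frontier_of D. \<exists>U i e \<gamma>.
        openin (RN N) U \<and> x \<in> U \<and> i < N \<and> e \<in> {-1, 1} \<and> Cinfty N \<gamma> \<and>
        (\<forall>y\<in>topspace (RN N). \<forall>t. \<gamma> (y(i := t)) = \<gamma> y) \<and>
        D \<inter> U = {y \<in> U. e * y i > \<gamma> y})"

definition bounded_smooth_domain :: "nat \<Rightarrow> (nat \<Rightarrow> real) set \<Rightarrow> bool" where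
  "bounded_smooth_domain N D \<longleftrightarrow>
     D \<noteq> {} \<and> openin (RN N) D \<and> connectedin (RN N) D \<and>
     (\<exists>R. \<forall>x\<in>D. \<forall>i<N. \<bar>x i\<bar> \<le> R) \<and> smooth_boundary N D"

section \<open>Lebesgue and Sobolev spaces\<close>

text \<open>Elements of the spaces are represented by functions, not by classes modulo a.e. equality.
  \<^term>\<open>Lnorm M q v\<close> is meaningful only for \<^term>\<open>v \<in> Lspace M q\<close>.\<close>

definition Lspace :: "'a measure \<Rightarrow> real \<Rightarrow> ('a \<Rightarrow> real) set" where
  "Lspace M q = {v \<in> borel_measurable M. integrable M (\<lambda>x. \<bar>v x\<bar> powr q)}"

definition Lnorm :: "'a measure \<Rightarrow> real \<Rightarrow> ('a \<Rightarrow> real) \<Rightarrow> real" where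
  "Lnorm M q v = (LINT x|M. \<bar>v x\<bar> powr q) powr (1 / q)"

definition pairing :: "'a measure \<Rightarrow> ('a \<Rightarrow> real) \<Rightarrow> ('a \<Rightarrow> real) \<Rightarrow> real" where
  "pairing M v w = (LINT x|M. v x * w x)"

definition test_functions :: "nat \<Rightarrow> (nat \<Rightarrow> real) set \<Rightarrow> ((nat \<Rightarrow> real) \<Rightarrow> real) set" where
  "test_functions N D =
     {\<phi>. Cinfty N \<phi> \<and> (\<exists>K. compactin (RN N) K \<and> K \<subseteq> D \<and> (\<forall>x\<in>topspace (RN N) - K. \<phi> x = 0))}"

definition is_weak_pd ::
  "nat \<Rightarrow> (nat \<Rightarrow> real) set \<Rightarrow> nat \<Rightarrow> ((nat \<Rightarrow> real) \<Rightarrow> real) \<Rightarrow> ((nat \<Rightarrow> real) \<Rightarrow> real) \<Rightarrow> bool" where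
  "is_weak_pd N D i v w \<longleftrightarrow>
     w \<in> Lspace (leb N D) 2 \<and>
     (\<forall>\<phi>\<in>test_functions N D. pairing (leb N D) v (pd i \<phi>) = - pairing (leb N D) w \<phi>)"

definition H1 :: "nat \<Rightarrow> (nat \<Rightarrow> real) set \<Rightarrow> ((nat \<Rightarrow> real) \<Rightarrow> real) set" where
  "H1 N D = {v \<in> Lspace (leb N D) 2. \<forall>i<N. \<exists>w. is_weak_pd N D i v w}"

text \<open>The weak partial derivative is unique up to a null set; one representative is chosen.\<close>

definition weak_pd ::
  "nat \<Rightarrow> (nat \<Rightarrow> real) set \<Rightarrow> nat \<Rightarrow> ((nat \<Rightarrow> real) \<Rightarrow> real) \<Rightarrow> (nat \<Rightarrow> real) \<Rightarrow> real" where
  "weak_pd N D i v = (SOME w. is_weak_pd N D i v w)"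

definition H1norm :: "nat \<Rightarrow> (nat \<Rightarrow> real) set \<Rightarrow> ((nat \<Rightarrow> real) \<Rightarrow> real) \<Rightarrow> real" where
  "H1norm N D v =
     sqrt ((Lnorm (leb N D) 2 v)\<^sup>2 + (\<Sum>i<N. (Lnorm (leb N D) 2 (weak_pd N D i v))\<^sup>2))"

definition H10 :: "nat \<Rightarrow> (nat \<Rightarrow> real) set \<Rightarrow> ((nat \<Rightarrow> real) \<Rightarrow> real) set" where
  "H10 N D = {v \<in> H1 N D. \<exists>\<phi>. (\<forall>n::nat. \<phi> n \<in> test_functions N D) \<and>
                (\<lambda>n. H1norm N D (\<lambda>x. v x - \<phi> n x)) \<longlonglongrightarrow> 0}"

section \<open>Bochner spaces and weak solutions\<close>

text \<open>Strong (Bochner) measurability on I of a map u into the space X of functions normed by nrm: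
  almost everywhere u is the limit of simple X-valued functions.\<close>

definition bochner_measurable_on ::
  "real set \<Rightarrow> ('a \<Rightarrow> real) set \<Rightarrow> (('a \<Rightarrow> real) \<Rightarrow> real) \<Rightarrow> (real \<Rightarrow> 'a \<Rightarrow> real) \<Rightarrow> bool" where
  "bochner_measurable_on I X nrm u \<longleftrightarrow>
     (\<exists>s. (\<forall>n::nat. finite (s n ` I) \<and> s n ` I \<subseteq> X \<and> (\<forall>w. {t\<in>I. s n t = w} \<in> sets lebesgue)) \<and>
          (AE t in lebesgue_on I. (\<lambda>n. nrm (\<lambda>x. u t x - s n t x)) \<longlonglongrightarrow> 0))"

text \<open>The space of locally q-integrable maps from the open half-line to X; ``locally'' refers to
  compact subintervals of the open half-line.\<close>

definition Lloc ::
  "real \<Rightarrow> ('a \<Rightarrow> real) set \<Rightarrow> (('a \<Rightarrow> real) \<Rightarrow> real) \<Rightarrow> (real \<Rightarrow> 'a \<Rightarrow> real) set" where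
  "Lloc q X nrm = {u. \<forall>a b. 0 < a \<and> a < b \<longrightarrow>
     (AE t in lebesgue_on {a..b}. u t \<in> X) \<and>
     bochner_measurable_on {a..b} X nrm u \<and>
     integrable (lebesgue_on {a..b}) (\<lambda>t. nrm (u t) powr q)}"

definition cont_L2 :: "'a measure \<Rightarrow> (real \<Rightarrow> 'a \<Rightarrow> real) set" where
  "cont_L2 M = {u. \<forall>t\<ge>0. u t \<in> Lspace M 2 \<and>
     ((\<lambda>s. Lnorm M 2 (\<lambda>x. u s x - u t x)) \<longlongrightarrow> 0) (at t within {0..})}"

definition time_test :: "(real \<Rightarrow> real) set" where
  "time_test = {\<eta>. (\<forall>n t. ((deriv ^^ n) \<eta>) differentiable (at t)) \<and>
     (\<exists>a b. 0 < a \<and> a < b \<and> (\<forall>t. t \<notin> {a..b} \<longrightarrow> \<eta> t = 0))}"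

text \<open>The equation holds as d/dt (u,v) + lam (u,v) + (grad u, grad v) + (f(u),v) = (g,v) in the
  sense of scalar distributions on the open half-line, for every v in the intersection of H10 and
  Lp.\<close>

definition weak_solution ::
  "nat \<Rightarrow> (nat \<Rightarrow> real) set \<Rightarrow> real \<Rightarrow> real \<Rightarrow> (real \<Rightarrow> real) \<Rightarrow> ((nat \<Rightarrow> real) \<Rightarrow> real) \<Rightarrow>
   ((nat \<Rightarrow> real) \<Rightarrow> real) \<Rightarrow> (real \<Rightarrow> (nat \<Rightarrow> real) \<Rightarrow> real) \<Rightarrow> bool" where
  "weak_solution N D p lam f g u0 u \<longleftrightarrow>
     u \<in> cont_L2 (leb N D) \<inter> Lloc p (Lspace (leb N D) p) (Lnorm (leb N D) p)
           \<inter> Lloc 2 (H10 N D) (H1norm N D) \<and>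
     (AE x in leb N D. u 0 x = u0 x) \<and>
     (\<forall>v \<in> H10 N D \<inter> Lspace (leb N D) p. \<forall>\<eta>\<in>time_test.
        (LINT t|lebesgue_on {0<..}.
            - (deriv \<eta> t * pairing (leb N D) (u t) v)
            + \<eta> t * (lam * pairing (leb N D) (u t) v
                    + (\<Sum>i<N. pairing (leb N D) (weak_pd N D i (u t)) (weak_pd N D i v))
                    + pairing (leb N D) (\<lambda>x. f (u t x)) v))
        = (LINT t|lebesgue_on {0<..}. \<eta> t * pairing (leb N D) g v))"

section \<open>Structure conditions and exponents\<close>

definition growth_conditions ::
  "real \<Rightarrow> real \<Rightarrow> real \<Rightarrow> real \<Rightarrow> real \<Rightarrow> real \<Rightarrow> (real \<Rightarrow> real) \<Rightarrow> bool" where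
  "growth_conditions p l \<kappa> \<alpha> \<beta> \<sigma> f \<longleftrightarrow>
     f C1_differentiable_on UNIV \<and>
     l > 0 \<and> \<kappa> > 0 \<and> \<alpha> > 0 \<and> \<beta> > 0 \<and> \<sigma> > 0 \<and> \<alpha> \<le> \<kappa> / (p - 1) \<and>
     (\<forall>s. deriv f s \<ge> \<kappa> * \<bar>s\<bar> powr (p - 2) - l) \<and>
     (\<forall>s. f s * s \<ge> \<alpha> * \<bar>s\<bar> powr p - \<beta>) \<and>
     (\<forall>s. \<bar>f s\<bar> \<le> \<sigma> * \<bar>s\<bar> powr (p - 1) + \<sigma>)"

definition monotone_part_conditions ::
  "real \<Rightarrow> real \<Rightarrow> real \<Rightarrow> (real \<Rightarrow> real) \<Rightarrow> bool" where
  "monotone_part_conditions p \<alpha>1 \<sigma>1 f1 \<longleftrightarrow>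
     f1 C1_differentiable_on UNIV \<and> \<alpha>1 > 0 \<and> \<sigma>1 > 0 \<and>
     (\<forall>s1 s2. (f1 s1 - f1 s2) * (s1 - s2) \<ge> \<alpha>1 * \<bar>s1 - s2\<bar> powr p) \<and>
     (\<forall>s1 s2. \<bar>f1 s1 - f1 s2\<bar> \<le> \<sigma>1 * \<bar>s1 - s2\<bar> * (1 + \<bar>s1\<bar> powr (p - 2) + \<bar>s2\<bar> powr (p - 2)))"

definition decomposition ::
  "real \<Rightarrow> real \<Rightarrow> real \<Rightarrow> real \<Rightarrow> real \<Rightarrow> real \<Rightarrow> real \<Rightarrow> real \<Rightarrow>
   (real \<Rightarrow> real) \<Rightarrow> (real \<Rightarrow> real) \<Rightarrow> (real \<Rightarrow> real) \<Rightarrow> bool" where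
  "decomposition p \<alpha>1 \<sigma>1 l2 \<kappa>2 \<alpha>2 \<beta>2 \<sigma>2 f f1 f2 \<longleftrightarrow>
     (\<forall>s. f s = f1 s + f2 s) \<and>
     monotone_part_conditions p \<alpha>1 \<sigma>1 f1 \<and> growth_conditions p l2 \<kappa>2 \<alpha>2 \<beta>2 \<sigma>2 f2"

text \<open>The sequences are indexed from 1; the values at 0 are irrelevant.\<close>

fun a_seq :: "real \<Rightarrow> nat \<Rightarrow> real" where
  "a_seq p 0 = 0"
| "a_seq p (Suc 0) = 1"
| "a_seq p (Suc (Suc k)) = a_seq p (Suc k) + (p - 2) / p"

fun b_seq :: "real \<Rightarrow> nat \<Rightarrow> real" where
  "b_seq p 0 = 0"
| "b_seq p (Suc 0) = 1"
| "b_seq p (Suc (Suc k)) =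
     a_seq p (Suc k) * b_seq p (Suc k) / a_seq p (Suc (Suc k)) + 2 / (p * a_seq p (Suc (Suc k)))"

end

theory Submission
  imports Defs "HOL-Real_Asymp.Real_Asymp"
begin

text \<open>Test the equation for the difference w of two solutions with smooth bounded truncations of
  \<open>\<bar>w\<bar>\<^sup>q\<^sup>-\<^sup>2 w\<close>. The gradient term has a sign and the strong monotonicity of the first part of f gives
  \<open>\<parallel>w(t)\<parallel>\<^sub>q\<^sup>q + q \<alpha>\<^sub>1 \<integral> \<parallel>w\<parallel>\<^sub>q\<^sub>+\<^sub>p\<^sub>-\<^sub>2\<^sup>q\<^sup>+\<^sup>p\<^sup>-\<^sup>2 \<le> \<parallel>w(s)\<parallel>\<^sub>q\<^sup>q + (q \<mu> / 2) \<integral> \<parallel>w\<parallel>\<^sub>q\<^sup>q\<close>, the integrals being over [s, t].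
  No chain rule for the weak time derivative is used: by convexity of the truncated power, the increment of
  its integral over each interval of a partition is at most the increment of w tested with the
  derivative at the right end point; the partition points are chosen where the gradient norm is below
  average, so that the sums converge to the time integrals as the mesh tends to zero. Averaging over s
  against a power of s and integrating in t with Tonelli's theorem turns a weighted space-time bound
  for the exponent q into one for q + p - 2, starting from the Gronwall bound for q = 2.\<close>

section \<open>Smooth functions of one variable\<close>

text \<open>The obstacle is regularity: a weak solution is continuous into L^2 only, it is tested
  with functions independent of time, and |w|^(q-2) w is not known to be an admissible test
  function. Bounded smooth truncations are, since H10 is the closure of the test functions and
  smooth maps fixing 0 preserve those. Powers of w are integrated with values in [0, infinity], so
  that finiteness is a result of the iteration.

  The nonlinearity reaches the constants only through (f r - f s)(r - s) >= \<alpha>1 |r - s|^p - l2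
  (r - s)^2, and \<mu> dominates 2 (l2 - lam). Integrability is gained from this inequality, the
  gradient is discarded, and so nothing depending on N or D enters the constants.

  The exponents that occur are 2 + k (p - 2), equal to p a_k for k >= 1. The iteration yields t^k
  times the integral of |w(t)| to this exponent, and the time integral of s^k times that of the next
  exponent. As b_k p a_k = p + 2 (k - 1), the theorem has the higher powers t^(p + 2k - 1) and s^(p
  + 2k); the surplus is bounded by powers of T.\<close>

primrec differentiable_times :: "nat \<Rightarrow> (real \<Rightarrow> real) \<Rightarrow> bool" where
  "differentiable_times 0 f \<longleftrightarrow> True"
| "differentiable_times (Suc k) f \<longleftrightarrow>
     (\<exists>f'. (\<forall>x. (f has_real_derivative f' x) (at x)) \<and> differentiable_times k f')"

text \<open>Encoded by iterated existence of a derivative instead of iterates of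
  \<open>deriv\<close>: the closure rules are then inductions on the order, with the functions left
  arbitrary. \<open>smooth_deriv\<close> gives the link back to \<open>deriv\<close>.\<close>

definition smooth :: "(real \<Rightarrow> real) \<Rightarrow> bool" where
  "smooth f \<longleftrightarrow> (\<forall>k. differentiable_times k f)"

lemma differentiable_times_mono: "differentiable_times (Suc k) f \<Longrightarrow> differentiable_times k f"
  by (induction k arbitrary: f) auto

lemma differentiable_times_const: "differentiable_times k (\<lambda>x. c)"
  by (induction k arbitrary: c) (auto intro!: exI[of _ "\<lambda>x. 0"])

lemma differentiable_times_add:
  assumes "differentiable_times k f" "differentiable_times k g"
  shows "differentiable_times k (\<lambda>x. f x + g x)"
  using assms
proof (induction k arbitrary: f g)
  case (Suc k)
  then obtain f' g' where "\<And>x. (f has_real_derivative f' x) (at x)" "differentiable_times k f'"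
    "\<And>x. (g has_real_derivative g' x) (at x)" "differentiable_times k g'" by auto
  then show ?case using Suc.IH[of f' g']
    by (auto intro!: exI[of _ "\<lambda>x. f' x + g' x"] derivative_eq_intros)
qed auto

lemma differentiable_times_mult:
  assumes "differentiable_times k f" "differentiable_times k g"
  shows "differentiable_times k (\<lambda>x. f x * g x)"
  using assms
proof (induction k arbitrary: f g)
  case (Suc k)
  then obtain f' g' where d: "\<And>x. (f has_real_derivative f' x) (at x)" "differentiable_times k f'"
    "\<And>x. (g has_real_derivative g' x) (at x)" "differentiable_times k g'" by auto
  have "differentiable_times k (\<lambda>x. f' x * g x + f x * g' x)"
    using Suc.IH d Suc.prems differentiable_times_mono by (intro differentiable_times_add) blast+
  then show ?case using d
    by (auto intro!: exI[of _ "\<lambda>x. f' x * g x + f x * g' x"] derivative_eq_intros)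
qed auto

lemma differentiable_times_compose:
  assumes "differentiable_times k f" "differentiable_times k g"
  shows "differentiable_times k (\<lambda>x. f (g x))"
  using assms
proof (induction k arbitrary: f g)
  case (Suc k)
  then obtain f' g' where d: "\<And>x. (f has_real_derivative f' x) (at x)" "differentiable_times k f'"
    "\<And>x. (g has_real_derivative g' x) (at x)" "differentiable_times k g'" by auto
  have "differentiable_times k (\<lambda>x. f' (g x) * g' x)"
    using Suc.IH[of f' g] d Suc.prems differentiable_times_mono by (intro differentiable_times_mult) blast+
  moreover have "((\<lambda>x. f (g x)) has_real_derivative f' (g x) * g' x) (at x)" for x
    using DERIV_chain2 d by blast
  ultimately show ?case by (auto intro: exI[of _ "\<lambda>x. f' (g x) * g' x"])
qed auto

lemma smooth_const: "smooth (\<lambda>x. c)"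
  by (simp add: smooth_def differentiable_times_const)

lemma smooth_id: "smooth (\<lambda>x. x)"
  unfolding smooth_def
proof
  fix k show "differentiable_times k (\<lambda>x. x)"
    by (cases k) (auto intro!: exI[of _ "\<lambda>x. 1"] differentiable_times_const derivative_eq_intros)
qed

lemma smooth_add: "smooth f \<Longrightarrow> smooth g \<Longrightarrow> smooth (\<lambda>x. f x + g x)"
  by (simp add: smooth_def differentiable_times_add)

lemma smooth_mult: "smooth f \<Longrightarrow> smooth g \<Longrightarrow> smooth (\<lambda>x. f x * g x)"
  by (simp add: smooth_def differentiable_times_mult)

lemma smooth_diff: "smooth f \<Longrightarrow> smooth g \<Longrightarrow> smooth (\<lambda>x. f x - g x)"
  using smooth_add[of f "\<lambda>x. - 1 * g x"] smooth_mult[OF smooth_const[of "-1"], of g] by simp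

lemma smooth_compose: "smooth f \<Longrightarrow> smooth g \<Longrightarrow> smooth (\<lambda>x. f (g x))"
  by (simp add: smooth_def differentiable_times_compose)

lemmas smooth_intros = smooth_const smooth_id smooth_add smooth_diff smooth_mult

lemma smooth_primitive:
  assumes "\<And>x. (F has_real_derivative f x) (at x)" "smooth f"
  shows "smooth F"
  unfolding smooth_def
proof
  fix k show "differentiable_times k F" using assms by (cases k) (auto simp: smooth_def)
qed

lemma smooth_deriv:
  assumes "smooth f"
  shows "(f has_real_derivative deriv f x) (at x)" "smooth (deriv f)"
proof -
  have 1: "(f has_real_derivative deriv f x) (at x)" for x
  proof -
    have "differentiable_times (Suc 0) f" using assms unfolding smooth_def by blast
    then show ?thesis using DERIV_deriv_iff_real_differentiable real_differentiable_def by fastforce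
  qed
  then show "(f has_real_derivative deriv f x) (at x)" .
  show "smooth (deriv f)" unfolding smooth_def
  proof
    fix k
    have "differentiable_times (Suc k) f" using assms unfolding smooth_def by blast
    then obtain f' where f': "\<And>x. (f has_real_derivative f' x) (at x)" "differentiable_times k f'" by auto
    then have "f' = deriv f" using 1 DERIV_unique by blast
    then show "differentiable_times k (deriv f)" using f' by simp
  qed
qed

lemma smooth_isCont: "smooth f \<Longrightarrow> isCont f x"
  using smooth_deriv(1) DERIV_isCont by blast

lemma smooth_continuous_on: "smooth f \<Longrightarrow> continuous_on S f"
  using smooth_isCont continuous_at_imp_continuous_on by blast

lemma smooth_funpow_deriv: "smooth f \<Longrightarrow> smooth ((deriv ^^ n) f)"
  by (induction n) (auto intro: smooth_deriv)

lemma smooth_funpow_deriv_differentiable: "smooth f \<Longrightarrow> ((deriv ^^ n) f) differentiable (at t)"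
  using smooth_funpow_deriv smooth_deriv(1) real_differentiable_def by blast

text \<open>For \<^term>\<open>c > 0\<close> the essential singularity makes this function flat at the origin for every
  exponent, so that the family is closed under differentiation up to linear combinations.\<close>

definition flat :: "real \<Rightarrow> real \<Rightarrow> real \<Rightarrow> real" where
  "flat a c x = (if x > 0 then x powr a * exp (- c / x) else 0)"

lemma flat_nonneg: "0 \<le> flat a c x"
  by (simp add: flat_def)

lemma flat_tendsto_0:
  assumes "c > 0"
  shows "((\<lambda>x. flat a c x) \<longlongrightarrow> 0) (at_right 0)"
proof -
  have "((\<lambda>x::real. x powr a * exp (- c / x)) \<longlongrightarrow> 0) (at_right 0)"
    using assms by real_asymp
  moreover have "\<forall>\<^sub>F x in at_right 0. x powr a * exp (- c / x) = flat a c x"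
    unfolding flat_def by (auto simp: eventually_at_right_less eventually_at_filter)
  ultimately show ?thesis by (simp cong: tendsto_cong)
qed

lemma flat_deriv:
  assumes "c > 0"
  shows "(flat a c has_real_derivative a * flat (a - 1) c x + c * flat (a - 2) c x) (at x)"
proof -
  consider "x < 0" | "x > 0" | "x = 0" by linarith
  then show ?thesis
  proof cases
    case 1
    have "((\<lambda>x. 0) has_real_derivative 0) (at x)" by simp
    then have "(flat a c has_real_derivative 0) (at x)"
      by (rule has_field_derivative_transform_within_open[where S="{..<0}"])
        (use 1 in \<open>auto simp: flat_def\<close>)
    then show ?thesis using 1 by (simp add: flat_def)
  next
    case 2
    have p: "x powr (a - 2) = x powr a / x^2" using 2
      by (simp add: powr_diff powr_numeral)
    have "((\<lambda>x. x powr a * exp (- c / x)) has_real_derivative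
       (a * x powr (a - 1) * exp (- c / x) + x powr a * (exp (- c / x) * (c / x^2)))) (at x)"
      using 2 by (auto intro!: derivative_eq_intros simp: power2_eq_square)
    then have "(flat a c has_real_derivative
       (a * x powr (a - 1) * exp (- c / x) + x powr a * (exp (- c / x) * (c / x^2)))) (at x)"
      by (rule has_field_derivative_transform_within_open[where S="{0<..}"])
        (use 2 in \<open>auto simp: flat_def\<close>)
    then show ?thesis using 2 p by (simp add: flat_def algebra_simps)
  next
    case 3
    \<comment> \<open>To the right of the origin the difference quotient is
      \<open>flat (a - 1) c\<close> itself, which tends to 0.\<close>
    have "((\<lambda>h. (flat a c (0 + h) - flat a c 0) / h) \<longlongrightarrow> 0) (at_right 0)"
    proof (rule Lim_transform_eventually[OF flat_tendsto_0[OF assms, of "a - 1"]])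
      show "\<forall>\<^sub>F x in at_right 0. flat (a - 1) c x = (flat a c (0 + x) - flat a c 0) / x"
        unfolding eventually_at_filter
        by (rule always_eventually) (auto simp: flat_def powr_diff)
    qed
    moreover have "((\<lambda>h. (flat a c (0 + h) - flat a c 0) / h) \<longlongrightarrow> 0) (at_left 0)"
      by (rule tendsto_eventually) (auto simp: eventually_at_filter flat_def)
    ultimately have "((\<lambda>h. (flat a c (0 + h) - flat a c 0) / h) \<longlongrightarrow> 0) (at 0)"
      using filterlim_split_at by blast
    then have "(flat a c has_real_derivative 0) (at 0)" by (simp add: DERIV_def)
    then show ?thesis using 3 by (simp add: flat_def)
  qed
qed

lemma smooth_flat:
  assumes "c > 0"
  shows "smooth (flat a c)"
  unfolding smooth_def
proof
  fix k show "differentiable_times k (flat a c)"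
  proof (induction k arbitrary: a)
    case (Suc k)
    have "differentiable_times k (\<lambda>x. a * flat (a - 1) c x + c * flat (a - 2) c x)"
      using Suc by (intro differentiable_times_add differentiable_times_mult differentiable_times_const) auto
    then show ?case using flat_deriv[OF assms]
      by (auto intro!: exI[of _ "\<lambda>x. a * flat (a - 1) c x + c * flat (a - 2) c x"])
  qed simp
qed

lemma flat_bounds: "c > 0 \<Longrightarrow> x \<ge> 0 \<Longrightarrow> flat a c x \<le> x powr a"
  by (auto simp: flat_def mult_left_le)

lemma flat_tendsto:
  assumes "c \<longlonglongrightarrow> 0" "x > 0"
  shows "(\<lambda>n. flat a (c n) x) \<longlonglongrightarrow> x powr a"
proof -
  have "(\<lambda>n. x powr a * exp (- c n / x)) \<longlonglongrightarrow> x powr a * exp (- 0 / x)"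
    using assms by (intro tendsto_intros) auto
  then show ?thesis using assms by (simp add: flat_def)
qed

text \<open>\<open>flat 0 1\<close> is the basic smooth cutoff: exp (-1/x) for positive x, zero
  elsewhere, with limit 1 at infinity. The truncated powers, the bumps on boxes and the smooth step
  in time are all built from it.\<close>

lemma flat_one_tendsto:
  assumes "filterlim y at_top sequentially"
  shows "(\<lambda>n. flat 0 1 (y n)) \<longlonglongrightarrow> 1"
proof -
  have "((\<lambda>x::real. exp (- 1 / x)) \<longlongrightarrow> 1) at_top" by real_asymp
  then have "((\<lambda>x. flat 0 1 x) \<longlongrightarrow> 1) at_top"
    by (rule Lim_transform_eventually) (auto simp: flat_def eventually_at_top_dense)
  then show ?thesis using filterlim_compose assms by blast
qed

lemma flat_0_1_bounds: "0 \<le> flat 0 1 x" "flat 0 1 x \<le> 1"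
  by (auto simp: flat_def)

section \<open>Antiderivatives and the smooth truncations of powers\<close>

lemma antiderivative_exists:
  fixes f :: "real \<Rightarrow> real"
  assumes "\<And>x. isCont f x"
  shows "\<exists>F. F 0 = 0 \<and> (\<forall>x. (F has_real_derivative f x) (at x))"
proof -
  have "\<exists>F. \<forall>x. -\<infinity> < ereal x \<longrightarrow> ereal x < \<infinity> \<longrightarrow> (F has_vector_derivative f x) (at x)"
    by (rule einterval_antiderivative) (auto simp: assms)
  then obtain F where F: "\<And>x. (F has_real_derivative f x) (at x)"
    by (auto simp: has_real_derivative_iff_has_vector_derivative)
  have "((\<lambda>x. F x - F 0) has_real_derivative f x) (at x)" for x
    using DERIV_diff[OF F[of x] DERIV_const[of "F 0"]] by simp
  then show ?thesis by (intro exI[of _ "\<lambda>x. F x - F 0"]) simp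
qed

text \<open>Together with the odd case this reduces all bounds on the iterated antiderivatives to
  nonnegative arguments.\<close>

lemma antiderivative_even:
  fixes F f :: "real \<Rightarrow> real"
  assumes "F 0 = 0" "\<And>x. (F has_real_derivative f x) (at x)" "\<And>x. f (-x) = f x"
  shows "F (-x) = - F x"
proof -
  have "((\<lambda>x. F x + F (-x)) has_real_derivative 0) (at x)" for x
  proof -
    have "((\<lambda>x. F (-x)) has_real_derivative f (-x) * (-1)) (at x)"
      by (rule DERIV_chain2[OF assms(2)]) (auto intro!: derivative_eq_intros)
    then show ?thesis using DERIV_add[OF assms(2)[of x], of "\<lambda>x. F (-x)" "f (-x) * (-1)"] assms(3)[of x]
      by simp
  qed
  then have "F x + F (-x) = F 0 + F (- 0)" using DERIV_isconst_all by blast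
  then show ?thesis using assms(1) by simp
qed

lemma antiderivative_odd:
  fixes F f :: "real \<Rightarrow> real"
  assumes "\<And>x. (F has_real_derivative f x) (at x)" "\<And>x. f (-x) = - f x"
  shows "F (-x) = F x"
proof -
  have "((\<lambda>x. F x - F (-x)) has_real_derivative 0) (at x)" for x
  proof -
    have "((\<lambda>x. F (-x)) has_real_derivative f (-x) * (-1)) (at x)"
      by (rule DERIV_chain2[OF assms(1)]) (auto intro!: derivative_eq_intros)
    then show ?thesis using DERIV_diff[OF assms(1)[of x], of "\<lambda>x. F (-x)" "f (-x) * (-1)"] assms(2)[of x]
      by simp
  qed
  then have "F x - F (-x) = F 0 - F (- 0)" using DERIV_isconst_all by blast
  then show ?thesis by simp
qed

text \<open>Bounds and pointwise convergence survive integration from 0, by dominated convergence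
  with the limiting power as majorant. It is applied twice: from the second derivatives to the first
  with exponent q - 2, and from there to the truncated powers with exponent q - 1.\<close>

lemma antiderivative_power_limit:
  fixes f F :: "nat \<Rightarrow> real \<Rightarrow> real"
  assumes F: "\<And>n. F n 0 = 0" "\<And>n x. (F n has_real_derivative f n x) (at x)"
    and f: "\<And>n x. x \<ge> 0 \<Longrightarrow> 0 \<le> f n x" "\<And>n x. x \<ge> 0 \<Longrightarrow> f n x \<le> c * x powr a"
      "\<And>x. x \<ge> 0 \<Longrightarrow> (\<lambda>n. f n x) \<longlonglongrightarrow> c * x powr a"
    and a: "a \<ge> 0" and s: "s \<ge> (0::real)"
  shows "0 \<le> F n s" "F n s \<le> c * s powr (a + 1) / (a + 1)"
    "(\<lambda>n. F n s) \<longlonglongrightarrow> c * s powr (a + 1) / (a + 1)"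
proof -
  have F_int: "(f n has_integral F n s) {0..s}" for n
    using fundamental_theorem_of_calculus[OF s, of "F n" "f n"] F
    by (simp add: has_real_derivative_iff_has_vector_derivative has_vector_derivative_at_within)
  have "((\<lambda>x. c * x powr a) has_integral (c * s powr (a + 1) / (a + 1) - c * 0 powr (a + 1) / (a + 1))) {0..s}"
  \<comment> \<open>The differentiation rule for real powers is applied at positive points only, so
    the end point 0 is covered by continuity.\<close>
  proof (rule fundamental_theorem_of_calculus_interior[OF s])
    show "continuous_on {0..s} (\<lambda>a'. c * a' powr (a + 1) / (a + 1))"
      using a by (intro continuous_intros continuous_on_powr') auto
    fix x assume "x \<in> {0<..<s}"
    then show "((\<lambda>a'. c * a' powr (a + 1) / (a + 1)) has_vector_derivative c * x powr a) (at x)"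
      unfolding has_real_derivative_iff_has_vector_derivative[symmetric]
      using a by (auto intro!: derivative_eq_intros)
  qed
  then have G_int: "((\<lambda>x. c * x powr a) has_integral c * s powr (a + 1) / (a + 1)) {0..s}" by simp
  show "0 \<le> F n s" using has_integral_nonneg[OF F_int] f(1) by auto
  show "F n s \<le> c * s powr (a + 1) / (a + 1)" using has_integral_le[OF F_int G_int] f(2) by auto
  have "(\<lambda>n. integral {0..s} (f n)) \<longlonglongrightarrow> integral {0..s} (\<lambda>x. c * x powr a)"
    by (rule dominated_convergence(2)[where h="\<lambda>x. c * x powr a"])
      (use F_int G_int f in auto)
  then show "(\<lambda>n. F n s) \<longlonglongrightarrow> c * s powr (a + 1) / (a + 1)"
    unfolding integral_unique[OF F_int] integral_unique[OF G_int] .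
qed

text \<open>The second derivatives \<^term>\<open>\<phi> n\<close> of the truncated powers increase to
  \<^term>\<open>(q - 1) * \<bar>s\<bar> powr (q - 2)\<close>, have compact support and are smooth also at the origin.\<close>

lemma smooth_power_approximation:
  fixes q :: real
  assumes q: "q \<ge> 2"
  obtains \<Phi> \<Psi> \<phi> :: "nat \<Rightarrow> real \<Rightarrow> real" and K :: "nat \<Rightarrow> real" where
    "\<And>n. smooth (\<Phi> n)" "\<And>n s. (\<Phi> n has_real_derivative \<phi> n s) (at s)" "\<And>n s. 0 \<le> \<phi> n s"
    "\<And>n s. \<phi> n s \<le> K n" "\<And>n s. \<bar>\<Phi> n s\<bar> \<le> K n" "\<And>n s. 0 \<le> \<Phi> n s * s"
    "\<And>n s. (\<Psi> n has_real_derivative \<Phi> n s) (at s)" "\<And>n s. 0 \<le> \<Psi> n s"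
    "\<And>n s. \<bar>\<Phi> n s\<bar> \<le> \<bar>s\<bar> powr (q - 1)" "\<And>n s. \<Psi> n s \<le> \<bar>s\<bar> powr q / q"
    "\<And>s. (\<lambda>n. \<bar>\<Phi> n s\<bar>) \<longlonglongrightarrow> \<bar>s\<bar> powr (q - 1)" "\<And>s. (\<lambda>n. \<Psi> n s) \<longlonglongrightarrow> \<bar>s\<bar> powr q / q"
proof -
  \<comment> \<open>Powers of \<open>s * s\<close> instead of powers of the absolute value keep the
    function smooth and even. The first \<open>flat\<close> factor flattens (s^2)^((q-2)/2) at the
    origin, with strength 1/(n+1) tending to 0; the second cuts off where s^2 reaches n + 1.\<close>
  define b where "b n s = (q - 1) * (flat ((q - 2) / 2) (1 / real (Suc n)) (s * s) * flat 0 1 (real (Suc n) - s * s))" for n s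
  have sm: "smooth (b n)" for n
  proof -
    have "smooth (\<lambda>s. flat ((q - 2) / 2) (1 / real (Suc n)) (s * s))"
      by (rule smooth_compose[of "flat _ _" "\<lambda>s. s * s"])
        (auto intro: smooth_flat smooth_mult smooth_id)
    moreover have "smooth (\<lambda>s. flat 0 1 (real (Suc n) - s * s))"
      by (rule smooth_compose[of "flat _ _" "\<lambda>s. real (Suc n) - s * s"])
        (intro smooth_flat smooth_mult smooth_id smooth_diff smooth_const zero_less_one)+
    ultimately show ?thesis unfolding b_def by (intro smooth_mult smooth_const)
  qed
  have b0: "0 \<le> b n s" for n s
    using q by (simp add: b_def flat_nonneg)
  have sq: "(s * s) powr ((q - 2) / 2) = s powr (q - 2)" if "s \<ge> 0" for s
    using that by (simp add: powr_mult flip: powr_add)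
  have bu: "b n s \<le> (q - 1) * s powr (q - 2)" if "s \<ge> 0" for n s
  proof -
    have "flat ((q - 2) / 2) (1 / real (Suc n)) (s * s) * flat 0 1 (real (Suc n) - s * s) \<le> s powr (q - 2) * 1"
      using flat_bounds[of "1 / real (Suc n)" "s * s" "(q - 2) / 2"] sq[OF that]
      by (intro mult_mono) (auto simp: flat_nonneg flat_0_1_bounds)
    then show ?thesis unfolding b_def using q by (intro mult_left_mono) auto
  qed
  have bl: "(\<lambda>n. b n s) \<longlonglongrightarrow> (q - 1) * s powr (q - 2)" if s: "s \<ge> 0" for s
  proof (cases "s = 0")
    case True then show ?thesis by (simp add: b_def flat_def)
  next
    case False
    then have "(\<lambda>n. flat ((q - 2) / 2) (1 / real (Suc n)) (s * s)) \<longlonglongrightarrow> s powr (q - 2)"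
      using flat_tendsto[OF LIMSEQ_Suc[OF lim_1_over_n], of "s * s" "(q - 2) / 2"] s sq[OF s] by simp
    moreover have "(\<lambda>n. flat 0 1 (real (Suc n) - s * s)) \<longlonglongrightarrow> 1"
      by (rule flat_one_tendsto) real_asymp
    ultimately show ?thesis unfolding b_def
      by (intro tendsto_mult_left) (use tendsto_mult in fastforce)
  qed
  have be: "b n (- s) = b n s" for n s by (simp add: b_def)
  have bs: "b n s = 0" if "\<bar>s\<bar> > real (Suc n)" for n s
  proof -
    have "real (Suc n) * 1 \<le> \<bar>s\<bar> * \<bar>s\<bar>" using that by (intro mult_mono) auto
    then show ?thesis by (simp add: b_def flat_def)
  qed
  have "\<exists>F. F 0 = 0 \<and> (\<forall>x. (F has_real_derivative b n x) (at x))" for n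
    using antiderivative_exists[of "b n"] smooth_isCont[OF sm] by blast
  then obtain \<Phi> where \<Phi>: "\<And>n. \<Phi> n 0 = (0::real)" "\<And>n x. (\<Phi> n has_real_derivative b n x) (at x)" by metis
  have "\<exists>F. F 0 = 0 \<and> (\<forall>x. (F has_real_derivative \<Phi> n x) (at x))" for n
    using antiderivative_exists[of "\<Phi> n"] \<Phi>(2) DERIV_isCont by blast
  then obtain \<Psi> where \<Psi>: "\<And>n. \<Psi> n 0 = (0::real)" "\<And>n x. (\<Psi> n has_real_derivative \<Phi> n x) (at x)" by metis
  have \<Phi>p: "0 \<le> \<Phi> n s" "\<Phi> n s \<le> 1 * s powr (q - 1)" "(\<lambda>n. \<Phi> n s) \<longlonglongrightarrow> 1 * s powr (q - 1)" if s: "s \<ge> 0" for n s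
  proof -
    note lim = antiderivative_power_limit[of \<Phi> b "q - 1" "q - 2" s, OF \<Phi> b0 bu bl _ s]
    have "q - 2 + 1 = q - 1" by simp
    then show "0 \<le> \<Phi> n s" "\<Phi> n s \<le> 1 * s powr (q - 1)" "(\<lambda>n. \<Phi> n s) \<longlonglongrightarrow> 1 * s powr (q - 1)"
      using lim q by simp_all
  qed
  have \<Psi>p: "0 \<le> \<Psi> n s" "\<Psi> n s \<le> s powr q / q" "(\<lambda>n. \<Psi> n s) \<longlonglongrightarrow> s powr q / q" if s: "s \<ge> 0" for n s
  proof -
    note lim = antiderivative_power_limit[of \<Psi> \<Phi> 1 "q - 1" s, OF \<Psi> \<Phi>p _ s]
    show "0 \<le> \<Psi> n s" "\<Psi> n s \<le> s powr q / q" "(\<lambda>n. \<Psi> n s) \<longlonglongrightarrow> s powr q / q"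
      using lim q by simp_all
  qed
  have \<Phi>m: "\<Phi> n (- s) = - \<Phi> n s" for n s
    using antiderivative_even[of "\<Phi> n" "b n"] \<Phi> be by blast
  have \<Psi>m: "\<Psi> n (- s) = \<Psi> n s" for n s
    using antiderivative_odd[of "\<Psi> n" "\<Phi> n"] \<Psi> \<Phi>m by blast
  have \<Phi>a: "\<bar>\<Phi> n s\<bar> = \<Phi> n \<bar>s\<bar>" for n s
    using \<Phi>p(1)[of "\<bar>s\<bar>" n] \<Phi>m[of n s] by (cases "s \<ge> 0") auto
  have \<Psi>a: "\<Psi> n s = \<Psi> n \<bar>s\<bar>" for n s
    using \<Psi>m[of n s] by (cases "s \<ge> 0") auto
  \<comment> \<open>\<open>b n\<close> vanishes beyond n + 1, so \<open>\<Phi> n\<close> is constant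
    there and bounds on the compact interval are global. One constant serves both functions.\<close>
  have "\<exists>K. (\<forall>s. b n s \<le> K) \<and> (\<forall>s. \<bar>\<Phi> n s\<bar> \<le> K)" for n
  proof -
    let ?I = "{-real (Suc n)..real (Suc n)}"
    have \<Phi>c: "continuous_on S (\<Phi> n)" for S
      using \<Phi>(2) DERIV_isCont continuous_at_imp_continuous_on by blast
    have "bounded (b n ` ?I)" "bounded (\<Phi> n ` ?I)"
      using compact_imp_bounded[OF compact_continuous_image[OF smooth_continuous_on[OF sm] compact_Icc]]
        compact_imp_bounded[OF compact_continuous_image[OF \<Phi>c compact_Icc]] by blast+
    then obtain A B where A: "\<And>s. s \<in> ?I \<Longrightarrow> \<bar>b n s\<bar> \<le> A" and B: "\<And>s. s \<in> ?I \<Longrightarrow> \<bar>\<Phi> n s\<bar> \<le> B"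
      unfolding bounded_iff by force
    have B': "\<bar>\<Phi> n s\<bar> \<le> B" for s
    proof (cases "\<bar>s\<bar> \<le> real (Suc n)")
      case True then show ?thesis using B[of s] by (auto simp: abs_le_iff)
    next
      case False
      have "\<Phi> n \<bar>s\<bar> = \<Phi> n (real (Suc n))"
      proof (rule DERIV_isconst2[of "real (Suc n)" "\<bar>s\<bar>"])
        show "continuous_on {real (Suc n)..\<bar>s\<bar>} (\<Phi> n)"
          by (rule \<Phi>c)
        show "DERIV (\<Phi> n) x :> 0" if "real (Suc n) < x" "x < \<bar>s\<bar>" for x
          using \<Phi>(2)[of n x] bs[of n x] that by simp
      qed (use False in auto)
      then show ?thesis using \<Phi>a B[of "real (Suc n)"] by simp
    qed
    have A': "b n s \<le> \<bar>A\<bar>" for s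
    proof (cases "\<bar>s\<bar> > real (Suc n)")
      case False
      then have "s \<in> ?I" by auto
      then show ?thesis using A[of s] by linarith
    qed (simp add: bs)
    show ?thesis
    proof (intro exI[of _ "\<bar>A\<bar> + \<bar>B\<bar>"] conjI allI)
      fix s
      show "b n s \<le> \<bar>A\<bar> + \<bar>B\<bar>" using A'[of s] by linarith
      show "\<bar>\<Phi> n s\<bar> \<le> \<bar>A\<bar> + \<bar>B\<bar>" using B'[of s] by linarith
    qed
  qed
  then obtain K where K: "\<And>n s. b n s \<le> K n" "\<And>n s. \<bar>\<Phi> n s\<bar> \<le> K n" by metis
  show thesis
  proof (rule that[of \<Phi> b K \<Psi>])
    show "smooth (\<Phi> n)" for n using smooth_primitive \<Phi>(2) sm by blast
    show "0 \<le> \<Phi> n s * s" for n s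
      using \<Phi>p(1)[of "\<bar>s\<bar>" n] \<Phi>m[of n s] by (cases "s \<ge> 0") (auto simp: mult_nonneg_nonneg mult_nonpos_nonpos)
    show "\<bar>\<Phi> n s\<bar> \<le> \<bar>s\<bar> powr (q - 1)" for n s using \<Phi>a \<Phi>p(2)[of "\<bar>s\<bar>" n] by simp
    show "(\<lambda>n. \<bar>\<Phi> n s\<bar>) \<longlonglongrightarrow> \<bar>s\<bar> powr (q - 1)" for s using \<Phi>a \<Phi>p(3)[of "\<bar>s\<bar>"] by simp
    show "0 \<le> \<Psi> n s" "\<Psi> n s \<le> \<bar>s\<bar> powr q / q" for n s using \<Psi>p(1,2)[of "\<bar>s\<bar>" n] \<Psi>a[of n s] by simp_all
    show "(\<lambda>n. \<Psi> n s) \<longlonglongrightarrow> \<bar>s\<bar> powr q / q" for s by (subst \<Psi>a) (use \<Psi>p(3)[of "\<bar>s\<bar>"] in simp)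
  qed (use \<Phi> \<Psi> b0 K in auto)
qed

section \<open>Smooth functions of several variables\<close>

lemma fun_upd_topspace_RN: "x \<in> topspace (RN N) \<Longrightarrow> i < N \<Longrightarrow> x(i := t) \<in> topspace (RN N)"
  by (auto simp: PiE_def extensional_def)

lemma Ck_continuous: "Ck N k \<phi> \<Longrightarrow> continuous_map (RN N) euclideanreal \<phi>"
  by (cases k) auto

lemma Ck_pd: "Ck N (Suc k) \<phi> \<Longrightarrow> i < N \<Longrightarrow> Ck N k (pd i \<phi>)"
  by simp

lemma Ck_has_pd:
  assumes "Ck N (Suc k) \<phi>" "i < N" "x \<in> topspace (RN N)"
  shows "((\<lambda>t. \<phi> (x(i := t))) has_real_derivative pd i \<phi> (x(i := t))) (at t)"
proof -
  have "\<forall>y\<in>topspace (RN N). (\<lambda>s. \<phi> (y(i := s))) differentiable (at (y i))"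
    using assms(1,2) by simp
  then have "(\<lambda>s. \<phi> ((x(i := t))(i := s))) differentiable (at ((x(i := t)) i))"
    using fun_upd_topspace_RN[OF assms(3,2)] by blast
  then show ?thesis unfolding pd_def by (simp add: DERIV_deriv_iff_real_differentiable)
qed

lemma pd_eqI:
  assumes "((\<lambda>t. \<phi> (x(i := t))) has_real_derivative d) (at (x i))"
  shows "pd i \<phi> x = d"
  unfolding pd_def using assms by (rule DERIV_imp_deriv)

text \<open>Changing a coordinate i < N of a point of the space does not leave the space, hence
  \<open>pd i\<close> at such a point sees only values on the space. What a function does outside
  the carrier is arbitrary.\<close>

lemma Ck_cong:
  assumes "\<And>x. x \<in> topspace (RN N) \<Longrightarrow> \<phi> x = \<psi> x" "Ck N k \<phi>"
  shows "Ck N k \<psi>"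
  using assms
proof (induction k arbitrary: \<phi> \<psi>)
  case 0
  have "continuous_map (RN N) euclideanreal \<phi>" using 0(2) by simp
  then show ?case unfolding Ck.simps by (rule continuous_map_eq) (rule 0(1))
next
  case (Suc k)
  have eq: "(\<lambda>t. \<phi> (x(i := t))) = (\<lambda>t. \<psi> (x(i := t)))" if "x \<in> topspace (RN N)" "i < N" for x i
    using Suc.prems(1) fun_upd_topspace_RN[OF that] by blast
  have "continuous_map (RN N) euclideanreal \<psi>"
    by (rule continuous_map_eq[OF Ck_continuous[OF Suc.prems(2)]]) (rule Suc.prems(1))
  moreover have "(\<lambda>t. \<psi> (x(i := t))) differentiable (at (x i))" if "x \<in> topspace (RN N)" "i < N" for x i
    unfolding eq[OF that, symmetric] using Suc.prems(2) that by simp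
  moreover have "Ck N k (pd i \<psi>)" if "i < N" for i
  proof (rule Suc.IH[of "pd i \<phi>"])
    show "pd i \<phi> x = pd i \<psi> x" if "x \<in> topspace (RN N)" for x
      unfolding pd_def using eq[OF that \<open>i < N\<close>] by simp
  qed (use Suc.prems that in auto)
  ultimately show ?case by auto
qed

text \<open>Lets the partial derivatives be given by explicit formulas; they need to agree with
  \<open>pd\<close> on the carrier only.\<close>

lemma Ck_SucI:
  assumes "continuous_map (RN N) euclideanreal \<phi>"
    and "\<And>i x. i < N \<Longrightarrow> x \<in> topspace (RN N) \<Longrightarrow>
      ((\<lambda>t. \<phi> (x(i := t))) has_real_derivative \<phi>' i x) (at (x i))"
    and "\<And>i. i < N \<Longrightarrow> Ck N k (\<phi>' i)"
  shows "Ck N (Suc k) \<phi>"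
proof -
  have "Ck N k (pd i \<phi>)" if "i < N" for i
    by (rule Ck_cong[OF _ assms(3)[OF that]]) (use assms(2) that pd_eqI in metis)
  then show ?thesis using assms(1,2) real_differentiable_def by (simp, blast)
qed

lemma Ck_mono: "Ck N (Suc k) \<phi> \<Longrightarrow> Ck N k \<phi>"
proof (induction k arbitrary: \<phi>)
  case (Suc k)
  then show ?case by (meson Ck.simps(2))
qed auto

lemma Ck_has_pd_at:
  assumes "Ck N (Suc k) \<phi>" "i < N" "x \<in> topspace (RN N)"
  shows "((\<lambda>t. \<phi> (x(i := t))) has_real_derivative pd i \<phi> x) (at (x i))"
  using Ck_has_pd[OF assms, of "x i"] by simp

lemma Ck_add:
  assumes "Ck N k \<phi>" "Ck N k \<psi>"
  shows "Ck N k (\<lambda>x. \<phi> x + \<psi> x)"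
  using assms
proof (induction k arbitrary: \<phi> \<psi>)
  case 0 then show ?case by (auto intro: continuous_map_add)
next
  case (Suc k)
  show ?case
  proof (rule Ck_SucI[where \<phi>'="\<lambda>i x. pd i \<phi> x + pd i \<psi> x"])
    show "continuous_map (RN N) euclideanreal (\<lambda>x. \<phi> x + \<psi> x)"
      using Suc.prems by (intro continuous_map_add Ck_continuous)
  next
    fix i x assume "i < N" "x \<in> topspace (RN N)"
    then show "((\<lambda>t. \<phi> (x(i := t)) + \<psi> (x(i := t))) has_real_derivative pd i \<phi> x + pd i \<psi> x) (at (x i))"
      using Suc.prems by (intro DERIV_add Ck_has_pd_at)
  next
    fix i assume "i < N"
    then show "Ck N k (\<lambda>x. pd i \<phi> x + pd i \<psi> x)" using Suc by simp
  qed
qed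

lemma Ck_mult:
  assumes "Ck N k \<phi>" "Ck N k \<psi>"
  shows "Ck N k (\<lambda>x. \<phi> x * \<psi> x)"
  using assms
proof (induction k arbitrary: \<phi> \<psi>)
  case 0 then show ?case by (auto intro: continuous_map_real_mult)
next
  case (Suc k)
  show ?case
  proof (rule Ck_SucI[where \<phi>'="\<lambda>i x. pd i \<phi> x * \<psi> x + pd i \<psi> x * \<phi> x"])
    show "continuous_map (RN N) euclideanreal (\<lambda>x. \<phi> x * \<psi> x)"
      using Suc.prems by (intro continuous_map_real_mult Ck_continuous)
  next
    fix i x assume ix: "i < N" "x \<in> topspace (RN N)"
    show "((\<lambda>t. \<phi> (x(i := t)) * \<psi> (x(i := t))) has_real_derivative pd i \<phi> x * \<psi> x + pd i \<psi> x * \<phi> x) (at (x i))"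
      using DERIV_mult[OF Ck_has_pd_at[OF Suc.prems(1) ix] Ck_has_pd_at[OF Suc.prems(2) ix]]
      by (simp only: fun_upd_triv)
  next
    fix i assume "i < N"
    then show "Ck N k (\<lambda>x. pd i \<phi> x * \<psi> x + pd i \<psi> x * \<phi> x)"
      using Suc.prems Suc.IH Ck_mono by (intro Ck_add) (meson Ck_pd)+
  qed
qed

lemma continuous_map_real_compose:
  assumes "continuous_on UNIV h" "continuous_map X euclideanreal \<phi>"
  shows "continuous_map X euclideanreal (\<lambda>x. h (\<phi> x :: real) :: real)"
  using continuous_map_compose[OF assms(2), of euclideanreal h] assms(1) by (simp add: o_def)

lemma Ck_compose:
  assumes "Ck N k \<phi>" "smooth h"
  shows "Ck N k (\<lambda>x. h (\<phi> x))"
  using assms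
proof (induction k arbitrary: h)
  case 0 then show ?case by (auto intro: continuous_map_real_compose smooth_continuous_on)
next
  case (Suc k)
  show ?case
  proof (rule Ck_SucI[where \<phi>'="\<lambda>i x. deriv h (\<phi> x) * pd i \<phi> x"])
    show "continuous_map (RN N) euclideanreal (\<lambda>x. h (\<phi> x))"
      by (rule continuous_map_real_compose[OF smooth_continuous_on[OF Suc.prems(2)] Ck_continuous[OF Suc.prems(1)]])
  next
    fix i x assume ix: "i < N" "x \<in> topspace (RN N)"
    have "(h has_real_derivative deriv h (\<phi> x)) (at (\<phi> (x(i := x i))))"
      using smooth_deriv(1)[OF Suc.prems(2)] by simp
    from DERIV_chain2[OF this Ck_has_pd_at[OF Suc.prems(1) ix]]
    show "((\<lambda>t. h (\<phi> (x(i := t)))) has_real_derivative deriv h (\<phi> x) * pd i \<phi> x) (at (x i))" .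
  next
    fix i assume "i < N"
    then show "Ck N k (\<lambda>x. deriv h (\<phi> x) * pd i \<phi> x)"
      using Suc.prems
      by (intro Ck_mult Suc.IH[OF Ck_mono[OF Suc.prems(1)] smooth_deriv(2)[OF Suc.prems(2)]]) auto
  qed
qed

text \<open>A partial derivative of such a product is a product of the same kind, with the one
  factor replaced by its derivative; this closes the induction over the order.\<close>

lemma Ck_prod_coordinates:
  assumes "\<And>i. i < N \<Longrightarrow> smooth (f i)"
  shows "Ck N k (\<lambda>x. \<Prod>i<N. f i (x i))"
  using assms
proof (induction k arbitrary: f)
  case 0
  have "continuous_map (RN N) euclideanreal (\<lambda>x. f i (x i))" if "i < N" for i
    using continuous_map_real_compose[OF smooth_continuous_on[OF 0[OF that]], of "RN N" "\<lambda>x. x i"]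
      continuous_map_product_projection[of i "{..<N}" "\<lambda>_. euclideanreal"] that by blast
  then show ?case by (auto intro!: continuous_map_prod)
next
  case (Suc k)
  show ?case
  proof (rule Ck_SucI[where \<phi>'="\<lambda>i x. \<Prod>j<N. (if j = i then deriv (f i) else f j) (x j)"])
    have "continuous_map (RN N) euclideanreal (\<lambda>x. f i (x i))" if "i < N" for i
      using continuous_map_real_compose[OF smooth_continuous_on[OF Suc.prems[OF that]], of "RN N" "\<lambda>x. x i"]
        continuous_map_product_projection[of i "{..<N}" "\<lambda>_. euclideanreal"] that by blast
    then show "continuous_map (RN N) euclideanreal (\<lambda>x. \<Prod>i<N. f i (x i))" by (auto intro!: continuous_map_prod)
  next
    fix i x assume i: "i < N" and "x \<in> topspace (RN N)"
    have split: "(\<Prod>j<N. g j) = g i * (\<Prod>j\<in>{..<N} - {i}. g j)" for g :: "nat \<Rightarrow> real"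
      using i by (simp add: prod.remove)
    have "((\<lambda>t. f i t * (\<Prod>j\<in>{..<N} - {i}. f j (x j))) has_real_derivative
        deriv (f i) (x i) * (\<Prod>j\<in>{..<N} - {i}. f j (x j))) (at (x i))"
      using smooth_deriv(1) Suc.prems i by (auto intro!: derivative_eq_intros)
    then show "((\<lambda>t. \<Prod>j<N. f j ((x(i := t)) j)) has_real_derivative
       (\<Prod>j<N. (if j = i then deriv (f i) else f j) (x j))) (at (x i))"
      unfolding split by simp
  next
    fix i assume "i < N"
    then show "Ck N k (\<lambda>x. \<Prod>j<N. (if j = i then deriv (f i) else f j) (x j))"
      using Suc by (auto intro!: Suc.IH smooth_deriv)
  qed
qed

lemma Cinfty_diff:
  assumes "Cinfty N \<phi>" "Cinfty N \<psi>"
  shows "Cinfty N (\<lambda>x. \<phi> x - \<psi> x)"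
proof -
  have "Ck N k (\<lambda>x. \<phi> x + - 1 * \<psi> x)" for k
    using assms Ck_compose[of N k \<psi> "\<lambda>y. - 1 * y"] smooth_mult[OF smooth_const[of "-1"] smooth_id]
    unfolding Cinfty_def by (intro Ck_add) blast+
  then show ?thesis by (simp add: Cinfty_def)
qed

lemma Cinfty_mult: "Cinfty N \<phi> \<Longrightarrow> Cinfty N \<psi> \<Longrightarrow> Cinfty N (\<lambda>x. \<phi> x * \<psi> x)"
  by (simp add: Cinfty_def Ck_mult)

lemma Cinfty_compose: "Cinfty N \<phi> \<Longrightarrow> smooth h \<Longrightarrow> Cinfty N (\<lambda>x. h (\<phi> x))"
  by (simp add: Cinfty_def Ck_compose)

lemma Cinfty_pd: "Cinfty N \<phi> \<Longrightarrow> i < N \<Longrightarrow> Cinfty N (pd i \<phi>)"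
  unfolding Cinfty_def using Ck_pd by blast

lemma Cinfty_has_pd:
  "Cinfty N \<phi> \<Longrightarrow> i < N \<Longrightarrow> x \<in> topspace (RN N) \<Longrightarrow>
    ((\<lambda>t. \<phi> (x(i := t))) has_real_derivative pd i \<phi> (x(i := t))) (at t)"
  unfolding Cinfty_def using Ck_has_pd by blast

lemma pd_diff:
  assumes "Cinfty N \<phi>" "Cinfty N \<psi>" "i < N" "x \<in> topspace (RN N)"
  shows "pd i (\<lambda>x. \<phi> x - \<psi> x) x = pd i \<phi> x - pd i \<psi> x"
  using DERIV_diff[OF Cinfty_has_pd[OF assms(1,3,4), of "x i"] Cinfty_has_pd[OF assms(2,3,4), of "x i"]]
  by (intro pd_eqI) simp

lemma pd_mult:
  assumes "Cinfty N \<phi>" "Cinfty N \<psi>" "i < N" "x \<in> topspace (RN N)"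
  shows "pd i (\<lambda>x. \<phi> x * \<psi> x) x = pd i \<phi> x * \<psi> x + pd i \<psi> x * \<phi> x"
  using DERIV_mult[OF Cinfty_has_pd[OF assms(1,3,4), of "x i"] Cinfty_has_pd[OF assms(2,3,4), of "x i"]]
  by (intro pd_eqI) simp

lemma pd_compose:
  assumes "Cinfty N \<phi>" "(h has_real_derivative h') (at (\<phi> x))" "i < N" "x \<in> topspace (RN N)"
  shows "pd i (\<lambda>x. h (\<phi> x)) x = h' * pd i \<phi> x"
proof -
  have "(h has_real_derivative h') (at (\<phi> (x(i := x i))))" using assms(2) by simp
  from DERIV_chain2[OF this Cinfty_has_pd[OF assms(1,3,4), of "x i"]] show ?thesis
    by (intro pd_eqI) simp
qed

section \<open>Test functions\<close>

lemma test_functions_Cinfty: "\<phi> \<in> test_functions N D \<Longrightarrow> Cinfty N \<phi>"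
  by (simp add: test_functions_def)

lemma test_functions_continuous: "\<phi> \<in> test_functions N D \<Longrightarrow> continuous_map (RN N) euclideanreal \<phi>"
  using test_functions_Cinfty unfolding Cinfty_def using Ck.simps(1) by blast

lemma test_functions_support:
  assumes "\<phi> \<in> test_functions N D"
  obtains K where "compactin (RN N) K" "K \<subseteq> D" "\<And>x. x \<in> topspace (RN N) - K \<Longrightarrow> \<phi> x = 0"
  using assms by (auto simp: test_functions_def)

lemma test_functionsI:
  assumes "Cinfty N \<phi>" "compactin (RN N) K" "K \<subseteq> D" "\<And>x. x \<in> topspace (RN N) - K \<Longrightarrow> \<phi> x = 0"
  shows "\<phi> \<in> test_functions N D"
  using assms unfolding test_functions_def by blast

lemma test_functions_diff:
  assumes "\<phi> \<in> test_functions N D" "\<psi> \<in> test_functions N D"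
  shows "(\<lambda>x. \<phi> x - \<psi> x) \<in> test_functions N D"
proof -
  obtain K where K: "compactin (RN N) K" "K \<subseteq> D" "\<And>x. x \<in> topspace (RN N) - K \<Longrightarrow> \<phi> x = 0"
    using test_functions_support[OF assms(1)] by blast
  obtain L where L: "compactin (RN N) L" "L \<subseteq> D" "\<And>x. x \<in> topspace (RN N) - L \<Longrightarrow> \<psi> x = 0"
    using test_functions_support[OF assms(2)] by blast
  show ?thesis
    by (rule test_functionsI[OF Cinfty_diff[OF assms[THEN test_functions_Cinfty]] compactin_Un[OF K(1) L(1)]])
      (use K L in auto)
qed

lemma test_functions_mult:
  assumes "\<phi> \<in> test_functions N D" "Cinfty N \<psi>"
  shows "(\<lambda>x. \<phi> x * \<psi> x) \<in> test_functions N D"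
proof -
  obtain K where K: "compactin (RN N) K" "K \<subseteq> D" "\<And>x. x \<in> topspace (RN N) - K \<Longrightarrow> \<phi> x = 0"
    using test_functions_support[OF assms(1)] by blast
  show ?thesis
    by (rule test_functionsI[OF Cinfty_mult[OF test_functions_Cinfty[OF assms(1)] assms(2)] K(1,2)]) (use K in auto)
qed

lemma test_functions_compose:
  assumes "\<phi> \<in> test_functions N D" "smooth h" "h 0 = 0"
  shows "(\<lambda>x. h (\<phi> x)) \<in> test_functions N D"
proof -
  obtain K where K: "compactin (RN N) K" "K \<subseteq> D" "\<And>x. x \<in> topspace (RN N) - K \<Longrightarrow> \<phi> x = 0"
    using test_functions_support[OF assms(1)] by blast
  show ?thesis
    by (rule test_functionsI[OF Cinfty_compose[OF test_functions_Cinfty[OF assms(1)] assms(2)] K(1,2)])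
      (use K assms(3) in auto)
qed

lemma compactin_RN_closedin: "compactin (RN N) K \<Longrightarrow> closedin (RN N) K"
  by (intro compactin_imp_closedin) (auto simp: Hausdorff_space_product_topology)

lemma openin_RN_line:
  assumes "openin (RN N) S" "x \<in> S" "i < N"
  shows "\<forall>\<^sub>F t in nhds (x i). x(i := t) \<in> S"
proof -
  obtain U where U: "\<forall>j\<in>{..<N}. openin euclideanreal (U j)" "x \<in> Pi\<^sub>E {..<N} U" "Pi\<^sub>E {..<N} U \<subseteq> S"
    using assms(1,2) unfolding openin_product_topology_alt by blast
  have "open (U i)" "x i \<in> U i" using U assms(3) by auto
  moreover have "x(i := t) \<in> S" if "t \<in> U i" for t
  proof -
    have "x(i := t) \<in> Pi\<^sub>E {..<N} U" using U(2) that assms(3) by (auto simp: PiE_def extensional_def)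
    then show ?thesis using U(3) by blast
  qed
  ultimately show ?thesis unfolding eventually_nhds by blast
qed

text \<open>The compact set \<open>K\<close> is closed, so off \<open>K\<close> the function
  vanishes on a whole neighbourhood of the point along the coordinate line. The same
  \<open>K\<close> therefore serves for the derivative.\<close>

lemma test_functions_pd:
  assumes "\<phi> \<in> test_functions N D" "i < N"
  shows "pd i \<phi> \<in> test_functions N D"
proof -
  obtain K where K: "compactin (RN N) K" "K \<subseteq> D" "\<And>x. x \<in> topspace (RN N) - K \<Longrightarrow> \<phi> x = 0"
    using test_functions_support[OF assms(1)] by blast
  have "openin (RN N) (topspace (RN N) - K)"
    using compactin_RN_closedin[OF K(1)] by blast
  then have *: "\<forall>\<^sub>F t in nhds (x i). x(i := t) \<in> topspace (RN N) - K" if "x \<in> topspace (RN N) - K" for x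
    using openin_RN_line that assms(2) by blast
  have "pd i \<phi> x = 0" if x: "x \<in> topspace (RN N) - K" for x
  proof (rule pd_eqI)
    have "\<forall>\<^sub>F t in nhds (x i). 0 = \<phi> (x(i := t))"
      using *[OF x] by eventually_elim (use K in auto)
    moreover have "((\<lambda>t. 0) has_real_derivative 0) (at (x i))" by simp
    ultimately show "((\<lambda>t. \<phi> (x(i := t))) has_real_derivative 0) (at (x i))"
      using DERIV_cong_ev[of "x i" "x i" "\<lambda>t. 0" "\<lambda>t. \<phi> (x(i := t))" 0 0] by simp
  qed
  then show ?thesis
    using test_functionsI[OF Cinfty_pd[OF test_functions_Cinfty[OF assms(1)] assms(2)] K(1,2)] by blast
qed

lemma test_functions_bounded:
  assumes "\<phi> \<in> test_functions N D"
  obtains B where "B > 0" "\<And>x. x \<in> topspace (RN N) \<Longrightarrow> \<bar>\<phi> x\<bar> \<le> B"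
proof -
  obtain K where K: "compactin (RN N) K" "K \<subseteq> D" "\<And>x. x \<in> topspace (RN N) - K \<Longrightarrow> \<phi> x = 0"
    using test_functions_support[OF assms(1)] by blast
  have "compactin euclideanreal (\<phi> ` K)"
    using image_compactin K(1) test_functions_continuous[OF assms] by blast
  then have "bounded (\<phi> ` K)" by (simp add: compact_imp_bounded)
  then obtain B where B: "\<And>x. x \<in> K \<Longrightarrow> \<bar>\<phi> x\<bar> \<le> B" by (auto simp: bounded_iff)
  show thesis
  proof (rule that[of "\<bar>B\<bar> + 1"])
    fix x assume "x \<in> topspace (RN N)"
    then show "\<bar>\<phi> x\<bar> \<le> \<bar>B\<bar> + 1" using B[of x] K(3)[of x] by (cases "x \<in> K") auto
  qed auto
qed

section \<open>Lebesgue measure on bounded open sets\<close>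

abbreviation lebP :: "nat \<Rightarrow> (nat \<Rightarrow> real) measure" where
  "lebP N \<equiv> PiM {..<N} (\<lambda>_. lborel)"

definition open_box :: "nat \<Rightarrow> (nat \<Rightarrow> real) \<Rightarrow> (nat \<Rightarrow> real) \<Rightarrow> (nat \<Rightarrow> real) set" where
  "open_box N a b = PiE {..<N} (\<lambda>i. {a i<..<b i})"

definition closed_box :: "nat \<Rightarrow> (nat \<Rightarrow> real) \<Rightarrow> (nat \<Rightarrow> real) \<Rightarrow> (nat \<Rightarrow> real) set" where
  "closed_box N a b = PiE {..<N} (\<lambda>i. {a i..b i})"

lemma space_lebP: "space (lebP N) = topspace (RN N)"
  by (simp add: space_PiM)

lemma open_box_sets: "open_box N a b \<in> sets (lebP N)"
  unfolding open_box_def by (intro sets_PiM_I_finite) auto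

lemma closed_box_sets: "closed_box N a b \<in> sets (lebP N)"
  unfolding closed_box_def by (intro sets_PiM_I_finite) auto

lemma open_box_subset: "open_box N a b \<subseteq> closed_box N a b"
  unfolding open_box_def closed_box_def by (intro PiE_mono) auto

lemma closed_box_compact: "compactin (RN N) (closed_box N a b)"
  unfolding closed_box_def by (subst compactin_PiE) auto

lemma product_sigma_finite_lborel: "product_sigma_finite (\<lambda>_::nat. lborel :: real measure)"
  by unfold_locales

lemma emeasure_closed_box: "emeasure (lebP N) (closed_box N a b) < \<infinity>"
proof -
  interpret product_sigma_finite "\<lambda>_::nat. lborel :: real measure" by (rule product_sigma_finite_lborel)
  have "emeasure (lebP N) (closed_box N a b) = (\<Prod>i<N. emeasure lborel {a i..b i})"
    unfolding closed_box_def by (rule emeasure_PiM) auto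
  also have "\<dots> < \<infinity>"
    by (induction N) (auto simp: ennreal_mult_less_top emeasure_lborel_Icc_eq)
  finally show ?thesis .
qed

text \<open>Rational corners make the family countable. The closed boxes are kept inside
  \<open>S\<close> because they become the compact supports of the bump functions, while the open
  ones are what the bumps converge to.\<close>

lemma openin_RN_Union_boxes:
  assumes S: "openin (RN N) S"
  obtains B where "countable B" "\<And>a b. (a, b) \<in> B \<Longrightarrow> closed_box N a b \<subseteq> S"
    "S = (\<Union>(a, b)\<in>B. open_box N a b)"
proof -
  define R where "R = PiE {..<N} (\<lambda>_. \<rat> :: real set)"
  define B where "B = {(a, b) \<in> R \<times> R. closed_box N a b \<subseteq> S}"
  have "countable R" unfolding R_def by (intro countable_PiE countable_rat) auto
  then have "countable B" unfolding B_def by (intro countable_subset[OF _ countable_SIGMA[of R "\<lambda>_. R"]]) auto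
  moreover have "x \<in> (\<Union>(a, b)\<in>B. open_box N a b)" if x: "x \<in> S" for x
  proof -
    obtain U where U: "\<forall>j\<in>{..<N}. openin euclideanreal (U j)" "x \<in> Pi\<^sub>E {..<N} U" "Pi\<^sub>E {..<N} U \<subseteq> S"
      using S x unfolding openin_product_topology_alt by blast
    have "\<exists>a b. a \<in> \<rat> \<and> b \<in> \<rat> \<and> a < x i \<and> x i < b \<and> {a..b} \<subseteq> U i" if i: "i < N" for i
    proof -
      have "open (U i)" "x i \<in> U i" using U i by auto
      then obtain e where e: "e > 0" "ball (x i) e \<subseteq> U i" using open_contains_ball by blast
      obtain a where a: "a \<in> \<rat>" "x i - e < a" "a < x i" using Rats_dense_in_real[of "x i - e" "x i"] e by auto
      obtain b where b: "b \<in> \<rat>" "x i < b" "b < x i + e" using Rats_dense_in_real[of "x i" "x i + e"] e by auto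
      have "{a..b} \<subseteq> ball (x i) e" using a b by (auto simp: dist_real_def)
      then show ?thesis using a b e by (intro exI[of _ a] exI[of _ b]) auto
    qed
    then obtain a b where ab: "\<And>i. i < N \<Longrightarrow> a i \<in> \<rat> \<and> b i \<in> \<rat> \<and> a i < x i \<and> x i < b i \<and> {a i..b i} \<subseteq> U i"
      by metis
    \<comment> \<open>Only corners that are undefined outside the index set belong to the countable
      set \<open>R\<close>.\<close>
    let ?a = "restrict a {..<N}" and ?b = "restrict b {..<N}"
    have "?a \<in> R" "?b \<in> R" using ab by (auto simp: R_def)
    moreover have "closed_box N ?a ?b \<subseteq> Pi\<^sub>E {..<N} U"
      unfolding closed_box_def by (rule PiE_mono) (use ab in auto)
    moreover have "x \<in> open_box N ?a ?b"
      using ab U(2) unfolding open_box_def by (auto simp: PiE_iff)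
    ultimately have "(?a, ?b) \<in> B" "x \<in> open_box N ?a ?b" using U(3) unfolding B_def by blast+
    then show ?thesis by blast
  qed
  moreover have "closed_box N a b \<subseteq> S" if "(a, b) \<in> B" for a b
    using that by (simp add: B_def)
  moreover have "open_box N a b \<subseteq> S" if "(a, b) \<in> B" for a b
    using that open_box_subset[of N a b] by (auto simp: B_def)
  ultimately have "S = (\<Union>(a, b)\<in>B. open_box N a b)" by blast
  then show thesis using that \<open>countable B\<close> \<open>\<And>a b. (a, b) \<in> B \<Longrightarrow> closed_box N a b \<subseteq> S\<close> by blast
qed

lemma openin_RN_sets: 
  assumes "openin (RN N) S"
  shows "S \<in> sets (lebP N)"
proof -
  obtain B where B: "countable B" "S = (\<Union>(a, b)\<in>B. open_box N a b)"
    using openin_RN_Union_boxes[OF assms] by metis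
  show ?thesis unfolding B(2)
    by (intro sets.countable_UN'[OF B(1)]) (auto simp: open_box_sets split: prod.splits)
qed

lemma continuous_map_RN_measurable:
  assumes "continuous_map (RN N) euclideanreal \<phi>"
  shows "\<phi> \<in> borel_measurable (lebP N)"
proof (rule borel_measurableI)
  fix S :: "real set" assume "open S"
  then have "openin (RN N) {x \<in> topspace (RN N). \<phi> x \<in> S}"
    using assms openin_continuous_map_preimage by fastforce
  moreover have "\<phi> -` S \<inter> space (lebP N) = {x \<in> topspace (RN N). \<phi> x \<in> S}"
    unfolding space_lebP by auto
  ultimately show "\<phi> -` S \<inter> space (lebP N) \<in> sets (lebP N)"
    using openin_RN_sets by metis
qed

text \<open>Fubini in the direction of the derivative.\<close>

lemma integral_pd_eq_0:
  assumes \<psi>: "\<psi> \<in> test_functions N D" and i: "i < N"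
  shows "(LINT x|lebP N. pd i \<psi> x) = 0"
proof -
  interpret P: product_sigma_finite "\<lambda>_::nat. lborel :: real measure" by (rule product_sigma_finite_lborel)
  obtain K where K: "compactin (RN N) K" "K \<subseteq> D" "\<And>x. x \<in> topspace (RN N) - K \<Longrightarrow> \<psi> x = 0"
    using test_functions_support[OF \<psi>] by blast
  have "\<exists>r. \<forall>x\<in>K. \<bar>x j\<bar> \<le> r" if "j < N" for j
  proof -
    have "compactin euclideanreal ((\<lambda>x. x j) ` K)"
      using image_compactin[OF K(1) continuous_map_product_projection[of j]] that by simp
    then show ?thesis using compact_imp_bounded by (fastforce simp: bounded_iff)
  qed
  then obtain r where r: "\<And>j x. j < N \<Longrightarrow> x \<in> K \<Longrightarrow> \<bar>x j\<bar> \<le> r j" by metis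
  obtain B where B: "\<And>x. x \<in> topspace (RN N) \<Longrightarrow> \<bar>pd i \<psi> x\<bar> \<le> B"
    using test_functions_bounded[OF test_functions_pd[OF \<psi> i]] by metis
  \<comment> \<open>One more than the extent of \<open>K\<close>, so that \<open>\<psi>\<close> and
    its derivative vanish at and beyond the ends of the interval used in the fundamental theorem of
    calculus.\<close>
  let ?r = "\<lambda>j. \<bar>r j\<bar> + 1"
  have \<psi>0: "\<psi> x = 0" if "x \<in> topspace (RN N)" "\<bar>x j\<bar> > \<bar>r j\<bar>" "j < N" for x j
    using K(3)[of x] r[of j x] that by force
  have pd0: "pd i \<psi> x = 0" if x: "x \<in> topspace (RN N)" "\<bar>x j\<bar> > \<bar>r j\<bar>" "j < N" for x j
  proof (rule pd_eqI)
    have "\<forall>\<^sub>F t in nhds (x i). x(i := t) \<in> topspace (RN N) \<and> \<bar>(x(i := t)) j\<bar> > \<bar>r j\<bar>"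
    proof (cases "j = i")
      case True
      have "\<forall>\<^sub>F t in nhds (x i). \<bar>r j\<bar> < \<bar>t\<bar>"
      proof -
        have "open {t. \<bar>r j\<bar> < \<bar>t\<bar>}" by (intro open_Collect_less continuous_intros)
        then show ?thesis using eventually_nhds_in_open[of "{t. \<bar>r j\<bar> < \<bar>t\<bar>}" "x i"] x(2) True by simp
      qed
      then show ?thesis using True fun_upd_topspace_RN[OF x(1) i] by (auto elim!: eventually_mono)
    qed (use x fun_upd_topspace_RN[OF x(1) i] in auto)
    then have "\<forall>\<^sub>F t in nhds (x i). 0 = \<psi> (x(i := t))"
      by eventually_elim (use \<psi>0 x(3) in metis)
    moreover have "((\<lambda>t. 0) has_real_derivative 0) (at (x i))" by simp
    ultimately show "((\<lambda>t. \<psi> (x(i := t))) has_real_derivative 0) (at (x i))"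
      using DERIV_cong_ev[of "x i" "x i" "\<lambda>t. 0" "\<lambda>t. \<psi> (x(i := t))" 0 0] by simp
  qed
  have meas: "pd i \<psi> \<in> borel_measurable (lebP N)"
    by (intro continuous_map_RN_measurable test_functions_continuous[where D=D] test_functions_pd \<psi> i)
  have ins: "insert i ({..<N} - {i}) = {..<N}" using i by auto
  \<comment> \<open>Fubini needs integrability on the whole space: the derivative is bounded and
    lives on a box of finite measure.\<close>
  have int: "integrable (lebP N) (pd i \<psi>)"
  proof (rule Bochner_Integration.integrable_bound)
    let ?Q = "closed_box N (\<lambda>j. - ?r j) ?r"
    show "integrable (lebP N) (\<lambda>x. B * indicator ?Q x)"
      using emeasure_closed_box closed_box_sets
      by (intro integrable_mult_right integrable_real_indicator) auto
    show "AE x in lebP N. norm (pd i \<psi> x) \<le> norm (B * indicator ?Q x)"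
    proof (rule AE_I2)
      fix x assume x: "x \<in> space (lebP N)"
      show "norm (pd i \<psi> x) \<le> norm (B * indicator ?Q x)"
      proof (cases "x \<in> ?Q")
        case True then show ?thesis using B[of x] x unfolding space_lebP by auto
      next
        case False
        then obtain j where "j < N" "\<not> (- ?r j \<le> x j \<and> x j \<le> ?r j)"
          using x unfolding closed_box_def space_lebP by (auto simp: PiE_iff)
        then have "\<bar>x j\<bar> > \<bar>r j\<bar>" by auto
        then show ?thesis using pd0[of x j] x \<open>j < N\<close> unfolding space_lebP by simp
      qed
    qed
  qed (rule meas)
  have "(LINT x|lebP N. pd i \<psi> x) = (LINT x|PiM (insert i ({..<N} - {i})) (\<lambda>_. lborel). pd i \<psi> x)"
    by (simp only: ins)
  also have "\<dots> = (LINT x|PiM ({..<N} - {i}) (\<lambda>_. lborel). (LINT y|lborel. pd i \<psi> (x(i := y))))"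
    by (rule P.product_integral_insert) (use int ins in auto)
  also have "\<dots> = (LINT x|PiM ({..<N} - {i}) (\<lambda>_. lborel :: real measure). 0)"
  proof (rule Bochner_Integration.integral_cong[OF refl])
    fix x :: "nat \<Rightarrow> real" assume x: "x \<in> space (PiM ({..<N} - {i}) (\<lambda>_. lborel :: real measure))"
    have top: "x(i := y) \<in> topspace (RN N)" for y
      using x i by (auto simp: space_PiM PiE_iff extensional_def)
    have d: "((\<lambda>t. \<psi> (x(i := t))) has_real_derivative pd i \<psi> (x(i := t))) (at t)" for t
      using Cinfty_has_pd[OF test_functions_Cinfty[OF \<psi>] i top[of t], of t] by simp
    have d2: "isCont (\<lambda>t. pd i \<psi> (x(i := t))) t" for t
      using Cinfty_has_pd[OF test_functions_Cinfty[OF test_functions_pd[OF \<psi> i]] i top[of t], of t]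
        DERIV_isCont by fastforce
    have "(LINT y|lborel. pd i \<psi> (x(i := y))) = (LINT y|lborel. indicator {- ?r i..?r i} y *\<^sub>R pd i \<psi> (x(i := y)))"
    proof (intro Bochner_Integration.integral_cong refl)
      fix y
      have "pd i \<psi> (x(i := y)) = 0" if "y \<notin> {- ?r i..?r i}"
        by (rule pd0[OF top _ i]) (use that in auto)
      then show "pd i \<psi> (x(i := y)) = indicator {- ?r i..?r i} y *\<^sub>R pd i \<psi> (x(i := y))"
        by (cases "y \<in> {- ?r i..?r i}") auto
    qed
    also have "\<dots> = \<psi> (x(i := ?r i)) - \<psi> (x(i := - ?r i))"
    proof (rule integral_FTC_atLeastAtMost[where F="\<lambda>t. \<psi> (x(i := t))"])
      show "((\<lambda>t. \<psi> (x(i := t))) has_vector_derivative pd i \<psi> (x(i := t))) (at t within {- ?r i..?r i})" for t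
        using d[of t] unfolding has_real_derivative_iff_has_vector_derivative
        by (rule has_vector_derivative_at_within)
      show "continuous_on {- ?r i..?r i} (\<lambda>t. pd i \<psi> (x(i := t)))"
        using d2 by (intro continuous_at_imp_continuous_on ballI)
    qed auto
    also have "\<dots> = 0"
    proof -
      have "\<psi> (x(i := ?r i)) = 0" "\<psi> (x(i := - ?r i)) = 0" by (rule \<psi>0[OF top _ i]; simp)+
      then show ?thesis by simp
    qed
    finally show "(LINT y|lborel. pd i \<psi> (x(i := y))) = 0" .
  qed
  finally show ?thesis by simp
qed

section \<open>Square integrable functions on a finite measure space\<close>

lemma Lspace_2_iff: "v \<in> Lspace M 2 \<longleftrightarrow> v \<in> borel_measurable M \<and> integrable M (\<lambda>x. (v x)\<^sup>2)"
  by (simp add: Lspace_def powr_numeral)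

lemma Lnorm_2_eq: "Lnorm M 2 v = sqrt (LINT x|M. (v x)\<^sup>2)"
  by (simp add: Lnorm_def powr_numeral powr_half_sqrt)

lemma Lnorm_2_power2: "(Lnorm M 2 v)\<^sup>2 = (LINT x|M. (v x)\<^sup>2)"
  by (simp add: Lnorm_2_eq)

lemma Lspace_2_measurable: "v \<in> Lspace M 2 \<Longrightarrow> v \<in> borel_measurable M"
  by (simp add: Lspace_def)

lemma Lspace_2_mult_integrable:
  assumes "v \<in> Lspace M 2" "w \<in> Lspace M 2"
  shows "integrable M (\<lambda>x. v x * w x)"
proof (rule Bochner_Integration.integrable_bound)
  show "integrable M (\<lambda>x. (v x)\<^sup>2 + (w x)\<^sup>2)" using assms by (simp add: Lspace_2_iff)
  have [measurable]: "v \<in> borel_measurable M" "w \<in> borel_measurable M"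
    using assms Lspace_2_measurable by auto
  show "(\<lambda>x. v x * w x) \<in> borel_measurable M" by measurable
  have "\<bar>a * b\<bar> \<le> a\<^sup>2 + b\<^sup>2" for a b :: real
  proof -
    have "2 * (\<bar>a\<bar> * \<bar>b\<bar>) \<le> a\<^sup>2 + b\<^sup>2" using sum_squares_bound[of "\<bar>a\<bar>" "\<bar>b\<bar>"] by simp
    moreover have "0 \<le> \<bar>a\<bar> * \<bar>b\<bar>" by simp
    ultimately show ?thesis by (simp only: abs_mult)
  qed
  then show "AE x in M. norm (v x * w x) \<le> norm ((v x)\<^sup>2 + (w x)\<^sup>2)" by auto
qed

lemma Lspace_2_lincomb:
  assumes "v \<in> Lspace M 2" "w \<in> Lspace M 2"
  shows "(\<lambda>x. a * v x + b * w x) \<in> Lspace M 2"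
proof -
  have [measurable]: "v \<in> borel_measurable M" "w \<in> borel_measurable M"
    using assms Lspace_2_measurable by auto
  have "integrable M (\<lambda>x. a\<^sup>2 * (v x)\<^sup>2 + b\<^sup>2 * (w x)\<^sup>2 + (2 * a * b) * (v x * w x))"
    using assms Lspace_2_mult_integrable[OF assms] by (simp add: Lspace_2_iff)
  then have "integrable M (\<lambda>x. (a * v x + b * w x)\<^sup>2)"
    by (rule back_subst[of "integrable M"]) (simp add: fun_eq_iff power2_eq_square algebra_simps)
  then show ?thesis by (simp add: Lspace_2_iff)
qed

lemma Lspace_2_diff: "v \<in> Lspace M 2 \<Longrightarrow> w \<in> Lspace M 2 \<Longrightarrow> (\<lambda>x. v x - w x) \<in> Lspace M 2"
  using Lspace_2_lincomb[of v M w 1 "-1"] by simp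

lemma Lspace_2_cmult: "v \<in> Lspace M 2 \<Longrightarrow> (\<lambda>x. a * v x) \<in> Lspace M 2"
  using Lspace_2_lincomb[of v M v a 0] by simp

lemma Lspace_2_bounded_mult:
  assumes "v \<in> Lspace M 2" "h \<in> borel_measurable M" "\<And>x. x \<in> space M \<Longrightarrow> \<bar>h x\<bar> \<le> B"
  shows "(\<lambda>x. h x * v x) \<in> Lspace M 2"
proof -
  have [measurable]: "v \<in> borel_measurable M" "h \<in> borel_measurable M"
    using assms Lspace_2_measurable by auto
  have "integrable M (\<lambda>x. (h x * v x)\<^sup>2)"
  proof (rule Bochner_Integration.integrable_bound)
    show "integrable M (\<lambda>x. B\<^sup>2 * (v x)\<^sup>2)" using assms by (simp add: Lspace_2_iff)
    show "AE x in M. norm ((h x * v x)\<^sup>2) \<le> norm (B\<^sup>2 * (v x)\<^sup>2)"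
    proof (rule AE_I2)
      fix x assume "x \<in> space M"
      then have "(h x)\<^sup>2 \<le> B\<^sup>2" using assms(3) by (metis abs_le_square_iff abs_of_nonneg abs_ge_zero order_trans)
      then show "norm ((h x * v x)\<^sup>2) \<le> norm (B\<^sup>2 * (v x)\<^sup>2)"
        by (simp add: power_mult_distrib mult_right_mono)
    qed
  qed measurable
  then show ?thesis by (simp add: Lspace_2_iff)
qed

lemma Lspace_2_AE_cong:
  assumes "v \<in> Lspace M 2" "AE x in M. v x = w x" "w \<in> borel_measurable M"
  shows "w \<in> Lspace M 2"
proof -
  have [measurable]: "v \<in> borel_measurable M" "w \<in> borel_measurable M"
    using assms Lspace_2_measurable by auto
  have "integrable M (\<lambda>x. (w x)\<^sup>2)"
    using assms(1) unfolding Lspace_2_iff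
    by (elim conjE, subst integrable_cong_AE[where g="\<lambda>x. (v x)\<^sup>2"]) (use assms(2) in auto)
  then show ?thesis using assms(3) by (simp add: Lspace_2_iff)
qed

text \<open>The squared norm of v + s w is a nonnegative quadratic polynomial in s; the inequality
  is that its discriminant is not positive.\<close>

lemma Cauchy_Schwarz_Lspace_2:
  assumes "v \<in> Lspace M 2" "w \<in> Lspace M 2"
  shows "\<bar>pairing M v w\<bar> \<le> Lnorm M 2 v * Lnorm M 2 w"
proof -
  have q: "0 \<le> (LINT x|M. (v x)\<^sup>2) + 2 * s * pairing M v w + s\<^sup>2 * (LINT x|M. (w x)\<^sup>2)" for s
  proof -
    have "(LINT x|M. (v x)\<^sup>2) + 2 * s * pairing M v w + s\<^sup>2 * (LINT x|M. (w x)\<^sup>2) =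
      (LINT x|M. (v x)\<^sup>2 + 2 * s * (v x * w x) + s\<^sup>2 * (w x)\<^sup>2)"
      unfolding pairing_def
      using assms Lspace_2_mult_integrable[OF assms] by (simp add: Lspace_2_iff)
    also have "\<dots> = (LINT x|M. (v x + s * w x)\<^sup>2)"
      by (simp add: power2_eq_square algebra_simps)
    finally show ?thesis by simp
  qed
  let ?A = "LINT x|M. (v x)\<^sup>2" and ?B = "pairing M v w" and ?C = "LINT x|M. (w x)\<^sup>2"
  have A: "?A \<ge> 0" and C: "?C \<ge> 0" by auto
  have "?B\<^sup>2 \<le> ?A * ?C"
  proof (cases "?C = 0")
    case True
    have "?B = 0"
    proof (rule ccontr)
      assume "?B \<noteq> 0"
      \<comment> \<open>When the quadratic coefficient is 0 the polynomial is affine, and at this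
        point it would equal -1.\<close>
      then show False using q[of "- (?A + 1) / (2 * ?B)"] True by (simp add: field_simps)
    qed
    then show ?thesis using True by simp
  next
    case False
    then have "?C > 0" using C by (metis order_le_imp_less_or_eq)
    then show ?thesis using q[of "- ?B / ?C"] by (simp add: field_simps power2_eq_square)
  qed
  then have "\<bar>?B\<bar> \<le> sqrt (?A * ?C)" by (simp add: real_le_rsqrt)
  then show ?thesis unfolding Lnorm_2_eq by (simp add: real_sqrt_mult)
qed

lemma pairing_tendsto:
  assumes "\<And>n. v n \<in> Lspace M 2" "v' \<in> Lspace M 2" "w \<in> Lspace M 2"
    and "(\<lambda>n. Lnorm M 2 (\<lambda>x. v' x - v n x)) \<longlonglongrightarrow> 0"
  shows "(\<lambda>n. pairing M (v n) w) \<longlonglongrightarrow> pairing M v' w"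
proof -
  have "(\<lambda>n. pairing M v' w - pairing M (v n) w) \<longlonglongrightarrow> 0"
  proof (rule Lim_null_comparison)
    show "\<forall>\<^sub>F n in sequentially. norm (pairing M v' w - pairing M (v n) w)
        \<le> Lnorm M 2 (\<lambda>x. v' x - v n x) * Lnorm M 2 w"
    proof (rule always_eventually, rule allI)
      fix n
      have "pairing M v' w - pairing M (v n) w = pairing M (\<lambda>x. v' x - v n x) w"
        unfolding pairing_def using Lspace_2_mult_integrable[OF _ assms(3)] assms(1,2)
        by (simp add: left_diff_distrib)
      then show "norm (pairing M v' w - pairing M (v n) w) \<le> Lnorm M 2 (\<lambda>x. v' x - v n x) * Lnorm M 2 w"
        using Cauchy_Schwarz_Lspace_2[OF Lspace_2_diff[OF assms(2,1)] assms(3)] by simp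
    qed
    show "(\<lambda>n. Lnorm M 2 (\<lambda>x. v' x - v n x) * Lnorm M 2 w) \<longlonglongrightarrow> 0"
      using tendsto_mult_right[OF assms(4)] by simp
  qed
  then show ?thesis using tendsto_diff[OF tendsto_const[of "pairing M v' w"]] by fastforce
qed

lemma pairing_commute: "pairing M v w = pairing M w v"
  by (simp add: pairing_def mult.commute)

lemma Lspace_2_bounded:
  assumes "finite_measure M" "h \<in> borel_measurable M" "\<And>x. x \<in> space M \<Longrightarrow> \<bar>h x\<bar> \<le> B"
  shows "h \<in> Lspace M 2"
proof -
  interpret finite_measure M by fact
  have "(\<lambda>x. 1) \<in> Lspace M 2" by (simp add: Lspace_2_iff)
  then show ?thesis using Lspace_2_bounded_mult[of "\<lambda>x. 1" M h B] assms by simp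
qed

lemma Lspace_2_integrable:
  assumes "finite_measure M" "v \<in> Lspace M 2"
  shows "integrable M v"
  using Lspace_2_mult_integrable[OF assms(2) Lspace_2_bounded[OF assms(1), of "\<lambda>_. 1" 1]] by simp

text \<open>The squares of the differences tend to 0 in L^1, which gives almost everywhere
  convergence along a subsequence; then roots are taken.\<close>

lemma Lspace_2_tendsto_AE_subseq:
  assumes v: "\<And>n. v n \<in> Lspace M 2" "v' \<in> Lspace M 2"
    and lim: "(\<lambda>n. Lnorm M 2 (\<lambda>x. v' x - v n x)) \<longlonglongrightarrow> 0"
  obtains r :: "nat \<Rightarrow> nat" where "strict_mono r" "AE x in M. (\<lambda>n. v (r n) x) \<longlonglongrightarrow> v' x"
proof -
  have "(\<lambda>n. LINT x|M. norm ((v' x - v n x)\<^sup>2)) \<longlonglongrightarrow> 0"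
    using tendsto_power[OF lim, of 2] by (simp add: Lnorm_2_power2)
  moreover have "integrable M (\<lambda>x. (v' x - v n x)\<^sup>2)" for n
    using Lspace_2_diff[OF v(2) v(1)[of n]] by (simp add: Lspace_2_iff)
  ultimately obtain r where r: "strict_mono r" "AE x in M. (\<lambda>n. (v' x - v (r n) x)\<^sup>2) \<longlonglongrightarrow> 0"
    using tendsto_L1_AE_subseq[of M "\<lambda>n x. (v' x - v n x)\<^sup>2"] by blast
  have "AE x in M. (\<lambda>n. v (r n) x) \<longlonglongrightarrow> v' x"
    using r(2)
  proof eventually_elim
    case (elim x)
    then have "(\<lambda>n. v' x - v (r n) x) \<longlonglongrightarrow> 0"
      using tendsto_real_sqrt[OF elim] by (simp add: tendsto_rabs_zero_iff)
    then show ?case using tendsto_diff[OF tendsto_const[of "v' x"]] by fastforce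
  qed
  then show thesis using that r(1) by blast
qed

section \<open>Weak derivatives on a bounded open set\<close>

lemma open_box_alt: "open_box N a b = {f\<in>(\<Pi>\<^sub>E i\<in>{..<N}. UNIV). \<forall>i\<in>{..<N}. f i \<in> {a i<..<b i}}"
  unfolding open_box_def PiE_def Pi_def by blast

text \<open>Supplies the generator for the uniqueness theorem on measures: open boxes are stable
  under intersection and exhaust the space.\<close>

lemma sets_lebP_eq_sigma_open_boxes:
  "sets (lebP N) = sigma_sets (topspace (RN N)) (range (\<lambda>(a, b). open_box N a b))"
proof -
  let ?E = "range (\<lambda>(a::real, b). {a<..<b})"
  have b: "sets (sigma UNIV ?E) = sets (lborel :: real measure)"
    using borel_eq_box[where 'a=real] by (simp only: box_real sets_lborel)
  have "sets (lebP N) = sets (PiM {..<N} (\<lambda>_. sigma (UNIV :: real set) ?E))"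
    by (intro sets_PiM_cong) (simp_all only: b)
  also have "\<dots> = sets (sigma (\<Pi>\<^sub>E i\<in>{..<N}. UNIV)
      {{f\<in>(\<Pi>\<^sub>E i\<in>{..<N}. UNIV). \<forall>i\<in>j. f i \<in> A i} | A j. j \<in> {{..<N}} \<and> A \<in> Pi j (\<lambda>_. ?E)})"
  proof (rule sets_PiM_sigma)
    fix i assume "i \<in> {..<N}"
    have "(UNIV :: real set) = (\<Union>n::nat. {- real n<..<real n})"
    proof (intro set_eqI iffI UNIV_I)
      fix x :: real
      obtain n where "\<bar>x\<bar> < real n" using reals_Archimedean2 by blast
      then have "x \<in> {- real n<..<real n}" by auto
      then show "x \<in> (\<Union>n::nat. {- real n<..<real n})" by blast
    qed
    then show "\<exists>S\<subseteq>?E. countable S \<and> UNIV = \<Union>S"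
      by (intro exI[of _ "range (\<lambda>n::nat. {- real n<..<real n})"]) auto
  qed auto
  also have "{{f\<in>(\<Pi>\<^sub>E i\<in>{..<N}. UNIV). \<forall>i\<in>j. f i \<in> A i} | A j. j \<in> {{..<N}} \<and> A \<in> Pi j (\<lambda>_. ?E)}
      = range (\<lambda>(a, b). open_box N a b)" (is "?L = ?R")
  proof (intro set_eqI iffI)
    fix X assume "X \<in> ?L"
    then obtain A where X: "X = {f\<in>(\<Pi>\<^sub>E i\<in>{..<N}. UNIV). \<forall>i\<in>{..<N}. f i \<in> A i}" and A: "A \<in> Pi {..<N} (\<lambda>_. ?E)"
      by auto
    have "\<forall>i\<in>{..<N}. \<exists>a b. A i = {a<..<b}" using A by fastforce
    then obtain a b where ab: "\<And>i. i < N \<Longrightarrow> A i = {a i<..<b i}" by (metis lessThan_iff)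
    have "X = open_box N a b" unfolding X open_box_alt using ab by simp
    then show "X \<in> ?R" by auto
  next
    fix X assume "X \<in> ?R"
    then obtain a b where "X = open_box N a b" by auto
    then have "X = {f\<in>(\<Pi>\<^sub>E i\<in>{..<N}. UNIV). \<forall>i\<in>{..<N}. f i \<in> {a i<..<b i}}"
      by (simp only: open_box_alt)
    moreover have "(\<lambda>i. {a i<..<b i}) \<in> Pi {..<N} (\<lambda>_. ?E)" by auto
    ultimately show "X \<in> ?L"
      by (intro CollectI exI[of _ "\<lambda>i. {a i<..<b i}"] exI[of _ "{..<N}"] conjI singletonI)
  qed
  also have "sets (sigma (\<Pi>\<^sub>E i\<in>{..<N}. UNIV) (range (\<lambda>(a, b). open_box N a b)))
    = sigma_sets (\<Pi>\<^sub>E i\<in>{..<N}. UNIV) (range (\<lambda>(a, b). open_box N a b))"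
  proof (rule sets_measure_of)
    have "open_box N a b \<subseteq> (\<Pi>\<^sub>E i\<in>{..<N}. UNIV)" for a b unfolding open_box_alt by blast
    then show "range (\<lambda>(a, b). open_box N a b) \<subseteq> Pow (\<Pi>\<^sub>E i\<in>{..<N}. UNIV)" by auto
  qed
  finally show ?thesis by simp
qed

lemma open_box_Int: "open_box N a b \<inter> open_box N c d = open_box N (\<lambda>i. max (a i) (c i)) (\<lambda>i. min (b i) (d i))"
  unfolding open_box_def PiE_Int by (intro PiE_cong) auto

text \<open>Product of one-dimensional smooth cutoffs with slope growing in \<open>n\<close>; the
  limit is the indicator of the open box, so that integrals over boxes are limits of integrals
  against test functions.\<close>

definition bump :: "nat \<Rightarrow> (nat \<Rightarrow> real) \<Rightarrow> (nat \<Rightarrow> real) \<Rightarrow> nat \<Rightarrow> (nat \<Rightarrow> real) \<Rightarrow> real" where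
  "bump N a b n x = (\<Prod>i<N. flat 0 1 (real n * (x i - a i)) * flat 0 1 (real n * (b i - x i)))"

lemma bump_test_function:
  assumes "closed_box N a b \<subseteq> D"
  shows "bump N a b n \<in> test_functions N D"
proof (rule test_functionsI[OF _ closed_box_compact assms])
  have "smooth (\<lambda>s. flat 0 1 (real n * (s - a i)) * flat 0 1 (real n * (b i - s)))" for i
    using smooth_compose[OF smooth_flat[of 1 0], of "\<lambda>s. real n * (s - a i)"]
      smooth_compose[OF smooth_flat[of 1 0], of "\<lambda>s. real n * (b i - s)"]
      smooth_mult[OF smooth_const[of "real n"] smooth_diff[OF smooth_id smooth_const[of "a i"]]]
      smooth_mult[OF smooth_const[of "real n"] smooth_diff[OF smooth_const[of "b i"] smooth_id]]
    by (intro smooth_mult) auto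
  then show "Cinfty N (bump N a b n)"
    unfolding Cinfty_def bump_def
    using Ck_prod_coordinates[of N "\<lambda>i s. flat 0 1 (real n * (s - a i)) * flat 0 1 (real n * (b i - s))"] by blast
next
  fix x assume "x \<in> topspace (RN N) - closed_box N a b"
  then obtain i where i: "i < N" "x i < a i \<or> x i > b i" unfolding closed_box_def by (auto simp: PiE_iff not_le)
  have "flat 0 1 (real n * (x i - a i)) * flat 0 1 (real n * (b i - x i)) = 0"
    using i(2) by (auto simp: flat_def zero_less_mult_iff)
  then show "bump N a b n x = 0" unfolding bump_def using i(1) by (intro prod_zero) auto
qed

lemma bump_bounds: "0 \<le> bump N a b n x" "bump N a b n x \<le> 1"
  unfolding bump_def
  by (auto intro!: prod_nonneg prod_le_1 mult_le_one simp: flat_0_1_bounds)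

lemma bump_tendsto:
  assumes "x \<in> topspace (RN N)"
  shows "(\<lambda>n. bump N a b n x) \<longlonglongrightarrow> indicator (open_box N a b) x"
proof (cases "x \<in> open_box N a b")
  case True
  have "(\<lambda>n. flat 0 1 (real n * (x i - a i)) * flat 0 1 (real n * (b i - x i))) \<longlonglongrightarrow> 1 * 1" if "i < N" for i
  proof (intro tendsto_mult flat_one_tendsto)
    have "x i - a i > 0" "b i - x i > 0" using True that by (auto simp: open_box_def PiE_iff)
    then show "filterlim (\<lambda>n. real n * (x i - a i)) at_top sequentially"
        "filterlim (\<lambda>n. real n * (b i - x i)) at_top sequentially"
      unfolding mult.commute[of "real _"]
      by (auto intro!: filterlim_tendsto_pos_mult_at_top[OF tendsto_const] filterlim_real_sequentially)
  qed
  then have "(\<lambda>n. bump N a b n x) \<longlonglongrightarrow> (\<Prod>i<N. 1)"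
    unfolding bump_def by (intro tendsto_prod) auto
  then show ?thesis using True by simp
next
  case False
  then obtain i where i: "i < N" "x i \<le> a i \<or> x i \<ge> b i"
    using assms unfolding open_box_def by (auto simp: PiE_iff not_less)
  have "bump N a b n x = 0" for n
  proof -
    have "flat 0 1 (real n * (x i - a i)) * flat 0 1 (real n * (b i - x i)) = 0"
      using i(2) by (auto simp: flat_def zero_less_mult_iff)
    then show ?thesis unfolding bump_def using i(1) by (intro prod_zero) auto
  qed
  then show ?thesis using False by simp
qed

text \<open>The positive and the negative part of \<open>w\<close> are densities of two finite
  measures that agree on open boxes, hence everywhere, and so the densities agree almost everywhere.
  As one of the two parts is 0 at each point, both are.\<close>

lemma AE_eq_0_if_open_box_integrals_0:
  assumes w: "integrable (lebP N) w" and box: "\<And>a b. (LINT x|lebP N. w x * indicator (open_box N a b) x) = 0"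
  shows "AE x in lebP N. w x = (0::real)"
proof -
  have [measurable]: "w \<in> borel_measurable (lebP N)" using w by auto
  note open_box_sets[measurable]
  let ?p = "\<lambda>x. ennreal (w x)" and ?m = "\<lambda>x. ennreal (- w x)"
  have fin: "(\<integral>\<^sup>+x. ?p x \<partial>lebP N) < \<infinity>" "(\<integral>\<^sup>+x. ?m x \<partial>lebP N) < \<infinity>"
    using w unfolding real_integrable_def by (auto simp: less_top)
  have eq: "density (lebP N) ?p = density (lebP N) ?m"
  proof (rule measure_eqI_generator_eq[where E="range (\<lambda>(a, b). open_box N a b)"
        and \<Omega>="topspace (RN N)" and A="\<lambda>n. open_box N (\<lambda>_. - real n) (\<lambda>_. real n)"])
    show "Int_stable (range (\<lambda>(a, b). open_box N a b))"
    proof (rule Int_stableI)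
      fix X Y assume "X \<in> range (\<lambda>(a, b). open_box N a b)" "Y \<in> range (\<lambda>(a, b). open_box N a b)"
      then obtain a b c d where "X = open_box N a b" "Y = open_box N c d" by auto
      then show "X \<inter> Y \<in> range (\<lambda>(a, b). open_box N a b)"
        unfolding open_box_Int by (intro image_eqI[of _ _ "(\<lambda>i. max (a i) (c i), \<lambda>i. min (b i) (d i))"]) (auto simp: open_box_Int)
    qed
    show "range (\<lambda>(a, b). open_box N a b) \<subseteq> Pow (topspace (RN N))"
      by (auto simp: open_box_def)
    show "sets (density (lebP N) ?p) = sigma_sets (topspace (RN N)) (range (\<lambda>(a, b). open_box N a b))"
      "sets (density (lebP N) ?m) = sigma_sets (topspace (RN N)) (range (\<lambda>(a, b). open_box N a b))"
      by (simp_all only: sets_density sets_lebP_eq_sigma_open_boxes)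
    show "range (\<lambda>n. open_box N (\<lambda>_. - real n) (\<lambda>_. real n)) \<subseteq> range (\<lambda>(a, b). open_box N a b)" by auto
    show "(\<Union>n. open_box N (\<lambda>_. - real n) (\<lambda>_. real n)) = topspace (RN N)"
    proof (intro set_eqI iffI)
      fix x assume x: "x \<in> topspace (RN N)"
      obtain n where n: "(\<Sum>i<N. \<bar>x i\<bar>) < real n" using reals_Archimedean2 by blast
      have "\<bar>x i\<bar> < real n" if "i < N" for i
        using member_le_sum[of i "{..<N}" "\<lambda>i. \<bar>x i\<bar>"] that n by auto
      then have "x \<in> open_box N (\<lambda>_. - real n) (\<lambda>_. real n)"
        using x unfolding open_box_alt by (simp add: abs_less_iff minus_less_iff)
      then show "x \<in> (\<Union>n. open_box N (\<lambda>_. - real n) (\<lambda>_. real n))" by blast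
    qed (auto simp: open_box_def PiE_iff)
    have le: "emeasure (density (lebP N) ?p) X \<le> (\<integral>\<^sup>+x. ?p x \<partial>lebP N)" if "X \<in> sets (lebP N)" for X
      using that by (auto simp: emeasure_density intro!: nn_integral_mono split: split_indicator)
    show "emeasure (density (lebP N) ?p) (open_box N (\<lambda>_. - real n) (\<lambda>_. real n)) \<noteq> \<infinity>" for n
      using le[OF open_box_sets, of "\<lambda>_. - real n" "\<lambda>_. real n"] fin(1) by (auto simp: top_unique)
    fix X assume "X \<in> range (\<lambda>(a, b). open_box N a b)"
    then obtain a b where X: "X = open_box N a b" by auto
    have Xs: "X \<in> sets (lebP N)" unfolding X by (rule open_box_sets)
    let ?w = "\<lambda>x. w x * indicator X x"
    have int: "integrable (lebP N) ?w"
      using Xs w by (rule integrable_mult_indicator[of X "lebP N" w, simplified mult.commute real_scaleR_def])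
    have "(LINT x|lebP N. ?w x) = 0" unfolding X by (rule box)
    then have "enn2real (\<integral>\<^sup>+x. ennreal (?w x) \<partial>lebP N) = enn2real (\<integral>\<^sup>+x. ennreal (- ?w x) \<partial>lebP N)"
      using real_lebesgue_integral_def[OF int] by simp
    moreover have "(\<integral>\<^sup>+x. ennreal (?w x) \<partial>lebP N) < top" "(\<integral>\<^sup>+x. ennreal (- ?w x) \<partial>lebP N) < top"
      using int unfolding real_integrable_def by (auto simp: less_top)
    ultimately have "(\<integral>\<^sup>+x. ennreal (?w x) \<partial>lebP N) = (\<integral>\<^sup>+x. ennreal (- ?w x) \<partial>lebP N)"
      by (metis ennreal_enn2real)
    moreover have "ennreal (?w x) = ?p x * indicator X x" "ennreal (- ?w x) = ?m x * indicator X x" for x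
      by (auto split: split_indicator)
    ultimately show "emeasure (density (lebP N) ?p) X = emeasure (density (lebP N) ?m) X"
      using Xs by (simp add: emeasure_density)
  qed
  have "AE x in lebP N. ?p x = ?m x"
    using finite_density_unique[of ?p "lebP N" ?m] fin eq by (auto simp: less_top)
  then show ?thesis
  proof eventually_elim
    case (elim x)
    then show ?case by (cases "w x \<ge> 0") (auto simp: ennreal_neg ennreal_eq_0_iff not_le)
  qed
qed

section \<open>Integration by parts and the fundamental lemma on a bounded open set\<close>

locale bounded_open_set =
  fixes N :: nat and D :: "(nat \<Rightarrow> real) set"
  assumes open_D: "openin (RN N) D"
    and bounded_D: "\<exists>R. \<forall>x\<in>D. \<forall>i<N. \<bar>x i\<bar> \<le> R"
begin

abbreviation "M \<equiv> leb N D"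

lemma D_top: "D \<subseteq> topspace (RN N)"
  using open_D openin_subset by blast

lemma D_sets: "D \<in> sets (lebP N)"
  using openin_RN_sets open_D by blast

lemma D_Int_space: "D \<inter> space (completion (lebP N)) \<in> sets (completion (lebP N))"
  using D_sets D_top by (intro sets.Int) auto

lemma space_M: "space M = D"
  using D_top space_lebP[of N] unfolding leb_def space_restrict_space by auto

lemma measurable_M: "f \<in> borel_measurable (lebP N) \<Longrightarrow> f \<in> borel_measurable M"
  unfolding leb_def by (intro measurable_restrict_space1 measurable_completion)

text \<open>\<open>leb N D\<close> restricts the completed product measure. Writing the restriction
  as an indicator allows Borel integrands to be moved to the uncompleted product measure, where
  Fubini and the box arguments take place.\<close>

lemma integral_M:
  fixes f :: "_ \<Rightarrow> real"
  shows "(LINT x|M. f x) = (LINT x|completion (lebP N). indicator D x * f x)"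
  unfolding leb_def by (subst integral_restrict_space[OF D_Int_space]) simp

lemma integrable_M:
  fixes f :: "_ \<Rightarrow> real"
  shows "integrable M f \<longleftrightarrow> integrable (completion (lebP N)) (\<lambda>x. indicator D x * f x)"
  unfolding leb_def by (subst integrable_restrict_space[OF D_Int_space]) simp

lemma finite_measure_M: "finite_measure M"
proof
  obtain R where R: "\<And>x i. x \<in> D \<Longrightarrow> i < N \<Longrightarrow> \<bar>x i\<bar> \<le> R" using bounded_D by blast
  have "D \<subseteq> closed_box N (\<lambda>_. - R) (\<lambda>_. R)"
    using R D_top by (fastforce simp: closed_box_def PiE_iff abs_le_iff)
  then have "emeasure (lebP N) D \<le> emeasure (lebP N) (closed_box N (\<lambda>_. - R) (\<lambda>_. R))"
    by (intro emeasure_mono closed_box_sets)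
  then have "emeasure (lebP N) D < \<infinity>" using emeasure_closed_box order_le_less_trans by blast
  moreover have "emeasure M (space M) = emeasure (lebP N) D"
    unfolding space_M unfolding leb_def using D_Int_space D_sets
    by (subst emeasure_restrict_space) auto
  ultimately show "emeasure M (space M) \<noteq> \<infinity>" by simp
qed

sublocale finite_measure M by (rule finite_measure_M)

lemma test_measurable: "\<phi> \<in> test_functions N D \<Longrightarrow> \<phi> \<in> borel_measurable M"
  by (intro measurable_M continuous_map_RN_measurable test_functions_continuous)

lemma test_bounded:
  assumes "\<phi> \<in> test_functions N D"
  obtains B where "B > 0" "\<And>x. x \<in> space M \<Longrightarrow> \<bar>\<phi> x\<bar> \<le> B"
  using test_functions_bounded[OF assms] D_top unfolding space_M by (metis subsetD)

lemma test_Lspace: "\<phi> \<in> test_functions N D \<Longrightarrow> \<phi> \<in> Lspace M 2"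
  using test_bounded[of \<phi>] Lspace_2_bounded[OF finite_measure_M test_measurable] by metis

lemma test_pd_Lspace: "\<phi> \<in> test_functions N D \<Longrightarrow> i < N \<Longrightarrow> pd i \<phi> \<in> Lspace M 2"
  by (intro test_Lspace test_functions_pd)

text \<open>The product of the two test functions is a test function, so its partial derivative
  integrates to 0 over the whole space; it vanishes off D, hence the same holds over D, and the
  product rule splits the integral.\<close>

lemma test_integration_by_parts:
  assumes \<phi>: "\<phi> \<in> test_functions N D" and \<psi>: "\<psi> \<in> test_functions N D" and i: "i < N"
  shows "pairing M \<phi> (pd i \<psi>) = - pairing M (pd i \<phi>) \<psi>"
proof -
  have \<phi>\<psi>: "(\<lambda>x. \<phi> x * \<psi> x) \<in> test_functions N D"
    using test_functions_mult \<phi> test_functions_Cinfty[OF \<psi>] by blast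
  have pdm: "pd i (\<lambda>x. \<phi> x * \<psi> x) \<in> test_functions N D" using test_functions_pd \<phi>\<psi> i by blast
  have z: "indicator D x * pd i (\<lambda>x. \<phi> x * \<psi> x) x = pd i (\<lambda>x. \<phi> x * \<psi> x) x" if "x \<in> space (lebP N)" for x
  proof (cases "x \<in> D")
    case False
    obtain K where K: "compactin (RN N) K" "K \<subseteq> D" "\<And>x. x \<in> topspace (RN N) - K \<Longrightarrow> pd i (\<lambda>x. \<phi> x * \<psi> x) x = 0"
      using test_functions_support[OF pdm] by blast
    have "x \<in> topspace (RN N) - K" using False that K(2) unfolding space_lebP by blast
    then have "pd i (\<lambda>x. \<phi> x * \<psi> x) x = 0" by (rule K(3))
    then show ?thesis by simp
  qed simp
  have "(LINT x|M. pd i (\<lambda>x. \<phi> x * \<psi> x) x) = (LINT x|completion (lebP N). pd i (\<lambda>x. \<phi> x * \<psi> x) x)"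
    unfolding integral_M
    by (rule Bochner_Integration.integral_cong[OF refl], rule z) (simp only: space_completion)
  also have "\<dots> = (LINT x|lebP N. pd i (\<lambda>x. \<phi> x * \<psi> x) x)"
    by (intro integral_completion continuous_map_RN_measurable test_functions_continuous[OF pdm])
  also have "\<dots> = 0" by (rule integral_pd_eq_0[OF \<phi>\<psi> i])
  finally have "(LINT x|M. pd i (\<lambda>x. \<phi> x * \<psi> x) x) = 0" .
  moreover have "(LINT x|M. pd i (\<lambda>x. \<phi> x * \<psi> x) x) = (LINT x|M. pd i \<phi> x * \<psi> x + \<phi> x * pd i \<psi> x)"
    using pd_mult[OF test_functions_Cinfty[OF \<phi>] test_functions_Cinfty[OF \<psi>] i] D_top
    by (intro Bochner_Integration.integral_cong) (auto simp: space_M mult.commute)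
  ultimately show ?thesis
    unfolding pairing_def
    using Lspace_2_mult_integrable[OF test_pd_Lspace[OF \<phi> i] test_Lspace[OF \<psi>]]
      Lspace_2_mult_integrable[OF test_Lspace[OF \<phi>] test_pd_Lspace[OF \<psi> i]]
    by simp
qed

text \<open>Testing with the bumps of a box whose closure lies in D and passing to the limit shows
  that the integral of \<open>w\<close> over that open box is 0. This applies to all subboxes too,
  so \<open>w\<close> vanishes almost everywhere on the box, and countably many boxes cover
  D.\<close>

lemma fundamental_lemma:
  assumes w: "integrable M w" and 0: "\<And>\<phi>. \<phi> \<in> test_functions N D \<Longrightarrow> pairing M w \<phi> = 0"
  shows "AE x in M. w x = 0"
proof -
  let ?W = "\<lambda>x. indicator D x * w x"
  have W: "integrable (completion (lebP N)) ?W" using w integrable_M by blast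
  \<comment> \<open>\<open>w\<close> is measurable for the completed measure only; the argument on
    boxes runs with a Borel function equal to it almost everywhere.\<close>
  obtain W' where W'm[measurable]: "W' \<in> borel_measurable (lebP N)" and W'e: "AE x in lebP N. ?W x = W' x"
    using completion_ex_borel_measurable_real borel_measurable_integrable[OF W] by blast
  have W'c: "AE x in completion (lebP N). ?W x = W' x" using W'e by (rule AE_completion)
  have "integrable (completion (lebP N)) W'"
    using W integrable_cong_AE[OF borel_measurable_integrable[OF W] measurable_completion[OF W'm] W'c] by blast
  then have W'i: "integrable (lebP N) W'" using integrable_completion[OF W'm] by blast
  note open_box_sets[measurable]
  have box: "(LINT x|lebP N. W' x * indicator (open_box N a b) x) = 0" if ab: "closed_box N a b \<subseteq> D" for a b
  proof -
    have [measurable]: "bump N a b n \<in> borel_measurable (lebP N)" for n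
      by (rule continuous_map_RN_measurable[OF test_functions_continuous[OF bump_test_function[OF ab]]])
    have "(LINT x|lebP N. W' x * bump N a b n x) = 0" for n
    proof -
      have "0 = pairing M w (bump N a b n)" using 0[OF bump_test_function[OF ab]] by simp
      also have "\<dots> = (LINT x|completion (lebP N). ?W x * bump N a b n x)"
        unfolding pairing_def integral_M by (simp add: mult.assoc)
      also have "\<dots> = (LINT x|completion (lebP N). W' x * bump N a b n x)"
      proof (rule integral_cong_AE)
        have b: "bump N a b n \<in> borel_measurable (completion (lebP N))" by (rule measurable_completion) simp
        show "(\<lambda>x. ?W x * bump N a b n x) \<in> borel_measurable (completion (lebP N))"
          by (rule borel_measurable_times[OF borel_measurable_integrable[OF W] b])
        show "(\<lambda>x. W' x * bump N a b n x) \<in> borel_measurable (completion (lebP N))"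
          by (rule borel_measurable_times[OF measurable_completion[OF W'm] b])
        show "AE x in completion (lebP N). ?W x * bump N a b n x = W' x * bump N a b n x"
          using W'c by eventually_elim simp
      qed
      also have "\<dots> = (LINT x|lebP N. W' x * bump N a b n x)"
        by (intro integral_completion) measurable
      finally show ?thesis by simp
    qed
    moreover have "(\<lambda>n. LINT x|lebP N. W' x * bump N a b n x) \<longlonglongrightarrow> (LINT x|lebP N. W' x * indicator (open_box N a b) x)"
    proof (rule integral_dominated_convergence[where w="\<lambda>x. \<bar>W' x\<bar>"])
      show "AE x in lebP N. (\<lambda>n. W' x * bump N a b n x) \<longlonglongrightarrow> W' x * indicator (open_box N a b) x"
        by (rule AE_I2) (simp only: space_lebP, intro tendsto_mult_left bump_tendsto)
      show "AE x in lebP N. norm (W' x * bump N a b n x) \<le> \<bar>W' x\<bar>" for n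
        using bump_bounds[of N a b n] by (intro AE_I2) (auto simp: abs_mult mult_left_le)
    qed (use W'i in auto)
    ultimately show ?thesis by (simp add: LIMSEQ_const_iff)
  qed
  obtain B where B: "countable B" "\<And>a b. (a, b) \<in> B \<Longrightarrow> closed_box N a b \<subseteq> D"
    "D = (\<Union>(a, b)\<in>B. open_box N a b)"
    using openin_RN_Union_boxes[OF open_D] by metis
  have "AE x in lebP N. W' x * indicator (open_box N a b) x = 0" if ab: "(a, b) \<in> B" for a b
  proof (rule AE_eq_0_if_open_box_integrals_0)
    show "integrable (lebP N) (\<lambda>x. W' x * indicator (open_box N a b) x)"
      using integrable_mult_indicator[OF open_box_sets W'i] by (simp add: mult.commute)
    fix c d
    \<comment> \<open>The intersection of the fixed box with an arbitrary one is a box whose closure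
      still lies in D, so the vanishing of box integrals applies to it.\<close>
    have "closed_box N (\<lambda>i. max (a i) (c i)) (\<lambda>i. min (b i) (d i)) \<subseteq> closed_box N a b"
      unfolding closed_box_def by (rule PiE_mono) auto
    then have "closed_box N (\<lambda>i. max (a i) (c i)) (\<lambda>i. min (b i) (d i)) \<subseteq> D" using B(2)[OF ab] by blast
    from box[OF this] show "(LINT x|lebP N. W' x * indicator (open_box N a b) x * indicator (open_box N c d) x) = 0"
      by (simp add: open_box_Int[symmetric] indicator_inter_arith mult.assoc)
  qed
  then have "AE x in lebP N. \<forall>(a, b)\<in>B. W' x * indicator (open_box N a b) x = 0"
    using B(1) by (intro AE_ball_countable') auto
  then have "AE x in lebP N. x \<in> D \<longrightarrow> w x = 0"
    using W'e
  proof eventually_elim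
    case (elim x)
    show ?case
    proof
      assume x: "x \<in> D"
      then obtain a b where "(a, b) \<in> B" "x \<in> open_box N a b" using B(3) by blast
      then show "w x = 0" using elim x by fastforce
    qed
  qed
  then have "AE x in completion (lebP N). x \<in> D \<longrightarrow> w x = 0" by (rule AE_completion)
  then show ?thesis unfolding leb_def using AE_restrict_space_iff[OF D_Int_space] by blast
qed

end

lemma Lnorm_2_nonneg: "0 \<le> Lnorm M 2 v"
  by (simp add: Lnorm_def)

lemma Lnorm_2_mono:
  assumes "w \<in> Lspace M 2" "v \<in> borel_measurable M" "AE x in M. \<bar>v x\<bar> \<le> \<bar>w x\<bar>"
  shows "Lnorm M 2 v \<le> Lnorm M 2 w"
proof -
  have sq: "AE x in M. (v x)\<^sup>2 \<le> (w x)\<^sup>2"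
    using assms(3) by eventually_elim (simp add: abs_le_square_iff)
  have "integrable M (\<lambda>x. (v x)\<^sup>2)"
    by (rule Bochner_Integration.integrable_bound[of _ "\<lambda>x. (w x)\<^sup>2"])
      (use assms sq in \<open>auto simp: Lspace_2_iff\<close>)
  then show ?thesis unfolding Lnorm_2_eq
    using assms sq by (intro real_sqrt_le_mono integral_mono_AE) (auto simp: Lspace_2_iff)
qed

lemma Lnorm_2_cong_AE:
  assumes "v \<in> borel_measurable M" "w \<in> borel_measurable M" "AE x in M. v x = w x"
  shows "Lnorm M 2 v = Lnorm M 2 w"
proof -
  have "(LINT x|M. (v x)\<^sup>2) = (LINT x|M. (w x)\<^sup>2)"
    by (rule integral_cong_AE) (use assms in auto)
  then show ?thesis by (simp add: Lnorm_2_eq)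
qed

lemma Lnorm_2_cmult: "Lnorm M 2 (\<lambda>x. c * v x) = \<bar>c\<bar> * Lnorm M 2 v"
  by (simp add: Lnorm_2_eq power_mult_distrib real_sqrt_mult)

lemma Lnorm_2_triangle:
  assumes "v \<in> Lspace M 2" "w \<in> Lspace M 2"
  shows "Lnorm M 2 (\<lambda>x. v x + w x) \<le> Lnorm M 2 v + Lnorm M 2 w"
proof (rule power2_le_imp_le)
  have "(LINT x|M. (v x + w x)\<^sup>2) = (LINT x|M. (v x)\<^sup>2 + (w x)\<^sup>2 + 2 * (v x * w x))"
    by (simp add: power2_sum mult.assoc)
  also have "\<dots> = (Lnorm M 2 v)\<^sup>2 + (Lnorm M 2 w)\<^sup>2 + 2 * pairing M v w"
    using assms Lspace_2_mult_integrable[OF assms] unfolding Lnorm_2_power2 pairing_def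
    by (simp add: Lspace_2_iff)
  also have "\<dots> \<le> (Lnorm M 2 v + Lnorm M 2 w)\<^sup>2"
    using Cauchy_Schwarz_Lspace_2[OF assms] by (simp add: power2_sum mult.assoc)
  finally show "(Lnorm M 2 (\<lambda>x. v x + w x))\<^sup>2 \<le> (Lnorm M 2 v + Lnorm M 2 w)\<^sup>2"
    unfolding Lnorm_2_power2 .
qed (simp add: Lnorm_2_nonneg)

lemma Lnorm_2_minus: "Lnorm M 2 (\<lambda>x. - v x) = Lnorm M 2 v"
  by (simp add: Lnorm_2_eq)

lemma Lnorm_2_triangle_diff:
  assumes "v \<in> Lspace M 2" "w \<in> Lspace M 2"
  shows "Lnorm M 2 (\<lambda>x. v x - w x) \<le> Lnorm M 2 v + Lnorm M 2 w"
  using Lnorm_2_triangle[OF assms(1) Lspace_2_cmult[OF assms(2), of "-1"]] by (simp add: Lnorm_2_minus)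

lemma pairing_diff_left:
  assumes "v \<in> Lspace M 2" "v' \<in> Lspace M 2" "w \<in> Lspace M 2"
  shows "pairing M (\<lambda>x. v x - v' x) w = pairing M v w - pairing M v' w"
  unfolding pairing_def using Lspace_2_mult_integrable[OF _ assms(3)] assms(1,2)
  by (simp add: left_diff_distrib)

lemma pairing_cong_AE:
  assumes "v \<in> Lspace M 2" "v' \<in> Lspace M 2" "w \<in> Lspace M 2" "w' \<in> Lspace M 2"
    and "AE x in M. v x = v' x" "AE x in M. w x = w' x"
  shows "pairing M v w = pairing M v' w'"
  unfolding pairing_def
proof (rule integral_cong_AE)
  show "AE x in M. v x * w x = v' x * w' x" using assms(5,6) by eventually_elim simp
qed (use assms Lspace_2_measurable in \<open>blast intro: borel_measurable_times\<close>)+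

lemma lipschitz_of_derivative_bound:
  fixes h :: "real \<Rightarrow> real"
  assumes "\<And>s. (h has_real_derivative h' s) (at s)" "\<And>s. \<bar>h' s\<bar> \<le> K"
  shows "\<bar>h a - h b\<bar> \<le> K * \<bar>a - b\<bar>"
proof -
  have "norm (h a - h b) \<le> K * norm (a - b)"
    by (rule field_differentiable_bound[of UNIV h h'])
      (use assms in \<open>auto intro: has_field_derivative_at_within\<close>)
  then show ?thesis by simp
qed

context bounded_open_set
begin

lemma is_weak_pd_Lspace: "is_weak_pd N D i v w \<Longrightarrow> w \<in> Lspace M 2"
  by (simp add: is_weak_pd_def)

lemma is_weak_pd_unique:
  assumes "is_weak_pd N D i v w" "is_weak_pd N D i v w'"
  shows "AE x in M. w x = w' x"
proof -
  have L: "w \<in> Lspace M 2" "w' \<in> Lspace M 2" using assms is_weak_pd_Lspace by auto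
  have "AE x in M. w x - w' x = 0"
  proof (rule fundamental_lemma)
    show "integrable M (\<lambda>x. w x - w' x)"
      using Lspace_2_integrable[OF finite_measure_M Lspace_2_diff[OF L]] .
    fix \<phi> assume \<phi>: "\<phi> \<in> test_functions N D"
    have "- pairing M w \<phi> = - pairing M w' \<phi>"
      using assms \<phi> unfolding is_weak_pd_def by metis
    then show "pairing M (\<lambda>x. w x - w' x) \<phi> = 0"
      using pairing_diff_left[OF L test_Lspace[OF \<phi>]] by simp
  qed
  then show ?thesis by auto
qed

lemma is_weak_pd_weak_pd: "is_weak_pd N D i v w \<Longrightarrow> is_weak_pd N D i v (weak_pd N D i v)"
  unfolding weak_pd_def by (rule someI[of "is_weak_pd N D i v"])

lemma weak_pd_AE_eq: "is_weak_pd N D i v w \<Longrightarrow> AE x in M. weak_pd N D i v x = w x"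
  using is_weak_pd_unique is_weak_pd_weak_pd by blast

lemma H1_is_weak_pd: "v \<in> H1 N D \<Longrightarrow> i < N \<Longrightarrow> is_weak_pd N D i v (weak_pd N D i v)"
  unfolding H1_def using is_weak_pd_weak_pd by blast

lemma weak_pd_Lspace: "v \<in> H1 N D \<Longrightarrow> i < N \<Longrightarrow> weak_pd N D i v \<in> Lspace M 2"
  using H1_is_weak_pd is_weak_pd_Lspace by blast

lemma H1_Lspace: "v \<in> H1 N D \<Longrightarrow> v \<in> Lspace M 2"
  by (simp add: H1_def)

lemma H10_H1: "v \<in> H10 N D \<Longrightarrow> v \<in> H1 N D"
  by (simp add: H10_def)

lemma is_weak_pd_test: "\<phi> \<in> test_functions N D \<Longrightarrow> i < N \<Longrightarrow> is_weak_pd N D i \<phi> (pd i \<phi>)"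
  unfolding is_weak_pd_def using test_integration_by_parts test_pd_Lspace by blast

lemma test_H1: "\<phi> \<in> test_functions N D \<Longrightarrow> \<phi> \<in> H1 N D"
  unfolding H1_def using is_weak_pd_test test_Lspace by blast

lemma is_weak_pd_diff:
  assumes "is_weak_pd N D i v w" "is_weak_pd N D i v' w'" "v \<in> Lspace M 2" "v' \<in> Lspace M 2" "i < N"
  shows "is_weak_pd N D i (\<lambda>x. v x - v' x) (\<lambda>x. w x - w' x)"
  unfolding is_weak_pd_def
proof (intro conjI ballI)
  have L: "w \<in> Lspace M 2" "w' \<in> Lspace M 2" using assms is_weak_pd_Lspace by auto
  then show "(\<lambda>x. w x - w' x) \<in> Lspace M 2" by (rule Lspace_2_diff)
  fix \<phi> assume \<phi>: "\<phi> \<in> test_functions N D"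
  then show "pairing M (\<lambda>x. v x - v' x) (pd i \<phi>) = - pairing M (\<lambda>x. w x - w' x) \<phi>"
    using assms pairing_diff_left[OF L test_Lspace[OF \<phi>]]
      pairing_diff_left[OF assms(3,4) test_pd_Lspace[OF \<phi> assms(5)]]
    unfolding is_weak_pd_def by simp
qed

text \<open>The limit \<^term>\<open>G\<close> of the gradients is a priori unrelated to the chosen weak derivatives.\<close>

definition H10_approx ::
  "((nat \<Rightarrow> real) \<Rightarrow> real) \<Rightarrow> (nat \<Rightarrow> (nat \<Rightarrow> real) \<Rightarrow> real) \<Rightarrow> (nat \<Rightarrow> (nat \<Rightarrow> real) \<Rightarrow> real) \<Rightarrow> bool" where
  "H10_approx v G \<phi> \<longleftrightarrow> v \<in> Lspace M 2 \<and> (\<forall>i<N. G i \<in> Lspace M 2) \<and>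
     (\<forall>n. \<phi> n \<in> test_functions N D) \<and> (\<lambda>n. Lnorm M 2 (\<lambda>x. v x - \<phi> n x)) \<longlonglongrightarrow> 0 \<and>
     (\<forall>i<N. (\<lambda>n. Lnorm M 2 (\<lambda>x. G i x - pd i (\<phi> n) x)) \<longlonglongrightarrow> 0)"

lemma H1norm_ge:
  shows "Lnorm M 2 v \<le> H1norm N D v" "i < N \<Longrightarrow> Lnorm M 2 (weak_pd N D i v) \<le> H1norm N D v"
proof -
  show "Lnorm M 2 v \<le> H1norm N D v"
    unfolding H1norm_def by (rule real_le_rsqrt) (simp add: sum_nonneg)
  assume "i < N"
  then have "(Lnorm M 2 (weak_pd N D i v))\<^sup>2 \<le> (\<Sum>i<N. (Lnorm M 2 (weak_pd N D i v))\<^sup>2)"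
    by (intro member_le_sum) auto
  then show "Lnorm M 2 (weak_pd N D i v) \<le> H1norm N D v"
    unfolding H1norm_def by (intro real_le_rsqrt) (simp add: add_increasing)
qed

text \<open>The norm of v - \<phi> n in H1 is computed from the derivatives chosen for the
  difference; by uniqueness these agree almost everywhere with the difference of the chosen
  derivative of v and the classical derivative of \<phi> n.\<close>

lemma H10_imp_approx:
  assumes "v \<in> H10 N D"
  obtains \<phi> where "H10_approx v (\<lambda>i. weak_pd N D i v) \<phi>"
proof -
  obtain \<phi> where \<phi>: "\<And>n. \<phi> n \<in> test_functions N D" "(\<lambda>n. H1norm N D (\<lambda>x. v x - \<phi> n x)) \<longlonglongrightarrow> 0"
    using assms unfolding H10_def by blast
  have v: "v \<in> H1 N D" "v \<in> Lspace M 2" using assms H10_H1 H1_Lspace by auto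
  have "(\<lambda>n. Lnorm M 2 (\<lambda>x. v x - \<phi> n x)) \<longlonglongrightarrow> 0"
    by (rule tendsto_sandwich[OF _ _ tendsto_const \<phi>(2)]) (auto simp: Lnorm_2_nonneg H1norm_ge)
  moreover have "(\<lambda>n. Lnorm M 2 (\<lambda>x. weak_pd N D i v x - pd i (\<phi> n) x)) \<longlonglongrightarrow> 0" if i: "i < N" for i
  proof (rule tendsto_sandwich[OF _ _ tendsto_const \<phi>(2)])
    have "Lnorm M 2 (\<lambda>x. weak_pd N D i v x - pd i (\<phi> n) x) \<le> H1norm N D (\<lambda>x. v x - \<phi> n x)" for n
    proof -
      let ?w = "\<lambda>x. weak_pd N D i v x - pd i (\<phi> n) x"
      have wd: "is_weak_pd N D i (\<lambda>x. v x - \<phi> n x) ?w"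
        using is_weak_pd_diff H1_is_weak_pd[OF v(1) i] is_weak_pd_test[OF \<phi>(1) i] v(2) test_Lspace[OF \<phi>(1)] i
        by blast
      have "Lnorm M 2 ?w = Lnorm M 2 (weak_pd N D i (\<lambda>x. v x - \<phi> n x))"
      proof (rule Lnorm_2_cong_AE)
        show "AE x in M. ?w x = weak_pd N D i (\<lambda>x. v x - \<phi> n x) x"
          using weak_pd_AE_eq[OF wd] by auto
      qed (use wd is_weak_pd_weak_pd[OF wd] is_weak_pd_Lspace Lspace_2_measurable in blast)+
      then show ?thesis using H1norm_ge(2)[OF i] by simp
    qed
    then show "\<forall>\<^sub>F n in sequentially. Lnorm M 2 (\<lambda>x. weak_pd N D i v x - pd i (\<phi> n) x) \<le> H1norm N D (\<lambda>x. v x - \<phi> n x)"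
      by simp
  qed (auto simp: Lnorm_2_nonneg)
  ultimately have "H10_approx v (\<lambda>i. weak_pd N D i v) \<phi>"
    unfolding H10_approx_def using \<phi>(1) v weak_pd_Lspace by blast
  then show thesis by (rule that)
qed

lemma H10_approx_weak_pd:
  assumes "H10_approx v G \<phi>" "i < N"
  shows "is_weak_pd N D i v (G i)"
  unfolding is_weak_pd_def
proof (intro conjI ballI)
  show "G i \<in> Lspace M 2" using assms unfolding H10_approx_def by blast
  fix \<psi> assume \<psi>: "\<psi> \<in> test_functions N D"
  have \<phi>: "\<phi> n \<in> test_functions N D" for n using assms(1) unfolding H10_approx_def by blast
  have "(\<lambda>n. pairing M (\<phi> n) (pd i \<psi>)) \<longlonglongrightarrow> pairing M v (pd i \<psi>)"
    using assms test_Lspace[OF \<phi>] test_pd_Lspace[OF \<psi>]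
    by (intro pairing_tendsto) (auto simp: H10_approx_def)
  moreover have "(\<lambda>n. - pairing M (pd i (\<phi> n)) \<psi>) \<longlonglongrightarrow> - pairing M (G i) \<psi>"
    using assms test_pd_Lspace[OF \<phi>] test_Lspace[OF \<psi>]
    by (intro tendsto_minus pairing_tendsto) (auto simp: H10_approx_def)
  moreover have "pairing M (\<phi> n) (pd i \<psi>) = - pairing M (pd i (\<phi> n)) \<psi>" for n
    using test_integration_by_parts[OF \<phi> \<psi> assms(2)] .
  ultimately show "pairing M v (pd i \<psi>) = - pairing M (G i) \<psi>"
    using LIMSEQ_unique by simp
qed

text \<open>Converse of \<open>H10_imp_approx\<close>: membership follows from approximating test
  functions and any candidate limits of their gradients, which is how compositions are shown to lie
  in H10.\<close>

lemma H10_approx_imp_H10: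
  assumes "H10_approx v G \<phi>"
  shows "v \<in> H10 N D"
proof -
  have L: "v \<in> Lspace M 2" "\<And>n. \<phi> n \<in> test_functions N D" using assms unfolding H10_approx_def by blast+
  have "H1norm N D (\<lambda>x. v x - \<phi> n x) =
     sqrt ((Lnorm M 2 (\<lambda>x. v x - \<phi> n x))\<^sup>2 + (\<Sum>i<N. (Lnorm M 2 (\<lambda>x. G i x - pd i (\<phi> n) x))\<^sup>2))" for n
  proof -
    have "Lnorm M 2 (weak_pd N D i (\<lambda>x. v x - \<phi> n x)) = Lnorm M 2 (\<lambda>x. G i x - pd i (\<phi> n) x)" if i: "i < N" for i
    proof -
      have wd: "is_weak_pd N D i (\<lambda>x. v x - \<phi> n x) (\<lambda>x. G i x - pd i (\<phi> n) x)"
        using is_weak_pd_diff H10_approx_weak_pd[OF assms i] is_weak_pd_test[OF L(2) i] L(1) test_Lspace[OF L(2)] i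
        by blast
      show ?thesis
        by (rule Lnorm_2_cong_AE[OF _ _ weak_pd_AE_eq[OF wd]])
          (use wd is_weak_pd_weak_pd[OF wd] is_weak_pd_Lspace Lspace_2_measurable in blast)+
    qed
    then show ?thesis unfolding H1norm_def by simp
  qed
  moreover have "(\<lambda>n. sqrt ((Lnorm M 2 (\<lambda>x. v x - \<phi> n x))\<^sup>2 + (\<Sum>i<N. (Lnorm M 2 (\<lambda>x. G i x - pd i (\<phi> n) x))\<^sup>2)))
     \<longlonglongrightarrow> sqrt (0\<^sup>2 + (\<Sum>i<N. 0\<^sup>2))"
    using assms unfolding H10_approx_def by (intro tendsto_intros) auto
  ultimately have "(\<lambda>n. H1norm N D (\<lambda>x. v x - \<phi> n x)) \<longlonglongrightarrow> 0" by simp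
  moreover have "v \<in> H1 N D" unfolding H1_def using L(1) H10_approx_weak_pd[OF assms] by blast
  ultimately show ?thesis unfolding H10_def using L(2) by blast
qed

lemma H10_approx_diff:
  assumes "H10_approx v G \<phi>" "H10_approx v' G' \<phi>'"
  shows "H10_approx (\<lambda>x. v x - v' x) (\<lambda>i x. G i x - G' i x) (\<lambda>n x. \<phi> n x - \<phi>' n x)"
proof -
  have conv: "(\<lambda>n. Lnorm M 2 (\<lambda>x. (f x - f' x) - (g n x - g' n x))) \<longlonglongrightarrow> 0"
    if "f \<in> Lspace M 2" "f' \<in> Lspace M 2" "\<And>n. g n \<in> Lspace M 2" "\<And>n. g' n \<in> Lspace M 2"
      "(\<lambda>n. Lnorm M 2 (\<lambda>x. f x - g n x)) \<longlonglongrightarrow> 0" "(\<lambda>n. Lnorm M 2 (\<lambda>x. f' x - g' n x)) \<longlonglongrightarrow> 0" for f f' g g'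
  proof (rule tendsto_sandwich[OF _ _ tendsto_const])
    show "(\<lambda>n. Lnorm M 2 (\<lambda>x. f x - g n x) + Lnorm M 2 (\<lambda>x. f' x - g' n x)) \<longlonglongrightarrow> 0"
      using tendsto_add[OF that(5,6)] by simp
    have "Lnorm M 2 (\<lambda>x. (f x - f' x) - (g n x - g' n x)) \<le> Lnorm M 2 (\<lambda>x. f x - g n x) + Lnorm M 2 (\<lambda>x. f' x - g' n x)" for n
      using Lnorm_2_triangle_diff[OF Lspace_2_diff[OF that(1) that(3)[of n]] Lspace_2_diff[OF that(2) that(4)[of n]]]
      by (simp add: algebra_simps)
    then show "\<forall>\<^sub>F n in sequentially. Lnorm M 2 (\<lambda>x. (f x - f' x) - (g n x - g' n x)) \<le> Lnorm M 2 (\<lambda>x. f x - g n x) + Lnorm M 2 (\<lambda>x. f' x - g' n x)"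
      by simp
  qed (auto simp: Lnorm_2_nonneg)
  have pdd: "Lnorm M 2 (\<lambda>x. (G i x - G' i x) - pd i (\<lambda>x. \<phi> n x - \<phi>' n x) x)
     = Lnorm M 2 (\<lambda>x. (G i x - G' i x) - (pd i (\<phi> n) x - pd i (\<phi>' n) x))" if "i < N" for i n
  proof -
    have "\<phi> n \<in> test_functions N D" "\<phi>' n \<in> test_functions N D" using assms unfolding H10_approx_def by blast+
    then have "pd i (\<lambda>x. \<phi> n x - \<phi>' n x) x = pd i (\<phi> n) x - pd i (\<phi>' n) x" if "x \<in> space M" for x
      using pd_diff test_functions_Cinfty that \<open>i < N\<close> D_top unfolding space_M by blast
    then show ?thesis unfolding Lnorm_def by (simp cong: Bochner_Integration.integral_cong)
  qed
  show ?thesis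
    unfolding H10_approx_def
    using assms conv[of v v' \<phi> \<phi>'] conv[of "G i" "G' i" "\<lambda>n. pd i (\<phi> n)" "\<lambda>n. pd i (\<phi>' n)" for i]
    unfolding H10_approx_def
    by (simp add: pdd Lspace_2_diff test_functions_diff test_Lspace test_pd_Lspace)
qed

text \<open>Chain rule obtained by composing the approximating test functions with \<open>h\<close>:
  since \<open>h\<close> is smooth and fixes 0 the compositions are again test functions, and the
  Lipschitz bound gives their convergence in L^2.\<close>

lemma H10_approx_compose:
  assumes ap: "H10_approx v G \<phi>" and h: "smooth h" "h 0 = 0"
    and h': "\<And>s. (h has_real_derivative h' s) (at s)" "\<And>s. \<bar>h' s\<bar> \<le> K"
  obtains r where "H10_approx (\<lambda>x. h (v x)) (\<lambda>i x. h' (v x) * G i x) (\<lambda>n x. h (\<phi> (r n) x))"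
proof -
  have v: "v \<in> Lspace M 2" and \<phi>: "\<And>n. \<phi> n \<in> test_functions N D"
    and G: "\<And>i. i < N \<Longrightarrow> G i \<in> Lspace M 2"
    and lim: "(\<lambda>n. Lnorm M 2 (\<lambda>x. v x - \<phi> n x)) \<longlonglongrightarrow> 0"
      "\<And>i. i < N \<Longrightarrow> (\<lambda>n. Lnorm M 2 (\<lambda>x. G i x - pd i (\<phi> n) x)) \<longlonglongrightarrow> 0"
    using ap unfolding H10_approx_def by blast+
  have K: "K \<ge> 0" using h'(2)[of 0] by linarith
  have h'_eq: "h' = deriv h" using DERIV_imp_deriv[OF h'(1)] by (simp add: fun_eq_iff)
  have h'c: "continuous_on UNIV h'" unfolding h'_eq by (intro smooth_continuous_on smooth_deriv(2) h(1))
  have hc: "continuous_on UNIV h" by (intro smooth_continuous_on h(1))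
  have [measurable]: "h' \<in> borel_measurable borel" "h \<in> borel_measurable borel"
    using borel_measurable_continuous_onI h'c hc by auto
  have [measurable]: "v \<in> borel_measurable M" "\<And>n. \<phi> n \<in> borel_measurable M"
    using Lspace_2_measurable[OF v] test_measurable[OF \<phi>] by auto
  have lip: "\<bar>h a - h b\<bar> \<le> K * \<bar>a - b\<bar>" for a b
    using lipschitz_of_derivative_bound[OF h'] .
  \<comment> \<open>The factors h' (\<phi> n) converge pointwise almost everywhere along a
    subsequence only, hence the \<open>r\<close> in the conclusion.\<close>
  obtain r where r: "strict_mono r" "AE x in M. (\<lambda>n. \<phi> (r n) x) \<longlonglongrightarrow> v x"
    using Lspace_2_tendsto_AE_subseq[OF test_Lspace[OF \<phi>] v lim(1)] by blast
  have limr: "(\<lambda>n. Lnorm M 2 (\<lambda>x. v x - \<phi> (r n) x)) \<longlonglongrightarrow> 0"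
    "\<And>i. i < N \<Longrightarrow> (\<lambda>n. Lnorm M 2 (\<lambda>x. G i x - pd i (\<phi> (r n)) x)) \<longlonglongrightarrow> 0"
    using LIMSEQ_subseq_LIMSEQ[OF lim(1) r(1)] LIMSEQ_subseq_LIMSEQ[OF lim(2) r(1)] by (auto simp: o_def)
  have "(\<lambda>n. Lnorm M 2 (\<lambda>x. h (v x) - h (\<phi> (r n) x))) \<longlonglongrightarrow> 0"
  proof (rule tendsto_sandwich[OF _ _ tendsto_const])
    show "(\<lambda>n. K * Lnorm M 2 (\<lambda>x. v x - \<phi> (r n) x)) \<longlonglongrightarrow> 0"
      using tendsto_mult_right_zero[OF limr(1)] .
    have "Lnorm M 2 (\<lambda>x. h (v x) - h (\<phi> (r n) x)) \<le> K * Lnorm M 2 (\<lambda>x. v x - \<phi> (r n) x)" for n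
    proof -
      have "Lnorm M 2 (\<lambda>x. h (v x) - h (\<phi> (r n) x)) \<le> Lnorm M 2 (\<lambda>x. K * (v x - \<phi> (r n) x))"
        by (rule Lnorm_2_mono) (use lip K Lspace_2_cmult[OF Lspace_2_diff[OF v test_Lspace[OF \<phi>]]] in \<open>auto simp: abs_mult\<close>)
      then show ?thesis using K by (simp only: Lnorm_2_cmult abs_of_nonneg)
    qed
    then show "\<forall>\<^sub>F n in sequentially. Lnorm M 2 (\<lambda>x. h (v x) - h (\<phi> (r n) x)) \<le> K * Lnorm M 2 (\<lambda>x. v x - \<phi> (r n) x)"
      by simp
  qed (auto simp: Lnorm_2_nonneg)
  moreover have "(\<lambda>n. Lnorm M 2 (\<lambda>x. h' (v x) * G i x - pd i (\<lambda>x. h (\<phi> (r n) x)) x)) \<longlonglongrightarrow> 0" if i: "i < N" for i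
  proof (rule tendsto_sandwich[OF _ _ tendsto_const])
    have [measurable]: "G i \<in> borel_measurable M" "\<And>n. pd i (\<phi> n) \<in> borel_measurable M"
      using Lspace_2_measurable G[OF i] test_pd_Lspace[OF \<phi> i] by auto
    \<comment> \<open>The error in the gradient is split. In \<open>?a\<close> the derivative factor
      converges and the fixed function \<open>G i\<close> dominates; in \<open>?b\<close> the factor
      is bounded by \<open>K\<close> and the gradients converge in L^2.\<close>
    let ?a = "\<lambda>n x. (h' (v x) - h' (\<phi> (r n) x)) * G i x" and ?b = "\<lambda>n x. h' (\<phi> (r n) x) * (G i x - pd i (\<phi> (r n)) x)"
    have bd: "\<bar>h' s - h' t\<bar> \<le> 2 * K" for s t using h'(2)[of s] h'(2)[of t] by linarith
    have aL: "?a n \<in> Lspace M 2" for n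
      by (rule Lspace_2_bounded_mult[OF G[OF i], where B="2 * K"]) (use bd in auto)
    have gL: "(\<lambda>x. G i x - pd i (\<phi> (r n)) x) \<in> Lspace M 2" for n
      using Lspace_2_diff[OF G[OF i] test_pd_Lspace[OF \<phi> i]] .
    have bL: "?b n \<in> Lspace M 2" for n
      by (rule Lspace_2_bounded_mult[OF gL, where B=K]) (use h'(2) in auto)
    have "(\<lambda>n. LINT x|M. (?a n x)\<^sup>2) \<longlonglongrightarrow> (LINT x|M. 0)"
    proof (rule integral_dominated_convergence[where w="\<lambda>x. (2 * K)\<^sup>2 * (G i x)\<^sup>2"])
      show "integrable M (\<lambda>x. (2 * K)\<^sup>2 * (G i x)\<^sup>2)" using G[OF i] by (simp add: Lspace_2_iff)
      show "AE x in M. norm ((?a n x)\<^sup>2) \<le> (2 * K)\<^sup>2 * (G i x)\<^sup>2" for n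
      proof (rule AE_I2)
        fix x
        have "(h' (v x) - h' (\<phi> (r n) x))\<^sup>2 \<le> (2 * K)\<^sup>2"
          using bd[of "v x" "\<phi> (r n) x"] K by (metis abs_ge_zero power2_abs power_mono)
        then show "norm ((?a n x)\<^sup>2) \<le> (2 * K)\<^sup>2 * (G i x)\<^sup>2"
          by (simp add: power_mult_distrib mult_right_mono del: power2_eq_iff)
      qed
      show "AE x in M. (\<lambda>n. (?a n x)\<^sup>2) \<longlonglongrightarrow> 0"
        using r(2)
      proof eventually_elim
        case (elim x)
        have "(\<lambda>n. h' (\<phi> (r n) x)) \<longlonglongrightarrow> h' (v x)"
          using h'c elim by (rule continuous_on_tendsto_compose) auto
        then have "(\<lambda>n. ((h' (v x) - h' (\<phi> (r n) x)) * G i x)\<^sup>2) \<longlonglongrightarrow> ((h' (v x) - h' (v x)) * G i x)\<^sup>2"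
          by (intro tendsto_intros)
        then show ?case by simp
      qed
    qed auto
    then have "(\<lambda>n. sqrt (LINT x|M. (?a n x)\<^sup>2)) \<longlonglongrightarrow> sqrt 0" by (intro tendsto_real_sqrt) simp
    then have a0: "(\<lambda>n. Lnorm M 2 (?a n)) \<longlonglongrightarrow> 0" by (simp only: Lnorm_2_eq real_sqrt_zero)
    show "(\<lambda>n. Lnorm M 2 (?a n) + K * Lnorm M 2 (\<lambda>x. G i x - pd i (\<phi> (r n)) x)) \<longlonglongrightarrow> 0"
      using tendsto_add[OF a0 tendsto_mult_right_zero[OF limr(2)[OF i]]] by simp
    have "Lnorm M 2 (\<lambda>x. h' (v x) * G i x - pd i (\<lambda>x. h (\<phi> (r n) x)) x)
        \<le> Lnorm M 2 (?a n) + K * Lnorm M 2 (\<lambda>x. G i x - pd i (\<phi> (r n)) x)" for n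
    proof -
      have "pd i (\<lambda>x. h (\<phi> (r n) x)) x = h' (\<phi> (r n) x) * pd i (\<phi> (r n)) x" if "x \<in> space M" for x
        using pd_compose[OF test_functions_Cinfty[OF \<phi>] h'(1) i] that D_top unfolding space_M by blast
      then have "Lnorm M 2 (\<lambda>x. h' (v x) * G i x - pd i (\<lambda>x. h (\<phi> (r n) x)) x) = Lnorm M 2 (\<lambda>x. ?a n x + ?b n x)"
        unfolding Lnorm_def by (simp add: algebra_simps cong: Bochner_Integration.integral_cong)
      also have "\<dots> \<le> Lnorm M 2 (?a n) + Lnorm M 2 (?b n)" by (rule Lnorm_2_triangle[OF aL bL])
      also have "Lnorm M 2 (?b n) \<le> Lnorm M 2 (\<lambda>x. K * (G i x - pd i (\<phi> (r n)) x))"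
        by (rule Lnorm_2_mono) (use gL h'(2) K in \<open>auto simp: abs_mult intro!: Lspace_2_cmult mult_right_mono\<close>)
      finally show ?thesis using K by (simp only: Lnorm_2_cmult abs_of_nonneg)
    qed
    then show "\<forall>\<^sub>F n in sequentially. Lnorm M 2 (\<lambda>x. h' (v x) * G i x - pd i (\<lambda>x. h (\<phi> (r n) x)) x)
        \<le> Lnorm M 2 (?a n) + K * Lnorm M 2 (\<lambda>x. G i x - pd i (\<phi> (r n)) x)" by simp
  qed (auto simp: Lnorm_2_nonneg)
  \<comment> \<open>As h 0 = 0, the function h (v x) is v x times a quotient bounded by the
    Lipschitz constant.\<close>
  moreover have "(\<lambda>x. h (v x)) \<in> Lspace M 2"
  proof (rule Lspace_2_AE_cong[OF _ AE_I2])
    show "(\<lambda>x. (if v x = 0 then 0 else h (v x) / v x) * v x) \<in> Lspace M 2"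
    proof (rule Lspace_2_bounded_mult[OF v, where B=K])
      show "\<bar>if v x = 0 then 0 else h (v x) / v x\<bar> \<le> K" for x
        using lip[of "v x" 0] h(2) K by (auto simp: divide_le_eq)
    qed measurable
  qed (use h(2) in auto)
  moreover have "(\<lambda>x. h' (v x) * G i x) \<in> Lspace M 2" if "i < N" for i
    by (rule Lspace_2_bounded_mult[OF G[OF that], where B=K]) (use h'(2) in auto)
  moreover have "(\<lambda>x. h (\<phi> (r n) x)) \<in> test_functions N D" for n
    using test_functions_compose[OF \<phi> h] .
  ultimately have "H10_approx (\<lambda>x. h (v x)) (\<lambda>i x. h' (v x) * G i x) (\<lambda>n x. h (\<phi> (r n) x))"
    unfolding H10_approx_def by blast
  then show thesis by (rule that)
qed

section \<open>The Dirichlet form and truncations of differences\<close>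

definition dirichlet :: "((nat \<Rightarrow> real) \<Rightarrow> real) \<Rightarrow> ((nat \<Rightarrow> real) \<Rightarrow> real) \<Rightarrow> real" where
  "dirichlet u v = (\<Sum>i<N. pairing M (weak_pd N D i u) (weak_pd N D i v))"

definition grad_sq :: "((nat \<Rightarrow> real) \<Rightarrow> real) \<Rightarrow> real" where
  "grad_sq v = (\<Sum>i<N. (Lnorm M 2 (weak_pd N D i v))\<^sup>2)"

lemma grad_sq_nonneg: "0 \<le> grad_sq v"
  by (simp add: grad_sq_def sum_nonneg)

lemma grad_sq_le_H1norm: "grad_sq v \<le> (H1norm N D v)\<^sup>2"
  by (simp add: grad_sq_def H1norm_def sum_nonneg)

lemma weak_pd_diff_AE:
  assumes "u \<in> H1 N D" "v \<in> H1 N D" "i < N"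
  shows "AE x in M. weak_pd N D i (\<lambda>x. u x - v x) x = weak_pd N D i u x - weak_pd N D i v x"
  by (rule weak_pd_AE_eq[OF is_weak_pd_diff[OF H1_is_weak_pd[OF assms(1,3)] H1_is_weak_pd[OF assms(2,3)]
        H1_Lspace[OF assms(1)] H1_Lspace[OF assms(2)] assms(3)]])

lemma H1_diff:
  assumes "u \<in> H1 N D" "v \<in> H1 N D"
  shows "(\<lambda>x. u x - v x) \<in> H1 N D"
proof -
  have L: "u \<in> Lspace M 2" "v \<in> Lspace M 2" using assms H1_Lspace by auto
  have "\<exists>w. is_weak_pd N D i (\<lambda>x. u x - v x) w" if i: "i < N" for i
    using is_weak_pd_diff[OF H1_is_weak_pd[OF assms(1) i] H1_is_weak_pd[OF assms(2) i] L i] by blast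
  then show ?thesis unfolding H1_def using Lspace_2_diff[OF L] by simp
qed

lemma dirichlet_diff_left:
  assumes "u \<in> H1 N D" "u' \<in> H1 N D" "v \<in> H1 N D"
  shows "dirichlet (\<lambda>x. u x - u' x) v = dirichlet u v - dirichlet u' v"
  unfolding dirichlet_def sum_subtractf[symmetric]
proof (rule sum.cong[OF refl])
  fix i assume "i \<in> {..<N}"
  then have i: "i < N" by simp
  have "pairing M (weak_pd N D i (\<lambda>x. u x - u' x)) (weak_pd N D i v) =
     pairing M (\<lambda>x. weak_pd N D i u x - weak_pd N D i u' x) (weak_pd N D i v)"
    using weak_pd_diff_AE[OF assms(1,2) i] assms i H1_diff
    by (intro pairing_cong_AE) (auto intro!: weak_pd_Lspace Lspace_2_diff)
  then show "pairing M (weak_pd N D i (\<lambda>x. u x - u' x)) (weak_pd N D i v) =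
    pairing M (weak_pd N D i u) (weak_pd N D i v) - pairing M (weak_pd N D i u') (weak_pd N D i v)"
    using assms i by (simp add: pairing_diff_left weak_pd_Lspace)
qed

text \<open>The free weight matters: later \<open>u\<close> is an approximation error whose gradient
  square is of order e^2 after integration in time, and with c = e both terms are of order
  e.\<close>

lemma dirichlet_Young:
  assumes "u \<in> H1 N D" "v \<in> H1 N D" "c > 0"
  shows "\<bar>dirichlet u v\<bar> \<le> grad_sq u / c + c * grad_sq v"
proof -
  have "\<bar>dirichlet u v\<bar> \<le> (\<Sum>i<N. \<bar>pairing M (weak_pd N D i u) (weak_pd N D i v)\<bar>)"
    unfolding dirichlet_def by (rule sum_abs)
  also have "\<dots> \<le> (\<Sum>i<N. (Lnorm M 2 (weak_pd N D i u))\<^sup>2 / c + c * (Lnorm M 2 (weak_pd N D i v))\<^sup>2)"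
  proof (rule sum_mono)
    fix i assume "i \<in> {..<N}"
    then have "\<bar>pairing M (weak_pd N D i u) (weak_pd N D i v)\<bar> \<le> Lnorm M 2 (weak_pd N D i u) * Lnorm M 2 (weak_pd N D i v)"
      using assms by (intro Cauchy_Schwarz_Lspace_2 weak_pd_Lspace) auto
    also have "\<dots> \<le> (Lnorm M 2 (weak_pd N D i u))\<^sup>2 / c + c * (Lnorm M 2 (weak_pd N D i v))\<^sup>2"
    proof -
      have "a * b \<le> a\<^sup>2 / c + c * b\<^sup>2" if "a \<ge> 0" "b \<ge> 0" for a b :: real
      proof -
        have "0 \<le> (a - c * b)\<^sup>2 + c * (a * b)" using that assms(3) by simp
        then have "c * (a * b) \<le> a\<^sup>2 + c\<^sup>2 * b\<^sup>2" by (simp add: power2_eq_square algebra_simps)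
        then have "c * (a * b) / c \<le> (a\<^sup>2 + c\<^sup>2 * b\<^sup>2) / c" using assms(3) by (intro divide_right_mono) auto
        then show ?thesis using assms(3) by (simp add: add_divide_distrib power2_eq_square)
      qed
      then show ?thesis by (simp add: Lnorm_2_nonneg)
    qed
    finally show "\<bar>pairing M (weak_pd N D i u) (weak_pd N D i v)\<bar> \<le> (Lnorm M 2 (weak_pd N D i u))\<^sup>2 / c + c * (Lnorm M 2 (weak_pd N D i v))\<^sup>2" .
  qed
  also have "\<dots> = grad_sq u / c + c * grad_sq v"
    by (simp add: grad_sq_def sum.distrib sum_divide_distrib sum_distrib_left)
  finally show ?thesis .
qed

text \<open>With both derivatives on the test function, the form depends on \<open>v\<close> through
  L^2 pairings alone, which are continuous along curves in L^2 even where the gradient is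
  not.\<close>

lemma dirichlet_test:
  assumes "\<phi> \<in> test_functions N D" "v \<in> H1 N D"
  shows "dirichlet \<phi> v = - (\<Sum>i<N. pairing M v (pd i (pd i \<phi>)))"
  unfolding dirichlet_def sum_negf[symmetric]
proof (rule sum.cong[OF refl])
  fix i assume "i \<in> {..<N}"
  then have i: "i < N" by simp
  have "pairing M (weak_pd N D i \<phi>) (weak_pd N D i v) = pairing M (pd i \<phi>) (weak_pd N D i v)"
    using weak_pd_AE_eq[OF is_weak_pd_test[OF assms(1) i]] assms i
    by (intro pairing_cong_AE) (auto intro!: weak_pd_Lspace test_H1 test_pd_Lspace)
  also have "\<dots> = - pairing M v (pd i (pd i \<phi>))"
    using H1_is_weak_pd[OF assms(2) i] test_functions_pd[OF assms(1) i] unfolding is_weak_pd_def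
    by (simp add: pairing_commute)
  finally show "pairing M (weak_pd N D i \<phi>) (weak_pd N D i v) = - pairing M v (pd i (pd i \<phi>))" .
qed

lemma dirichlet_commute: "dirichlet u v = dirichlet v u"
  unfolding dirichlet_def by (simp add: pairing_commute)

lemma grad_sq_diff_le:
  assumes "u \<in> H1 N D" "v \<in> H1 N D"
  shows "grad_sq (\<lambda>x. u x - v x) \<le> 2 * grad_sq u + 2 * grad_sq v"
proof -
  have "(Lnorm M 2 (weak_pd N D i (\<lambda>x. u x - v x)))\<^sup>2 \<le> 2 * (Lnorm M 2 (weak_pd N D i u))\<^sup>2 + 2 * (Lnorm M 2 (weak_pd N D i v))\<^sup>2"
    if i: "i < N" for i
  proof -
    have "Lnorm M 2 (weak_pd N D i (\<lambda>x. u x - v x)) = Lnorm M 2 (\<lambda>x. weak_pd N D i u x - weak_pd N D i v x)"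
      using assms i
      by (intro Lnorm_2_cong_AE weak_pd_diff_AE Lspace_2_measurable weak_pd_Lspace Lspace_2_diff H1_diff)
    also have "\<dots> \<le> Lnorm M 2 (weak_pd N D i u) + Lnorm M 2 (weak_pd N D i v)"
      using assms i by (intro Lnorm_2_triangle_diff weak_pd_Lspace)
    finally have "(Lnorm M 2 (weak_pd N D i (\<lambda>x. u x - v x)))\<^sup>2 \<le> (Lnorm M 2 (weak_pd N D i u) + Lnorm M 2 (weak_pd N D i v))\<^sup>2"
      by (intro power_mono Lnorm_2_nonneg)
    also have "\<dots> \<le> 2 * (Lnorm M 2 (weak_pd N D i u))\<^sup>2 + 2 * (Lnorm M 2 (weak_pd N D i v))\<^sup>2"
      using sum_squares_bound[of "Lnorm M 2 (weak_pd N D i u)" "Lnorm M 2 (weak_pd N D i v)"] by (simp add: power2_sum)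
    finally show ?thesis .
  qed
  then show ?thesis unfolding grad_sq_def sum_distrib_left sum.distrib[symmetric]
    by (intro sum_mono) auto
qed

text \<open>The weak gradient of the truncation is h'(w) times the gradient of w = u1 - u2. Its
  pairing with the gradient of w is therefore an integral of h'(w) times a square, and its norm is
  at most K times that of the gradient of w.\<close>

lemma truncation_H10:
  assumes u: "u1 \<in> H10 N D" "u2 \<in> H10 N D" and h: "smooth h" "h 0 = 0"
    and h': "\<And>s. (h has_real_derivative h' s) (at s)" "\<And>s. 0 \<le> h' s" "\<And>s. h' s \<le> K"
  shows "(\<lambda>x. h (u1 x - u2 x)) \<in> H10 N D"
    and "0 \<le> dirichlet u1 (\<lambda>x. h (u1 x - u2 x)) - dirichlet u2 (\<lambda>x. h (u1 x - u2 x))"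
    and "grad_sq (\<lambda>x. h (u1 x - u2 x)) \<le> 2 * K\<^sup>2 * (grad_sq u1 + grad_sq u2)"
proof -
  let ?v = "\<lambda>x. h (u1 x - u2 x)" and ?G = "\<lambda>i x. weak_pd N D i u1 x - weak_pd N D i u2 x"
  have h'_abs: "\<bar>h' s\<bar> \<le> K" for s using h'(2,3)[of s] by simp
  have K: "0 \<le> K" using h'_abs[of 0] by simp
  have H1: "u1 \<in> H1 N D" "u2 \<in> H1 N D" using u H10_H1 by auto
  obtain \<phi>1 where \<phi>1: "H10_approx u1 (\<lambda>i. weak_pd N D i u1) \<phi>1" by (rule H10_imp_approx[OF u(1)])
  obtain \<phi>2 where \<phi>2: "H10_approx u2 (\<lambda>i. weak_pd N D i u2) \<phi>2" by (rule H10_imp_approx[OF u(2)])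
  obtain r where ap: "H10_approx ?v (\<lambda>i x. h' (u1 x - u2 x) * ?G i x) (\<lambda>n x. h (\<phi>1 (r n) x - \<phi>2 (r n) x))"
    by (rule H10_approx_compose[OF H10_approx_diff[OF \<phi>1 \<phi>2] h h'(1) h'_abs])
  show v: "?v \<in> H10 N D" by (rule H10_approx_imp_H10[OF ap])
  have v1: "?v \<in> H1 N D" using H10_H1[OF v] .
  have ae: "AE x in M. weak_pd N D i ?v x = h' (u1 x - u2 x) * ?G i x" if "i < N" for i
    using weak_pd_AE_eq[OF H10_approx_weak_pd[OF ap that]] .
  have GL: "?G i \<in> Lspace M 2" if "i < N" for i using H1 that by (intro Lspace_2_diff weak_pd_Lspace)
  have hGL: "(\<lambda>x. h' (u1 x - u2 x) * ?G i x) \<in> Lspace M 2" if "i < N" for i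
    using ap that unfolding H10_approx_def by blast
  have "dirichlet u1 ?v - dirichlet u2 ?v = (\<Sum>i<N. pairing M (?G i) (weak_pd N D i ?v))"
    unfolding dirichlet_def sum_subtractf[symmetric]
    using H1 v1 by (intro sum.cong refl) (simp add: pairing_diff_left weak_pd_Lspace)
  also have "\<dots> \<ge> 0"
  proof (rule sum_nonneg)
    fix i assume "i \<in> {..<N}"
    then have i: "i < N" by simp
    have "pairing M (?G i) (weak_pd N D i ?v) = pairing M (?G i) (\<lambda>x. h' (u1 x - u2 x) * ?G i x)"
      using ae[OF i] GL[OF i] hGL[OF i] v1 i by (intro pairing_cong_AE) (auto intro!: weak_pd_Lspace)
    also have "\<dots> = (LINT x|M. h' (u1 x - u2 x) * (?G i x)\<^sup>2)"
      unfolding pairing_def by (simp add: power2_eq_square mult_ac)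
    also have "\<dots> \<ge> 0" using h'(2) by (intro Bochner_Integration.integral_nonneg) simp
    finally show "0 \<le> pairing M (?G i) (weak_pd N D i ?v)" .
  qed
  finally show "0 \<le> dirichlet u1 ?v - dirichlet u2 ?v" .
  have "(Lnorm M 2 (weak_pd N D i ?v))\<^sup>2 \<le> K\<^sup>2 * (Lnorm M 2 (weak_pd N D i (\<lambda>x. u1 x - u2 x)))\<^sup>2" if i: "i < N" for i
  proof -
    have "Lnorm M 2 (weak_pd N D i ?v) \<le> Lnorm M 2 (\<lambda>x. K * weak_pd N D i (\<lambda>x. u1 x - u2 x) x)"
    proof (rule Lnorm_2_mono)
      show "(\<lambda>x. K * weak_pd N D i (\<lambda>x. u1 x - u2 x) x) \<in> Lspace M 2"
        using H1 i by (intro Lspace_2_cmult weak_pd_Lspace H1_diff)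
      show "weak_pd N D i ?v \<in> borel_measurable M"
        using v1 i by (intro Lspace_2_measurable weak_pd_Lspace)
      show "AE x in M. \<bar>weak_pd N D i ?v x\<bar> \<le> \<bar>K * weak_pd N D i (\<lambda>x. u1 x - u2 x) x\<bar>"
        using ae[OF i] weak_pd_diff_AE[OF H1 i]
        by eventually_elim (use h'_abs K in \<open>auto simp: abs_mult intro!: mult_right_mono\<close>)
    qed
    then have "Lnorm M 2 (weak_pd N D i ?v) \<le> K * Lnorm M 2 (weak_pd N D i (\<lambda>x. u1 x - u2 x))"
      using K by (simp only: Lnorm_2_cmult abs_of_nonneg)
    then have "(Lnorm M 2 (weak_pd N D i ?v))\<^sup>2 \<le> (K * Lnorm M 2 (weak_pd N D i (\<lambda>x. u1 x - u2 x)))\<^sup>2"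
      by (intro power_mono Lnorm_2_nonneg)
    then show ?thesis by (simp add: power_mult_distrib)
  qed
  then have "grad_sq ?v \<le> K\<^sup>2 * grad_sq (\<lambda>x. u1 x - u2 x)"
    unfolding grad_sq_def sum_distrib_left by (intro sum_mono) auto
  also have "\<dots> \<le> K\<^sup>2 * (2 * grad_sq u1 + 2 * grad_sq u2)"
    by (intro mult_left_mono grad_sq_diff_le H1) auto
  finally show "grad_sq ?v \<le> 2 * K\<^sup>2 * (grad_sq u1 + grad_sq u2)" by (simp add: algebra_simps)
qed

end

section \<open>Continuous curves in the space of square integrable functions\<close>

text \<open>If the sequence stayed at distance e from the limit infinitely often, enumerating those
  indices would give a subsequence contradicting the hypothesis.\<close>

lemma LIMSEQ_subseq_criterion:
  fixes X :: "nat \<Rightarrow> 'a::metric_space"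
  assumes "\<And>r. strict_mono (r :: nat \<Rightarrow> nat) \<Longrightarrow> \<exists>s. strict_mono (s :: nat \<Rightarrow> nat) \<and> (\<lambda>n. X (r (s n))) \<longlonglongrightarrow> l"
  shows "X \<longlonglongrightarrow> l"
proof (rule ccontr)
  assume "\<not> X \<longlonglongrightarrow> l"
  then obtain e where e: "e > 0" "\<not> (\<forall>\<^sub>F n in sequentially. dist (X n) l < e)"
    by (auto simp: tendsto_iff)
  then have inf: "infinite {n. \<not> dist (X n) l < e}"
    using frequently_cofinite[of "\<lambda>n. \<not> dist (X n) l < e"] by (simp add: not_eventually cofinite_eq_sequentially)
  define r where "r = enumerate {n. \<not> dist (X n) l < e}"
  have r: "strict_mono r" "\<And>n. \<not> dist (X (r n)) l < e"
    using strict_mono_enumerate[OF inf] enumerate_in_set[OF inf] by (auto simp: r_def)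
  obtain s where s: "strict_mono s" "(\<lambda>n. X (r (s n))) \<longlonglongrightarrow> l" using assms[OF r(1)] by blast
  have "\<forall>\<^sub>F n in sequentially. dist (X (r (s n))) l < e" using s(2) e(1) by (rule tendstoD)
  then show False using r(2) by simp
qed

lemma cont_L2_Lspace: "u \<in> cont_L2 M \<Longrightarrow> 0 \<le> t \<Longrightarrow> u t \<in> Lspace M 2"
  by (simp add: cont_L2_def)

lemma cont_L2_measurable: "u \<in> cont_L2 M \<Longrightarrow> 0 \<le> t \<Longrightarrow> u t \<in> borel_measurable M"
  using cont_L2_Lspace Lspace_2_measurable by blast

lemma Lnorm_2_diff_commute: "Lnorm M 2 (\<lambda>x. v x - w x) = Lnorm M 2 (\<lambda>x. w x - v x)"
  by (simp add: Lnorm_2_eq power2_commute)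

lemma cont_L2_sequentially:
  assumes "u \<in> cont_L2 M" "\<And>n. 0 \<le> s n" "0 \<le> t" "s \<longlonglongrightarrow> t"
  shows "(\<lambda>n. Lnorm M 2 (\<lambda>x. u t x - u (s n) x)) \<longlonglongrightarrow> 0"
proof -
  have lim: "((\<lambda>s. Lnorm M 2 (\<lambda>x. u s x - u t x)) \<longlongrightarrow> 0) (at t within {0..})"
    using assms(1,3) by (simp add: cont_L2_def)
  have "((\<lambda>s. Lnorm M 2 (\<lambda>x. u s x - u t x)) \<longlongrightarrow> Lnorm M 2 (\<lambda>x. u t x - u t x)) (at t within {0..})"
    using lim by (simp add: Lnorm_2_eq)
  then have "continuous (at t within {0..}) (\<lambda>s. Lnorm M 2 (\<lambda>x. u s x - u t x))"
    by (simp add: continuous_within)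
  then have "(\<lambda>n. Lnorm M 2 (\<lambda>x. u (s n) x - u t x)) \<longlonglongrightarrow> Lnorm M 2 (\<lambda>x. u t x - u t x)"
    using assms(2,4) by (simp add: continuous_within_sequentially o_def)
  then show ?thesis by (subst Lnorm_2_diff_commute) (simp add: Lnorm_2_eq)
qed

lemma cont_L2_continuous_pairing:
  assumes "u \<in> cont_L2 M" "v \<in> Lspace M 2"
  shows "continuous_on {0..} (\<lambda>t. pairing M (u t) v)"
proof (rule continuous_on_sequentiallyI)
  fix s :: "nat \<Rightarrow> real" and t assume "\<forall>n. s n \<in> {0..}" "t \<in> {0..}" "s \<longlonglongrightarrow> t"
  then show "(\<lambda>n. pairing M (u (s n)) v) \<longlonglongrightarrow> pairing M (u t) v"
    using assms cont_L2_sequentially[OF assms(1), of s t] by (intro pairing_tendsto) (auto simp: cont_L2_Lspace)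
qed

lemma cont_L2_diff:
  assumes "u \<in> cont_L2 M" "v \<in> cont_L2 M"
  shows "(\<lambda>t x. u t x - v t x) \<in> cont_L2 M"
  unfolding cont_L2_def
proof (intro CollectI allI impI conjI)
  fix t :: real assume t: "0 \<le> t"
  show "(\<lambda>x. u t x - v t x) \<in> Lspace M 2" using assms t by (intro Lspace_2_diff cont_L2_Lspace)
  show "((\<lambda>s. Lnorm M 2 (\<lambda>x. u s x - v s x - (u t x - v t x))) \<longlongrightarrow> 0) (at t within {0..})"
  proof (rule tendsto_sandwich[OF _ _ tendsto_const])
    have "((\<lambda>s. Lnorm M 2 (\<lambda>x. u s x - u t x) + Lnorm M 2 (\<lambda>x. v s x - v t x)) \<longlongrightarrow> 0 + 0) (at t within {0..})"
      using assms t by (intro tendsto_add) (auto simp: cont_L2_def)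
    then show "((\<lambda>s. Lnorm M 2 (\<lambda>x. u s x - u t x) + Lnorm M 2 (\<lambda>x. v s x - v t x)) \<longlongrightarrow> 0) (at t within {0..})"
      by simp
    have "Lnorm M 2 (\<lambda>x. u s x - v s x - (u t x - v t x)) \<le> Lnorm M 2 (\<lambda>x. u s x - u t x) + Lnorm M 2 (\<lambda>x. v s x - v t x)"
      if "s \<ge> 0" for s
      using Lnorm_2_triangle_diff[of "\<lambda>x. u s x - u t x" M "\<lambda>x. v s x - v t x"] assms that t
      by (simp add: Lspace_2_diff cont_L2_Lspace algebra_simps)
    then show "\<forall>\<^sub>F s in at t within {0..}. Lnorm M 2 (\<lambda>x. u s x - v s x - (u t x - v t x)) \<le> Lnorm M 2 (\<lambda>x. u s x - u t x) + Lnorm M 2 (\<lambda>x. v s x - v t x)"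
      by (auto simp: eventually_at_filter)
  qed (auto simp: Lnorm_2_nonneg)
qed

context finite_measure
begin

text \<open>Every subsequence has a further subsequence along which the curve converges almost
  everywhere.\<close>

lemma cont_L2_integral_tendsto:
  fixes \<zeta> :: "'a \<Rightarrow> real" and h :: "real \<Rightarrow> real"
  assumes u: "u \<in> cont_L2 M" and s: "\<And>n. 0 \<le> s n" "0 \<le> t" "s \<longlonglongrightarrow> t"
    and z: "integrable M \<zeta>" and h: "continuous_on UNIV h" "\<And>a. \<bar>h a\<bar> \<le> B"
  shows "(\<lambda>n. LINT x|M. \<zeta> x * h (u (s n) x)) \<longlonglongrightarrow> (LINT x|M. \<zeta> x * h (u t x))"
proof (rule LIMSEQ_subseq_criterion)
  fix r :: "nat \<Rightarrow> nat" assume r: "strict_mono r"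
  have "(\<lambda>n. s (r n)) \<longlonglongrightarrow> t" using LIMSEQ_subseq_LIMSEQ[OF s(3) r] by (simp add: o_def)
  then have "(\<lambda>n. Lnorm M 2 (\<lambda>x. u t x - u (s (r n)) x)) \<longlonglongrightarrow> 0"
    using cont_L2_sequentially[OF u, of "\<lambda>n. s (r n)" t] s by simp
  then obtain q where q: "strict_mono q" "AE x in M. (\<lambda>n. u (s (r (q n))) x) \<longlonglongrightarrow> u t x"
    using Lspace_2_tendsto_AE_subseq[of "\<lambda>n. u (s (r n))" M "u t"] u s cont_L2_Lspace by blast
  have [measurable]: "h \<in> borel_measurable borel" using h(1) by (rule borel_measurable_continuous_onI)
  have [measurable]: "u t \<in> borel_measurable M" "\<And>n. u (s n) \<in> borel_measurable M" "\<zeta> \<in> borel_measurable M"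
    using cont_L2_measurable[OF u] s z by auto
  have "(\<lambda>n. LINT x|M. \<zeta> x * h (u (s (r (q n))) x)) \<longlonglongrightarrow> (LINT x|M. \<zeta> x * h (u t x))"
  proof (rule integral_dominated_convergence[where w="\<lambda>x. B * \<bar>\<zeta> x\<bar>"])
    show "AE x in M. (\<lambda>n. \<zeta> x * h (u (s (r (q n))) x)) \<longlonglongrightarrow> \<zeta> x * h (u t x)"
      using q(2)
    proof eventually_elim
      case (elim x)
      have "(\<lambda>n. h (u (s (r (q n))) x)) \<longlonglongrightarrow> h (u t x)"
        using h(1) elim by (rule continuous_on_tendsto_compose) auto
      then show ?case by (intro tendsto_mult_left)
    qed
    show "AE x in M. norm (\<zeta> x * h (u (s (r (q n))) x)) \<le> B * \<bar>\<zeta> x\<bar>" for n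
      using h(2) by (intro AE_I2) (auto simp: abs_mult mult.commute[of B] intro!: mult_left_mono)
  qed (use z in auto)
  then show "\<exists>q. strict_mono q \<and> (\<lambda>n. LINT x|M. \<zeta> x * h (u (s (r (q n))) x)) \<longlonglongrightarrow> (LINT x|M. \<zeta> x * h (u t x))"
    using q(1) by blast
qed

lemma cont_L2_continuous_integral:
  assumes "u \<in> cont_L2 M" "integrable M \<zeta>" "continuous_on UNIV h" "\<And>a. \<bar>h a\<bar> \<le> B"
  shows "continuous_on {0..} (\<lambda>t. LINT x|M. \<zeta> x * h (u t x :: real) :: real)"
  by (rule continuous_on_sequentiallyI, rule cont_L2_integral_tendsto[OF assms(1) _ _ _ assms(2-4)]) auto

lemma cont_L2_continuous_integral_1:
  assumes "u \<in> cont_L2 M" "continuous_on UNIV h" "\<And>a. \<bar>h a\<bar> \<le> B"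
  shows "continuous_on {0..} (\<lambda>t. LINT x|M. h (u t x :: real) :: real)"
  using cont_L2_continuous_integral[OF assms(1) _ assms(2,3), of "\<lambda>_. 1"] by simp

text \<open>The values u t are representatives chosen separately for each time, so joint
  measurability in (t, x) is not at hand. Instead the integrand is cut at n, which makes the
  integral continuous in time, and monotone convergence removes the cut. \<open>max 0 t\<close>
  extends the curve as a constant to negative times, so that the result is Borel on the whole
  line.\<close>

lemma cont_L2_nn_integral_borel_measurable:
  assumes u: "u \<in> cont_L2 M" and h: "continuous_on UNIV h" "\<And>a. 0 \<le> h a"
  shows "(\<lambda>t. \<integral>\<^sup>+x. ennreal (h (u (max 0 t) x :: real)) \<partial>M) \<in> borel_measurable borel"
proof -
  have [measurable]: "h \<in> borel_measurable borel" using h(1) by (rule borel_measurable_continuous_onI)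
  have "(\<integral>\<^sup>+x. ennreal (h (u (max 0 t) x)) \<partial>M) = (SUP n. ennreal (LINT x|M. min (real n) (h (u (max 0 t) x))))" for t
  proof -
    have [measurable]: "u (max 0 t) \<in> borel_measurable M" by (rule cont_L2_measurable[OF u]) simp
    have sup: "ennreal a = (SUP n. ennreal (min (real n) a))" if "a \<ge> 0" for a
    proof (rule antisym)
      obtain n where "a \<le> real n" using real_arch_simple by blast
      then show "ennreal a \<le> (SUP n. ennreal (min (real n) a))"
        by (intro SUP_upper2[of n]) (auto simp: min_def)
      show "(SUP n. ennreal (min (real n) a)) \<le> ennreal a"
        by (intro SUP_least ennreal_leI) auto
    qed
    have "(\<integral>\<^sup>+x. ennreal (h (u (max 0 t) x)) \<partial>M) = (\<integral>\<^sup>+x. (SUP n. ennreal (min (real n) (h (u (max 0 t) x)))) \<partial>M)"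
      using sup h(2) by (intro nn_integral_cong) blast
    also have "\<dots> = (SUP n. \<integral>\<^sup>+x. ennreal (min (real n) (h (u (max 0 t) x))) \<partial>M)"
      by (intro nn_integral_monotone_convergence_SUP) (auto simp: incseq_def le_fun_def intro!: ennreal_leI)
    also have "\<dots> = (SUP n. ennreal (LINT x|M. min (real n) (h (u (max 0 t) x))))"
    proof (intro SUP_cong refl nn_integral_eq_integral)
      fix n
      show "integrable M (\<lambda>x. min (real n) (h (u (max 0 t) x)))"
        by (rule integrable_const_bound[where B="real n"]) (use h(2) in \<open>auto simp: min_def\<close>)
    qed (use h(2) in auto)
    finally show ?thesis .
  qed
  then have eq: "(\<lambda>t. \<integral>\<^sup>+x. ennreal (h (u (max 0 t) x)) \<partial>M) =
     (\<lambda>t. SUP n. ennreal (LINT x|M. min (real n) (h (u (max 0 t) x))))" by (rule ext)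
  show ?thesis unfolding eq
  proof (intro borel_measurable_SUP measurable_compose[OF _ measurable_ennreal])
    fix n
    have "continuous_on {0..} (\<lambda>t. LINT x|M. (\<lambda>a. min (real n) (h a)) (u t x))"
    proof (rule cont_L2_continuous_integral_1[OF u, where B="real n"])
      show "continuous_on UNIV (\<lambda>a. min (real n) (h a))" using h(1) by (intro continuous_intros)
      show "\<bar>min (real n) (h a)\<bar> \<le> real n" for a using h(2)[of a] by simp
    qed
    then have "continuous_on UNIV (\<lambda>t. LINT x|M. (\<lambda>a. min (real n) (h a)) (u (max 0 t) x))"
      by (rule continuous_on_compose2) (auto intro!: continuous_intros)
    then show "(\<lambda>t. LINT x|M. min (real n) (h (u (max 0 t) x))) \<in> borel_measurable borel"
      by (rule borel_measurable_continuous_onI)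
  qed auto
qed

lemma cont_L2_nn_integral_measurable:
  assumes u: "u \<in> cont_L2 M" and h: "continuous_on UNIV h" "\<And>a. 0 \<le> h a" and S: "S \<in> sets lebesgue" "S \<subseteq> {0..}"
  shows "(\<lambda>t. \<integral>\<^sup>+x. ennreal (h (u t x :: real)) \<partial>M) \<in> borel_measurable (lebesgue_on S)"
proof -
  have "(\<lambda>t. \<integral>\<^sup>+x. ennreal (h (u (max 0 t) x)) \<partial>M) \<in> borel_measurable (lebesgue_on S)"
    using cont_L2_nn_integral_borel_measurable[OF u h]
    by (intro measurable_restrict_space1 measurable_completion) simp
  then show ?thesis
  proof (rule measurable_cong[THEN iffD1, rotated])
    fix t assume "t \<in> space (lebesgue_on S)"
    then have "max 0 t = t" using S by (auto simp: max_absorb2)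
    then show "(\<integral>\<^sup>+x. ennreal (h (u (max 0 t) x)) \<partial>M) = (\<integral>\<^sup>+x. ennreal (h (u t x)) \<partial>M)" by simp
  qed
qed

end

section \<open>From distributions to increments\<close>

text \<open>The step is the normalised primitive of the bump
  \<open>flat 0 1 x * flat 0 1 (1 - x)\<close>. Its derivative is used as a mollifier kernel, hence
  the clauses on sign, support and total mass.\<close>

lemma smooth_step_exists:
  obtains \<theta> \<theta>' :: "real \<Rightarrow> real" where "smooth \<theta>" "\<And>x. (\<theta> has_real_derivative \<theta>' x) (at x)" "\<And>x. 0 \<le> \<theta>' x"
    "\<And>x. x \<le> 0 \<Longrightarrow> \<theta> x = 0" "\<And>x. x \<ge> 1 \<Longrightarrow> \<theta> x = 1" "\<And>x. x \<notin> {0..1} \<Longrightarrow> \<theta>' x = 0" "continuous_on UNIV \<theta>'"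
    "\<And>x. 0 \<le> \<theta> x" "\<And>x. \<theta> x \<le> 1"
    "(LINT x|lborel. \<theta>' x) = 1"
proof -
  let ?b = "\<lambda>x. flat 0 1 x * flat 0 1 (1 - x)"
  have sm: "smooth ?b"
    by (rule smooth_mult[OF smooth_flat smooth_compose[OF smooth_flat smooth_diff[OF smooth_const smooth_id]]]) auto
  obtain F where F: "F 0 = 0" "\<And>x. (F has_real_derivative ?b x) (at x)"
    using antiderivative_exists[of ?b] smooth_isCont[OF sm] by blast
  have Fc: "continuous_on S F" for S
    using F(2) DERIV_isCont continuous_at_imp_continuous_on by blast
  have b0: "?b x = 0" if "x \<notin> {0..1}" for x using that by (auto simp: flat_def)
  have bn: "0 \<le> ?b x" for x by (simp add: flat_nonneg)
  have mono: "F x \<le> F y" if "x \<le> y" for x y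
    using DERIV_nonneg_imp_nondecreasing[OF that] F(2) bn by blast
  have F0: "F x = 0" if "x \<le> 0" for x
  proof (cases "x = 0")
    case False
    have "F x = F 0"
    proof (rule DERIV_isconst_end[of x 0 F, symmetric])
      show "x < 0" using that False by simp
      show "continuous_on {x..0} F" by (rule Fc)
      show "(F has_real_derivative 0) (at y)" if "x < y" "y < 0" for y
        using F(2)[of y] b0[of y] that by simp
    qed
    then show ?thesis using F(1) by simp
  qed (use F in simp)
  have F1: "F x = F 1" if "x \<ge> 1" for x
  proof (cases "x = 1")
    case False
    show ?thesis
    proof (rule DERIV_isconst_end[of 1 x F])
      show "1 < x" using that False by simp
      show "continuous_on {1..x} F" by (rule Fc)
      show "(F has_real_derivative 0) (at y)" if "1 < y" "y < x" for y
        using F(2)[of y] b0[of y] that by simp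
    qed
  qed simp
  have "F 0 < F 1"
  proof (rule DERIV_pos_imp_increasing_open[of 0 1 F])
    show "\<exists>y. (F has_real_derivative y) (at x) \<and> 0 < y" if "0 < x" "x < 1" for x
      using F(2)[of x] that by (auto simp: flat_def)
  qed (use Fc in auto)
  then have Z: "F 1 > 0" using F(1) by simp
  show thesis
  proof (rule that[of "\<lambda>x. 1 / F 1 * F x" "\<lambda>x. 1 / F 1 * ?b x"])
    show "smooth (\<lambda>x. 1 / F 1 * F x)"
      by (intro smooth_mult smooth_const smooth_primitive[OF F(2) sm])
    show "((\<lambda>x. 1 / F 1 * F x) has_real_derivative 1 / F 1 * ?b x) (at x)" for x
      by (rule DERIV_cmult[OF F(2)])
    show "1 / F 1 * F x \<le> 1" for x
      using mono[of x 1] F1[of x] Z by (cases "x \<le> 1") auto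
    show "0 \<le> 1 / F 1 * F x" for x
      using mono[of 0 x] F0[of x] F(1) Z by (cases "x \<le> 0") auto
    show "continuous_on UNIV (\<lambda>x. 1 / F 1 * ?b x)"
      by (intro continuous_intros smooth_continuous_on[OF sm])
    have "(LINT x|lborel. 1 / F 1 * ?b x) = (LINT x|lborel. indicator {0..1} x *\<^sub>R (1 / F 1 * ?b x))"
      using b0 by (intro Bochner_Integration.integral_cong) (auto simp: indicator_def)
    also have "\<dots> = 1 / F 1 * F 1 - 1 / F 1 * F 0"
    proof (rule integral_FTC_atLeastAtMost)
      show "((\<lambda>x. 1 / F 1 * F x) has_vector_derivative 1 / F 1 * ?b x) (at x within {0..1})" for x
        using DERIV_cmult[OF F(2)[of x], of "1 / F 1"]
        unfolding has_real_derivative_iff_has_vector_derivative by (rule has_vector_derivative_at_within)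
      show "continuous_on {0..1} (\<lambda>x. 1 / F 1 * ?b x)"
        by (intro continuous_intros smooth_continuous_on[OF sm])
    qed simp
    finally show "(LINT x|lborel. 1 / F 1 * ?b x) = 1" using Z F(1) by simp
    show "0 \<le> 1 / F 1 * ?b x" for x using Z by (simp add: flat_nonneg)
    show "1 / F 1 * F x = 0" if "x \<le> 0" for x using F0[OF that] by simp
    show "1 / F 1 * F x = 1" if "x \<ge> 1" for x using F1[OF that] Z by simp
    show "1 / F 1 * ?b x = 0" if "x \<notin> {0..1}" for x using b0[OF that] by simp
  qed
qed

text \<open>One-sided mollification at \<open>s\<close>: the kernel lives on [s, s + 1/n] for d = 0
  and on [s - 1/n, s] for d = -1. In this way each end of a time interval can be approached from
  inside it.\<close>

lemma mollifier_tendsto: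
  fixes G :: "real \<Rightarrow> real"
  assumes G: "continuous_on {a..b} G" and ab: "a \<le> s" "s \<le> b" and d: "d \<in> {-1, 0::real}"
    and \<theta>: "continuous_on UNIV \<theta>'" "\<And>x. 0 \<le> \<theta>' x" "\<And>x. x \<notin> {0..1} \<Longrightarrow> \<theta>' x = 0" "(LINT x|lborel. \<theta>' x) = 1"
    and I: "\<forall>\<^sub>F n in sequentially. \<forall>\<tau>. real n * (\<tau> - s) - d \<in> {0..1} \<longrightarrow> \<tau> \<in> {a..b}"
  shows "(\<lambda>n. LINT \<tau>|lebesgue_on {a..b}. real n * \<theta>' (real n * (\<tau> - s) - d) * G \<tau>) \<longlonglongrightarrow> G s"
proof -
  \<comment> \<open>Constant extension of \<open>G\<close> beyond the interval, so that the
    substitution can be made on the whole line.\<close>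
  define g where "g x = G (max a (min b x))" for x
  have gc: "continuous_on UNIV g"
    unfolding g_def using ab by (intro continuous_on_compose2[OF G] continuous_intros) auto
  have gG: "g \<tau> = G \<tau>" if "\<tau> \<in> {a..b}" for \<tau> using that by (simp add: g_def min_absorb2 max_absorb2)
  have [measurable]: "g \<in> borel_measurable borel" "\<theta>' \<in> borel_measurable borel"
    using gc \<theta>(1) borel_measurable_continuous_onI by auto
  have "compact (g ` UNIV)"
  proof -
    have "g ` UNIV = G ` {a..b}"
    proof (intro set_eqI iffI)
      fix y assume "y \<in> G ` {a..b}"
      then show "y \<in> range g" using gG by (metis (no_types, lifting) imageE rangeI)
    qed (use ab in \<open>auto simp: g_def\<close>)
    then show ?thesis using compact_continuous_image[OF G] by simp
  qed
  then obtain B where B: "\<And>x. \<bar>g x\<bar> \<le> B" using compact_imp_bounded by (fastforce simp: bounded_iff)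
  have \<theta>_int: "integrable lborel \<theta>'" using \<theta>(4) not_integrable_integral_eq by fastforce
  have "(\<lambda>n. LINT y|lborel. \<theta>' y * g (s + (1 / real n) * (y + d))) \<longlonglongrightarrow> (LINT y|lborel. \<theta>' y * g (s + 0 * (y + d)))"
  proof (rule integral_dominated_convergence[where w="\<lambda>y. \<theta>' y * B"])
    show "AE y in lborel. (\<lambda>n. \<theta>' y * g (s + (1 / real n) * (y + d))) \<longlonglongrightarrow> \<theta>' y * g (s + 0 * (y + d))"
      by (intro AE_I2 tendsto_mult_left continuous_on_tendsto_compose[OF gc] tendsto_add tendsto_const tendsto_mult_right lim_1_over_n) auto
    show "AE y in lborel. norm (\<theta>' y * g (s + (1 / real n) * (y + d))) \<le> \<theta>' y * B" for n
      using B \<theta>(2) by (intro AE_I2) (auto simp: abs_mult intro!: mult_left_mono)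
  qed (use \<theta>_int in auto)
  then have lim: "(\<lambda>n. LINT y|lborel. \<theta>' y * g (s + (1 / real n) * (y + d))) \<longlonglongrightarrow> G s"
    using \<theta>(4) gG[of s] ab by simp
  have "\<forall>\<^sub>F n in sequentially. (LINT y|lborel. \<theta>' y * g (s + (1 / real n) * (y + d))) =
     (LINT \<tau>|lebesgue_on {a..b}. real n * \<theta>' (real n * (\<tau> - s) - d) * G \<tau>)"
    using I eventually_gt_at_top[of "0::nat"]
  proof eventually_elim
    case (elim n)
    have n: "real n \<noteq> 0" using elim by simp
    have "(LINT \<tau>|lebesgue_on {a..b}. real n * \<theta>' (real n * (\<tau> - s) - d) * G \<tau>)
       = (LINT \<tau>|lebesgue. indicator {a..b} \<tau> *\<^sub>R (real n * \<theta>' (real n * (\<tau> - s) - d) * G \<tau>))"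
      by (rule integral_restrict_space) simp
    also have "\<dots> = (LINT \<tau>|lebesgue. real n * \<theta>' (real n * (\<tau> - s) - d) * g \<tau>)"
    proof (rule Bochner_Integration.integral_cong[OF refl])
      fix \<tau>
      show "indicator {a..b} \<tau> *\<^sub>R (real n * \<theta>' (real n * (\<tau> - s) - d) * G \<tau>) = real n * \<theta>' (real n * (\<tau> - s) - d) * g \<tau>"
        using elim(1) \<theta>(3)[of "real n * (\<tau> - s) - d"] gG[of \<tau>] by (cases "\<tau> \<in> {a..b}") auto
    qed
    also have "\<dots> = (LINT \<tau>|lborel. real n * \<theta>' (real n * (\<tau> - s) - d) * g \<tau>)"
      by (rule integral_completion) measurable
    also have "\<dots> = \<bar>1 / real n\<bar> *\<^sub>R (LINT y|lborel. real n * \<theta>' (real n * ((s + d / real n) + (1 / real n) * y - s) - d) * g ((s + d / real n) + (1 / real n) * y))"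
      by (rule lborel_integral_real_affine) (use n in auto)
    also have "\<dots> = (LINT y|lborel. \<theta>' y * g (s + (1 / real n) * (y + d)))"
      using n by (simp add: field_simps flip: integral_mult_right_zero)
    finally show ?case by simp
  qed
  then show ?thesis by (rule Lim_transform_eventually[OF lim])
qed

text \<open>The test functions approximate the indicator of (s, t]; their derivatives are mollifiers
  at \<open>s\<close> and \<open>t\<close>, and continuity of \<open>G\<close> turns the limits into
  point values.\<close>

lemma distributional_increment:
  fixes G H :: "real \<Rightarrow> real"
  assumes ab: "0 < a" "a \<le> s" "s < t" "t \<le> b"
    and G: "continuous_on {a..b} G" and H: "integrable (lebesgue_on {a..b}) H"
    and eq: "\<And>\<eta>. \<eta> \<in> time_test \<Longrightarrow> (\<And>\<tau>. \<tau> \<notin> {a..b} \<Longrightarrow> \<eta> \<tau> = 0) \<Longrightarrow>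
      (LINT \<tau>|lebesgue_on {a..b}. - (deriv \<eta> \<tau> * G \<tau>) + \<eta> \<tau> * H \<tau>) = 0"
  shows "G t - G s + (LINT \<tau>|lebesgue_on {a..b}. indicator {s<..t} \<tau> * H \<tau>) = 0"
proof -
  obtain \<theta> \<theta>' :: "real \<Rightarrow> real" where \<theta>: "smooth \<theta>" "\<And>x. (\<theta> has_real_derivative \<theta>' x) (at x)"
    "\<And>x. 0 \<le> \<theta>' x" "\<And>x. x \<le> 0 \<Longrightarrow> \<theta> x = 0" "\<And>x. x \<ge> 1 \<Longrightarrow> \<theta> x = 1" "\<And>x. x \<notin> {0..1} \<Longrightarrow> \<theta>' x = 0"
    "continuous_on UNIV \<theta>'" "\<And>x. 0 \<le> \<theta> x" "\<And>x. \<theta> x \<le> 1" "(LINT x|lborel. \<theta>' x) = 1"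
    using smooth_step_exists that by blast
  let ?L = "lebesgue_on {a..b}"
  \<comment> \<open>Rises from 0 to 1 on [s, s + 1/n] and falls back on [t - 1/n, t]; the shift by 1
    in the second term keeps the descent to the left of \<open>t\<close>.\<close>
  define \<eta> where "\<eta> n \<tau> = \<theta> (real n * (\<tau> - s)) - \<theta> (real n * (\<tau> - t) + 1)" for n \<tau>
  define e1 where "e1 n \<tau> = real n * \<theta>' (real n * (\<tau> - s) - 0)" for n \<tau>
  define e2 where "e2 n \<tau> = real n * \<theta>' (real n * (\<tau> - t) - (-1))" for n \<tau>
  \<comment> \<open>From this \<open>n\<close> on each ramp fits into [s, t], so
    \<open>\<eta> n\<close> is supported there.\<close>
  have big: "\<forall>\<^sub>F n in sequentially. real n * (t - s) \<ge> 1"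
  proof -
    obtain n0 where "1 / (t - s) \<le> real n0" using real_arch_simple by blast
    then have "1 \<le> real n * (t - s)" if "n \<ge> n0" for n
      using ab(3) that by (simp add: divide_le_eq) (meson mult_right_mono of_nat_mono diff_ge_0_iff_ge less_imp_le order_trans)
    then show ?thesis unfolding eventually_sequentially by blast
  qed
  have der: "(\<eta> n has_real_derivative e1 n \<tau> - e2 n \<tau>) (at \<tau>)" for n \<tau>
  proof -
    have "((\<lambda>\<tau>. \<theta> (real n * (\<tau> - s))) has_real_derivative \<theta>' (real n * (\<tau> - s)) * real n) (at \<tau>)"
      by (rule DERIV_chain2[OF \<theta>(2)]) (auto intro!: derivative_eq_intros)
    moreover have "((\<lambda>\<tau>. \<theta> (real n * (\<tau> - t) + 1)) has_real_derivative \<theta>' (real n * (\<tau> - t) + 1) * real n) (at \<tau>)"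
      by (rule DERIV_chain2[OF \<theta>(2)]) (auto intro!: derivative_eq_intros)
    ultimately show ?thesis
      unfolding \<eta>_def e1_def e2_def by (auto dest: DERIV_diff simp: mult.commute)
  qed
  have "smooth (\<eta> n)" for n
  proof -
    have "smooth (\<lambda>\<tau>. real n * (\<tau> - s))" "smooth (\<lambda>\<tau>. real n * (\<tau> - t) + 1)"
      by (intro smooth_intros)+
    then show ?thesis unfolding \<eta>_def by (intro smooth_diff smooth_compose[OF \<theta>(1)])
  qed
  then have diff: "((deriv ^^ k) (\<eta> n)) differentiable (at \<tau>)" for k n \<tau>
    using smooth_funpow_deriv_differentiable by blast
  have supp: "\<eta> n \<tau> = 0" if n: "real n * (t - s) \<ge> 1" and \<tau>: "\<tau> \<notin> {s..t}" for n \<tau>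
  proof (cases "\<tau> < s")
    case True
    have "real n * (\<tau> - s) \<le> 0" using True by (simp add: mult_nonneg_nonpos)
    moreover have "real n * (\<tau> - t) + 1 \<le> 0" using n \<open>real n * (\<tau> - s) \<le> 0\<close> by (simp add: algebra_simps)
    ultimately show ?thesis using \<theta>(4) by (simp add: \<eta>_def)
  next
    case False
    then have "\<tau> > t" using \<tau> by auto
    then have "real n * (\<tau> - t) \<ge> 0" by simp
    moreover have "real n * (\<tau> - s) \<ge> 1" using n \<open>real n * (\<tau> - t) \<ge> 0\<close> by (simp add: algebra_simps)
    ultimately show ?thesis using \<theta>(5) by (simp add: \<eta>_def)
  qed
  have cont: "continuous_on {a..b} (e1 n)" "continuous_on {a..b} (e2 n)" "continuous_on {a..b} (\<eta> n)" for n
    unfolding e1_def e2_def \<eta>_def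
    by (intro continuous_intros continuous_on_compose2[OF \<theta>(7)] continuous_on_compose2[OF smooth_continuous_on[OF \<theta>(1), of UNIV]]; simp)+
  have int: "integrable ?L (\<lambda>\<tau>. e1 n \<tau> * G \<tau>)" "integrable ?L (\<lambda>\<tau>. e2 n \<tau> * G \<tau>)" for n
    by (intro continuous_imp_integrable_real continuous_on_mult cont G)+
  have \<eta>m: "\<eta> n \<in> borel_measurable ?L" for n
    by (rule continuous_imp_measurable_on_sets_lebesgue[OF cont(3)]) simp
  have \<eta>b: "\<bar>\<eta> n \<tau>\<bar> \<le> 1" for n \<tau>
    using \<theta>(8,9)[of "real n * (\<tau> - s)"] \<theta>(8,9)[of "real n * (\<tau> - t) + 1"] unfolding \<eta>_def by linarith
  have intH: "integrable ?L (\<lambda>\<tau>. \<eta> n \<tau> * H \<tau>)" for n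
  proof (rule Bochner_Integration.integrable_bound[OF H])
    show "(\<lambda>\<tau>. \<eta> n \<tau> * H \<tau>) \<in> borel_measurable ?L"
      by (rule borel_measurable_times[OF \<eta>m borel_measurable_integrable[OF H]])
    show "AE \<tau> in ?L. norm (\<eta> n \<tau> * H \<tau>) \<le> norm (H \<tau>)"
      using \<eta>b by (intro AE_I2) (simp add: abs_mult mult_left_le_one_le)
  qed
  have e1lim: "(\<lambda>n. LINT \<tau>|?L. e1 n \<tau> * G \<tau>) \<longlonglongrightarrow> G s"
    unfolding e1_def
  proof (rule mollifier_tendsto[OF G _ _ _ \<theta>(7,3,6,10)])
    show "\<forall>\<^sub>F n in sequentially. \<forall>\<tau>. real n * (\<tau> - s) - 0 \<in> {0..1} \<longrightarrow> \<tau> \<in> {a..b}"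
      using big
    proof eventually_elim
      case (elim n)
      then have n: "real n > 0" using ab(3) by (metis less_eq_real_def mult_eq_0_iff not_one_le_zero of_nat_0_le_iff)
      show ?case
      proof (intro allI impI)
        fix \<tau> assume "real n * (\<tau> - s) - 0 \<in> {0..1}"
        then have "0 \<le> real n * (\<tau> - s)" "real n * (\<tau> - s) \<le> real n * (t - s)" using elim by auto
        then have "0 \<le> \<tau> - s" "\<tau> - s \<le> t - s" using n by (simp_all add: zero_le_mult_iff)
        then show "\<tau> \<in> {a..b}" using ab by auto
      qed
    qed
  qed (use ab in auto)
  have e2lim: "(\<lambda>n. LINT \<tau>|?L. e2 n \<tau> * G \<tau>) \<longlonglongrightarrow> G t"
    unfolding e2_def
  proof (rule mollifier_tendsto[OF G _ _ _ \<theta>(7,3,6,10)])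
    show "\<forall>\<^sub>F n in sequentially. \<forall>\<tau>. real n * (\<tau> - t) - (-1) \<in> {0..1} \<longrightarrow> \<tau> \<in> {a..b}"
      using big
    proof eventually_elim
      case (elim n)
      then have n: "real n > 0" using ab(3) by (metis less_eq_real_def mult_eq_0_iff not_one_le_zero of_nat_0_le_iff)
      show ?case
      proof (intro allI impI)
        fix \<tau> assume "real n * (\<tau> - t) - (-1) \<in> {0..1}"
        then have "0 \<le> real n * (t - \<tau>)" "real n * (t - \<tau>) \<le> real n * (t - s)" using elim by (auto simp: algebra_simps)
        then have "0 \<le> t - \<tau>" "t - \<tau> \<le> t - s" using n by (simp_all add: zero_le_mult_iff)
        then show "\<tau> \<in> {a..b}" using ab by auto
      qed
    qed
  qed (use ab in auto)
  have Hlim: "(\<lambda>n. LINT \<tau>|?L. \<eta> n \<tau> * H \<tau>) \<longlonglongrightarrow> (LINT \<tau>|?L. indicator {s<..t} \<tau> * H \<tau>)"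
  proof (rule integral_dominated_convergence[where w="\<lambda>\<tau>. \<bar>H \<tau>\<bar>"])
    \<comment> \<open>At the time \<open>t\<close> itself \<open>\<eta> n\<close> is eventually 0
      while the indicator of {s<..t} is 1; this one point is discarded as a null set.\<close>
    have "AE \<tau> in lebesgue. \<tau> \<noteq> t"
      by (rule AE_completion) (rule AE_lborel_singleton)
    then have "AE \<tau> in ?L. \<tau> \<noteq> t" by (subst AE_restrict_space_iff) auto
    then show "AE \<tau> in ?L. (\<lambda>n. \<eta> n \<tau> * H \<tau>) \<longlonglongrightarrow> indicator {s<..t} \<tau> * H \<tau>"
    proof eventually_elim
      case (elim \<tau>)
      have "(\<lambda>n. \<eta> n \<tau>) \<longlonglongrightarrow> indicator {s<..t} \<tau>"
      proof (cases "\<tau> \<in> {s<..t}")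
        case True
        then have pos: "\<tau> - s > 0" "t - \<tau> > 0" using elim by auto
        have ex: "\<forall>\<^sub>F n in sequentially. real n * c \<ge> 1" if "c > 0" for c :: real
        proof -
          obtain n0 where "1 / c \<le> real n0" using real_arch_simple by blast
          then have "1 \<le> real n * c" if "n \<ge> n0" for n
            using \<open>c > 0\<close> that by (simp add: divide_le_eq) (meson mult_right_mono of_nat_mono less_imp_le order_trans)
          then show ?thesis unfolding eventually_sequentially by blast
        qed
        have "\<forall>\<^sub>F n in sequentially. \<eta> n \<tau> = 1"
          using ex[OF pos(1)] ex[OF pos(2)]
        proof eventually_elim
          case (elim n)
          have "real n * (\<tau> - t) + 1 \<le> 0" using elim(2) by (simp add: algebra_simps)
          then show ?case using \<theta>(4,5) elim(1) by (simp add: \<eta>_def)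
        qed
        then show ?thesis using True by (simp add: tendsto_eventually)
      next
        case False
        have "\<forall>\<^sub>F n in sequentially. \<eta> n \<tau> = 0"
          using big
        proof eventually_elim
          case (elim n)
          show ?case
          proof (cases "\<tau> = s")
            case True
            have "real n * (\<tau> - t) + 1 \<le> 0" using elim True by (simp add: algebra_simps)
            then show ?thesis using True \<theta>(4) by (simp add: \<eta>_def)
          next
            case \<tau>: False
            show ?thesis by (rule supp[OF elim]) (use False \<tau> in auto)
          qed
        qed
        then show ?thesis using False by (simp add: tendsto_eventually)
      qed
      then show ?case by (rule tendsto_mult_right)
    qed
    show "AE \<tau> in ?L. norm (\<eta> n \<tau> * H \<tau>) \<le> \<bar>H \<tau>\<bar>" for n
      using \<eta>b by (intro AE_I2) (simp add: abs_mult mult_left_le_one_le)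
    show "(\<lambda>\<tau>. indicator {s<..t} \<tau> * H \<tau>) \<in> borel_measurable ?L"
      by (rule borel_measurable_times[OF measurable_restrict_space1 borel_measurable_integrable[OF H]])
        (rule borel_measurable_indicator, simp)
  qed (use intH H in auto)
  have "(\<lambda>n. - (LINT \<tau>|?L. e1 n \<tau> * G \<tau>) + (LINT \<tau>|?L. e2 n \<tau> * G \<tau>) + (LINT \<tau>|?L. \<eta> n \<tau> * H \<tau>))
     \<longlonglongrightarrow> - G s + G t + (LINT \<tau>|?L. indicator {s<..t} \<tau> * H \<tau>)"
    by (intro tendsto_add tendsto_minus e1lim e2lim Hlim)
  moreover have "\<forall>\<^sub>F n in sequentially. - (LINT \<tau>|?L. e1 n \<tau> * G \<tau>) + (LINT \<tau>|?L. e2 n \<tau> * G \<tau>) + (LINT \<tau>|?L. \<eta> n \<tau> * H \<tau>) = 0"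
    using big
  proof eventually_elim
    case (elim n)
    have tt: "\<eta> n \<in> time_test"
      unfolding time_test_def using diff supp[OF elim] ab
      by (intro CollectI conjI allI exI[of _ s] exI[of _ t]) auto
    have "deriv (\<eta> n) \<tau> = e1 n \<tau> - e2 n \<tau>" for \<tau> using der by (rule DERIV_imp_deriv)
    then have "0 = (LINT \<tau>|?L. - ((e1 n \<tau> - e2 n \<tau>) * G \<tau>) + \<eta> n \<tau> * H \<tau>)"
      using eq[OF tt] supp[OF elim] ab by force
    also have "\<dots> = (LINT \<tau>|?L. - (e1 n \<tau> * G \<tau>) + e2 n \<tau> * G \<tau> + \<eta> n \<tau> * H \<tau>)"
      by (simp add: algebra_simps)
    also have "\<dots> = - (LINT \<tau>|?L. e1 n \<tau> * G \<tau>) + (LINT \<tau>|?L. e2 n \<tau> * G \<tau>) + (LINT \<tau>|?L. \<eta> n \<tau> * H \<tau>)"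
      using int[of n] intH[of n] by simp
    finally show ?case by simp
  qed
  ultimately have "(\<lambda>n. 0) \<longlonglongrightarrow> - G s + G t + (LINT \<tau>|?L. indicator {s<..t} \<tau> * H \<tau>)"
    by (rule Lim_transform_eventually)
  then show ?thesis by (simp add: LIMSEQ_const_iff)
qed

section \<open>Weak solutions\<close>

text \<open>Completeness of Lebesgue measure. The quantities attached to a weak solution are known
  to be limits of measurable functions at almost every time only.\<close>

lemma borel_measurable_AE_lebesgue_on:
  fixes f g :: "real \<Rightarrow> real"
  assumes S: "S \<in> sets lebesgue" and f: "f \<in> borel_measurable (lebesgue_on S)" and ae: "AE x in lebesgue_on S. f x = g x"
  shows "g \<in> borel_measurable (lebesgue_on S)"
proof -
  have "(\<lambda>x. if x \<in> S then f x else 0) \<in> borel_measurable lebesgue"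
    using f borel_measurable_if[OF S] by blast
  moreover have "AE x in lebesgue. x \<in> S \<longrightarrow> f x = g x"
    using ae S by (subst (asm) AE_restrict_space_iff) auto
  then have "AE x in lebesgue. (if x \<in> S then f x else 0) = (if x \<in> S then g x else 0)"
    by eventually_elim auto
  ultimately have "(\<lambda>x. if x \<in> S then g x else 0) \<in> borel_measurable lebesgue"
    by (rule borel_measurable_AE)
  then show ?thesis using borel_measurable_if[OF S] by blast
qed

lemma borel_measurable_AE_LIMSEQ_lebesgue_on:
  fixes f :: "nat \<Rightarrow> real \<Rightarrow> real"
  assumes S: "S \<in> sets lebesgue" and f: "\<And>n. f n \<in> borel_measurable (lebesgue_on S)"
    and ae: "AE x in lebesgue_on S. (\<lambda>n. f n x) \<longlonglongrightarrow> g x"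
  shows "g \<in> borel_measurable (lebesgue_on S)"
proof (rule borel_measurable_AE_lebesgue_on[OF S])
  show "(\<lambda>x. lim (\<lambda>n. f n x)) \<in> borel_measurable (lebesgue_on S)"
    by (rule borel_measurable_lim_metric[OF f])
  show "AE x in lebesgue_on S. lim (\<lambda>n. f n x) = g x"
    using ae by eventually_elim (rule limI)
qed

lemma integral_lebesgue_on_support:
  fixes F :: "real \<Rightarrow> real"
  assumes "A \<subseteq> B" "A \<in> sets lebesgue" "B \<in> sets lebesgue" "\<And>x. x \<notin> A \<Longrightarrow> F x = 0"
  shows "(LINT x|lebesgue_on B. F x) = (LINT x|lebesgue_on A. F x)"
proof -
  have "(LINT x|lebesgue_on B. F x) = (LINT x|lebesgue. indicator B x *\<^sub>R F x)"
    using assms by (intro integral_restrict_space) auto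
  also have "\<dots> = (LINT x|lebesgue. indicator A x *\<^sub>R F x)"
    using assms by (intro Bochner_Integration.integral_cong refl) (auto simp: indicator_def)
  also have "\<dots> = (LINT x|lebesgue_on A. F x)"
    using assms by (intro integral_restrict_space[symmetric]) auto
  finally show ?thesis .
qed

lemma finite_measure_lebesgue_on_Icc: "finite_measure (lebesgue_on {a..b::real})"
  by (rule finite_measure_lebesgue_on) auto

text \<open>A crude form of Young's inequality, by replacing the smaller of the two numbers with the
  larger one.\<close>

lemma powr_mult_le_powr_add:
  fixes a b p :: real
  assumes "p > 1"
  shows "\<bar>a\<bar> powr (p - 1) * \<bar>b\<bar> \<le> \<bar>a\<bar> powr p + \<bar>b\<bar> powr p"
proof -
  have e: "\<bar>x\<bar> powr (p - 1) * \<bar>x\<bar> = \<bar>x\<bar> powr p" for x :: real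
    by (cases "x = 0") (simp_all add: powr_diff)
  show ?thesis
  proof (cases "\<bar>b\<bar> \<le> \<bar>a\<bar>")
    case True
    then have "\<bar>a\<bar> powr (p - 1) * \<bar>b\<bar> \<le> \<bar>a\<bar> powr (p - 1) * \<bar>a\<bar>" by (intro mult_left_mono) auto
    then show ?thesis using e by (simp add: add_increasing2)
  next
    case False
    then have "\<bar>a\<bar> powr (p - 1) * \<bar>b\<bar> \<le> \<bar>b\<bar> powr (p - 1) * \<bar>b\<bar>" using assms by (intro mult_right_mono powr_mono2) auto
    then show ?thesis using e by (simp add: add_increasing)
  qed
qed

lemma abs_le_1_add_powr:
  fixes b p :: real
  assumes "p \<ge> 1"
  shows "\<bar>b\<bar> \<le> 1 + \<bar>b\<bar> powr p"
proof (cases "\<bar>b\<bar> \<le> 1")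
  case True then show ?thesis by (simp add: add_increasing2)
next
  case False
  then have "\<bar>b\<bar> powr 1 \<le> \<bar>b\<bar> powr p" using assms by (intro powr_mono) auto
  then show ?thesis using False by simp
qed

locale reaction_diffusion = bounded_open_set N D for N D +
  fixes p lam \<sigma> :: real and f :: "real \<Rightarrow> real" and g :: "(nat \<Rightarrow> real) \<Rightarrow> real"
  assumes p_gt_2: "p > 2" and f_continuous: "continuous_on UNIV f"
    and f_growth: "\<And>s. \<bar>f s\<bar> \<le> \<sigma> * \<bar>s\<bar> powr (p - 1) + \<sigma>" and g_Lspace: "g \<in> Lspace M 2"
begin

abbreviation solution :: "((nat \<Rightarrow> real) \<Rightarrow> real) \<Rightarrow> (real \<Rightarrow> (nat \<Rightarrow> real) \<Rightarrow> real) \<Rightarrow> bool" where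
  "solution \<equiv> weak_solution N D p lam f g"

lemma \<sigma>_nonneg: "0 \<le> \<sigma>"
proof -
  have "\<bar>f 0\<bar> \<le> \<sigma>" using f_growth[of 0] by simp
  then show ?thesis by linarith
qed

lemma f_borel[measurable]: "f \<in> borel_measurable borel"
  using f_continuous by (rule borel_measurable_continuous_onI)

lemma f_abs_le: "\<bar>f s * r\<bar> \<le> \<sigma> * (\<bar>s\<bar> powr p + 2 * \<bar>r\<bar> powr p + 1)"
proof -
  have "\<bar>f s * r\<bar> \<le> (\<sigma> * \<bar>s\<bar> powr (p - 1) + \<sigma>) * \<bar>r\<bar>"
    unfolding abs_mult by (intro mult_right_mono f_growth) auto
  also have "\<dots> = \<sigma> * (\<bar>s\<bar> powr (p - 1) * \<bar>r\<bar> + \<bar>r\<bar>)" by (simp add: algebra_simps)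
  also have "\<dots> \<le> \<sigma> * (\<bar>s\<bar> powr p + 2 * \<bar>r\<bar> powr p + 1)"
    using powr_mult_le_powr_add[of p s r] abs_le_1_add_powr[of p r] p_gt_2 \<sigma>_nonneg
    by (intro mult_left_mono) auto
  finally show ?thesis .
qed

lemma Lspace_p_integrable: "v \<in> Lspace M p \<Longrightarrow> integrable M v"
  by (rule Bochner_Integration.integrable_bound[of _ "\<lambda>x. 1 + \<bar>v x\<bar> powr p"])
    (use abs_le_1_add_powr[of p] p_gt_2 in \<open>auto simp: Lspace_def abs_of_nonneg\<close>)

lemma f_mult_integrable:
  assumes "v \<in> Lspace M p" "w \<in> Lspace M p"
  shows "integrable M (\<lambda>x. f (v x) * w x)"
proof (rule Bochner_Integration.integrable_bound)
  show "integrable M (\<lambda>x. \<sigma> * (\<bar>v x\<bar> powr p + 2 * \<bar>w x\<bar> powr p + 1))"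
    using assms by (auto simp: Lspace_def)
  have [measurable]: "v \<in> borel_measurable M" "w \<in> borel_measurable M" using assms by (auto simp: Lspace_def)
  show "(\<lambda>x. f (v x) * w x) \<in> borel_measurable M" by measurable
  show "AE x in M. norm (f (v x) * w x) \<le> norm (\<sigma> * (\<bar>v x\<bar> powr p + 2 * \<bar>w x\<bar> powr p + 1))"
    using order_trans[OF f_abs_le abs_ge_self] by (intro AE_I2) (simp only: real_norm_def)
qed

lemma const_Lspace: "(\<lambda>x. c) \<in> Lspace M p"
  by (simp add: Lspace_def)

lemma f_integrable: "v \<in> Lspace M p \<Longrightarrow> integrable M (\<lambda>x. f (v x))"
  using f_mult_integrable[OF _ const_Lspace[of 1]] by simp

lemma solution_cont: "solution u0 u \<Longrightarrow> u \<in> cont_L2 M"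
  by (simp add: weak_solution_def)

lemma solution_AE:
  assumes "solution u0 u" "0 < a" "a < b"
  shows "AE t in lebesgue_on {a..b}. u t \<in> H10 N D \<and> u t \<in> Lspace M p"
proof -
  have "AE t in lebesgue_on {a..b}. u t \<in> H10 N D" "AE t in lebesgue_on {a..b}. u t \<in> Lspace M p"
    using assms by (auto simp: weak_solution_def Lloc_def)
  then show ?thesis by eventually_elim auto
qed

lemma solution_integrable_p:
  assumes "solution u0 u" "0 < a" "a < b"
  shows "integrable (lebesgue_on {a..b}) (\<lambda>t. LINT x|M. \<bar>u t x\<bar> powr p)"
proof -
  have "integrable (lebesgue_on {a..b}) (\<lambda>t. Lnorm M p (u t) powr p)"
    using assms by (auto simp: weak_solution_def Lloc_def)
  moreover have "Lnorm M p (u t) powr p = (LINT x|M. \<bar>u t x\<bar> powr p)" for t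
    using p_gt_2 by (simp add: Lnorm_def powr_powr)
  ultimately show ?thesis by simp
qed

lemma solution_integrable_H1:
  assumes "solution u0 u" "0 < a" "a < b"
  shows "integrable (lebesgue_on {a..b}) (\<lambda>t. (H1norm N D (u t))\<^sup>2)"
proof -
  have "integrable (lebesgue_on {a..b}) (\<lambda>t. H1norm N D (u t) powr 2)"
    using assms by (auto simp: weak_solution_def Lloc_def)
  moreover have "H1norm N D (u t) powr 2 = (H1norm N D (u t))\<^sup>2" for t
  proof -
    have "0 \<le> H1norm N D (u t)" by (simp add: H1norm_def sum_nonneg)
    then show ?thesis by (cases "H1norm N D (u t) = 0") (auto simp: powr_numeral)
  qed
  ultimately show ?thesis by simp
qed

section \<open>Measurability and integrability in time of the terms of the equation\<close>

lemma continuous_measurable_time: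
  fixes F :: "real \<Rightarrow> real"
  assumes "continuous_on {0..} F" "0 \<le> a"
  shows "F \<in> borel_measurable (lebesgue_on {a..b::real})" "integrable (lebesgue_on {a..b}) F"
proof -
  have c: "continuous_on {a..b} F" using assms(1) by (rule continuous_on_subset) (use assms(2) in auto)
  then show "F \<in> borel_measurable (lebesgue_on {a..b})" by (rule continuous_imp_measurable_on_sets_lebesgue) simp
  show "integrable (lebesgue_on {a..b}) F" using c by (rule continuous_imp_integrable_real)
qed

text \<open>Measurability comes from approximating \<open>v\<close> by test functions: with both
  derivatives moved onto them the form is continuous in time, and it converges at every time at
  which the solution lies in H10. Young's inequality with weight 1 gives the integrable
  bound.\<close>

lemma dirichlet_time_integrable:
  assumes sol: "solution u0 u" and ab: "0 < a" "a < b" and v: "v \<in> H10 N D"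
  shows "integrable (lebesgue_on {a..b}) (\<lambda>\<tau>. dirichlet (u \<tau>) v)"
proof -
  note uc = solution_cont[OF sol]
  obtain \<phi> where ap: "H10_approx v (\<lambda>i. weak_pd N D i v) \<phi>" using H10_imp_approx[OF v] by blast
  then have \<phi>: "\<phi> n \<in> test_functions N D" for n unfolding H10_approx_def by blast
  have meas: "(\<lambda>\<tau>. dirichlet (u \<tau>) v) \<in> borel_measurable (lebesgue_on {a..b})"
  proof (rule borel_measurable_AE_LIMSEQ_lebesgue_on)
    show "(\<lambda>\<tau>. - (\<Sum>i<N. pairing M (u \<tau>) (pd i (pd i (\<phi> n))))) \<in> borel_measurable (lebesgue_on {a..b})" for n
      using ab by (intro continuous_measurable_time continuous_on_minus continuous_on_sum
          cont_L2_continuous_pairing[OF uc] test_Lspace test_functions_pd \<phi>) auto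
    show "AE \<tau> in lebesgue_on {a..b}. (\<lambda>n. - (\<Sum>i<N. pairing M (u \<tau>) (pd i (pd i (\<phi> n))))) \<longlonglongrightarrow> dirichlet (u \<tau>) v"
      using solution_AE[OF sol ab]
    proof eventually_elim
      case (elim \<tau>)
      then have u1: "u \<tau> \<in> H1 N D" using H10_H1 by blast
      have "(\<lambda>n. dirichlet (\<phi> n) (u \<tau>)) \<longlonglongrightarrow> dirichlet v (u \<tau>)"
        unfolding dirichlet_def
      proof (rule tendsto_sum)
        fix i assume "i \<in> {..<N}"
        then have i: "i < N" by simp
        have "(\<lambda>n. pairing M (pd i (\<phi> n)) (weak_pd N D i (u \<tau>))) \<longlonglongrightarrow> pairing M (weak_pd N D i v) (weak_pd N D i (u \<tau>))"
          using ap i u1 weak_pd_Lspace test_pd_Lspace unfolding H10_approx_def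
          by (intro pairing_tendsto) auto
        moreover have "pairing M (weak_pd N D i (\<phi> n)) (weak_pd N D i (u \<tau>)) = pairing M (pd i (\<phi> n)) (weak_pd N D i (u \<tau>))" for n
          using weak_pd_AE_eq[OF is_weak_pd_test[OF \<phi> i]] u1 i \<phi>
          by (intro pairing_cong_AE) (auto intro!: weak_pd_Lspace test_H1 test_pd_Lspace)
        ultimately show "(\<lambda>n. pairing M (weak_pd N D i (\<phi> n)) (weak_pd N D i (u \<tau>))) \<longlonglongrightarrow> pairing M (weak_pd N D i v) (weak_pd N D i (u \<tau>))"
          by simp
      qed
      then show ?case
        using dirichlet_test[OF \<phi> u1] by (simp add: dirichlet_commute[of "u \<tau>"])
    qed
  qed simp
  show ?thesis
  proof (rule Bochner_Integration.integrable_bound[OF _ meas])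
    show "integrable (lebesgue_on {a..b}) (\<lambda>\<tau>. (H1norm N D (u \<tau>))\<^sup>2 + grad_sq v)"
      using solution_integrable_H1[OF sol ab] finite_measure.integrable_const[OF finite_measure_lebesgue_on_Icc] by simp
    show "AE \<tau> in lebesgue_on {a..b}. norm (dirichlet (u \<tau>) v) \<le> norm ((H1norm N D (u \<tau>))\<^sup>2 + grad_sq v)"
      using solution_AE[OF sol ab]
    proof eventually_elim
      case (elim \<tau>)
      then have "\<bar>dirichlet (u \<tau>) v\<bar> \<le> grad_sq (u \<tau>) + grad_sq v"
        using dirichlet_Young[of "u \<tau>" v 1] H10_H1 v by auto
      then show ?case using grad_sq_le_H1norm[of "u \<tau>"] by auto
    qed
  qed
qed

text \<open>Clipping the values of \<open>f\<close> to [-n, n] makes the pairing continuous in time;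
  at almost every time the clipped pairings converge by dominated convergence. The growth condition
  supplies the integrable bound.\<close>

lemma f_time_integrable:
  assumes sol: "solution u0 u" and ab: "0 < a" "a < b" and v: "v \<in> Lspace M p"
  shows "integrable (lebesgue_on {a..b}) (\<lambda>\<tau>. pairing M (\<lambda>x. f (u \<tau> x)) v)"
proof -
  note uc = solution_cont[OF sol]
  let ?f = "\<lambda>n s. max (- real n) (min (real n) (f s))"
  have fc: "continuous_on UNIV (?f n)" for n using f_continuous by (intro continuous_intros)
  have fb: "\<bar>?f n s\<bar> \<le> real n" for n s by (auto simp: abs_le_iff)
  have fle: "\<bar>?f n s\<bar> \<le> \<bar>f s\<bar>" for n s by auto
  have meas: "(\<lambda>\<tau>. pairing M (\<lambda>x. f (u \<tau> x)) v) \<in> borel_measurable (lebesgue_on {a..b})"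
  proof (rule borel_measurable_AE_LIMSEQ_lebesgue_on)
    show "(\<lambda>\<tau>. LINT x|M. v x * ?f n (u \<tau> x)) \<in> borel_measurable (lebesgue_on {a..b})" for n
      using ab cont_L2_continuous_integral[OF uc Lspace_p_integrable[OF v] fc fb]
      by (intro continuous_measurable_time) auto
    show "AE \<tau> in lebesgue_on {a..b}. (\<lambda>n. LINT x|M. v x * ?f n (u \<tau> x)) \<longlonglongrightarrow> pairing M (\<lambda>x. f (u \<tau> x)) v"
      using solution_AE[OF sol ab]
    proof eventually_elim
      case (elim \<tau>)
      have [measurable]: "v \<in> borel_measurable M" "u \<tau> \<in> borel_measurable M" using v elim by (auto simp: Lspace_def)
      have "(\<lambda>n. LINT x|M. v x * ?f n (u \<tau> x)) \<longlonglongrightarrow> (LINT x|M. v x * f (u \<tau> x))"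
      proof (rule integral_dominated_convergence[where w="\<lambda>x. \<bar>f (u \<tau> x) * v x\<bar>"])
        show "integrable M (\<lambda>x. \<bar>f (u \<tau> x) * v x\<bar>)"
          using elim v by (intro integrable_abs f_mult_integrable) auto
        show "AE x in M. (\<lambda>n. v x * ?f n (u \<tau> x)) \<longlonglongrightarrow> v x * f (u \<tau> x)"
        proof (rule AE_I2)
          fix x
          obtain n0 where n0: "\<bar>f (u \<tau> x)\<bar> \<le> real n0" using real_arch_simple by blast
          have "?f n (u \<tau> x) = f (u \<tau> x)" if "n \<ge> n0" for n
          proof -
            have "\<bar>f (u \<tau> x)\<bar> \<le> real n" using n0 that of_nat_mono[OF that, where 'a=real] by linarith
            then have "f (u \<tau> x) \<le> real n" "- real n \<le> f (u \<tau> x)" by linarith+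
            then show ?thesis by (simp only: min_absorb2 max_absorb2)
          qed
          then have "\<forall>\<^sub>F n in sequentially. ?f n (u \<tau> x) = f (u \<tau> x)"
            unfolding eventually_sequentially by blast
          then show "(\<lambda>n. v x * ?f n (u \<tau> x)) \<longlonglongrightarrow> v x * f (u \<tau> x)"
            by (intro tendsto_mult_left tendsto_eventually)
        qed
        show "AE x in M. norm (v x * ?f n (u \<tau> x)) \<le> \<bar>f (u \<tau> x) * v x\<bar>" for n
        proof (rule AE_I2)
          fix x
          have le: "norm (c * r) \<le> \<bar>q * c\<bar>" if "\<bar>r\<bar> \<le> \<bar>q\<bar>" for r q c :: real
            using mult_left_mono[OF that, of "\<bar>c\<bar>"] by (simp add: abs_mult mult.commute)
          show "norm (v x * ?f n (u \<tau> x)) \<le> \<bar>f (u \<tau> x) * v x\<bar>" by (rule le[OF fle])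
        qed
      qed measurable
      then show ?case by (simp add: pairing_def mult.commute)
    qed
  qed simp
  show ?thesis
  proof (rule Bochner_Integration.integrable_bound[OF _ meas])
    show "integrable (lebesgue_on {a..b}) (\<lambda>\<tau>. \<sigma> * ((LINT x|M. \<bar>u \<tau> x\<bar> powr p) + (LINT x|M. 2 * \<bar>v x\<bar> powr p + 1)))"
      using solution_integrable_p[OF sol ab] finite_measure.integrable_const[OF finite_measure_lebesgue_on_Icc] by simp
    show "AE \<tau> in lebesgue_on {a..b}. norm (pairing M (\<lambda>x. f (u \<tau> x)) v) \<le> norm (\<sigma> * ((LINT x|M. \<bar>u \<tau> x\<bar> powr p) + (LINT x|M. 2 * \<bar>v x\<bar> powr p + 1)))"
      using solution_AE[OF sol ab]
    proof eventually_elim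
      case (elim \<tau>)
      have i: "integrable M (\<lambda>x. \<bar>u \<tau> x\<bar> powr p)" "integrable M (\<lambda>x. \<bar>v x\<bar> powr p)" using elim v by (auto simp: Lspace_def)
      have "norm (pairing M (\<lambda>x. f (u \<tau> x)) v) \<le> (LINT x|M. norm (f (u \<tau> x) * v x))"
        unfolding pairing_def by (rule integral_norm_bound)
      also have "\<dots> \<le> (LINT x|M. \<sigma> * (\<bar>u \<tau> x\<bar> powr p + (2 * \<bar>v x\<bar> powr p + 1)))"
      proof (rule integral_mono)
        show "integrable M (\<lambda>x. norm (f (u \<tau> x) * v x))" using f_mult_integrable elim v by (intro integrable_norm) blast
        show "norm (f (u \<tau> x) * v x) \<le> \<sigma> * (\<bar>u \<tau> x\<bar> powr p + (2 * \<bar>v x\<bar> powr p + 1))" for x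
          using f_abs_le[of "u \<tau> x" "v x"] by (simp add: add.assoc)
      qed (use i in auto)
      also have "\<dots> = \<sigma> * ((LINT x|M. \<bar>u \<tau> x\<bar> powr p) + (LINT x|M. 2 * \<bar>v x\<bar> powr p + 1))"
        using i by simp
      finally show ?case by simp
    qed
  qed
qed

text \<open>Needed for a bound on the lower order terms that does not involve the test function; it
  enters \<open>majorant\<close>.\<close>

lemma abs_f_time_integrable:
  assumes sol: "solution u0 u" and ab: "0 < a" "a < b"
  shows "integrable (lebesgue_on {a..b}) (\<lambda>\<tau>. LINT x|M. \<bar>f (u \<tau> x)\<bar>)"
proof -
  note uc = solution_cont[OF sol]
  have eq: "(LINT x|M. \<bar>f (u \<tau> x)\<bar>) = enn2real (\<integral>\<^sup>+x. ennreal \<bar>f (u \<tau> x)\<bar> \<partial>M)" if "\<tau> \<in> {a..b}" for \<tau>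
  proof -
    have [measurable]: "u \<tau> \<in> borel_measurable M" using cont_L2_measurable[OF uc] ab that by auto
    show ?thesis by (rule integral_eq_nn_integral) auto
  qed
  have "(\<lambda>\<tau>. \<integral>\<^sup>+x. ennreal \<bar>f (u \<tau> x)\<bar> \<partial>M) \<in> borel_measurable (lebesgue_on {a..b})"
    by (rule cont_L2_nn_integral_measurable[OF uc]) (use f_continuous ab in \<open>auto intro!: continuous_intros\<close>)
  then have "(\<lambda>\<tau>. enn2real (\<integral>\<^sup>+x. ennreal \<bar>f (u \<tau> x)\<bar> \<partial>M)) \<in> borel_measurable (lebesgue_on {a..b})"
    by measurable
  then have meas: "(\<lambda>\<tau>. LINT x|M. \<bar>f (u \<tau> x)\<bar>) \<in> borel_measurable (lebesgue_on {a..b})"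
    by (rule measurable_cong[THEN iffD1, rotated]) (simp add: eq)
  show ?thesis
  proof (rule Bochner_Integration.integrable_bound[OF _ meas])
    show "integrable (lebesgue_on {a..b}) (\<lambda>\<tau>. \<sigma> * ((LINT x|M. \<bar>u \<tau> x\<bar> powr p) + (LINT x|M. 3)))"
      using solution_integrable_p[OF sol ab] finite_measure.integrable_const[OF finite_measure_lebesgue_on_Icc] by simp
    show "AE \<tau> in lebesgue_on {a..b}. norm (LINT x|M. \<bar>f (u \<tau> x)\<bar>) \<le> norm (\<sigma> * ((LINT x|M. \<bar>u \<tau> x\<bar> powr p) + (LINT x|M. 3)))"
      using solution_AE[OF sol ab]
    proof eventually_elim
      case (elim \<tau>)
      have i: "integrable M (\<lambda>x. \<bar>u \<tau> x\<bar> powr p)" using elim by (auto simp: Lspace_def)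
      have "(LINT x|M. \<bar>f (u \<tau> x)\<bar>) \<le> (LINT x|M. \<sigma> * (\<bar>u \<tau> x\<bar> powr p + 3))"
      proof (rule integral_mono)
        show "integrable M (\<lambda>x. \<bar>f (u \<tau> x)\<bar>)" using f_integrable elim by (intro integrable_abs) blast
        show "\<bar>f (u \<tau> x)\<bar> \<le> \<sigma> * (\<bar>u \<tau> x\<bar> powr p + 3)" for x
          using f_abs_le[of "u \<tau> x" 1] by (simp add: add.commute)
      qed (use i in auto)
      also have "\<dots> = \<sigma> * ((LINT x|M. \<bar>u \<tau> x\<bar> powr p) + (LINT x|M. 3))"
        using i by (simp del: lebesgue_integral_const)
      finally have "(LINT x|M. \<bar>f (u \<tau> x)\<bar>) \<le> \<sigma> * ((LINT x|M. \<bar>u \<tau> x\<bar> powr p) + (LINT x|M. 3))" .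
      moreover have "0 \<le> (LINT x|M. \<bar>f (u \<tau> x)\<bar>)" by simp
      ultimately show ?case unfolding real_norm_def by arith
    qed
  qed
qed

text \<open>A test function in time supported in [a, b] reduces the equation on the half-line to
  this interval, where all terms are integrable, and \<open>distributional_increment\<close> turns
  it into an identity between two times. The interval stays away from 0 because the integrability of
  a weak solution is local in the open half-line.\<close>

lemma solution_increment:
  assumes sol: "solution u0 u" and ab: "0 < a" "a \<le> s" "s < t" "t \<le> b" and v: "v \<in> H10 N D" "v \<in> Lspace M p"
  shows "pairing M (u t) v - pairing M (u s) v + (LINT \<tau>|lebesgue_on {a..b}. indicator {s<..t} \<tau> *
      (lam * pairing M (u \<tau>) v + dirichlet (u \<tau>) v + pairing M (\<lambda>x. f (u \<tau> x)) v - pairing M g v)) = 0"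
    and "integrable (lebesgue_on {a..b}) (\<lambda>\<tau>. lam * pairing M (u \<tau>) v + dirichlet (u \<tau>) v + pairing M (\<lambda>x. f (u \<tau> x)) v)"
proof -
  note uc = solution_cont[OF sol]
  have ab': "a < b" using ab by simp
  let ?L = "lebesgue_on {a..b}"
  let ?G = "\<lambda>\<tau>. pairing M (u \<tau>) v"
  let ?H = "\<lambda>\<tau>. lam * pairing M (u \<tau>) v + dirichlet (u \<tau>) v + pairing M (\<lambda>x. f (u \<tau> x)) v"
  have v2: "v \<in> Lspace M 2" using v(1) H10_H1 H1_Lspace by blast
  have Gc: "continuous_on {0..} ?G" by (rule cont_L2_continuous_pairing[OF uc v2])
  have Gc': "continuous_on {a..b} ?G" using Gc by (rule continuous_on_subset) (use ab in auto)
  have Hi: "integrable ?L ?H"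
    using continuous_measurable_time(2)[OF Gc] dirichlet_time_integrable[OF sol ab(1) ab' v(1)]
      f_time_integrable[OF sol ab(1) ab' v(2)] ab by simp
  then show "integrable ?L ?H" .
  have const: "integrable ?L (\<lambda>_. c)" for c :: real
    using finite_measure.integrable_const[OF finite_measure_lebesgue_on_Icc] .
  show "?G t - ?G s + (LINT \<tau>|?L. indicator {s<..t} \<tau> * (?H \<tau> - pairing M g v)) = 0"
  proof (rule distributional_increment[OF ab Gc'])
    show "integrable ?L (\<lambda>\<tau>. ?H \<tau> - pairing M g v)" using Hi const by simp
    fix \<eta> assume \<eta>: "\<eta> \<in> time_test" and supp: "\<And>\<tau>. \<tau> \<notin> {a..b} \<Longrightarrow> \<eta> \<tau> = 0"
    have d: "((deriv ^^ n) \<eta>) differentiable (at \<tau>)" for n \<tau> using \<eta> by (simp add: time_test_def)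
    have \<eta>c: "continuous_on S \<eta>" for S
      using d[of 0] by (intro differentiable_imp_continuous_on) (simp add: differentiable_on_def differentiable_at_withinI)
    have \<eta>'c: "continuous_on S (deriv \<eta>)" for S
      using d[of 1] by (intro differentiable_imp_continuous_on) (simp add: differentiable_on_def differentiable_at_withinI)
    have supp': "deriv \<eta> \<tau> = 0" if "\<tau> \<notin> {a..b}" for \<tau>
    proof (rule DERIV_imp_deriv)
      have "((\<lambda>_. 0) has_real_derivative 0) (at \<tau>)" by simp
      then show "(\<eta> has_real_derivative 0) (at \<tau>)"
        by (rule has_field_derivative_transform_within_open[where S="- {a..b}"]) (use that supp in \<open>auto simp: open_Compl\<close>)
    qed
    have bd: "integrable ?L (\<lambda>\<tau>. \<eta> \<tau> * F \<tau>)" if F: "integrable ?L F" for F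
    proof -
      have "bounded (\<eta> ` {a..b})" by (intro compact_imp_bounded compact_continuous_image \<eta>c compact_Icc)
      then obtain B where "\<forall>y\<in>\<eta> ` {a..b}. norm y \<le> B" unfolding bounded_iff by blast
      then have B: "\<bar>\<eta> \<tau>\<bar> \<le> B" if "\<tau> \<in> {a..b}" for \<tau> using that by auto
      show ?thesis
      proof (rule Bochner_Integration.integrable_bound)
        show "integrable ?L (\<lambda>\<tau>. B * F \<tau>)" using F by simp
        show "(\<lambda>\<tau>. \<eta> \<tau> * F \<tau>) \<in> borel_measurable ?L"
          by (rule borel_measurable_times[OF continuous_imp_measurable_on_sets_lebesgue[OF \<eta>c] borel_measurable_integrable[OF F]]) simp
        show "AE \<tau> in ?L. norm (\<eta> \<tau> * F \<tau>) \<le> norm (B * F \<tau>)"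
        proof (rule AE_I2)
          fix \<tau> assume "\<tau> \<in> space ?L"
          then have "\<bar>\<eta> \<tau>\<bar> \<le> \<bar>B\<bar>" using B[of \<tau>] by simp
          then show "norm (\<eta> \<tau> * F \<tau>) \<le> norm (B * F \<tau>)" by (simp add: abs_mult mult_right_mono)
        qed
      qed
    qed
    have gi: "integrable ?L (\<lambda>\<tau>. deriv \<eta> \<tau> * ?G \<tau>)"
      by (intro continuous_imp_integrable_real continuous_on_mult \<eta>'c Gc')
    have "(LINT \<tau>|lebesgue_on {0<..}. - (deriv \<eta> \<tau> * ?G \<tau>) + \<eta> \<tau> * ?H \<tau>) = (LINT \<tau>|lebesgue_on {0<..}. \<eta> \<tau> * pairing M g v)"
      using sol v \<eta> unfolding weak_solution_def dirichlet_def by blast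
    moreover have "(LINT \<tau>|lebesgue_on {0<..}. - (deriv \<eta> \<tau> * ?G \<tau>) + \<eta> \<tau> * ?H \<tau>) = (LINT \<tau>|?L. - (deriv \<eta> \<tau> * ?G \<tau>) + \<eta> \<tau> * ?H \<tau>)"
      by (rule integral_lebesgue_on_support) (use ab supp supp' in auto)
    moreover have "(LINT \<tau>|lebesgue_on {0<..}. \<eta> \<tau> * pairing M g v) = (LINT \<tau>|?L. \<eta> \<tau> * pairing M g v)"
      by (rule integral_lebesgue_on_support) (use ab supp in auto)
    moreover have "(LINT \<tau>|?L. - (deriv \<eta> \<tau> * ?G \<tau>) + \<eta> \<tau> * (?H \<tau> - pairing M g v)) =
       (LINT \<tau>|?L. (- (deriv \<eta> \<tau> * ?G \<tau>) + \<eta> \<tau> * ?H \<tau>) - \<eta> \<tau> * pairing M g v)"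
      by (simp add: algebra_simps)
    moreover have "\<dots> = (LINT \<tau>|?L. - (deriv \<eta> \<tau> * ?G \<tau>) + \<eta> \<tau> * ?H \<tau>) - (LINT \<tau>|?L. \<eta> \<tau> * pairing M g v)"
      using gi bd[OF Hi] bd[OF const] by (intro Bochner_Integration.integral_diff Bochner_Integration.integrable_add integrable_minus)
    ultimately show "(LINT \<tau>|?L. - (deriv \<eta> \<tau> * ?G \<tau>) + \<eta> \<tau> * (?H \<tau> - pairing M g v)) = 0" by simp
  qed
qed

end

section \<open>Approximation by simple functions with values in the test functions\<close>

context bounded_open_set
begin

lemma grad_sq_commute:
  assumes "u \<in> H1 N D" "v \<in> H1 N D"
  shows "grad_sq (\<lambda>x. u x - v x) = grad_sq (\<lambda>x. v x - u x)"
  unfolding grad_sq_def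
proof (rule sum.cong[OF refl])
  fix i assume "i \<in> {..<N}"
  then have i: "i < N" by simp
  have "AE x in M. weak_pd N D i (\<lambda>x. u x - v x) x = - weak_pd N D i (\<lambda>x. v x - u x) x"
    using weak_pd_diff_AE[OF assms i] weak_pd_diff_AE[OF assms(2,1) i] by eventually_elim simp
  then have "Lnorm M 2 (weak_pd N D i (\<lambda>x. u x - v x)) = Lnorm M 2 (\<lambda>x. - weak_pd N D i (\<lambda>x. v x - u x) x)"
    using assms i
    by (intro Lnorm_2_cong_AE borel_measurable_uminus Lspace_2_measurable weak_pd_Lspace H1_diff)
  then show "(Lnorm M 2 (weak_pd N D i (\<lambda>x. u x - v x)))\<^sup>2 = (Lnorm M 2 (weak_pd N D i (\<lambda>x. v x - u x)))\<^sup>2"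
    by (simp add: Lnorm_2_minus)
qed

lemma grad_sq_triangle:
  assumes "u \<in> H1 N D" "v \<in> H1 N D" "w \<in> H1 N D"
  shows "grad_sq (\<lambda>x. u x - w x) \<le> 2 * grad_sq (\<lambda>x. u x - v x) + 2 * grad_sq (\<lambda>x. v x - w x)"
proof -
  have "grad_sq (\<lambda>x. (u x - v x) - (w x - v x)) \<le> 2 * grad_sq (\<lambda>x. u x - v x) + 2 * grad_sq (\<lambda>x. w x - v x)"
    using assms by (intro grad_sq_diff_le H1_diff)
  then show ?thesis using grad_sq_commute[OF assms(3,2)] by simp
qed

lemma zero_test_function: "(\<lambda>x. 0) \<in> test_functions N D"
proof (rule test_functionsI[of _ _ "{}"])
  have "Ck N k (\<lambda>x. 0)" for k
    using Ck_compose[OF Ck_prod_coordinates[of N "\<lambda>i x. x" k], of "\<lambda>_. 0"] smooth_const smooth_id by simp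
  then show "Cinfty N (\<lambda>x. 0)" by (simp add: Cinfty_def)
qed auto

end

text \<open>The values are functions, and no sigma-algebra on them is involved: since the range is
  finite, an arbitrary predicate of the value gives a finite union of level sets.\<close>

lemma simple_preimage_sets:
  assumes "finite (s ` I)" "\<And>w. {t \<in> I. s t = w} \<in> sets lebesgue"
  shows "{t \<in> I. P (s t)} \<in> sets lebesgue"
proof -
  have "{t \<in> I. P (s t)} = (\<Union>w\<in>{w \<in> s ` I. P w}. {t \<in> I. s t = w})" by auto
  then show ?thesis using assms by (simp only:) (intro sets.finite_UN, auto)
qed

lemma simple_pair_preimage_sets:
  assumes "finite (s ` I)" "\<And>w. {t \<in> I. s t = w} \<in> sets lebesgue"
    and "finite (r ` I)" "\<And>w. {t \<in> I. r t = w} \<in> sets lebesgue"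
  shows "{t \<in> I. P (s t) (r t)} \<in> sets lebesgue"
proof -
  have "{t \<in> I. P (s t) (r t)} = (\<Union>w\<in>s ` I. {t \<in> I. s t = w} \<inter> {t \<in> I. P w (r t)})" by auto
  moreover have "{t \<in> I. P w (r t)} \<in> sets lebesgue" for w
    using simple_preimage_sets[OF assms(3,4)] by blast
  ultimately show ?thesis using assms by (simp only:) (intro sets.finite_UN sets.Int, auto)
qed

context reaction_diffusion
begin

text \<open>The sets on which the approximating sequence is uniformly Cauchy are measurable because they
  involve the simple functions only; no measurability of \<^term>\<open>u\<close> itself is used.\<close>

lemma solution_simple_approximation:
  assumes sol: "solution u0 u" and ab: "0 < a" "a < b" and e: "e > 0"
  obtains s G where "\<And>\<tau>. s \<tau> \<in> test_functions N D" "finite (s ` {a..b})"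
    "\<And>w. {\<tau> \<in> {a..b}. s \<tau> = w} \<in> sets lebesgue"
    "integrable (lebesgue_on {a..b}) G" "(LINT \<tau>|lebesgue_on {a..b}. G \<tau>) \<le> e"
    "AE \<tau> in lebesgue_on {a..b}. grad_sq (\<lambda>x. u \<tau> x - s \<tau> x) \<le> G \<tau>"
proof -
  let ?L = "lebesgue_on {a..b}" and ?I = "{a..b}"
  have "u \<in> Lloc 2 (H10 N D) (H1norm N D)" using sol by (simp add: weak_solution_def)
  then have "bochner_measurable_on ?I (H10 N D) (H1norm N D) u" using ab by (simp add: Lloc_def)
  then obtain s where s: "\<And>n::nat. finite (s n ` ?I)" "\<And>n. s n ` ?I \<subseteq> H10 N D"
    "\<And>n w. {t\<in>?I. s n t = w} \<in> sets lebesgue"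
    and s_lim: "AE t in ?L. (\<lambda>n. H1norm N D (\<lambda>x. u t x - s n t x)) \<longlonglongrightarrow> 0"
    unfolding bochner_measurable_on_def by blast
  have ex: "\<exists>\<phi>. \<phi> \<in> test_functions N D \<and> (x \<in> H10 N D \<longrightarrow> H1norm N D (\<lambda>y. x y - \<phi> y) < 1 / real (Suc n))" for x n
  proof (cases "x \<in> H10 N D")
    case True
    then obtain \<phi> where \<phi>: "\<And>k. \<phi> k \<in> test_functions N D" "(\<lambda>k. H1norm N D (\<lambda>y. x y - \<phi> k y)) \<longlonglongrightarrow> 0"
      unfolding H10_def by blast
    have "\<forall>\<^sub>F k in sequentially. H1norm N D (\<lambda>y. x y - \<phi> k y) < 1 / real (Suc n)"
      using order_tendstoD(2)[OF \<phi>(2)] by simp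
    then obtain k where "H1norm N D (\<lambda>y. x y - \<phi> k y) < 1 / real (Suc n)"
      unfolding eventually_sequentially by blast
    then show ?thesis using \<phi>(1) by blast
  qed (use zero_test_function in blast)
  \<comment> \<open>Each value of the n-th simple function is replaced by a test function within
    1/(n+1) in the H1 norm; the choice depends on the value alone, so \<open>r n\<close> is again
    simple.\<close>
  define c where "c n x = (SOME \<phi>. \<phi> \<in> test_functions N D \<and> (x \<in> H10 N D \<longrightarrow> H1norm N D (\<lambda>y. x y - \<phi> y) < 1 / real (Suc n)))"
    for n x
  have c: "c n x \<in> test_functions N D"
    "x \<in> H10 N D \<Longrightarrow> H1norm N D (\<lambda>y. x y - c n x y) < 1 / real (Suc n)" for n x
    using someI_ex[OF ex[of x n]] unfolding c_def by blast+
  define r where "r n t = c n (s n t)" for n t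
  have r_test: "r n t \<in> test_functions N D" for n t by (simp add: r_def c)
  have r_H1: "r n t \<in> H1 N D" for n t by (intro test_H1 r_test)
  have r_fin: "finite (r n ` ?I)" for n
  proof -
    have "r n ` ?I = c n ` (s n ` ?I)" by (auto simp: r_def)
    then show ?thesis using s(1) by simp
  qed
  have r_sets: "{t \<in> ?I. r n t = w} \<in> sets lebesgue" for n w
    unfolding r_def by (rule simple_preimage_sets[OF s(1) s(3)])
  have r_lim: "AE t in ?L. (\<lambda>n. grad_sq (\<lambda>x. u t x - r n t x)) \<longlonglongrightarrow> 0"
    using solution_AE[OF sol ab] s_lim AE_space
  proof eventually_elim
    case (elim t)
    then have t: "t \<in> ?I" by simp
    have uH: "u t \<in> H1 N D" using elim H10_H1 by blast
    have sH10: "s n t \<in> H10 N D" for n using s(2) t by blast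
    then have sH: "s n t \<in> H1 N D" for n using H10_H1 by blast
    have n0: "0 \<le> H1norm N D v" for v by (simp add: H1norm_def sum_nonneg)
    show ?case
    proof (rule tendsto_sandwich[OF _ _ tendsto_const])
      have "(\<lambda>n. 2 * (H1norm N D (\<lambda>x. u t x - s n t x))\<^sup>2 + 2 * (1 / real (Suc n))\<^sup>2) \<longlonglongrightarrow> 2 * 0\<^sup>2 + 2 * 0\<^sup>2"
        using elim(2) LIMSEQ_Suc[OF lim_1_over_n] by (intro tendsto_intros) auto
      then show "(\<lambda>n. 2 * (H1norm N D (\<lambda>x. u t x - s n t x))\<^sup>2 + 2 * (1 / real (Suc n))\<^sup>2) \<longlonglongrightarrow> 0" by simp
      have "grad_sq (\<lambda>x. u t x - r n t x) \<le> 2 * (H1norm N D (\<lambda>x. u t x - s n t x))\<^sup>2 + 2 * (1 / real (Suc n))\<^sup>2" for n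
      proof -
        have "grad_sq (\<lambda>x. s n t x - r n t x) \<le> (H1norm N D (\<lambda>x. s n t x - r n t x))\<^sup>2" by (rule grad_sq_le_H1norm)
        also have "\<dots> \<le> (1 / real (Suc n))\<^sup>2"
          using c(2)[OF sH10, of n n] n0 unfolding r_def by (intro power_mono) (auto intro: less_imp_le)
        finally show ?thesis
          using grad_sq_triangle[OF uH sH[of n] r_H1[of n t]] grad_sq_le_H1norm[of "\<lambda>x. u t x - s n t x"] by linarith
      qed
      then show "\<forall>\<^sub>F n in sequentially. grad_sq (\<lambda>x. u t x - r n t x) \<le> 2 * (H1norm N D (\<lambda>x. u t x - s n t x))\<^sup>2 + 2 * (1 / real (Suc n))\<^sup>2"
        by simp
    qed (auto simp: grad_sq_nonneg)
  qed
  \<comment> \<open>Chosen so that 4 d times the length of the interval is e/2. The factor 4 arises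
    from the estimate with factor 2 for the gradient square of a sum, applied to two errors of size
    d.\<close>
  define d where "d = e / (8 * (b - a))"
  have d: "d > 0" using e ab by (simp add: d_def)
  \<comment> \<open>The times at which all later approximations are within \<open>d\<close> of the
    m-th one. Almost every time lies in \<open>B m\<close> for all large m.\<close>
  define B where "B m = {t \<in> ?I. \<forall>k\<ge>m. grad_sq (\<lambda>x. r k t x - r m t x) \<le> d}" for m
  have B_sets: "B m \<in> sets lebesgue" for m
  proof -
    have "{t \<in> ?I. k \<ge> m \<longrightarrow> grad_sq (\<lambda>x. r k t x - r m t x) \<le> d} \<in> sets lebesgue" for k
      by (rule simple_pair_preimage_sets[OF r_fin r_sets r_fin r_sets])
    then have "(\<Inter>k. {t \<in> ?I. k \<ge> m \<longrightarrow> grad_sq (\<lambda>x. r k t x - r m t x) \<le> d}) \<in> sets lebesgue"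
      by (intro sets.countable_INT) blast+
    moreover have "(\<Inter>k. {t \<in> ?I. k \<ge> m \<longrightarrow> grad_sq (\<lambda>x. r k t x - r m t x) \<le> d}) = B m"
      unfolding B_def by blast
    ultimately show ?thesis by (simp only:)
  qed
  have H1i: "integrable ?L (\<lambda>t. (H1norm N D (u t))\<^sup>2)" by (rule solution_integrable_H1[OF sol ab])
  have indm: "(\<lambda>t. indicator (- B m) t :: real) \<in> borel_measurable ?L" for m
    using B_sets[of m] by (intro measurable_restrict_space1 borel_measurable_indicator) (simp only: Compl_in_sets_lebesgue)
  have Bi: "integrable ?L (\<lambda>t. indicator (- B m) t * (H1norm N D (u t))\<^sup>2)" for m
    by (rule Bochner_Integration.integrable_bound[OF H1i borel_measurable_times[OF indm borel_measurable_integrable[OF H1i]]])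
      (auto simp: indicator_def)
  have "(\<lambda>m. LINT t|?L. indicator (- B m) t * (H1norm N D (u t))\<^sup>2) \<longlonglongrightarrow> (LINT t|?L. 0)"
  proof (rule integral_dominated_convergence[where w="\<lambda>t. (H1norm N D (u t))\<^sup>2"])
    show "AE t in ?L. (\<lambda>m. indicator (- B m) t * (H1norm N D (u t))\<^sup>2) \<longlonglongrightarrow> 0"
      using r_lim solution_AE[OF sol ab] AE_space
    proof eventually_elim
      case (elim t)
      have uH: "u t \<in> H1 N D" using elim H10_H1 by blast
      have "\<forall>\<^sub>F n in sequentially. grad_sq (\<lambda>x. u t x - r n t x) < d / 4"
        by (rule order_tendstoD(2)[OF elim(1)]) (use d in simp)
      then obtain n0 where n0: "\<And>n. n \<ge> n0 \<Longrightarrow> grad_sq (\<lambda>x. u t x - r n t x) < d / 4"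
        unfolding eventually_sequentially by blast
      have "t \<in> B m" if m: "m \<ge> n0" for m
      proof -
        have "grad_sq (\<lambda>x. r k t x - r m t x) \<le> d" if k: "k \<ge> m" for k
          using grad_sq_triangle[OF r_H1[of k t] uH r_H1[of m t]] grad_sq_commute[OF r_H1[of k t] uH]
            n0[OF m] n0[of k] m k by simp
        then show ?thesis using elim(3) by (auto simp: B_def)
      qed
      then have "\<forall>\<^sub>F m in sequentially. indicator (- B m) t * (H1norm N D (u t))\<^sup>2 = 0"
        unfolding eventually_sequentially by (intro exI[of _ n0]) auto
      then show ?case by (rule tendsto_eventually)
    qed
  qed (use H1i Bi in \<open>auto simp: indicator_def\<close>)
  then have "(\<lambda>m. LINT t|?L. indicator (- B m) t * (H1norm N D (u t))\<^sup>2) \<longlonglongrightarrow> 0" by simp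
  then have "\<forall>\<^sub>F m in sequentially. (LINT t|?L. indicator (- B m) t * (H1norm N D (u t))\<^sup>2) < e / 2"
    by (rule order_tendstoD(2)) (use e in simp)
  then obtain m where m: "(LINT t|?L. indicator (- B m) t * (H1norm N D (u t))\<^sup>2) < e / 2"
    unfolding eventually_sequentially by blast
  \<comment> \<open>Off \<open>B m\<close> the approximation is 0, so the error there is bounded by
    the squared H1 norm of the solution, whose integral over the complement of \<open>B m\<close> is
    small.\<close>
  define S where "S t = (if t \<in> B m then r m t else (\<lambda>x. 0))" for t
  show thesis
  proof (rule that[of S "\<lambda>t. 4 * d + indicator (- B m) t * (H1norm N D (u t))\<^sup>2"])
    show "S \<tau> \<in> test_functions N D" for \<tau> using r_test zero_test_function by (simp add: S_def)
    have "S ` ?I \<subseteq> insert (\<lambda>x. 0) (r m ` ?I)" by (auto simp: S_def)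
    then show "finite (S ` ?I)" using r_fin finite_subset by blast
    show "{\<tau> \<in> ?I. S \<tau> = w} \<in> sets lebesgue" for w
    proof -
      have "{\<tau> \<in> ?I. S \<tau> = w} = ({\<tau> \<in> ?I. r m \<tau> = w} \<inter> B m) \<union> (if w = (\<lambda>x. 0) then ?I - B m else {})"
        by (auto simp: S_def)
      moreover have "?I - B m \<in> sets lebesgue" using B_sets[of m] by (intro sets.Diff) simp_all
      then have "(if w = (\<lambda>x. 0) then ?I - B m else {}) \<in> sets lebesgue" by simp
      ultimately show ?thesis using sets.Un[OF sets.Int[OF r_sets[of m w] B_sets[of m]]] by (simp only:)
    qed
    have c: "integrable ?L (\<lambda>_. 4 * d)" using finite_measure.integrable_const[OF finite_measure_lebesgue_on_Icc] .
    show "integrable ?L (\<lambda>t. 4 * d + indicator (- B m) t * (H1norm N D (u t))\<^sup>2)" using c Bi by simp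
    have "(LINT t|?L. 4 * d + indicator (- B m) t * (H1norm N D (u t))\<^sup>2) = (LINT t|?L. 4 * d) + (LINT t|?L. indicator (- B m) t * (H1norm N D (u t))\<^sup>2)"
      using c Bi by (intro Bochner_Integration.integral_add)
    also have "(LINT t|?L. 4 * d) = e / 2"
    proof -
      have "4 * (e / (8 * h)) * h = e / 2" if "h \<noteq> 0" for h :: real using that by (simp add: field_simps)
      moreover have "(LINT t|?L. 4 * d) = 4 * d * (b - a)" using ab by (simp add: measure_restrict_space)
      moreover have "b - a \<noteq> 0" using ab by simp
      ultimately show ?thesis unfolding d_def by metis
    qed
    finally show "(LINT t|?L. 4 * d + indicator (- B m) t * (H1norm N D (u t))\<^sup>2) \<le> e" using m by simp
    show "AE t in ?L. grad_sq (\<lambda>x. u t x - S t x) \<le> 4 * d + indicator (- B m) t * (H1norm N D (u t))\<^sup>2"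
      using r_lim solution_AE[OF sol ab]
    proof eventually_elim
      case (elim t)
      have uH: "u t \<in> H1 N D" using elim H10_H1 by blast
      show ?case
      proof (cases "t \<in> B m")
        case True
        have "\<forall>\<^sub>F n in sequentially. grad_sq (\<lambda>x. u t x - r n t x) < d"
          using order_tendstoD(2)[OF elim(1)] d by simp
        then obtain k where k: "k \<ge> m" "grad_sq (\<lambda>x. u t x - r k t x) < d"
          unfolding eventually_sequentially by (meson nle_le)
        have "grad_sq (\<lambda>x. r k t x - r m t x) \<le> d" using True k(1) by (simp add: B_def)
        then show ?thesis using True k(2) grad_sq_triangle[OF uH r_H1[of k t] r_H1[of m t]] by (simp add: S_def)
      next
        case False
        then show ?thesis using grad_sq_le_H1norm[of "u t"] d by (simp add: S_def)
      qed
    qed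
  qed
qed

end

section \<open>Partitions adapted to an integrable function\<close>

lemma integral_indicator_Ioc:
  assumes "a \<le> c" "c \<le> d" "d \<le> b"
  shows "(LINT \<tau>|lebesgue_on {a..b}. indicator {c<..d} \<tau>) = d - (c::real)"
proof -
  have "{c<..d} \<inter> space (lebesgue_on {a..b}) = {c<..d}" using assms by auto
  then have "(LINT \<tau>|lebesgue_on {a..b}. indicator {c<..d} \<tau>) = measure (lebesgue_on {a..b}) {c<..d}"
    by simp
  also have "\<dots> = d - c" using assms by (subst measure_restrict_space) auto
  finally show ?thesis .
qed

text \<open>Otherwise \<open>Q\<close> would exceed its average at every good point of the cell, so
  that a function positive at almost every point of the cell and zero outside would have integral 0,
  and the cell would be a null set.\<close>

lemma exists_point_below_average:
  fixes Q :: "real \<Rightarrow> real"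
  assumes ac: "a \<le> c" "c < d" "d \<le> b" and Q: "integrable (lebesgue_on {a..b}) Q"
    and good: "AE t in lebesgue_on {a..b}. good t"
  obtains t where "c < t" "t \<le> d" "good t"
    "(d - c) * Q t \<le> (LINT \<tau>|lebesgue_on {a..b}. indicator {c<..d} \<tau> * Q \<tau>)"
proof (rule ccontr)
  note ex = that
  let ?L = "lebesgue_on {a..b}" and ?J = "{c<..d}"
  let ?I = "LINT \<tau>|?L. indicator ?J \<tau> * Q \<tau>"
  assume "\<not> thesis"
  then have no: "\<not> (d - c) * Q t \<le> ?I" if "t \<in> ?J" "good t" for t
    using ex[of t] that \<open>\<not> thesis\<close> by auto
  have J: "?J \<in> sets ?L" using ac by (auto simp: sets_restrict_space intro!: image_eqI[of _ _ ?J])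
  have emJ: "emeasure ?L ?J = ennreal (d - c)"
    using ac by (subst emeasure_restrict_space) auto
  have indi: "integrable ?L (indicator ?J :: real \<Rightarrow> real)"
    using J emJ by (intro integrable_real_indicator) auto
  have iQ: "integrable ?L (\<lambda>\<tau>. indicator ?J \<tau> * Q \<tau>)"
    using integrable_mult_indicator[OF J Q] by simp
  let ?F = "\<lambda>\<tau>. (d - c) * (indicator ?J \<tau> * Q \<tau>) - ?I * indicator ?J \<tau>"
  have Fi: "integrable ?L ?F" using iQ indi by (intro Bochner_Integration.integrable_diff integrable_mult_right)
  have F: "AE \<tau> in ?L. 0 \<le> ?F \<tau> \<and> (\<tau> \<in> ?J \<longrightarrow> ?F \<tau> \<noteq> 0)"
    using good
  proof eventually_elim
    case (elim \<tau>)
    show ?case using no[OF _ elim] by (cases "\<tau> \<in> ?J") auto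
  qed
  have "(LINT \<tau>|?L. ?F \<tau>) = (d - c) * ?I - ?I * (LINT \<tau>|?L. indicator ?J \<tau>)"
    using iQ indi by (subst Bochner_Integration.integral_diff) auto
  also have "(LINT \<tau>|?L. indicator ?J \<tau>) = d - c"
    using ac by (intro integral_indicator_Ioc) auto
  finally have "(LINT \<tau>|?L. ?F \<tau>) = 0" by simp
  moreover have "AE \<tau> in ?L. 0 \<le> ?F \<tau>" using F by eventually_elim simp
  ultimately have "AE \<tau> in ?L. ?F \<tau> = 0"
    using integral_nonneg_eq_0_iff_AE[OF Fi] by blast
  then have "AE \<tau> in ?L. \<tau> \<notin> ?J" using F by eventually_elim auto
  then have "emeasure ?L ?J = 0"
  proof (subst (asm) AE_iff_measurable[OF J])
    show "{\<tau> \<in> space ?L. \<not> \<tau> \<notin> ?J} = ?J" using ac by auto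
  qed
  then show False using emJ ac by simp
qed

text \<open>\<^term>\<open>\<theta> \<tau>\<close> is the first partition point to the right of \<^term>\<open>\<tau>\<close>. The partition points are chosen
  where \<^term>\<open>Q\<close> does not exceed its average, which bounds the Riemann sums of \<^term>\<open>Q\<close>.\<close>

lemma partition_increment:
  fixes E Q :: "real \<Rightarrow> real" and Z :: "real \<Rightarrow> real \<Rightarrow> real"
  assumes ab: "a < b" and Q: "integrable (lebesgue_on {a..b}) Q" "\<And>t. 0 \<le> Q t"
    and good: "AE t in lebesgue_on {a..b}. good t"
    and Zi: "\<And>t. t \<in> {a..b} \<Longrightarrow> good t \<Longrightarrow> integrable (lebesgue_on {a..b}) (\<lambda>\<tau>. Z \<tau> t)"
    and E: "\<And>s t. a \<le> s \<Longrightarrow> s < t \<Longrightarrow> t \<le> b \<Longrightarrow> good t \<Longrightarrow>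
      E t - E s \<le> (LINT \<tau>|lebesgue_on {a..b}. indicator {s<..t} \<tau> * Z \<tau> t)"
    and \<delta>: "\<delta> > 0"
  shows "a + real k * \<delta> \<le> b \<Longrightarrow> \<exists>c \<theta>. c \<in> {a..b} \<and> c \<le> a + real k * \<delta> \<and> a + real k * \<delta> - \<delta> \<le> c \<and>
    (\<forall>\<tau>\<in>{a<..c}. good (\<theta> \<tau>) \<and> \<tau> \<le> \<theta> \<tau> \<and> \<theta> \<tau> \<le> c \<and> \<theta> \<tau> \<le> \<tau> + 2 * \<delta>) \<and>
    (\<forall>Y. (\<forall>t\<in>{a..b}. good t \<longrightarrow> integrable (lebesgue_on {a..b}) (\<lambda>\<tau>. Y \<tau> t)) \<longrightarrow>
        integrable (lebesgue_on {a..b}) (\<lambda>\<tau>. indicator {a<..c} \<tau> * Y \<tau> (\<theta> \<tau>) :: real)) \<and>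
    E c - E a \<le> (LINT \<tau>|lebesgue_on {a..b}. indicator {a<..c} \<tau> * Z \<tau> (\<theta> \<tau>)) \<and>
    (LINT \<tau>|lebesgue_on {a..b}. indicator {a<..c} \<tau> * Q (\<theta> \<tau>)) \<le>
       2 * (LINT \<tau>|lebesgue_on {a..b}. indicator {a<..a + real k * \<delta>} \<tau> * Q \<tau>)"
proof (induction k)
  case 0
  show ?case using ab \<delta> by (intro exI[of _ a]) auto
next
  case (Suc k)
  let ?L = "lebesgue_on {a..b}"
  let ?x = "a + real k * \<delta>" and ?y = "a + real (Suc k) * \<delta>"
  have xy: "?y - ?x = \<delta>" by (simp add: algebra_simps)
  have x: "a \<le> ?x" "?x < ?y" "?x \<le> b" using \<delta> Suc.prems by (auto simp: algebra_simps)
  obtain c \<theta> where IH: "c \<in> {a..b}" "c \<le> ?x" "?x - \<delta> \<le> c"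
    "\<And>\<tau>. \<tau> \<in> {a<..c} \<Longrightarrow> good (\<theta> \<tau>) \<and> \<tau> \<le> \<theta> \<tau> \<and> \<theta> \<tau> \<le> c \<and> \<theta> \<tau> \<le> \<tau> + 2 * \<delta>"
    "\<And>Y. (\<And>t. t \<in> {a..b} \<Longrightarrow> good t \<Longrightarrow> integrable ?L (\<lambda>\<tau>. Y \<tau> t)) \<Longrightarrow> integrable ?L (\<lambda>\<tau>. indicator {a<..c} \<tau> * Y \<tau> (\<theta> \<tau>) :: real)"
    "E c - E a \<le> (LINT \<tau>|?L. indicator {a<..c} \<tau> * Z \<tau> (\<theta> \<tau>))"
    "(LINT \<tau>|?L. indicator {a<..c} \<tau> * Q (\<theta> \<tau>)) \<le> 2 * (LINT \<tau>|?L. indicator {a<..?x} \<tau> * Q \<tau>)"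
    using Suc.IH[OF x(3)] by blast
  obtain t where t: "?x < t" "t \<le> ?y" "good t" "(?y - ?x) * Q t \<le> (LINT \<tau>|?L. indicator {?x<..?y} \<tau> * Q \<tau>)"
    by (rule exists_point_below_average[OF x(1,2) Suc.prems Q(1) good])
  \<comment> \<open>\<open>c\<close> lies in the preceding cell, or is the starting point, and
    \<open>t\<close> in the current one; consecutive points are therefore at most two mesh widths
    apart.\<close>
  have ct: "c < t" "t \<in> {a..b}" "t - c \<le> 2 * \<delta>" using IH t x Suc.prems xy by auto
  define \<theta>' where "\<theta>' \<tau> = (if \<tau> \<le> c then \<theta> \<tau> else t)" for \<tau>
  have split: "indicator {a<..t} \<tau> * Y \<tau> (\<theta>' \<tau>) = indicator {a<..c} \<tau> * Y \<tau> (\<theta> \<tau>) + indicator {c<..t} \<tau> * (Y \<tau> t :: real)" for Y :: "real \<Rightarrow> real \<Rightarrow> real" and \<tau>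
    using ct(1) IH(1) by (auto simp: \<theta>'_def indicator_def)
  have Ioc: "{u<..v} \<inter> {a..b} \<in> sets ?L" for u v
    by (auto simp: sets_restrict_space intro!: image_eqI[of _ _ "{u<..v} \<inter> {a..b}"])
  have ii: "integrable ?L (\<lambda>\<tau>. indicator {u<..v} \<tau> * F \<tau>)" if "integrable ?L F" for u v and F :: "real \<Rightarrow> real"
  proof -
    have "integrable ?L (\<lambda>\<tau>. indicator ({u<..v} \<inter> {a..b}) \<tau> *\<^sub>R F \<tau>)"
      by (rule integrable_mult_indicator[OF Ioc that])
    then show ?thesis
      by (rule Bochner_Integration.integrable_cong[THEN iffD1, rotated 2]) (auto simp: indicator_def)
  qed
  have int: "integrable ?L (\<lambda>\<tau>. indicator {a<..t} \<tau> * Y \<tau> (\<theta>' \<tau>))"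
    "(LINT \<tau>|?L. indicator {a<..t} \<tau> * Y \<tau> (\<theta>' \<tau>)) = (LINT \<tau>|?L. indicator {a<..c} \<tau> * Y \<tau> (\<theta> \<tau>)) + (LINT \<tau>|?L. indicator {c<..t} \<tau> * Y \<tau> t)"
    if Y: "\<And>t. t \<in> {a..b} \<Longrightarrow> good t \<Longrightarrow> integrable ?L (\<lambda>\<tau>. Y \<tau> t)" for Y :: "real \<Rightarrow> real \<Rightarrow> real"
  proof -
    have "integrable ?L (\<lambda>\<tau>. indicator {a<..c} \<tau> * Y \<tau> (\<theta> \<tau>))" by (rule IH(5)[of Y]) (rule Y)
    then show "integrable ?L (\<lambda>\<tau>. indicator {a<..t} \<tau> * Y \<tau> (\<theta>' \<tau>))"
      "(LINT \<tau>|?L. indicator {a<..t} \<tau> * Y \<tau> (\<theta>' \<tau>)) = (LINT \<tau>|?L. indicator {a<..c} \<tau> * Y \<tau> (\<theta> \<tau>)) + (LINT \<tau>|?L. indicator {c<..t} \<tau> * Y \<tau> t)"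
      unfolding split using ii[OF Y[OF ct(2) t(3)]] by auto
  qed
  have E': "E t - E a \<le> (LINT \<tau>|?L. indicator {a<..t} \<tau> * Z \<tau> (\<theta>' \<tau>))"
  proof -
    have "E t - E c \<le> (LINT \<tau>|?L. indicator {c<..t} \<tau> * Z \<tau> t)"
      by (rule E) (use IH(1) ct t(3) in auto)
    moreover have "(LINT \<tau>|?L. indicator {a<..t} \<tau> * Z \<tau> (\<theta>' \<tau>)) =
        (LINT \<tau>|?L. indicator {a<..c} \<tau> * Z \<tau> (\<theta> \<tau>)) + (LINT \<tau>|?L. indicator {c<..t} \<tau> * Z \<tau> t)"
      by (rule int(2)[of Z]) (rule Zi)
    ultimately show ?thesis using IH(6) by linarith
  qed
  have const: "integrable ?L (\<lambda>\<tau>. r)" for r :: real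
    using finite_measure.integrable_const[OF finite_measure_lebesgue_on_Icc] .
  have "(LINT \<tau>|?L. indicator {a<..t} \<tau> * Q (\<theta>' \<tau>)) = (LINT \<tau>|?L. indicator {a<..c} \<tau> * Q (\<theta> \<tau>)) + (LINT \<tau>|?L. indicator {c<..t} \<tau> * Q t)"
    using int(2)[of "\<lambda>_. Q"] const by blast
  also have "(LINT \<tau>|?L. indicator {c<..t} \<tau> * Q t) = (t - c) * Q t"
  proof -
    have "(LINT \<tau>|?L. indicator {c<..t} \<tau>) = t - c"
      using ct IH(1) by (intro integral_indicator_Ioc) auto
    then show ?thesis by simp
  qed
  \<comment> \<open>The gap is at most twice the mesh width, while one mesh width times Q t is at
    most the integral of \<open>Q\<close> over the cell: this is the factor 2 in the bound on the
    Riemann sum.\<close>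
  also have "(t - c) * Q t \<le> 2 * ((?y - ?x) * Q t)" using mult_right_mono[OF ct(3) Q(2)[of t]] unfolding xy by (simp only: mult.assoc)
  also have "\<dots> \<le> 2 * (LINT \<tau>|?L. indicator {?x<..?y} \<tau> * Q \<tau>)" using t(4) by simp
  finally have "(LINT \<tau>|?L. indicator {a<..t} \<tau> * Q (\<theta>' \<tau>)) \<le> 2 * ((LINT \<tau>|?L. indicator {a<..?x} \<tau> * Q \<tau>) + (LINT \<tau>|?L. indicator {?x<..?y} \<tau> * Q \<tau>))"
    using IH(7) by simp
  also have "(LINT \<tau>|?L. indicator {a<..?x} \<tau> * Q \<tau>) + (LINT \<tau>|?L. indicator {?x<..?y} \<tau> * Q \<tau>) =
      (LINT \<tau>|?L. indicator {a<..?x} \<tau> * Q \<tau> + indicator {?x<..?y} \<tau> * Q \<tau>)"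
    using ii[OF Q(1)] by simp
  also have "\<dots> = (LINT \<tau>|?L. indicator {a<..?y} \<tau> * Q \<tau>)"
    using x by (intro Bochner_Integration.integral_cong refl) (auto simp: indicator_def)
  finally have Q': "(LINT \<tau>|?L. indicator {a<..t} \<tau> * Q (\<theta>' \<tau>)) \<le> 2 * (LINT \<tau>|?L. indicator {a<..?y} \<tau> * Q \<tau>)" .
  have \<theta>': "good (\<theta>' \<tau>) \<and> \<tau> \<le> \<theta>' \<tau> \<and> \<theta>' \<tau> \<le> t \<and> \<theta>' \<tau> \<le> \<tau> + 2 * \<delta>" if "\<tau> \<in> {a<..t}" for \<tau>
    using that IH(4)[of \<tau>] ct t(3) by (auto simp: \<theta>'_def)
  show ?case
    using ct(2) t(1,2) xy \<theta>' int(1) E' Q' by (intro exI[of _ t] exI[of _ \<theta>'] conjI allI impI ballI) auto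
qed

section \<open>The energy inequality for bounded truncations\<close>

text \<open>The graph of a convex function lies above its tangent at \<open>x\<close>. Used with
  \<open>x\<close> as the value at the later time, it makes the truncation at the right end point
  the test function for the increment.\<close>

lemma convex_increment_le:
  fixes \<Psi> h :: "real \<Rightarrow> real"
  assumes "\<And>s. (\<Psi> has_real_derivative h s) (at s)" "\<And>r s. r \<le> s \<Longrightarrow> h r \<le> h s"
  shows "\<Psi> x - \<Psi> y \<le> h x * (x - y)"
proof (cases x y rule: linorder_cases)
  case less
  then obtain z where z: "x < z" "z < y" "\<Psi> y - \<Psi> x = (y - x) * h z"
    using MVT2[OF less, of \<Psi> h] assms(1) by blast
  have "(y - x) * h x \<le> (y - x) * h z" using z less assms(2)[of x z] by (intro mult_left_mono) auto
  then show ?thesis using z(3) by (simp add: algebra_simps)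
next
  case greater
  then obtain z where z: "y < z" "z < x" "\<Psi> x - \<Psi> y = (x - y) * h z"
    using MVT2[OF greater, of \<Psi> h] assms(1) by blast
  have "(x - y) * h z \<le> (x - y) * h x" using z greater assms(2)[of z x] by (intro mult_left_mono) auto
  then show ?thesis using z(3) by (simp add: algebra_simps)
qed simp

context finite_measure
begin

lemma lipschitz_comp_integrable:
  fixes \<Psi> :: "real \<Rightarrow> real"
  assumes v: "v \<in> Lspace M 2" and lip: "\<And>r s. \<bar>\<Psi> r - \<Psi> s\<bar> \<le> K * \<bar>r - s\<bar>" and c: "continuous_on UNIV \<Psi>"
  shows "integrable M (\<lambda>x. \<Psi> (v x))"
proof (rule Bochner_Integration.integrable_bound)
  have [measurable]: "v \<in> borel_measurable M" "\<Psi> \<in> borel_measurable borel"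
    using Lspace_2_measurable[OF v] borel_measurable_continuous_onI[OF c] by auto
  show "integrable M (\<lambda>x. K * \<bar>v x\<bar> + \<bar>\<Psi> 0\<bar>)"
    using Lspace_2_integrable[OF finite_measure_axioms v] by simp
  show "(\<lambda>x. \<Psi> (v x)) \<in> borel_measurable M" by measurable
  show "AE x in M. norm (\<Psi> (v x)) \<le> norm (K * \<bar>v x\<bar> + \<bar>\<Psi> 0\<bar>)"
  proof (rule AE_I2)
    fix x show "norm (\<Psi> (v x)) \<le> norm (K * \<bar>v x\<bar> + \<bar>\<Psi> 0\<bar>)"
      using lip[of "v x" 0] by simp
  qed
qed

text \<open>The primitive of a bounded truncation is Lipschitz but need not be bounded;
  Cauchy-Schwarz against the constant 1 replaces dominated convergence.\<close>

lemma cont_L2_lipschitz_integral_tendsto: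
  fixes \<Psi> :: "real \<Rightarrow> real"
  assumes u: "u \<in> cont_L2 M" and s: "\<And>n. 0 \<le> s n" "0 \<le> t" "s \<longlonglongrightarrow> t"
    and lip: "\<And>r s. \<bar>\<Psi> r - \<Psi> s\<bar> \<le> K * \<bar>r - s\<bar>" and c: "continuous_on UNIV \<Psi>"
  shows "(\<lambda>n. LINT x|M. \<Psi> (u (s n) x)) \<longlonglongrightarrow> (LINT x|M. \<Psi> (u t x))"
proof -
  have uL: "u t \<in> Lspace M 2" "u (s n) \<in> Lspace M 2" for n using cont_L2_Lspace[OF u] s by auto
  have one: "(\<lambda>_. 1) \<in> Lspace M 2" by (simp add: Lspace_2_iff)
  have K: "0 \<le> K" using lip[of 1 0] by simp
  have "(\<lambda>n. (LINT x|M. \<Psi> (u t x)) - (LINT x|M. \<Psi> (u (s n) x))) \<longlonglongrightarrow> 0"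
  proof (rule Lim_null_comparison)
    show "\<forall>\<^sub>F n in sequentially. norm ((LINT x|M. \<Psi> (u t x)) - (LINT x|M. \<Psi> (u (s n) x)))
       \<le> K * (Lnorm M 2 (\<lambda>x. u t x - u (s n) x) * Lnorm M 2 (\<lambda>_. 1))"
    proof (rule always_eventually, rule allI)
      fix n
      have d: "(\<lambda>x. u t x - u (s n) x) \<in> Lspace M 2" using uL by (intro Lspace_2_diff)
      have da: "(\<lambda>x. \<bar>u t x - u (s n) x\<bar>) \<in> Lspace M 2"
        using d borel_measurable_abs[OF Lspace_2_measurable[OF d]] by (simp add: Lspace_2_iff)
      have i: "integrable M (\<lambda>x. \<Psi> (u t x))" "integrable M (\<lambda>x. \<Psi> (u (s n) x))"
        using lipschitz_comp_integrable[OF _ lip c] uL by auto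
      have "norm ((LINT x|M. \<Psi> (u t x)) - (LINT x|M. \<Psi> (u (s n) x))) = norm (LINT x|M. \<Psi> (u t x) - \<Psi> (u (s n) x))"
        using i by simp
      also have "\<dots> \<le> (LINT x|M. norm (\<Psi> (u t x) - \<Psi> (u (s n) x)))" by (rule integral_norm_bound)
      also have "\<dots> \<le> (LINT x|M. K * \<bar>u t x - u (s n) x\<bar>)"
        using i Lspace_2_integrable[OF finite_measure_axioms da] lip by (intro integral_mono) auto
      also have "\<dots> = K * pairing M (\<lambda>x. \<bar>u t x - u (s n) x\<bar>) (\<lambda>_. 1)" by (simp add: pairing_def)
      also have "\<dots> \<le> K * (Lnorm M 2 (\<lambda>x. \<bar>u t x - u (s n) x\<bar>) * Lnorm M 2 (\<lambda>_. 1))"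
        using Cauchy_Schwarz_Lspace_2[OF da one] K by (intro mult_left_mono) auto
      finally show "norm ((LINT x|M. \<Psi> (u t x)) - (LINT x|M. \<Psi> (u (s n) x)))
       \<le> K * (Lnorm M 2 (\<lambda>x. u t x - u (s n) x) * Lnorm M 2 (\<lambda>_. 1))"
        by (simp add: Lnorm_2_eq)
    qed
    show "(\<lambda>n. K * (Lnorm M 2 (\<lambda>x. u t x - u (s n) x) * Lnorm M 2 (\<lambda>_. 1))) \<longlonglongrightarrow> 0"
      using cont_L2_sequentially[OF u s] by (intro tendsto_mult_right_zero tendsto_mult_left_zero)
  qed
  then show ?thesis using tendsto_diff[OF tendsto_const[of "LINT x|M. \<Psi> (u t x)"]] by fastforce
qed

end

text \<open>\<open>g\<close> is an arbitrary function of the values; it will be the functional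
  \<open>J\<close> at a fixed time and the bound for it.\<close>

lemma simple_function_integrable_lebesgue_on:
  fixes g :: "'b \<Rightarrow> real"
  assumes "finite (s ` {a..b})" "\<And>w. {t \<in> {a..b}. s t = w} \<in> sets lebesgue"
  shows "integrable (lebesgue_on {a..b::real}) (\<lambda>\<tau>. g (s \<tau>))"
proof -
  interpret F: finite_measure "lebesgue_on {a..b}" by (rule finite_measure_lebesgue_on_Icc)
  have meas: "(\<lambda>\<tau>. g (s \<tau>)) \<in> borel_measurable (lebesgue_on {a..b})"
  proof (rule measurableI)
    fix A :: "real set" assume "A \<in> sets borel"
    have "{t \<in> {a..b}. g (s t) \<in> A} \<in> sets lebesgue" by (rule simple_preimage_sets[OF assms])
    moreover have "(\<lambda>\<tau>. g (s \<tau>)) -` A \<inter> space (lebesgue_on {a..b}) = {t \<in> {a..b}. g (s t) \<in> A}" by auto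
    ultimately show "(\<lambda>\<tau>. g (s \<tau>)) -` A \<inter> space (lebesgue_on {a..b}) \<in> sets (lebesgue_on {a..b})"
      by (subst sets_restrict_space_iff) (auto intro: subsetD)
  qed simp
  show ?thesis
  proof (rule F.integrable_const_bound[OF _ meas])
    show "AE \<tau> in lebesgue_on {a..b}. norm (g (s \<tau>)) \<le> (\<Sum>w\<in>s ` {a..b}. \<bar>g w\<bar>)"
    proof (rule AE_I2)
      fix \<tau> assume "\<tau> \<in> space (lebesgue_on {a..b})"
      then show "norm (g (s \<tau>)) \<le> (\<Sum>w\<in>s ` {a..b}. \<bar>g w\<bar>)"
        using member_le_sum[of "s \<tau>" "s ` {a..b}" "\<lambda>w. \<bar>g w\<bar>"] assms(1) by auto
    qed
  qed
qed

lemma AE_lebesgue_on_neq: "AE \<tau> in lebesgue_on {a..b::real}. \<tau> \<noteq> c"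
proof -
  have "AE \<tau> in lebesgue. \<tau> \<noteq> c" by (rule AE_completion) (rule AE_lborel_singleton)
  then show ?thesis by (subst AE_restrict_space_iff) auto
qed

text \<open>Two solutions with a bounded, nondecreasing, smooth truncation \<open>h\<close> of
  bounded slope and a primitive \<open>\<Psi>\<close> of it. The aim is the energy inequality for
  the integral of \<open>\<Psi>\<close> of the difference between the times \<open>a\<close> and
  \<open>b\<close>.\<close>

locale truncated_difference = reaction_diffusion N D p lam \<sigma> f g
  for N D p lam \<sigma> f g +
  fixes u01 u02 u1 u2 and h h' \<Psi> :: "real \<Rightarrow> real" and K a b :: real
  assumes sol1: "solution u01 u1" and sol2: "solution u02 u2"
    and h: "smooth h" "h 0 = 0" and h': "\<And>s. (h has_real_derivative h' s) (at s)" "\<And>s. 0 \<le> h' s" "\<And>s. h' s \<le> K"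
    and h_bound: "\<And>s. \<bar>h s\<bar> \<le> K" and \<Psi>: "\<And>s. (\<Psi> has_real_derivative h s) (at s)"
    and ab: "0 < a" "a < b"
begin

abbreviation "L \<equiv> lebesgue_on {a..b}"

definition "w t x = u1 t x - u2 t x"

definition "V t = (\<lambda>x. h (w t x))"

text \<open>At these times \<open>V t\<close> is an admissible test function, so partition points
  are chosen among them. Almost every time is good.\<close>

definition "good t \<longleftrightarrow> t \<in> {a..b} \<and> u1 t \<in> H10 N D \<and> u1 t \<in> Lspace M p \<and> u2 t \<in> H10 N D \<and> u2 t \<in> Lspace M p"

definition "E t = (LINT x|M. \<Psi> (w t x))"

definition "Q t = (H1norm N D (u1 t))\<^sup>2 + (H1norm N D (u2 t))\<^sup>2"

text \<open>The two times are kept apart: the solutions run with \<open>\<tau>\<close> while the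
  test function is frozen at the partition point \<open>t\<close>. A sign is known on the diagonal,
  and the passage to the diagonal is the purpose of the Riemann sums.\<close>

definition "dir \<tau> t = dirichlet (u1 \<tau>) (V t) - dirichlet (u2 \<tau>) (V t)"

definition "low \<tau> t = lam * (pairing M (u1 \<tau>) (V t) - pairing M (u2 \<tau>) (V t)) +
   (pairing M (\<lambda>x. f (u1 \<tau> x)) (V t) - pairing M (\<lambda>x. f (u2 \<tau> x)) (V t))"

definition "\<zeta> \<tau> x = lam * w \<tau> x + (f (u1 \<tau> x) - f (u2 \<tau> x))"

definition "F \<tau> = (LINT x|M. \<zeta> \<tau> x * h (w \<tau> x))"

text \<open>The Dirichlet form of \<open>\<phi>\<close> and \<open>V t\<close> after both
  derivatives are moved onto \<open>\<phi>\<close>. In this form it makes sense at every time and is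
  continuous in \<open>t\<close>, whereas \<open>V t\<close> lies in H10 at good times.\<close>

definition "J \<phi> t = - (\<Sum>i<N. LINT x|M. pd i (pd i \<phi>) x * h (w t x))"

lemma K_nonneg: "0 \<le> K"
  using h_bound[of 0] by linarith

lemma h_cont: "continuous_on UNIV h"
  using smooth_continuous_on h(1) by blast

lemma h_mono: "r \<le> s \<Longrightarrow> h r \<le> h s"
  using DERIV_nonneg_imp_nondecreasing h' by blast

lemma \<Psi>_cont: "continuous_on UNIV \<Psi>"
  using \<Psi> DERIV_isCont continuous_at_imp_continuous_on by blast

lemma \<Psi>_lip: "\<bar>\<Psi> r - \<Psi> s\<bar> \<le> K * \<bar>r - s\<bar>"
  by (rule lipschitz_of_derivative_bound[OF \<Psi> h_bound])

lemma cont1: "u1 \<in> cont_L2 M" and cont2: "u2 \<in> cont_L2 M"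
  using sol1 sol2 by (auto intro: solution_cont)

lemma w_cont: "w \<in> cont_L2 M"
proof -
  have "(\<lambda>t x. u1 t x - u2 t x) \<in> cont_L2 M" by (rule cont_L2_diff[OF cont1 cont2])
  moreover have "(\<lambda>t x. u1 t x - u2 t x) = w" by (intro ext) (simp add: w_def)
  ultimately show ?thesis by simp
qed

lemma AE_good: "AE t in L. good t"
  using solution_AE[OF sol1 ab] solution_AE[OF sol2 ab] AE_space
  by eventually_elim (auto simp: good_def)

lemma w_measurable: "0 \<le> t \<Longrightarrow> w t \<in> borel_measurable M"
  using cont_L2_measurable[OF w_cont] .

lemma V_measurable: "0 \<le> t \<Longrightarrow> V t \<in> borel_measurable M"
  unfolding V_def using w_measurable borel_measurable_continuous_onI[OF h_cont] by measurable

lemma V_Lspace_p: 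
  assumes "0 \<le> t"
  shows "V t \<in> Lspace M p"
proof -
  have [measurable]: "V t \<in> borel_measurable M" using V_measurable[OF assms] .
  have "integrable M (\<lambda>x. \<bar>V t x\<bar> powr p)"
  proof (rule integrable_const_bound[where B="K powr p"])
    have "norm (\<bar>V t x\<bar> powr p) \<le> K powr p" for x
      using h_bound[of "w t x"] p_gt_2 by (simp add: V_def powr_mono2)
    then show "AE x in M. norm (\<bar>V t x\<bar> powr p) \<le> K powr p" by simp
  qed measurable
  then show ?thesis by (simp add: Lspace_def)
qed

lemma good_H1: "good t \<Longrightarrow> u1 t \<in> H1 N D" "good t \<Longrightarrow> u2 t \<in> H1 N D"
  by (auto simp: good_def H10_H1)

lemma V_truncation:
  assumes "good t"
  shows "V t \<in> H10 N D" "0 \<le> dir t t" "grad_sq (V t) \<le> 2 * K\<^sup>2 * Q t"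
proof -
  have u: "u1 t \<in> H10 N D" "u2 t \<in> H10 N D" using assms by (auto simp: good_def)
  have V: "V t = (\<lambda>x. h (u1 t x - u2 t x))" by (simp add: V_def w_def)
  show "V t \<in> H10 N D" unfolding V by (rule truncation_H10(1)[OF u h h'])
  show "0 \<le> dir t t" unfolding dir_def V by (rule truncation_H10(2)[OF u h h'])
  have "grad_sq (V t) \<le> 2 * K\<^sup>2 * (grad_sq (u1 t) + grad_sq (u2 t))"
    unfolding V by (rule truncation_H10(3)[OF u h h'])
  also have "\<dots> \<le> 2 * K\<^sup>2 * Q t"
    unfolding Q_def by (intro mult_left_mono add_mono grad_sq_le_H1norm) auto
  finally show "grad_sq (V t) \<le> 2 * K\<^sup>2 * Q t" .
qed

lemma Q_nonneg: "0 \<le> Q t"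
  by (simp add: Q_def)

lemma Q_integrable: "integrable L Q"
  unfolding Q_def using solution_integrable_H1[OF sol1 ab] solution_integrable_H1[OF sol2 ab] by simp

lemma dir_low_integrable:
  assumes "good t"
  shows "integrable L (\<lambda>\<tau>. dir \<tau> t)" "integrable L (\<lambda>\<tau>. low \<tau> t)"
proof -
  have t: "0 \<le> t" using assms ab by (auto simp: good_def)
  have V: "V t \<in> H10 N D" "V t \<in> Lspace M p" "V t \<in> Lspace M 2"
    using V_truncation(1)[OF assms] V_Lspace_p[OF t] H10_H1 H1_Lspace by auto
  show "integrable L (\<lambda>\<tau>. dir \<tau> t)"
    unfolding dir_def using dirichlet_time_integrable[OF sol1 ab V(1)] dirichlet_time_integrable[OF sol2 ab V(1)] by simp
  show "integrable L (\<lambda>\<tau>. low \<tau> t)"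
    unfolding low_def
    using f_time_integrable[OF sol1 ab V(2)] f_time_integrable[OF sol2 ab V(2)]
      continuous_measurable_time(2)[OF cont_L2_continuous_pairing[OF cont1 V(3)]]
      continuous_measurable_time(2)[OF cont_L2_continuous_pairing[OF cont2 V(3)]] ab by simp
qed

lemma Ioc_indicator_integrable:
  fixes G :: "real \<Rightarrow> real"
  assumes "integrable L G"
  shows "integrable L (\<lambda>\<tau>. indicator {r<..q} \<tau> * G \<tau>)"
proof -
  have "(indicator {r<..q} :: real \<Rightarrow> real) \<in> borel_measurable L"
    by (rule measurable_restrict_space1) (rule borel_measurable_indicator, simp)
  then have "(\<lambda>\<tau>. indicator {r<..q} \<tau> * G \<tau>) \<in> borel_measurable L"
    using borel_measurable_integrable[OF assms] by (rule borel_measurable_times)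
  then show ?thesis
    by (rule Bochner_Integration.integrable_bound[OF assms]) (auto simp: indicator_def)
qed

text \<open>Convexity bounds the increment of \<open>E\<close> by the increment of the difference
  tested with the fixed function \<open>V t\<close>; the increments of both solutions against this
  function follow from the equation, and the source \<open>g\<close> cancels.\<close>

lemma E_increment:
  assumes st: "a \<le> s" "s < t" "t \<le> b" and t: "good t"
  shows "E t - E s \<le> (LINT \<tau>|L. indicator {s<..t} \<tau> * (- (dir \<tau> t + low \<tau> t)))"
proof -
  have t0: "0 \<le> t" "0 \<le> s" using st ab by auto
  have V: "V t \<in> H10 N D" "V t \<in> Lspace M p" "V t \<in> Lspace M 2"
    using V_truncation(1)[OF t] V_Lspace_p[OF t0(1)] H10_H1 H1_Lspace by auto
  have uL: "u1 r \<in> Lspace M 2" "u2 r \<in> Lspace M 2" "w r \<in> Lspace M 2" if "0 \<le> r" for r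
    using that cont_L2_Lspace cont1 cont2 w_cont by auto
  have Ei: "integrable M (\<lambda>x. \<Psi> (w r x))" if "0 \<le> r" for r
    using lipschitz_comp_integrable[OF uL(3)[OF that] \<Psi>_lip \<Psi>_cont] .
  have "E t - E s = (LINT x|M. \<Psi> (w t x) - \<Psi> (w s x))"
    unfolding E_def using Ei t0 by simp
  also have "\<dots> \<le> (LINT x|M. w t x * V t x - w s x * V t x)"
  proof (rule integral_mono)
    show "integrable M (\<lambda>x. w t x * V t x - w s x * V t x)"
      using Lspace_2_mult_integrable[OF uL(3) V(3)] t0 by (intro Bochner_Integration.integrable_diff) auto
    show "\<Psi> (w t x) - \<Psi> (w s x) \<le> w t x * V t x - w s x * V t x" for x
      using convex_increment_le[OF \<Psi> h_mono, of "w t x" "w s x"] by (simp add: V_def algebra_simps)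
  qed (use Ei t0 in auto)
  also have "\<dots> = pairing M (w t) (V t) - pairing M (w s) (V t)"
    unfolding pairing_def using Lspace_2_mult_integrable[OF uL(3) V(3)] t0 by simp
  also have "\<dots> = (pairing M (u1 t) (V t) - pairing M (u1 s) (V t)) - (pairing M (u2 t) (V t) - pairing M (u2 s) (V t))"
    using pairing_diff_left[OF uL(1,2) V(3)] t0 unfolding w_def[abs_def] by simp
  also have "\<dots> = (LINT \<tau>|L. indicator {s<..t} \<tau> * (- (dir \<tau> t + low \<tau> t)))"
  proof -
    let ?H = "\<lambda>u \<tau>. lam * pairing M (u \<tau>) (V t) + dirichlet (u \<tau>) (V t) + pairing M (\<lambda>x. f (u \<tau> x)) (V t)"
    let ?c = "pairing M g (V t)"
    have const: "integrable L (\<lambda>_. r)" for r :: real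
      using finite_measure.integrable_const[OF finite_measure_lebesgue_on_Icc] .
    have i: "integrable L (\<lambda>\<tau>. indicator {s<..t} \<tau> * (?H u1 \<tau> - ?c))" "integrable L (\<lambda>\<tau>. indicator {s<..t} \<tau> * (?H u2 \<tau> - ?c))"
      using solution_increment(2)[OF sol1 ab(1) st V(1,2)] solution_increment(2)[OF sol2 ab(1) st V(1,2)] const
      by (auto intro!: Ioc_indicator_integrable)
    have "(pairing M (u1 t) (V t) - pairing M (u1 s) (V t)) - (pairing M (u2 t) (V t) - pairing M (u2 s) (V t)) =
      (LINT \<tau>|L. indicator {s<..t} \<tau> * (?H u2 \<tau> - ?c)) - (LINT \<tau>|L. indicator {s<..t} \<tau> * (?H u1 \<tau> - ?c))"
      using solution_increment(1)[OF sol1 ab(1) st V(1,2)] solution_increment(1)[OF sol2 ab(1) st V(1,2)] by linarith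
    also have "\<dots> = (LINT \<tau>|L. indicator {s<..t} \<tau> * (?H u2 \<tau> - ?c) - indicator {s<..t} \<tau> * (?H u1 \<tau> - ?c))"
      using i by (intro Bochner_Integration.integral_diff[symmetric])
    also have "\<dots> = (LINT \<tau>|L. indicator {s<..t} \<tau> * (- (dir \<tau> t + low \<tau> t)))"
      by (intro Bochner_Integration.integral_cong refl) (simp add: dir_def low_def algebra_simps)
    finally show ?thesis .
  qed
  finally show ?thesis .
qed

lemma low_eq:
  assumes "good \<tau>" "0 \<le> t"
  shows "low \<tau> t = (LINT x|M. \<zeta> \<tau> x * h (w t x))" "integrable M (\<zeta> \<tau>)"
    "(LINT x|M. \<bar>\<zeta> \<tau> x\<bar>) \<le> \<bar>lam\<bar> * ((LINT x|M. 1 + \<bar>u1 \<tau> x\<bar> powr p) + (LINT x|M. 1 + \<bar>u2 \<tau> x\<bar> powr p)) +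
       ((LINT x|M. \<bar>f (u1 \<tau> x)\<bar>) + (LINT x|M. \<bar>f (u2 \<tau> x)\<bar>))"
proof -
  have u: "u1 \<tau> \<in> Lspace M p" "u2 \<tau> \<in> Lspace M p" using assms by (auto simp: good_def)
  have V: "V t \<in> Lspace M p" by (rule V_Lspace_p[OF assms(2)])
  have [measurable]: "V t \<in> borel_measurable M" using V_measurable[OF assms(2)] .
  have ui: "integrable M (u1 \<tau>)" "integrable M (u2 \<tau>)" using Lspace_p_integrable u by auto
  have fi: "integrable M (\<lambda>x. f (u1 \<tau> x))" "integrable M (\<lambda>x. f (u2 \<tau> x))" using f_integrable u by auto
  have Vi: "integrable M (\<lambda>x. v x * V t x)" if "integrable M v" for v
  proof (rule Bochner_Integration.integrable_bound)
    show "integrable M (\<lambda>x. K * v x)" using that by simp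
    show "(\<lambda>x. v x * V t x) \<in> borel_measurable M" using borel_measurable_integrable[OF that] by measurable
    show "AE x in M. norm (v x * V t x) \<le> norm (K * v x)"
    proof (rule AE_I2)
      fix x
      have "\<bar>V t x\<bar> * \<bar>v x\<bar> \<le> K * \<bar>v x\<bar>" by (intro mult_right_mono) (auto simp: V_def h_bound)
      then show "norm (v x * V t x) \<le> norm (K * v x)" using K_nonneg by (simp add: abs_mult mult.commute)
    qed
  qed
  have "(LINT x|M. \<zeta> \<tau> x * h (w t x)) = (LINT x|M. lam * (u1 \<tau> x * V t x - u2 \<tau> x * V t x) + (f (u1 \<tau> x) * V t x - f (u2 \<tau> x) * V t x))"
    by (simp add: \<zeta>_def w_def V_def algebra_simps)
  also have "\<dots> = low \<tau> t"
    unfolding low_def pairing_def using Vi[OF ui(1)] Vi[OF ui(2)] Vi[OF fi(1)] Vi[OF fi(2)] by simp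
  finally show "low \<tau> t = (LINT x|M. \<zeta> \<tau> x * h (w t x))" by simp
  show zi: "integrable M (\<zeta> \<tau>)" unfolding \<zeta>_def w_def using ui fi by simp
  have pi: "integrable M (\<lambda>x. 1 + \<bar>u1 \<tau> x\<bar> powr p)" "integrable M (\<lambda>x. 1 + \<bar>u2 \<tau> x\<bar> powr p)"
    using u by (auto simp: Lspace_def)
  have "(LINT x|M. \<bar>\<zeta> \<tau> x\<bar>) \<le> (LINT x|M. \<bar>lam\<bar> * ((1 + \<bar>u1 \<tau> x\<bar> powr p) + (1 + \<bar>u2 \<tau> x\<bar> powr p)) + (\<bar>f (u1 \<tau> x)\<bar> + \<bar>f (u2 \<tau> x)\<bar>))"
  proof (rule integral_mono)
    fix x
    have "\<bar>\<zeta> \<tau> x\<bar> \<le> \<bar>lam\<bar> * (\<bar>u1 \<tau> x\<bar> + \<bar>u2 \<tau> x\<bar>) + (\<bar>f (u1 \<tau> x)\<bar> + \<bar>f (u2 \<tau> x)\<bar>)"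
    proof -
      have "\<bar>lam * w \<tau> x\<bar> \<le> \<bar>lam\<bar> * (\<bar>u1 \<tau> x\<bar> + \<bar>u2 \<tau> x\<bar>)"
        unfolding abs_mult w_def by (intro mult_left_mono abs_triangle_ineq4) auto
      then show ?thesis unfolding \<zeta>_def by linarith
    qed
    also have "\<dots> \<le> \<bar>lam\<bar> * ((1 + \<bar>u1 \<tau> x\<bar> powr p) + (1 + \<bar>u2 \<tau> x\<bar> powr p)) + (\<bar>f (u1 \<tau> x)\<bar> + \<bar>f (u2 \<tau> x)\<bar>)"
      using p_gt_2 by (intro add_mono mult_left_mono abs_le_1_add_powr) auto
    finally show "\<bar>\<zeta> \<tau> x\<bar> \<le> \<bar>lam\<bar> * ((1 + \<bar>u1 \<tau> x\<bar> powr p) + (1 + \<bar>u2 \<tau> x\<bar> powr p)) + (\<bar>f (u1 \<tau> x)\<bar> + \<bar>f (u2 \<tau> x)\<bar>)" .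
  next
    show "integrable M (\<lambda>x. \<bar>\<zeta> \<tau> x\<bar>)" using zi by (rule integrable_abs)
    show "integrable M (\<lambda>x. \<bar>lam\<bar> * ((1 + \<bar>u1 \<tau> x\<bar> powr p) + (1 + \<bar>u2 \<tau> x\<bar> powr p)) + (\<bar>f (u1 \<tau> x)\<bar> + \<bar>f (u2 \<tau> x)\<bar>))"
      by (intro Bochner_Integration.integrable_add integrable_mult_right pi integrable_abs fi)
  qed
  also have "\<dots> = \<bar>lam\<bar> * ((LINT x|M. 1 + \<bar>u1 \<tau> x\<bar> powr p) + (LINT x|M. 1 + \<bar>u2 \<tau> x\<bar> powr p)) +
       ((LINT x|M. \<bar>f (u1 \<tau> x)\<bar>) + (LINT x|M. \<bar>f (u2 \<tau> x)\<bar>))"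
  proof -
    have "integrable M (\<lambda>x. \<bar>f (u1 \<tau> x)\<bar>)" "integrable M (\<lambda>x. \<bar>f (u2 \<tau> x)\<bar>)" using fi by auto
    then show ?thesis
      using Bochner_Integration.integral_add[OF integrable_mult_right[OF Bochner_Integration.integrable_add[OF pi], of "\<bar>lam\<bar>"] Bochner_Integration.integrable_add]
        Bochner_Integration.integral_add[OF pi] by simp
  qed
  finally show "(LINT x|M. \<bar>\<zeta> \<tau> x\<bar>) \<le> \<bar>lam\<bar> * ((LINT x|M. 1 + \<bar>u1 \<tau> x\<bar> powr p) + (LINT x|M. 1 + \<bar>u2 \<tau> x\<bar> powr p)) +
       ((LINT x|M. \<bar>f (u1 \<tau> x)\<bar>) + (LINT x|M. \<bar>f (u2 \<tau> x)\<bar>))" .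
qed

text \<open>Bounds \<open>low \<tau> t\<close> uniformly in \<open>t\<close> and is integrable in
  time, as dominated convergence of the Riemann sums requires.\<close>

definition "majorant \<tau> = K * (\<bar>lam\<bar> * ((LINT x|M. 1 + \<bar>u1 \<tau> x\<bar> powr p) + (LINT x|M. 1 + \<bar>u2 \<tau> x\<bar> powr p)) +
       ((LINT x|M. \<bar>f (u1 \<tau> x)\<bar>) + (LINT x|M. \<bar>f (u2 \<tau> x)\<bar>)))"

lemma majorant_integrable: "integrable L majorant"
proof -
  have "integrable L (\<lambda>\<tau>. LINT x|M. 1 + \<bar>u \<tau> x\<bar> powr p)" if sol: "solution u0 u" for u0 u
  proof -
    have i: "integrable L (\<lambda>\<tau>. measure M (space M) + (LINT x|M. \<bar>u \<tau> x\<bar> powr p))"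
      using solution_integrable_p[OF sol ab] finite_measure.integrable_const[OF finite_measure_lebesgue_on_Icc] by simp
    have ae: "AE \<tau> in L. measure M (space M) + (LINT x|M. \<bar>u \<tau> x\<bar> powr p) = (LINT x|M. 1 + \<bar>u \<tau> x\<bar> powr p)"
      using solution_AE[OF sol ab] by eventually_elim (simp add: Lspace_def)
    have "(\<lambda>\<tau>. LINT x|M. 1 + \<bar>u \<tau> x\<bar> powr p) \<in> borel_measurable L"
      by (rule borel_measurable_AE_lebesgue_on[OF _ borel_measurable_integrable[OF i] ae]) simp
    then show ?thesis using integrable_cong_AE[OF borel_measurable_integrable[OF i] _ ae] i by blast
  qed
  then show ?thesis unfolding majorant_def
    using sol1 sol2 abs_f_time_integrable[OF sol1 ab] abs_f_time_integrable[OF sol2 ab] by simp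
qed

lemma low_bound:
  assumes "good \<tau>" "0 \<le> t"
  shows "\<bar>low \<tau> t\<bar> \<le> majorant \<tau>"
proof -
  have z: "integrable M (\<zeta> \<tau>)" using low_eq(2)[OF assms] .
  have [measurable]: "w t \<in> borel_measurable M" "h \<in> borel_measurable borel"
    using w_measurable[OF assms(2)] borel_measurable_continuous_onI[OF h_cont] by auto
  have le: "norm (\<zeta> \<tau> x * h (w t x)) \<le> K * \<bar>\<zeta> \<tau> x\<bar>" for x
  proof -
    have "\<bar>h (w t x)\<bar> * \<bar>\<zeta> \<tau> x\<bar> \<le> K * \<bar>\<zeta> \<tau> x\<bar>" by (intro mult_right_mono h_bound) auto
    then show ?thesis by (simp add: abs_mult mult.commute)
  qed
  have i: "integrable M (\<lambda>x. \<zeta> \<tau> x * h (w t x))"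
  proof (rule Bochner_Integration.integrable_bound[of _ "\<lambda>x. K * \<bar>\<zeta> \<tau> x\<bar>"])
    show "integrable M (\<lambda>x. K * \<bar>\<zeta> \<tau> x\<bar>)" using z by simp
    show "(\<lambda>x. \<zeta> \<tau> x * h (w t x)) \<in> borel_measurable M" using borel_measurable_integrable[OF z] by measurable
    show "AE x in M. norm (\<zeta> \<tau> x * h (w t x)) \<le> norm (K * \<bar>\<zeta> \<tau> x\<bar>)"
      using le order_trans[OF le abs_ge_self] by (intro AE_I2) (simp only: real_norm_def)
  qed
  have "\<bar>low \<tau> t\<bar> \<le> (LINT x|M. norm (\<zeta> \<tau> x * h (w t x)))"
    unfolding low_eq(1)[OF assms] real_norm_def[symmetric] by (rule integral_norm_bound)
  also have "\<dots> \<le> (LINT x|M. K * \<bar>\<zeta> \<tau> x\<bar>)"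
    using i z le by (intro integral_mono) auto
  also have "\<dots> \<le> majorant \<tau>"
    unfolding majorant_def using low_eq(3)[OF assms] K_nonneg by (simp add: mult_left_mono)
  finally show ?thesis .
qed

lemma J_eq: "\<phi> \<in> test_functions N D \<Longrightarrow> good t \<Longrightarrow> J \<phi> t = dirichlet \<phi> (V t)"
  using dirichlet_test[of \<phi> "V t"] V_truncation(1) H10_H1 by (simp add: J_def V_def pairing_def mult.commute)

lemma J_tendsto:
  assumes \<phi>: "\<phi> \<in> test_functions N D" and s: "\<And>n. 0 \<le> s n" "0 \<le> t" "s \<longlonglongrightarrow> t"
  shows "(\<lambda>n. J \<phi> (s n)) \<longlonglongrightarrow> J \<phi> t"
  unfolding J_def
proof (intro tendsto_minus tendsto_sum)
  fix i assume "i \<in> {..<N}"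
  then have "pd i (pd i \<phi>) \<in> test_functions N D" using \<phi> by (intro test_functions_pd) auto
  then have "integrable M (pd i (pd i \<phi>))" using Lspace_2_integrable[OF finite_measure_M] test_Lspace by blast
  then show "(\<lambda>n. LINT x|M. pd i (pd i \<phi>) x * h (w (s n) x)) \<longlonglongrightarrow> (LINT x|M. pd i (pd i \<phi>) x * h (w t x))"
    using cont_L2_integral_tendsto[OF w_cont s _ h_cont h_bound] by blast
qed

lemma J_bound:
  assumes \<phi>: "\<phi> \<in> test_functions N D" and t: "0 \<le> t"
  shows "\<bar>J \<phi> t\<bar> \<le> (\<Sum>i<N. LINT x|M. K * \<bar>pd i (pd i \<phi>) x\<bar>)"
proof -
  have "\<bar>J \<phi> t\<bar> \<le> (\<Sum>i<N. \<bar>LINT x|M. pd i (pd i \<phi>) x * h (w t x)\<bar>)"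
    unfolding J_def by (simp add: sum_abs)
  also have "\<dots> \<le> (\<Sum>i<N. LINT x|M. K * \<bar>pd i (pd i \<phi>) x\<bar>)"
  proof (rule sum_mono)
    fix i assume "i \<in> {..<N}"
    then have T: "pd i (pd i \<phi>) \<in> test_functions N D" using \<phi> by (intro test_functions_pd) auto
    have z: "integrable M (pd i (pd i \<phi>))" using Lspace_2_integrable[OF finite_measure_M test_Lspace[OF T]] .
    have [measurable]: "w t \<in> borel_measurable M" "h \<in> borel_measurable borel"
      using w_measurable[OF t] borel_measurable_continuous_onI[OF h_cont] by auto
    have le: "norm (pd i (pd i \<phi>) x * h (w t x)) \<le> K * \<bar>pd i (pd i \<phi>) x\<bar>" for x
    proof -
      have "\<bar>h (w t x)\<bar> * \<bar>pd i (pd i \<phi>) x\<bar> \<le> K * \<bar>pd i (pd i \<phi>) x\<bar>" by (intro mult_right_mono h_bound) auto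
      then show ?thesis by (simp add: abs_mult mult.commute)
    qed
    have i: "integrable M (\<lambda>x. pd i (pd i \<phi>) x * h (w t x))"
    proof (rule Bochner_Integration.integrable_bound[of _ "\<lambda>x. K * \<bar>pd i (pd i \<phi>) x\<bar>"])
      show "integrable M (\<lambda>x. K * \<bar>pd i (pd i \<phi>) x\<bar>)" using z by simp
      show "(\<lambda>x. pd i (pd i \<phi>) x * h (w t x)) \<in> borel_measurable M" using borel_measurable_integrable[OF z] by measurable
      show "AE x in M. norm (pd i (pd i \<phi>) x * h (w t x)) \<le> norm (K * \<bar>pd i (pd i \<phi>) x\<bar>)"
        using le order_trans[OF le abs_ge_self] by (intro AE_I2) (simp only: real_norm_def)
    qed
    have "\<bar>LINT x|M. pd i (pd i \<phi>) x * h (w t x)\<bar> \<le> (LINT x|M. norm (pd i (pd i \<phi>) x * h (w t x)))"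
      unfolding real_norm_def[symmetric] by (rule integral_norm_bound)
    also have "\<dots> \<le> (LINT x|M. K * \<bar>pd i (pd i \<phi>) x\<bar>)"
      using i z le by (intro integral_mono) auto
    finally show "\<bar>LINT x|M. pd i (pd i \<phi>) x * h (w t x)\<bar> \<le> (LINT x|M. K * \<bar>pd i (pd i \<phi>) x\<bar>)" .
  qed
  finally show ?thesis .
qed

end

section \<open>Riemann sums and the passage to the energy inequality\<close>

context truncated_difference
begin

text \<open>With n + 1 cells of equal length the last cell ends at \<open>b\<close>. The last
  partition point \<open>c n\<close> has to be a good time, so it is only within one mesh width of
  \<open>b\<close>; continuity of \<open>E\<close> closes the gap.\<close>

lemma partition_sequence:
  obtains c :: "nat \<Rightarrow> real" and \<theta> :: "nat \<Rightarrow> real \<Rightarrow> real" where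
    "\<And>n. c n \<in> {a..b}" "\<And>n. b - (b - a) / real (Suc n) \<le> c n"
    "\<And>n \<tau>. \<tau> \<in> {a<..c n} \<Longrightarrow> good (\<theta> n \<tau>) \<and> \<tau> \<le> \<theta> n \<tau> \<and> \<theta> n \<tau> \<le> \<tau> + 2 * ((b - a) / real (Suc n))"
    "\<And>n Y. (\<And>t. good t \<Longrightarrow> integrable L (\<lambda>\<tau>. Y \<tau> t)) \<Longrightarrow>
       integrable L (\<lambda>\<tau>. indicator {a<..c n} \<tau> * Y \<tau> (\<theta> n \<tau>) :: real)"
    "\<And>n. E (c n) - E a \<le> (LINT \<tau>|L. indicator {a<..c n} \<tau> * (- (dir \<tau> (\<theta> n \<tau>) + low \<tau> (\<theta> n \<tau>))))"
    "\<And>n. (LINT \<tau>|L. indicator {a<..c n} \<tau> * Q (\<theta> n \<tau>)) \<le> 2 * (LINT \<tau>|L. Q \<tau>)"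
proof -
  let ?d = "\<lambda>n. (b - a) / real (Suc n)"
  let ?P = "\<lambda>n c \<theta>. c \<in> {a..b} \<and> b - ?d n \<le> c \<and>
    (\<forall>\<tau>\<in>{a<..c}. good (\<theta> \<tau>) \<and> \<tau> \<le> \<theta> \<tau> \<and> \<theta> \<tau> \<le> \<tau> + 2 * ?d n) \<and>
    (\<forall>Y. (\<forall>t. good t \<longrightarrow> integrable L (\<lambda>\<tau>. Y \<tau> t)) \<longrightarrow> integrable L (\<lambda>\<tau>. indicator {a<..c} \<tau> * Y \<tau> (\<theta> \<tau>) :: real)) \<and>
    E c - E a \<le> (LINT \<tau>|L. indicator {a<..c} \<tau> * (- (dir \<tau> (\<theta> \<tau>) + low \<tau> (\<theta> \<tau>)))) \<and>
    (LINT \<tau>|L. indicator {a<..c} \<tau> * Q (\<theta> \<tau>)) \<le> 2 * (LINT \<tau>|L. Q \<tau>)"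
  have "\<exists>c \<theta>. ?P n c \<theta>" for n
  proof -
    have d: "?d n > 0" "a + real (Suc n) * ?d n = b" using ab by auto
    have "\<exists>c \<theta>. c \<in> {a..b} \<and> c \<le> a + real (Suc n) * ?d n \<and> a + real (Suc n) * ?d n - ?d n \<le> c \<and>
      (\<forall>\<tau>\<in>{a<..c}. good (\<theta> \<tau>) \<and> \<tau> \<le> \<theta> \<tau> \<and> \<theta> \<tau> \<le> c \<and> \<theta> \<tau> \<le> \<tau> + 2 * ?d n) \<and>
      (\<forall>Y. (\<forall>t\<in>{a..b}. good t \<longrightarrow> integrable L (\<lambda>\<tau>. Y \<tau> t)) \<longrightarrow>
          integrable L (\<lambda>\<tau>. indicator {a<..c} \<tau> * Y \<tau> (\<theta> \<tau>) :: real)) \<and>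
      E c - E a \<le> (LINT \<tau>|L. indicator {a<..c} \<tau> * (- (dir \<tau> (\<theta> \<tau>) + low \<tau> (\<theta> \<tau>)))) \<and>
      (LINT \<tau>|L. indicator {a<..c} \<tau> * Q (\<theta> \<tau>)) \<le>
         2 * (LINT \<tau>|L. indicator {a<..a + real (Suc n) * ?d n} \<tau> * Q \<tau>)"
    proof (rule partition_increment[where Z="\<lambda>\<tau> t. - (dir \<tau> t + low \<tau> t)"])
      show "integrable L (\<lambda>\<tau>. - (dir \<tau> t + low \<tau> t))" if "good t" for t
        using dir_low_integrable[OF that] by simp
      show "E t - E s \<le> (LINT \<tau>|L. indicator {s<..t} \<tau> * - (dir \<tau> t + low \<tau> t))"
        if "a \<le> s" "s < t" "t \<le> b" "good t" for s t by (rule E_increment[OF that])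
    qed (use ab Q_integrable Q_nonneg AE_good d in auto)
    then obtain c \<theta> where c: "c \<in> {a..b}" "a + real (Suc n) * ?d n - ?d n \<le> c"
      "\<forall>\<tau>\<in>{a<..c}. good (\<theta> \<tau>) \<and> \<tau> \<le> \<theta> \<tau> \<and> \<theta> \<tau> \<le> c \<and> \<theta> \<tau> \<le> \<tau> + 2 * ?d n"
      "\<forall>Y. (\<forall>t\<in>{a..b}. good t \<longrightarrow> integrable L (\<lambda>\<tau>. Y \<tau> t)) \<longrightarrow>
          integrable L (\<lambda>\<tau>. indicator {a<..c} \<tau> * Y \<tau> (\<theta> \<tau>) :: real)"
      "E c - E a \<le> (LINT \<tau>|L. indicator {a<..c} \<tau> * (- (dir \<tau> (\<theta> \<tau>) + low \<tau> (\<theta> \<tau>))))"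
      "(LINT \<tau>|L. indicator {a<..c} \<tau> * Q (\<theta> \<tau>)) \<le>
         2 * (LINT \<tau>|L. indicator {a<..a + real (Suc n) * ?d n} \<tau> * Q \<tau>)" by blast
    have "(LINT \<tau>|L. indicator {a<..a + real (Suc n) * ?d n} \<tau> * Q \<tau>) \<le> (LINT \<tau>|L. Q \<tau>)"
      by (rule integral_mono[OF Ioc_indicator_integrable[OF Q_integrable] Q_integrable])
        (use Q_nonneg in \<open>auto simp: indicator_def\<close>)
    then have Q2: "(LINT \<tau>|L. indicator {a<..c} \<tau> * Q (\<theta> \<tau>)) \<le> 2 * (LINT \<tau>|L. Q \<tau>)" using c(6) by linarith
    have lo: "b - ?d n \<le> c" using c(2) unfolding d(2) .
    show ?thesis
      by (intro exI[of _ c] exI[of _ \<theta>] conjI c(1) lo Q2 c(5)) (use c(3,4) in blast)+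
  qed
  then have "\<forall>n. \<exists>c \<theta>. ?P n c \<theta>" by (rule allI)
  from choice[OF this] obtain c where "\<forall>n. \<exists>\<theta>. ?P n (c n) \<theta>" by (rule exE)
  from choice[OF this] obtain \<theta> where P: "\<forall>n. ?P n (c n) (\<theta> n)" by (rule exE)
  show thesis
  proof (rule that[of c \<theta>])
    fix n
    note Pn = spec[OF P, of n]
    note Pn2 = conjunct2[OF Pn]
    note Pn5 = conjunct2[OF conjunct2[OF conjunct2[OF Pn2]]]
    show "c n \<in> {a..b}" by (rule conjunct1[OF Pn])
    show "b - (b - a) / real (Suc n) \<le> c n" by (rule conjunct1[OF Pn2])
    show "good (\<theta> n \<tau>) \<and> \<tau> \<le> \<theta> n \<tau> \<and> \<theta> n \<tau> \<le> \<tau> + 2 * ((b - a) / real (Suc n))" if "\<tau> \<in> {a<..c n}" for \<tau>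
      using Pn that by blast
    show "integrable L (\<lambda>\<tau>. indicator {a<..c n} \<tau> * Y \<tau> (\<theta> n \<tau>) :: real)"
      if "\<And>t. good t \<Longrightarrow> integrable L (\<lambda>\<tau>. Y \<tau> t)" for Y using Pn that by blast
    show "E (c n) - E a \<le> (LINT \<tau>|L. indicator {a<..c n} \<tau> * (- (dir \<tau> (\<theta> n \<tau>) + low \<tau> (\<theta> n \<tau>))))"
      by (rule conjunct1[OF Pn5])
    show "(LINT \<tau>|L. indicator {a<..c n} \<tau> * Q (\<theta> n \<tau>)) \<le> 2 * (LINT \<tau>|L. Q \<tau>)" by (rule conjunct2[OF Pn5])
  qed
qed

text \<open>For fixed \<open>\<tau>\<close> the partition point to its right tends to
  \<open>\<tau>\<close>. Hence continuity in the second argument gives pointwise convergence to the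
  diagonal, and a majorant integrable in time gives convergence of the integrals.\<close>

lemma Riemann_limit:
  fixes c :: "nat \<Rightarrow> real" and \<theta> :: "nat \<Rightarrow> real \<Rightarrow> real" and Y :: "real \<Rightarrow> real \<Rightarrow> real"
  assumes c: "\<And>n. c n \<in> {a..b}" "\<And>n. b - (b - a) / real (Suc n) \<le> c n"
    and \<theta>: "\<And>n \<tau>. \<tau> \<in> {a<..c n} \<Longrightarrow> good (\<theta> n \<tau>) \<and> \<tau> \<le> \<theta> n \<tau> \<and> \<theta> n \<tau> \<le> \<tau> + 2 * ((b - a) / real (Suc n))"
    and Yi: "\<And>n. integrable L (\<lambda>\<tau>. indicator {a<..c n} \<tau> * Y \<tau> (\<theta> n \<tau>))"
    and lim: "\<And>\<tau> s. good \<tau> \<Longrightarrow> (\<And>n. 0 \<le> s n) \<Longrightarrow> s \<longlonglongrightarrow> \<tau> \<Longrightarrow> (\<lambda>n. Y \<tau> (s n)) \<longlonglongrightarrow> X \<tau>"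
    and bound: "\<And>\<tau> t. good \<tau> \<Longrightarrow> 0 \<le> t \<Longrightarrow> \<bar>Y \<tau> t\<bar> \<le> G \<tau>" and G: "integrable L G"
  shows "integrable L X" "(\<lambda>n. LINT \<tau>|L. indicator {a<..c n} \<tau> * Y \<tau> (\<theta> n \<tau>)) \<longlonglongrightarrow> (LINT \<tau>|L. X \<tau>)"
proof -
  let ?Y = "\<lambda>n \<tau>. indicator {a<..c n} \<tau> * Y \<tau> (\<theta> n \<tau>)"
  have pt: "AE \<tau> in L. (\<lambda>n. ?Y n \<tau>) \<longlonglongrightarrow> X \<tau>"
    using AE_good AE_lebesgue_on_neq[where a=a and b=b and c=a] AE_lebesgue_on_neq[where a=a and b=b and c=b]
  proof eventually_elim
    case (elim \<tau>)
    then have \<tau>: "a < \<tau>" "\<tau> < b" by (auto simp: good_def)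
    \<comment> \<open>Equals the partition point once \<open>c n\<close> has passed
      \<open>\<tau>\<close>; for the finitely many other n the value \<open>\<tau>\<close> keeps the
      sequence between its bounds.\<close>
    define s where "s n = (if \<tau> \<in> {a<..c n} then \<theta> n \<tau> else \<tau>)" for n
    have d0: "(\<lambda>n. (b - a) / real (Suc n)) \<longlonglongrightarrow> 0"
      using LIMSEQ_Suc[OF lim_const_over_n[of "b - a"]] by simp
    have "s \<longlonglongrightarrow> \<tau>"
    proof (rule tendsto_sandwich[OF _ _ tendsto_const])
      show "(\<lambda>n. \<tau> + 2 * ((b - a) / real (Suc n))) \<longlonglongrightarrow> \<tau>"
        using tendsto_add[OF tendsto_const[of \<tau>] tendsto_mult_right_zero[OF d0, of 2]] by simp
      show "\<forall>\<^sub>F n in sequentially. \<tau> \<le> s n" using \<theta> by (auto simp: s_def)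
      show "\<forall>\<^sub>F n in sequentially. s n \<le> \<tau> + 2 * ((b - a) / real (Suc n))"
        using \<theta> ab by (intro always_eventually allI) (simp add: s_def)
    qed
    moreover have "0 \<le> s n" for n using \<theta>[of \<tau> n] \<tau> ab by (auto simp: s_def)
    ultimately have "(\<lambda>n. Y \<tau> (s n)) \<longlonglongrightarrow> X \<tau>" using lim elim(1) by blast
    moreover have "\<forall>\<^sub>F n in sequentially. Y \<tau> (s n) = ?Y n \<tau>"
    proof -
      have "\<forall>\<^sub>F n in sequentially. (b - a) / real (Suc n) < b - \<tau>"
        by (rule order_tendstoD(2)[OF d0]) (use \<tau> in simp)
      then show ?thesis
      proof eventually_elim
        case (elim n)
        then have "\<tau> \<in> {a<..c n}" using c(2)[of n] \<tau> by simp
        then show ?case by (simp add: s_def)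
      qed
    qed
    ultimately show ?case by (rule Lim_transform_eventually)
  qed
  have Xm: "X \<in> borel_measurable L"
    by (rule borel_measurable_AE_LIMSEQ_lebesgue_on[OF _ borel_measurable_integrable[OF Yi] pt]) simp
  have dom: "AE \<tau> in L. norm (?Y n \<tau>) \<le> G \<tau>" for n
    using AE_good
  proof eventually_elim
    case (elim \<tau>)
    have G0: "0 \<le> G \<tau>" using bound[OF elim, of 0] by simp
    show ?case
    proof (cases "\<tau> \<in> {a<..c n}")
      case True
      then have "0 \<le> \<theta> n \<tau>" using \<theta>[OF True] ab by auto
      then show ?thesis using True bound[OF elim] by simp
    qed (use G0 in auto)
  qed
  show "integrable L X"
    by (rule integrable_dominated_convergence[OF Xm borel_measurable_integrable[OF Yi] G pt dom])
  show "(\<lambda>n. LINT \<tau>|L. ?Y n \<tau>) \<longlonglongrightarrow> (LINT \<tau>|L. X \<tau>)"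
    by (rule integral_dominated_convergence[OF Xm borel_measurable_integrable[OF Yi] G pt dom])
qed

text \<open>Only weak convergence of the gradients of \<^term>\<open>V (\<theta> n \<tau>)\<close> is available. It is enough, since
  \<^term>\<open>u1\<close> and \<^term>\<open>u2\<close> can be replaced by simple functions with values in the test functions, on which
  both derivatives are moved; the error is controlled by the Riemann sums of \<^term>\<open>Q\<close>.\<close>

lemma energy_inequality_approx:
  assumes e: "e > 0"
  shows "integrable L F" "E b - E a \<le> - (LINT \<tau>|L. F \<tau>) + e * (4 + 12 * K\<^sup>2 * (LINT \<tau>|L. Q \<tau>))"
proof -
  obtain c \<theta> where c: "\<And>n. c n \<in> {a..b}" "\<And>n. b - (b - a) / real (Suc n) \<le> c n"
    and \<theta>: "\<And>n \<tau>. \<tau> \<in> {a<..c n} \<Longrightarrow> good (\<theta> n \<tau>) \<and> \<tau> \<le> \<theta> n \<tau> \<and> \<theta> n \<tau> \<le> \<tau> + 2 * ((b - a) / real (Suc n))"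
    and ci: "\<And>n Y. (\<And>t. good t \<Longrightarrow> integrable L (\<lambda>\<tau>. Y \<tau> t)) \<Longrightarrow>
       integrable L (\<lambda>\<tau>. indicator {a<..c n} \<tau> * Y \<tau> (\<theta> n \<tau>) :: real)"
    and cE: "\<And>n. E (c n) - E a \<le> (LINT \<tau>|L. indicator {a<..c n} \<tau> * (- (dir \<tau> (\<theta> n \<tau>) + low \<tau> (\<theta> n \<tau>))))"
    and cQ: "\<And>n. (LINT \<tau>|L. indicator {a<..c n} \<tau> * Q (\<theta> n \<tau>)) \<le> 2 * (LINT \<tau>|L. Q \<tau>)"
    using partition_sequence by blast
  \<comment> \<open>Accuracy e^2 in the squared gradient: divided by \<open>e\<close> in Young's
    inequality it leaves an error of order e.\<close>
  have e2: "e\<^sup>2 > 0" using e by simp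
  obtain s1 G1 where s1: "\<And>\<tau>. s1 \<tau> \<in> test_functions N D" "finite (s1 ` {a..b})"
    "\<And>w. {\<tau> \<in> {a..b}. s1 \<tau> = w} \<in> sets lebesgue"
    and G1: "integrable L G1" "(LINT \<tau>|L. G1 \<tau>) \<le> e\<^sup>2" "AE \<tau> in L. grad_sq (\<lambda>x. u1 \<tau> x - s1 \<tau> x) \<le> G1 \<tau>"
    using solution_simple_approximation[OF sol1 ab e2] by blast
  obtain s2 G2 where s2: "\<And>\<tau>. s2 \<tau> \<in> test_functions N D" "finite (s2 ` {a..b})"
    "\<And>w. {\<tau> \<in> {a..b}. s2 \<tau> = w} \<in> sets lebesgue"
    and G2: "integrable L G2" "(LINT \<tau>|L. G2 \<tau>) \<le> e\<^sup>2" "AE \<tau> in L. grad_sq (\<lambda>x. u2 \<tau> x - s2 \<tau> x) \<le> G2 \<tau>"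
    using solution_simple_approximation[OF sol2 ab e2] by blast
  let ?G = "\<lambda>\<tau>. G1 \<tau> + G2 \<tau>" and ?IQ = "LINT \<tau>|L. Q \<tau>"
  have Gi: "integrable L ?G" using G1 G2 by simp
  have GI: "(LINT \<tau>|L. ?G \<tau>) \<le> 2 * e\<^sup>2" using G1 G2 by simp
  have G0: "AE \<tau> in L. 0 \<le> ?G \<tau>"
    using G1(3) G2(3) by eventually_elim (meson add_nonneg_nonneg grad_sq_nonneg order_trans)
  have low_lim: "integrable L F" "(\<lambda>n. LINT \<tau>|L. indicator {a<..c n} \<tau> * low \<tau> (\<theta> n \<tau>)) \<longlonglongrightarrow> (LINT \<tau>|L. F \<tau>)"
  proof -
    have li: "integrable L (\<lambda>\<tau>. indicator {a<..c n} \<tau> * low \<tau> (\<theta> n \<tau>))" for n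
      by (rule ci) (rule dir_low_integrable(2))
    have ll: "(\<lambda>n. low \<tau> (s n)) \<longlonglongrightarrow> F \<tau>" if g: "good \<tau>" and s: "\<And>n. 0 \<le> s n" "s \<longlonglongrightarrow> \<tau>" for \<tau> s
    proof -
      have \<tau>: "0 \<le> \<tau>" using g ab by (auto simp: good_def)
      show ?thesis
        unfolding F_def low_eq(1)[OF g s(1)]
        by (rule cont_L2_integral_tendsto[OF w_cont s(1) \<tau> s(2) low_eq(2)[OF g \<tau>] h_cont h_bound])
    qed
    show "integrable L F" "(\<lambda>n. LINT \<tau>|L. indicator {a<..c n} \<tau> * low \<tau> (\<theta> n \<tau>)) \<longlonglongrightarrow> (LINT \<tau>|L. F \<tau>)"
      using Riemann_limit[OF c \<theta> li ll low_bound majorant_integrable] by blast+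
  qed
  show "integrable L F" by (rule low_lim(1))
  let ?Y = "\<lambda>\<tau> t. J (s1 \<tau>) t - J (s2 \<tau>) t" and ?R = "\<lambda>\<tau>. J (s1 \<tau>) \<tau> - J (s2 \<tau>) \<tau>"
  have Yi: "integrable L (\<lambda>\<tau>. ?Y \<tau> t)" for t
    using simple_function_integrable_lebesgue_on[OF s1(2,3), of "\<lambda>\<phi>. J \<phi> t"]
      simple_function_integrable_lebesgue_on[OF s2(2,3), of "\<lambda>\<phi>. J \<phi> t"] by simp
  have Yci: "integrable L (\<lambda>\<tau>. indicator {a<..c n} \<tau> * ?Y \<tau> (\<theta> n \<tau>))" for n
    by (rule ci[of ?Y]) (rule Yi)
  have R: "integrable L ?R" "(\<lambda>n. LINT \<tau>|L. indicator {a<..c n} \<tau> * ?Y \<tau> (\<theta> n \<tau>)) \<longlonglongrightarrow> (LINT \<tau>|L. ?R \<tau>)"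
  proof -
    let ?B = "\<lambda>\<phi>. \<Sum>i<N. LINT x|M. K * \<bar>pd i (pd i \<phi>) x\<bar>"
    have lim: "(\<lambda>n. ?Y \<tau> (s n)) \<longlonglongrightarrow> ?R \<tau>" if g: "good \<tau>" and s: "\<And>n. 0 \<le> s n" "s \<longlonglongrightarrow> \<tau>" for \<tau> s
    proof -
      have "0 \<le> \<tau>" using g ab by (auto simp: good_def)
      then show ?thesis using s by (intro tendsto_diff J_tendsto s1(1) s2(1))
    qed
    have bound: "\<bar>?Y \<tau> t\<bar> \<le> ?B (s1 \<tau>) + ?B (s2 \<tau>)" if "good \<tau>" "0 \<le> t" for \<tau> t
      using J_bound[OF s1(1) that(2), of \<tau>] J_bound[OF s2(1) that(2), of \<tau>] by linarith
    have Bi: "integrable L (\<lambda>\<tau>. ?B (s1 \<tau>) + ?B (s2 \<tau>))"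
      by (intro Bochner_Integration.integrable_add simple_function_integrable_lebesgue_on[OF s1(2,3), of ?B]
          simple_function_integrable_lebesgue_on[OF s2(2,3), of ?B])
    show "integrable L ?R" "(\<lambda>n. LINT \<tau>|L. indicator {a<..c n} \<tau> * ?Y \<tau> (\<theta> n \<tau>)) \<longlonglongrightarrow> (LINT \<tau>|L. ?R \<tau>)"
      using Riemann_limit[of c \<theta> ?Y ?R, OF c \<theta> Yci lim bound Bi] by blast+
  qed
  \<comment> \<open>Young's inequality for each of the two solutions with weight \<open>e\<close>;
    the gradient square of the truncation is at most 2 K^2 Q t, and the two solutions together give
    the factor 4.\<close>
  have err: "\<bar>dir \<tau> t - ?Y \<tau> t\<bar> \<le> ?G \<tau> / e + 4 * e * K\<^sup>2 * Q t"
    if g: "good \<tau>" "good t" and l: "grad_sq (\<lambda>x. u1 \<tau> x - s1 \<tau> x) \<le> G1 \<tau>" "grad_sq (\<lambda>x. u2 \<tau> x - s2 \<tau> x) \<le> G2 \<tau>" for \<tau> t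
  proof -
    have V: "V t \<in> H1 N D" using V_truncation(1)[OF g(2)] H10_H1 by blast
    have sH: "s1 \<tau> \<in> H1 N D" "s2 \<tau> \<in> H1 N D" using s1(1) s2(1) test_H1 by auto
    have "dir \<tau> t - ?Y \<tau> t = dirichlet (\<lambda>x. u1 \<tau> x - s1 \<tau> x) (V t) - dirichlet (\<lambda>x. u2 \<tau> x - s2 \<tau> x) (V t)"
      unfolding dir_def J_eq[OF s1(1) g(2)] J_eq[OF s2(1) g(2)]
      using dirichlet_diff_left[OF good_H1(1)[OF g(1)] sH(1) V] dirichlet_diff_left[OF good_H1(2)[OF g(1)] sH(2) V] by simp
    moreover have "\<bar>dirichlet (\<lambda>x. u1 \<tau> x - s1 \<tau> x) (V t)\<bar> \<le> grad_sq (\<lambda>x. u1 \<tau> x - s1 \<tau> x) / e + e * grad_sq (V t)"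
      by (rule dirichlet_Young[OF H1_diff[OF good_H1(1)[OF g(1)] sH(1)] V e])
    moreover have "\<bar>dirichlet (\<lambda>x. u2 \<tau> x - s2 \<tau> x) (V t)\<bar> \<le> grad_sq (\<lambda>x. u2 \<tau> x - s2 \<tau> x) / e + e * grad_sq (V t)"
      by (rule dirichlet_Young[OF H1_diff[OF good_H1(2)[OF g(1)] sH(2)] V e])
    moreover have "e * grad_sq (V t) \<le> 2 * e * K\<^sup>2 * Q t"
      using mult_left_mono[OF V_truncation(3)[OF g(2)], of e] e by (simp add: mult_ac)
    moreover have "grad_sq (\<lambda>x. u1 \<tau> x - s1 \<tau> x) / e + grad_sq (\<lambda>x. u2 \<tau> x - s2 \<tau> x) / e \<le> ?G \<tau> / e"
      using l e by (simp add: divide_right_mono flip: add_divide_distrib)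
    ultimately show ?thesis by linarith
  qed
  \<comment> \<open>This is where the sign of the gradient term enters: on the diagonal
    \<open>dir\<close> is nonnegative, and the replacement by simple functions costs at most the
    error just estimated.\<close>
  have R_lower: "- (2 * e) - 4 * e * K\<^sup>2 * ?IQ \<le> (LINT \<tau>|L. ?R \<tau>)"
  proof -
    have "(LINT \<tau>|L. - (?G \<tau> / e) - 4 * e * K\<^sup>2 * Q \<tau>) \<le> (LINT \<tau>|L. ?R \<tau>)"
    proof (rule integral_mono_AE)
      show "integrable L (\<lambda>\<tau>. - (?G \<tau> / e) - 4 * e * K\<^sup>2 * Q \<tau>)" using Gi Q_integrable by auto
      show "AE \<tau> in L. - (?G \<tau> / e) - 4 * e * K\<^sup>2 * Q \<tau> \<le> ?R \<tau>"
        using AE_good G1(3) G2(3)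
      proof eventually_elim
        case (elim \<tau>)
        then show ?case using err[OF elim(1) elim(1) elim(2,3)] V_truncation(2)[OF elim(1)] by linarith
      qed
    qed (rule R(1))
    also have "(LINT \<tau>|L. - (?G \<tau> / e) - 4 * e * K\<^sup>2 * Q \<tau>) = - ((LINT \<tau>|L. ?G \<tau>) / e) - 4 * e * K\<^sup>2 * ?IQ"
      using Gi Q_integrable by (subst Bochner_Integration.integral_diff) auto
    finally have "- ((LINT \<tau>|L. ?G \<tau>) / e) - 4 * e * K\<^sup>2 * ?IQ \<le> (LINT \<tau>|L. ?R \<tau>)" .
    moreover have "(LINT \<tau>|L. ?G \<tau>) / e \<le> 2 * e"
      using GI e by (simp add: divide_le_eq power2_eq_square)
    ultimately show ?thesis by linarith
  qed
  have step: "E (c n) - E a \<le> - (LINT \<tau>|L. indicator {a<..c n} \<tau> * low \<tau> (\<theta> n \<tau>))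
      - (LINT \<tau>|L. indicator {a<..c n} \<tau> * ?Y \<tau> (\<theta> n \<tau>)) + 2 * e + 8 * e * K\<^sup>2 * ?IQ" for n
  proof -
    let ?i = "indicator {a<..c n} :: real \<Rightarrow> real"
    have di: "integrable L (\<lambda>\<tau>. ?i \<tau> * dir \<tau> (\<theta> n \<tau>))" and li: "integrable L (\<lambda>\<tau>. ?i \<tau> * low \<tau> (\<theta> n \<tau>))"
      by (rule ci, rule dir_low_integrable(1), assumption) (rule ci, rule dir_low_integrable(2))
    have qi: "integrable L (\<lambda>\<tau>. ?i \<tau> * Q (\<theta> n \<tau>))"
      by (rule ci[of "\<lambda>_. Q"]) (rule finite_measure.integrable_const[OF finite_measure_lebesgue_on_Icc])
    have "(LINT \<tau>|L. ?i \<tau> * ?Y \<tau> (\<theta> n \<tau>) - (?i \<tau> * dir \<tau> (\<theta> n \<tau>))) \<le> (LINT \<tau>|L. ?G \<tau> / e + 4 * e * K\<^sup>2 * (?i \<tau> * Q (\<theta> n \<tau>)))"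
    proof (rule integral_mono_AE)
      show "integrable L (\<lambda>\<tau>. ?i \<tau> * ?Y \<tau> (\<theta> n \<tau>) - (?i \<tau> * dir \<tau> (\<theta> n \<tau>)))" using Yci di by (intro Bochner_Integration.integrable_diff)
      show "integrable L (\<lambda>\<tau>. ?G \<tau> / e + 4 * e * K\<^sup>2 * (?i \<tau> * Q (\<theta> n \<tau>)))" using Gi qi by auto
      show "AE \<tau> in L. ?i \<tau> * ?Y \<tau> (\<theta> n \<tau>) - (?i \<tau> * dir \<tau> (\<theta> n \<tau>)) \<le> ?G \<tau> / e + 4 * e * K\<^sup>2 * (?i \<tau> * Q (\<theta> n \<tau>))"
        using AE_good G1(3) G2(3) G0
      proof eventually_elim
        case (elim \<tau>)
        show ?case
        proof (cases "\<tau> \<in> {a<..c n}")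
          case True
          have "good (\<theta> n \<tau>)" using \<theta>[OF True] by blast
          then show ?thesis using True err[OF elim(1) _ elim(2,3), of "\<theta> n \<tau>"] by simp
        next
          case False
          then show ?thesis using elim(4) e by simp
        qed
      qed
    qed
    also have "\<dots> = (LINT \<tau>|L. ?G \<tau>) / e + 4 * e * K\<^sup>2 * (LINT \<tau>|L. ?i \<tau> * Q (\<theta> n \<tau>))"
      using Gi qi by (subst Bochner_Integration.integral_add) auto
    also have "\<dots> \<le> 2 * e + 4 * e * K\<^sup>2 * (2 * ?IQ)"
      using GI cQ[of n] e by (intro add_mono mult_left_mono) (auto simp: divide_le_eq power2_eq_square)
    finally have "(LINT \<tau>|L. ?i \<tau> * ?Y \<tau> (\<theta> n \<tau>)) - (LINT \<tau>|L. ?i \<tau> * dir \<tau> (\<theta> n \<tau>)) \<le> 2 * e + 8 * e * K\<^sup>2 * ?IQ"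
      using Bochner_Integration.integral_diff[OF Yci di] by simp
    moreover have "(LINT \<tau>|L. ?i \<tau> * (- (dir \<tau> (\<theta> n \<tau>) + low \<tau> (\<theta> n \<tau>)))) =
        - (LINT \<tau>|L. ?i \<tau> * dir \<tau> (\<theta> n \<tau>)) - (LINT \<tau>|L. ?i \<tau> * low \<tau> (\<theta> n \<tau>))"
    proof -
      have "(LINT \<tau>|L. ?i \<tau> * (- (dir \<tau> (\<theta> n \<tau>) + low \<tau> (\<theta> n \<tau>)))) =
         (LINT \<tau>|L. - (?i \<tau> * dir \<tau> (\<theta> n \<tau>)) - ?i \<tau> * low \<tau> (\<theta> n \<tau>))"
        by (intro Bochner_Integration.integral_cong refl) (simp add: algebra_simps)
      also have "\<dots> = - (LINT \<tau>|L. ?i \<tau> * dir \<tau> (\<theta> n \<tau>)) - (LINT \<tau>|L. ?i \<tau> * low \<tau> (\<theta> n \<tau>))"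
        using di li by (subst Bochner_Integration.integral_diff) auto
      finally show ?thesis .
    qed
    ultimately show ?thesis using cE[of n] by linarith
  qed
  have "c \<longlonglongrightarrow> b"
  proof (rule tendsto_sandwich[OF _ _ _ tendsto_const])
    have "(\<lambda>n. b - (b - a) / real (Suc n)) \<longlonglongrightarrow> b - 0"
      using LIMSEQ_Suc[OF lim_const_over_n[of "b - a"]] by (intro tendsto_diff tendsto_const)
    then show "(\<lambda>n. b - (b - a) / real (Suc n)) \<longlonglongrightarrow> b" by simp
  qed (use c in \<open>auto intro!: always_eventually\<close>)
  moreover have "0 \<le> c n" for n using c(1)[of n] ab by simp
  ultimately have "(\<lambda>n. E (c n)) \<longlonglongrightarrow> E b"
    unfolding E_def using cont_L2_lipschitz_integral_tendsto[OF w_cont _ _ _ \<Psi>_lip \<Psi>_cont, of c b] ab by simp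
  then have "(\<lambda>n. E (c n) - E a) \<longlonglongrightarrow> E b - E a" by (intro tendsto_diff tendsto_const)
  moreover have "(\<lambda>n. - (LINT \<tau>|L. indicator {a<..c n} \<tau> * low \<tau> (\<theta> n \<tau>))
      - (LINT \<tau>|L. indicator {a<..c n} \<tau> * ?Y \<tau> (\<theta> n \<tau>)) + 2 * e + 8 * e * K\<^sup>2 * ?IQ)
     \<longlonglongrightarrow> - (LINT \<tau>|L. F \<tau>) - (LINT \<tau>|L. ?R \<tau>) + 2 * e + 8 * e * K\<^sup>2 * ?IQ"
    by (intro tendsto_add tendsto_diff tendsto_minus tendsto_const low_lim(2) R(2))
  ultimately have "E b - E a \<le> - (LINT \<tau>|L. F \<tau>) - (LINT \<tau>|L. ?R \<tau>) + 2 * e + 8 * e * K\<^sup>2 * ?IQ"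
    by (rule LIMSEQ_le) (use step in blast)
  \<comment> \<open>The error 2 e + 8 e K^2 comes from the Riemann sums, with the factor 2 in the
    bound for the sums of \<open>Q\<close>, and 2 e + 4 e K^2 from the diagonal; the terms with K^2
    carry the integral of \<open>Q\<close>.\<close>
  then have "E b - E a \<le> - (LINT \<tau>|L. F \<tau>) + 4 * e + 12 * e * K\<^sup>2 * ?IQ" using R_lower by linarith
  then show "E b - E a \<le> - (LINT \<tau>|L. F \<tau>) + e * (4 + 12 * K\<^sup>2 * ?IQ)" by (simp add: algebra_simps)
qed

lemma energy_inequality: "integrable L F" "E b - E a \<le> - (LINT \<tau>|L. F \<tau>)"
proof -
  show "integrable L F" by (rule energy_inequality_approx(1)[OF zero_less_one])
  show "E b - E a \<le> - (LINT \<tau>|L. F \<tau>)"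
  proof (rule field_le_epsilon)
    fix e :: real assume e: "0 < e"
    let ?C = "4 + 12 * K\<^sup>2 * (LINT \<tau>|L. Q \<tau>)"
    have C: "?C > 0" using Q_nonneg by (intro add_pos_nonneg mult_nonneg_nonneg) auto
    then have "e / ?C > 0" using e by simp
    from energy_inequality_approx(2)[OF this] show "E b - E a \<le> - (LINT \<tau>|L. F \<tau>) + e" using C by simp
  qed
qed

end

section \<open>Iteration of the smoothing estimate\<close>

text \<open>Exchange of the order on the triangle 0 <= s <= \<tau> <= T; integrating s^k over
  [0, \<tau>] raises the weight by one power of time.\<close>

lemma Tonelli_triangle:
  fixes g :: "real \<Rightarrow> ennreal"
  assumes [measurable]: "g \<in> borel_measurable borel" and T: "T > 0"
  shows "(\<integral>\<^sup>+s. ennreal (s ^ k) * indicator {0..T} s * (\<integral>\<^sup>+\<tau>. g \<tau> * indicator {s..T} \<tau> \<partial>lborel) \<partial>lborel) =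
    (\<integral>\<^sup>+\<tau>. ennreal (\<tau> ^ Suc k / real (Suc k)) * g \<tau> * indicator {0..T} \<tau> \<partial>lborel)"
proof -
  let ?f = "\<lambda>s \<tau>. ennreal (s ^ k) * (if 0 \<le> s \<and> s \<le> \<tau> \<and> \<tau> \<le> T then g \<tau> else 0)"
  have "(\<integral>\<^sup>+s. ennreal (s ^ k) * indicator {0..T} s * (\<integral>\<^sup>+\<tau>. g \<tau> * indicator {s..T} \<tau> \<partial>lborel) \<partial>lborel) =
     (\<integral>\<^sup>+s. (\<integral>\<^sup>+\<tau>. ?f s \<tau> \<partial>lborel) \<partial>lborel)"
  proof (rule nn_integral_cong)
    fix s :: real
    have "ennreal (s ^ k) * indicator {0..T} s * (\<integral>\<^sup>+\<tau>. g \<tau> * indicator {s..T} \<tau> \<partial>lborel) =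
       (\<integral>\<^sup>+\<tau>. ennreal (s ^ k) * indicator {0..T} s * (g \<tau> * indicator {s..T} \<tau>) \<partial>lborel)"
      by (rule nn_integral_cmult[symmetric]) measurable
    also have "\<dots> = (\<integral>\<^sup>+\<tau>. ?f s \<tau> \<partial>lborel)"
      by (rule nn_integral_cong) (auto simp: indicator_def)
    finally show "ennreal (s ^ k) * indicator {0..T} s * (\<integral>\<^sup>+\<tau>. g \<tau> * indicator {s..T} \<tau> \<partial>lborel) = (\<integral>\<^sup>+\<tau>. ?f s \<tau> \<partial>lborel)" .
  qed
  also have "\<dots> = (\<integral>\<^sup>+\<tau>. (\<integral>\<^sup>+s. ?f s \<tau> \<partial>lborel) \<partial>lborel)"
    by (rule lborel_pair.Fubini') measurable
  also have "\<dots> = (\<integral>\<^sup>+\<tau>. ennreal (\<tau> ^ Suc k / real (Suc k)) * g \<tau> * indicator {0..T} \<tau> \<partial>lborel)"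
  proof (rule nn_integral_cong)
    fix \<tau> :: real
    show "(\<integral>\<^sup>+s. ?f s \<tau> \<partial>lborel) = ennreal (\<tau> ^ Suc k / real (Suc k)) * g \<tau> * indicator {0..T} \<tau>"
    proof (cases "\<tau> \<in> {0..T}")
      case True
      have "(\<integral>\<^sup>+s. ?f s \<tau> \<partial>lborel) = (\<integral>\<^sup>+s. ennreal (s ^ k) * indicator {0..\<tau>} s * g \<tau> \<partial>lborel)"
        using True by (intro nn_integral_cong) (auto simp: indicator_def)
      also have "\<dots> = (\<integral>\<^sup>+s. ennreal (s ^ k) * indicator {0..\<tau>} s \<partial>lborel) * g \<tau>"
        by (rule nn_integral_multc) measurable
      also have "(\<integral>\<^sup>+s. ennreal (s ^ k) * indicator {0..\<tau>} s \<partial>lborel) = ennreal (\<tau> ^ Suc k / real (Suc k) - 0 ^ Suc k / real (Suc k))"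
      proof (rule nn_integral_FTC_Icc)
        fix s :: real
        have "((\<lambda>x. x ^ Suc k / real (Suc k)) has_real_derivative (real (Suc k) * s ^ k) / real (Suc k)) (at s)"
          using DERIV_pow[of "Suc k" s UNIV] by (intro DERIV_cdivide) simp
        then show "((\<lambda>x. x ^ Suc k / real (Suc k)) has_real_derivative s ^ k) (at s)" by simp
      qed (use True in auto)
      finally show ?thesis using True by simp
    next
      case False
      then have "(\<integral>\<^sup>+s. ?f s \<tau> \<partial>lborel) = (\<integral>\<^sup>+s. 0 \<partial>(lborel :: real measure))"
        by (intro nn_integral_cong) auto
      then show ?thesis using False by simp
    qed
  qed
  finally show ?thesis .
qed

lemma ennreal_cmult_le_iff_divide:
  assumes "c > 0" "d \<ge> 0" "ennreal c * X \<le> ennreal d"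
  shows "X \<le> ennreal (d / c)"
proof -
  have "X = ennreal (1 / c) * (ennreal c * X)"
    using assms(1) by (simp add: mult.assoc[symmetric] ennreal_mult[symmetric])
  also have "\<dots> \<le> ennreal (1 / c) * ennreal d" by (rule mult_left_mono[OF assms(3)]) simp
  also have "\<dots> = ennreal (d / c)" using assms by (simp add: ennreal_mult[symmetric])
  finally show ?thesis .
qed

text \<open>The arithmetic progression of exponents of the iteration: index 0 is the L^2 level, and
  for k >= 1 it equals p a_k.\<close>

definition qexp :: "real \<Rightarrow> nat \<Rightarrow> real" where
  "qexp p k = 2 + real k * (p - 2)"

text \<open>At index 0: the L^2 level is at most exp (\<mu> T) y0, and integrating it over a time at
  most T gives the factor 1 + \<mu> T; 2 \<alpha> is the coefficient of the gained term. In the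
  step, with q the exponent of index k + 1, integration against s^k turns the coefficient into q
  \<alpha> / (k + 1), while \<tau>^(k+1) <= T \<tau>^k accounts for the factor 1 + q \<mu> T / (2 (k
  + 1)).\<close>

primrec smoothing_const :: "real \<Rightarrow> real \<Rightarrow> real \<Rightarrow> real \<Rightarrow> nat \<Rightarrow> real" where
  "smoothing_const p \<alpha> \<mu> T 0 = (1 + \<mu> * T) * exp (\<mu> * T) / (2 * \<alpha>)"
| "smoothing_const p \<alpha> \<mu> T (Suc k) =
     (1 + qexp p (Suc k) * \<mu> / 2 * T / real (Suc k)) * smoothing_const p \<alpha> \<mu> T k / (qexp p (Suc k) * \<alpha> / real (Suc k))"

lemma smoothing_const_nonneg:
  assumes "p > 2" "\<alpha> > 0" "\<mu> \<ge> 0" "T > 0"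
  shows "0 \<le> smoothing_const p \<alpha> \<mu> T k"
  using assms by (induction k) (auto simp: qexp_def)

lemma qexp_ge_2: "p > 2 \<Longrightarrow> 2 \<le> qexp p k"
  by (simp add: qexp_def)

lemma qexp_Suc: "qexp p (Suc k) = qexp p k + p - 2"
  by (simp add: qexp_def algebra_simps)

text \<open>\<open>Y q t\<close> stands for the integral of |w(t)|^q, possibly infinite. The
  iteration uses nothing but these scalar inequalities and the bound at q = 2 by the initial
  datum.\<close>

locale smoothing_scale =
  fixes Y :: "real \<Rightarrow> real \<Rightarrow> ennreal" and p \<alpha> \<mu> T y0 :: real
  assumes p: "p > 2" and \<alpha>: "\<alpha> > 0" and \<mu>: "\<mu> \<ge> 0" and T: "T > 0" and y0: "y0 \<ge> 0"
    and Y_measurable: "\<And>q. q \<ge> 2 \<Longrightarrow> Y q \<in> borel_measurable borel"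
    and Y_step: "\<And>q s t. q \<ge> 2 \<Longrightarrow> 0 < s \<Longrightarrow> s < t \<Longrightarrow> t \<le> T \<Longrightarrow>
       Y q t + ennreal (q * \<alpha>) * (\<integral>\<^sup>+\<tau>. Y (q + p - 2) \<tau> * indicator {s..t} \<tau> \<partial>lborel) \<le>
       Y q s + ennreal (q * \<mu> / 2) * (\<integral>\<^sup>+\<tau>. Y q \<tau> * indicator {s..t} \<tau> \<partial>lborel)"
    and Y_base: "\<And>t. 0 < t \<Longrightarrow> t \<le> T \<Longrightarrow> Y 2 t \<le> ennreal (exp (\<mu> * T) * y0)"
begin

abbreviation "A k \<equiv> smoothing_const p \<alpha> \<mu> T k"

lemma A_nonneg: "0 \<le> A k"
  by (rule smoothing_const_nonneg[OF p \<alpha> \<mu> T])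

lemma Y_qexp_measurable[measurable]: "Y (qexp p k) \<in> borel_measurable borel"
  by (rule Y_measurable[OF qexp_ge_2[OF p]])

text \<open>The step inequality starts at positive times only; the integral over [0, T] is the
  supremum of those over [s, T], which are bounded uniformly in s.\<close>

lemma integral_base: "(\<integral>\<^sup>+\<tau>. Y (qexp p 1) \<tau> * indicator {0..T} \<tau> \<partial>lborel) \<le> ennreal (A 0 * y0)"
proof -
  have [measurable]: "Y 2 \<in> borel_measurable borel" by (rule Y_measurable) simp
  let ?B = "exp (\<mu> * T) * y0"
  have q1: "2 + p - 2 = qexp p 1" by (simp add: qexp_def)
  have part: "(\<integral>\<^sup>+\<tau>. Y (qexp p 1) \<tau> * indicator {s..T} \<tau> \<partial>lborel) \<le> ennreal (A 0 * y0)" if s: "0 < s" "s < T" for s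
  proof -
    have "(\<integral>\<^sup>+\<tau>. Y 2 \<tau> * indicator {s..T} \<tau> \<partial>lborel) \<le> (\<integral>\<^sup>+\<tau>. ennreal ?B * indicator {s..T} \<tau> \<partial>lborel)"
      using Y_base s by (intro nn_integral_mono) (auto simp: indicator_def)
    also have "\<dots> = ennreal ?B * ennreal (T - s)"
      using s by (subst nn_integral_cmult_indicator) auto
    also have "\<dots> \<le> ennreal ?B * ennreal T" using s by (intro mult_left_mono ennreal_leI) auto
    finally have I: "(\<integral>\<^sup>+\<tau>. Y 2 \<tau> * indicator {s..T} \<tau> \<partial>lborel) \<le> ennreal (?B * T)"
      using y0 T by (simp add: ennreal_mult)
    have "ennreal (2 * \<alpha>) * (\<integral>\<^sup>+\<tau>. Y (qexp p 1) \<tau> * indicator {s..T} \<tau> \<partial>lborel) \<le>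
       Y 2 T + ennreal (2 * \<alpha>) * (\<integral>\<^sup>+\<tau>. Y (2 + p - 2) \<tau> * indicator {s..T} \<tau> \<partial>lborel)"
      unfolding q1 by simp
    also have "\<dots> \<le> Y 2 s + ennreal (2 * \<mu> / 2) * (\<integral>\<^sup>+\<tau>. Y 2 \<tau> * indicator {s..T} \<tau> \<partial>lborel)"
      by (rule Y_step) (use s in auto)
    also have "\<dots> \<le> ennreal ?B + ennreal (2 * \<mu> / 2) * ennreal (?B * T)"
      using Y_base s I by (intro add_mono mult_left_mono) auto
    also have "\<dots> = ennreal (?B + \<mu> * (?B * T))"
      using \<mu> T y0 by (simp add: ennreal_mult[symmetric] ennreal_plus[symmetric] del: ennreal_plus)
    finally have "(\<integral>\<^sup>+\<tau>. Y (qexp p 1) \<tau> * indicator {s..T} \<tau> \<partial>lborel) \<le> ennreal ((?B + \<mu> * (?B * T)) / (2 * \<alpha>))"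
      using \<alpha> \<mu> T y0 by (intro ennreal_cmult_le_iff_divide) auto
    also have "(?B + \<mu> * (?B * T)) / (2 * \<alpha>) = A 0 * y0" by (simp add: algebra_simps)
    finally show ?thesis .
  qed
  \<comment> \<open>The offset 2 keeps every starting time strictly below T.\<close>
  let ?s = "\<lambda>n. T / real (n + 2)"
  have "(\<integral>\<^sup>+\<tau>. Y (qexp p 1) \<tau> * indicator {0..T} \<tau> \<partial>lborel) = (\<integral>\<^sup>+\<tau>. (SUP n. Y (qexp p 1) \<tau> * indicator {?s n..T} \<tau>) \<partial>lborel)"
  proof (rule nn_integral_cong_AE)
    have "AE \<tau> in lborel. \<tau> \<noteq> (0::real)" by (rule AE_lborel_singleton)
    then show "AE \<tau> in lborel. Y (qexp p 1) \<tau> * indicator {0..T} \<tau> = (SUP n. Y (qexp p 1) \<tau> * indicator {?s n..T} \<tau>)"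
    proof eventually_elim
      case (elim \<tau>)
      show ?case
      proof (cases "\<tau> \<in> {0..T}")
        case True
        then have pos: "\<tau> > 0" using elim by auto
        obtain n where n: "T / \<tau> \<le> real n" using real_arch_simple by blast
        have "T \<le> \<tau> * real n" using n pos by (simp add: divide_le_eq mult.commute)
        also have "\<dots> \<le> \<tau> * real (n + 2)" using pos by (intro mult_left_mono) auto
        finally have "?s n \<le> \<tau>" by (simp add: divide_le_eq mult.commute)
        then have in_n: "\<tau> \<in> {?s n..T}" using True by simp
        show ?thesis
        proof (rule antisym)
          show "Y (qexp p 1) \<tau> * indicator {0..T} \<tau> \<le> (SUP n. Y (qexp p 1) \<tau> * indicator {?s n..T} \<tau>)"
            using True in_n by (intro SUP_upper2[of n]) auto
          show "(SUP n. Y (qexp p 1) \<tau> * indicator {?s n..T} \<tau>) \<le> Y (qexp p 1) \<tau> * indicator {0..T} \<tau>"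
            using True by (intro SUP_least) (auto simp: indicator_def)
        qed
      next
        case False
        have "\<tau> \<notin> {?s n..T}" for n
        proof -
          have "0 \<le> ?s n" using T by simp
          then show ?thesis using False by auto
        qed
        then show ?thesis using False by simp
      qed
    qed
  qed
  also have "\<dots> = (SUP n. (\<integral>\<^sup>+\<tau>. Y (qexp p 1) \<tau> * indicator {?s n..T} \<tau> \<partial>lborel))"
  proof (rule nn_integral_monotone_convergence_SUP)
    show "incseq (\<lambda>n \<tau>. Y (qexp p 1) \<tau> * indicator {?s n..T} \<tau>)"
    proof (rule incseq_SucI, rule le_funI)
      fix n \<tau>
      have "?s (Suc n) \<le> ?s n" using T by (intro divide_left_mono) auto
      then show "Y (qexp p 1) \<tau> * indicator {?s n..T} \<tau> \<le> Y (qexp p 1) \<tau> * indicator {?s (Suc n)..T} \<tau>"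
        by (auto simp: indicator_def)
    qed
  qed measurable
  also have "\<dots> \<le> ennreal (A 0 * y0)"
  proof (rule SUP_least)
    fix n
    have "T < T * real (n + 2)" using T by simp
    then have "?s n < T" by (simp add: divide_less_eq)
    then show "(\<integral>\<^sup>+\<tau>. Y (qexp p 1) \<tau> * indicator {?s n..T} \<tau> \<partial>lborel) \<le> ennreal (A 0 * y0)"
      using T by (intro part) auto
  qed
  finally show ?thesis .
qed

text \<open>The step inequality on [s, T] is multiplied by s^k and integrated over s in [0, T]. By
  Tonelli the gained term on the left acquires the weight \<tau>^(k+1) / (k+1) at the next exponent,
  and everything on the right is controlled by the weighted integral of the induction
  hypothesis.\<close>

lemma weighted_integral_bound:
  "(\<integral>\<^sup>+\<tau>. ennreal (\<tau> ^ k) * Y (qexp p (Suc k)) \<tau> * indicator {0..T} \<tau> \<partial>lborel) \<le> ennreal (A k * y0)"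
proof (induction k)
  case 0
  then show ?case using integral_base by simp
next
  case (Suc k)
  let ?q = "qexp p (Suc k)" and ?K = "real (Suc k)"
  let ?J = "\<integral>\<^sup>+\<tau>. ennreal (\<tau> ^ k) * Y ?q \<tau> * indicator {0..T} \<tau> \<partial>lborel"
  let ?J' = "\<integral>\<^sup>+\<tau>. ennreal (\<tau> ^ Suc k) * Y (qexp p (Suc (Suc k))) \<tau> * indicator {0..T} \<tau> \<partial>lborel"
  let ?g = "Y (qexp p (Suc (Suc k)))"
  have q: "?q \<ge> 2" by (rule qexp_ge_2[OF p])
  have q': "?q + p - 2 = qexp p (Suc (Suc k))" by (simp only: qexp_Suc)
  have weight: "ennreal (\<tau> ^ Suc k / ?K) * X * indicator {0..T} \<tau> = ennreal (1 / ?K) * (ennreal (\<tau> ^ Suc k) * X * indicator {0..T} \<tau>)" for \<tau> X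
    by (cases "\<tau> \<in> {0..T}") (simp_all add: ennreal_mult[symmetric] mult.assoc[symmetric] del: power_Suc)
  have "ennreal (?q * \<alpha> / ?K) * ?J' = ennreal (?q * \<alpha>) * (ennreal (1 / ?K) * ?J')"
    using q \<alpha> by (simp add: mult.assoc[symmetric] ennreal_mult[symmetric])
  also have "ennreal (1 / ?K) * ?J' = (\<integral>\<^sup>+\<tau>. ennreal (\<tau> ^ Suc k / ?K) * ?g \<tau> * indicator {0..T} \<tau> \<partial>lborel)"
    unfolding weight by (rule nn_integral_cmult[symmetric]) measurable
  also have "\<dots> = (\<integral>\<^sup>+s. ennreal (s ^ k) * indicator {0..T} s * (\<integral>\<^sup>+\<tau>. ?g \<tau> * indicator {s..T} \<tau> \<partial>lborel) \<partial>lborel)"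
    by (rule Tonelli_triangle[symmetric]) (use T in auto)
  also have "ennreal (?q * \<alpha>) * \<dots> = (\<integral>\<^sup>+s. ennreal (?q * \<alpha>) * (ennreal (s ^ k) * indicator {0..T} s * (\<integral>\<^sup>+\<tau>. ?g \<tau> * indicator {s..T} \<tau> \<partial>lborel)) \<partial>lborel)"
  proof (rule nn_integral_cmult[symmetric])
    have "(\<lambda>s. \<integral>\<^sup>+\<tau>. ?g \<tau> * indicator {s..T} \<tau> \<partial>lborel) = (\<lambda>s. \<integral>\<^sup>+\<tau>. (if s \<le> \<tau> \<and> \<tau> \<le> T then ?g \<tau> else 0) \<partial>lborel)"
      by (intro ext nn_integral_cong) (auto simp: indicator_def)
    moreover have "\<dots> \<in> borel_measurable lborel" by measurable
    ultimately have [measurable]: "(\<lambda>s. \<integral>\<^sup>+\<tau>. ?g \<tau> * indicator {s..T} \<tau> \<partial>lborel) \<in> borel_measurable borel" by simp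
    show "(\<lambda>s. ennreal (s ^ k) * indicator {0..T} s * (\<integral>\<^sup>+\<tau>. ?g \<tau> * indicator {s..T} \<tau> \<partial>lborel)) \<in> borel_measurable lborel"
      by measurable
  qed
  also have "\<dots> \<le> (\<integral>\<^sup>+s. ennreal (s ^ k) * Y ?q s * indicator {0..T} s +
      ennreal (?q * \<mu> / 2) * (ennreal (s ^ k) * indicator {0..T} s * (\<integral>\<^sup>+\<tau>. Y ?q \<tau> * indicator {s..T} \<tau> \<partial>lborel)) \<partial>lborel)"
  proof (rule nn_integral_mono_AE)
    have "AE s in lborel. s \<noteq> (0::real)" "AE s in lborel. s \<noteq> T" by (rule AE_lborel_singleton)+
    then show "AE s in lborel. ennreal (?q * \<alpha>) * (ennreal (s ^ k) * indicator {0..T} s * (\<integral>\<^sup>+\<tau>. ?g \<tau> * indicator {s..T} \<tau> \<partial>lborel)) \<le>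
      ennreal (s ^ k) * Y ?q s * indicator {0..T} s +
      ennreal (?q * \<mu> / 2) * (ennreal (s ^ k) * indicator {0..T} s * (\<integral>\<^sup>+\<tau>. Y ?q \<tau> * indicator {s..T} \<tau> \<partial>lborel))"
    proof eventually_elim
      case (elim s)
      show ?case
      proof (cases "s \<in> {0..T}")
        case True
        then have s: "0 < s" "s < T" using elim by auto
        let ?I = "\<integral>\<^sup>+\<tau>. ?g \<tau> * indicator {s..T} \<tau> \<partial>lborel" and ?H = "\<integral>\<^sup>+\<tau>. Y ?q \<tau> * indicator {s..T} \<tau> \<partial>lborel"
        have "ennreal (?q * \<alpha>) * ?I \<le> Y ?q T + ennreal (?q * \<alpha>) * (\<integral>\<^sup>+\<tau>. Y (?q + p - 2) \<tau> * indicator {s..T} \<tau> \<partial>lborel)"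
          unfolding q' by simp
        also have "\<dots> \<le> Y ?q s + ennreal (?q * \<mu> / 2) * ?H" by (rule Y_step[OF q s]) simp
        finally have "ennreal (s ^ k) * (ennreal (?q * \<alpha>) * ?I) \<le> ennreal (s ^ k) * (Y ?q s + ennreal (?q * \<mu> / 2) * ?H)"
          by (rule mult_left_mono) simp
        then show ?thesis using True by (simp add: distrib_left mult_ac)
      qed simp
    qed
  qed
  also have "\<dots> = ?J + ennreal (?q * \<mu> / 2) * (\<integral>\<^sup>+s. ennreal (s ^ k) * indicator {0..T} s * (\<integral>\<^sup>+\<tau>. Y ?q \<tau> * indicator {s..T} \<tau> \<partial>lborel) \<partial>lborel)"
  proof -
    have "(\<lambda>s. \<integral>\<^sup>+\<tau>. Y ?q \<tau> * indicator {s..T} \<tau> \<partial>lborel) = (\<lambda>s. \<integral>\<^sup>+\<tau>. (if s \<le> \<tau> \<and> \<tau> \<le> T then Y ?q \<tau> else 0) \<partial>lborel)"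
      by (intro ext nn_integral_cong) (auto simp: indicator_def)
    moreover have "\<dots> \<in> borel_measurable lborel" by measurable
    ultimately have [measurable]: "(\<lambda>s. \<integral>\<^sup>+\<tau>. Y ?q \<tau> * indicator {s..T} \<tau> \<partial>lborel) \<in> borel_measurable borel" by simp
    show ?thesis by (simp add: nn_integral_add nn_integral_cmult)
  qed
  also have "(\<integral>\<^sup>+s. ennreal (s ^ k) * indicator {0..T} s * (\<integral>\<^sup>+\<tau>. Y ?q \<tau> * indicator {s..T} \<tau> \<partial>lborel) \<partial>lborel) =
      (\<integral>\<^sup>+\<tau>. ennreal (\<tau> ^ Suc k / ?K) * Y ?q \<tau> * indicator {0..T} \<tau> \<partial>lborel)"
    by (rule Tonelli_triangle) (use T in auto)
  also have "\<dots> \<le> (\<integral>\<^sup>+\<tau>. ennreal (T / ?K) * (ennreal (\<tau> ^ k) * Y ?q \<tau> * indicator {0..T} \<tau>) \<partial>lborel)"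
  proof (rule nn_integral_mono)
    fix \<tau>
    show "ennreal (\<tau> ^ Suc k / ?K) * Y ?q \<tau> * indicator {0..T} \<tau> \<le> ennreal (T / ?K) * (ennreal (\<tau> ^ k) * Y ?q \<tau> * indicator {0..T} \<tau>)"
    proof (cases "\<tau> \<in> {0..T}")
      case True
      have "\<tau> ^ Suc k / ?K \<le> (T / ?K) * \<tau> ^ k" using True by (simp add: mult_right_mono divide_right_mono)
      then have "ennreal (\<tau> ^ Suc k / ?K) \<le> ennreal (T / ?K) * ennreal (\<tau> ^ k)"
        using True T by (simp add: ennreal_mult[symmetric] ennreal_leI del: power_Suc)
      then have "ennreal (\<tau> ^ Suc k / ?K) * Y ?q \<tau> \<le> ennreal (T / ?K) * ennreal (\<tau> ^ k) * Y ?q \<tau>"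
        by (rule mult_right_mono) simp
      then show ?thesis using True by (simp add: mult.assoc del: power_Suc)
    qed simp
  qed
  also have "\<dots> = ennreal (T / ?K) * ?J" by (rule nn_integral_cmult) measurable
  finally have "ennreal (?q * \<alpha> / ?K) * ?J' \<le> ?J + ennreal (?q * \<mu> / 2) * (ennreal (T / ?K) * ?J)"
    by (simp add: mult_left_mono add_left_mono)
  also have "\<dots> \<le> ennreal (A k * y0) + ennreal (?q * \<mu> / 2) * (ennreal (T / ?K) * ennreal (A k * y0))"
    using Suc.IH by (intro add_mono mult_left_mono) auto
  also have "\<dots> = ennreal (A k * y0 + ?q * \<mu> / 2 * (T / ?K * (A k * y0)))"
    using q \<mu> T y0 A_nonneg[of k] by (simp add: ennreal_mult[symmetric] ennreal_plus[symmetric] del: ennreal_plus)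
  finally have "?J' \<le> ennreal ((A k * y0 + ?q * \<mu> / 2 * (T / ?K * (A k * y0))) / (?q * \<alpha> / ?K))"
    using q \<mu> \<alpha> T y0 A_nonneg[of k] by (intro ennreal_cmult_le_iff_divide) auto
  also have "(A k * y0 + ?q * \<mu> / 2 * (T / ?K * (A k * y0))) / (?q * \<alpha> / ?K) = A (Suc k) * y0"
  proof -
    have "A k * y0 + ?q * \<mu> / 2 * (T / ?K * (A k * y0)) = (1 + ?q * \<mu> / 2 * T / ?K) * A k * y0"
      by (simp add: distrib_right mult.assoc)
    then show ?thesis by simp
  qed
  finally show ?case .
qed

text \<open>The step inequality from s to t is averaged over s in [t/2, t]. There s^k is at least
  (t/2)^k, the interval contributes one more factor t/2, and the right-hand side is controlled by
  the weighted integral.\<close>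

lemma pointwise_bound:
  assumes t: "0 < t" "t \<le> T"
  shows "ennreal ((t / 2) ^ Suc k) * Y (qexp p (Suc k)) t \<le> ennreal ((1 + qexp p (Suc k) * \<mu> / 2 * T) * A k * y0)"
proof -
  let ?q = "qexp p (Suc k)"
  let ?J = "\<integral>\<^sup>+\<tau>. ennreal (\<tau> ^ k) * Y ?q \<tau> * indicator {0..T} \<tau> \<partial>lborel"
  have q: "?q \<ge> 2" by (rule qexp_ge_2[OF p])
  have point: "ennreal ((t / 2) ^ k) * Y ?q t \<le> ennreal (s ^ k) * Y ?q s + ennreal (?q * \<mu> / 2) * ?J" if s: "t / 2 \<le> s" "s < t" for s
  proof -
    have s0: "0 < s" using s t by linarith
    have "Y ?q t \<le> Y ?q t + ennreal (?q * \<alpha>) * (\<integral>\<^sup>+\<tau>. Y (?q + p - 2) \<tau> * indicator {s..t} \<tau> \<partial>lborel)" by simp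
    also have "\<dots> \<le> Y ?q s + ennreal (?q * \<mu> / 2) * (\<integral>\<^sup>+\<tau>. Y ?q \<tau> * indicator {s..t} \<tau> \<partial>lborel)"
      by (rule Y_step[OF q s0 s(2) t(2)])
    finally have "ennreal (s ^ k) * Y ?q t \<le> ennreal (s ^ k) * (Y ?q s + ennreal (?q * \<mu> / 2) * (\<integral>\<^sup>+\<tau>. Y ?q \<tau> * indicator {s..t} \<tau> \<partial>lborel))"
      by (rule mult_left_mono) simp
    also have "\<dots> = ennreal (s ^ k) * Y ?q s + ennreal (?q * \<mu> / 2) * (ennreal (s ^ k) * (\<integral>\<^sup>+\<tau>. Y ?q \<tau> * indicator {s..t} \<tau> \<partial>lborel))"
      by (simp add: distrib_left mult_ac)
    also have "ennreal (s ^ k) * (\<integral>\<^sup>+\<tau>. Y ?q \<tau> * indicator {s..t} \<tau> \<partial>lborel) = (\<integral>\<^sup>+\<tau>. ennreal (s ^ k) * (Y ?q \<tau> * indicator {s..t} \<tau>) \<partial>lborel)"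
      by (rule nn_integral_cmult[symmetric]) measurable
    also have "\<dots> \<le> ?J"
    proof (rule nn_integral_mono)
      fix \<tau>
      show "ennreal (s ^ k) * (Y ?q \<tau> * indicator {s..t} \<tau>) \<le> ennreal (\<tau> ^ k) * Y ?q \<tau> * indicator {0..T} \<tau>"
      proof (cases "\<tau> \<in> {s..t}")
        case True
        then have "ennreal (s ^ k) \<le> ennreal (\<tau> ^ k)" using s0 by (intro ennreal_leI power_mono) auto
        then show ?thesis using True s0 t by (simp add: mult_right_mono)
      qed simp
    qed
    finally have "ennreal (s ^ k) * Y ?q t \<le> ennreal (s ^ k) * Y ?q s + ennreal (?q * \<mu> / 2) * ?J"
      by (simp add: mult_left_mono add_left_mono)
    moreover have "ennreal ((t / 2) ^ k) * Y ?q t \<le> ennreal (s ^ k) * Y ?q t"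
      using s t by (intro mult_right_mono ennreal_leI power_mono) auto
    ultimately show ?thesis by (rule order_trans[rotated])
  qed
  have "ennreal ((t / 2) ^ Suc k) * Y ?q t = (\<integral>\<^sup>+s. (ennreal ((t / 2) ^ k) * Y ?q t) * indicator {t / 2..t} s \<partial>lborel)"
  proof -
    have "ennreal ((t / 2) ^ Suc k) = ennreal ((t / 2) ^ k) * ennreal (t / 2)"
      using t by (simp add: ennreal_mult[symmetric] mult.commute)
    then show ?thesis using t by (subst nn_integral_cmult_indicator) (auto simp: mult_ac)
  qed
  also have "\<dots> \<le> (\<integral>\<^sup>+s. ennreal (s ^ k) * Y ?q s * indicator {0..T} s + (ennreal (?q * \<mu> / 2) * ?J) * indicator {0..T} s \<partial>lborel)"
  proof (rule nn_integral_mono_AE)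
    have "AE s in lborel. s \<noteq> t" by (rule AE_lborel_singleton)
    then show "AE s in lborel. (ennreal ((t / 2) ^ k) * Y ?q t) * indicator {t / 2..t} s \<le>
        ennreal (s ^ k) * Y ?q s * indicator {0..T} s + (ennreal (?q * \<mu> / 2) * ?J) * indicator {0..T} s"
    proof eventually_elim
      case (elim s)
      show ?case using point[of s] elim t by (cases "s \<in> {t / 2..t}") auto
    qed
  qed
  also have "\<dots> = ?J + (ennreal (?q * \<mu> / 2) * ?J) * ennreal T"
    using T by (subst nn_integral_add) (auto simp: nn_integral_cmult_indicator)
  also have "\<dots> \<le> ennreal (A k * y0) + (ennreal (?q * \<mu> / 2) * ennreal (A k * y0)) * ennreal T"
    using weighted_integral_bound[of k] by (intro add_mono mult_right_mono mult_left_mono) auto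
  also have "\<dots> = ennreal (A k * y0 + ?q * \<mu> / 2 * (A k * y0) * T)"
    using q \<mu> T y0 A_nonneg[of k] by (simp add: ennreal_mult[symmetric] ennreal_plus[symmetric] del: ennreal_plus)
  also have "A k * y0 + ?q * \<mu> / 2 * (A k * y0) * T = (1 + ?q * \<mu> / 2 * T) * A k * y0"
    by (simp add: algebra_simps)
  finally show ?thesis .
qed

end

section \<open>Energy inequalities for powers of the difference\<close>

lemma nn_integral_lebesgue_on_Icc:
  "(\<integral>\<^sup>+\<tau>. G \<tau> \<partial>lebesgue_on {a..b::real}) = (\<integral>\<^sup>+\<tau>. G \<tau> * indicator {a..b} \<tau> \<partial>lborel)"
proof -
  have "(\<integral>\<^sup>+\<tau>. G \<tau> \<partial>lebesgue_on {a..b}) = (\<integral>\<^sup>+\<tau>. G \<tau> * indicator {a..b} \<tau> \<partial>lebesgue)"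
    by (rule nn_integral_restrict_space) simp
  then show ?thesis by (simp add: nn_integral_completion)
qed

text \<open>Superadditivity of the lower limit, so that Fatou's lemma can be used for both terms on
  the left of the energy inequality at once.\<close>

lemma ennreal_liminf_add_le:
  fixes X Z :: "nat \<Rightarrow> ennreal"
  assumes "x \<le> liminf X" "z \<le> liminf Z" "\<And>n. X n + Z n \<le> C"
  shows "x + z \<le> C"
proof -
  let ?x = "\<lambda>n. INF m\<in>{n..}. X m" and ?z = "\<lambda>n. INF m\<in>{n..}. Z m"
  have inc: "incseq ?x" "incseq ?z" by (auto intro!: incseq_SucI INF_superset_mono)
  have "x + z \<le> (SUP n. ?x n) + (SUP n. ?z n)"
    using assms(1,2) unfolding liminf_SUP_INF by (rule add_mono)
  also have "\<dots> = (SUP n. ?x n + ?z n)" by (rule ennreal_SUP_add[OF inc, symmetric])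
  also have "\<dots> \<le> C"
  proof (rule SUP_least)
    fix n
    have "?x n + ?z n \<le> X n + Z n" by (intro add_mono INF_lower) auto
    then show "?x n + ?z n \<le> C" using assms(3)[of n] by (rule order_trans)
  qed
  finally show ?thesis .
qed

lemma ennreal_cmult_liminf_le:
  fixes X :: "nat \<Rightarrow> ennreal"
  shows "c * liminf X \<le> liminf (\<lambda>n. c * X n)"
  unfolding liminf_SUP_INF SUP_mult_left_ennreal
proof (rule SUP_mono)
  fix n :: nat
  have "c * (INF m\<in>{n..}. X m) \<le> (INF m\<in>{n..}. c * X m)"
    by (intro INF_greatest mult_left_mono INF_lower) auto
  then show "\<exists>m\<in>UNIV. c * (INF m\<in>{n..}. X m) \<le> (INF n\<in>{m..}. c * X n)" by blast
qed

lemma liminf_eq_lim_ennreal: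
  fixes r :: real
  assumes "X \<longlonglongrightarrow> r"
  shows "liminf (\<lambda>n. ennreal (X n)) = ennreal r"
  by (intro lim_imp_Liminf tendsto_ennrealI assms) simp

text \<open>The integral inequality is known between positive times; the exponential bound from s to
  t is derived first and then s tends to 0, where \<open>y\<close> is continuous.\<close>

lemma Gronwall_from_0:
  fixes y :: "real \<Rightarrow> real"
  assumes c: "continuous_on {0..} y" and \<mu>: "\<mu> \<ge> 0"
    and le: "\<And>s t. 0 < s \<Longrightarrow> s < t \<Longrightarrow> y t \<le> y s + \<mu> * integral {s..t} y"
    and t: "t > 0"
  shows "y t \<le> exp (\<mu> * t) * y 0"
proof -
  have step: "y t \<le> exp (\<mu> * (t - s)) * y s" if s: "0 < s" "s < t" for s
  proof -
    have cs: "continuous_on {s..t} y" using c by (rule continuous_on_subset) (use s in auto)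
    define z where "z r = y s + \<mu> * integral {s..r} y" for r
    \<comment> \<open>\<open>z\<close> is the right-hand side of the inequality: its derivative is
      \<mu> y, which is at most \<mu> z, so with the integrating factor \<open>k\<close> is
      nonincreasing.\<close>
    define k where "k r = exp (- \<mu> * (r - s)) * z r" for r
    have dz: "(z has_real_derivative \<mu> * y r) (at r within {s..t})" if "r \<in> {s..t}" for r
      unfolding z_def using integral_has_real_derivative[OF cs that]
      by (auto intro!: derivative_eq_intros)
    have dk: "(k has_real_derivative exp (- \<mu> * (r - s)) * (\<mu> * (y r - z r))) (at r within {s..t})" if "r \<in> {s..t}" for r
    proof -
      have "((\<lambda>r. exp (- \<mu> * (r - s))) has_real_derivative exp (- \<mu> * (r - s)) * (- \<mu>)) (at r within {s..t})"
        by (auto intro!: derivative_eq_intros)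
      from DERIV_mult[OF this dz[OF that]] show ?thesis
        unfolding k_def by (simp add: algebra_simps)
    qed
    have yz: "y r \<le> z r" if "r \<in> {s<..t}" for r using le[of s r] that s by (simp add: z_def)
    have "k t \<le> k s"
    proof (rule DERIV_nonpos_imp_decreasing_open[of s t k])
      show "s \<le> t" using s by simp
      show "continuous_on {s..t} k"
        by (rule DERIV_continuous_on[OF dk])
      fix r assume r: "s < r" "r < t"
      have "(k has_real_derivative exp (- \<mu> * (r - s)) * (\<mu> * (y r - z r))) (at r)"
        using dk[of r] r by (simp add: at_within_Icc_at)
      moreover have "exp (- \<mu> * (r - s)) * (\<mu> * (y r - z r)) \<le> 0"
        using yz[of r] r \<mu> by (intro mult_nonneg_nonpos) auto
      ultimately show "\<exists>d. (k has_real_derivative d) (at r) \<and> d \<le> 0" by blast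
    qed
    then have "exp (- \<mu> * (t - s)) * z t \<le> y s" by (simp add: k_def z_def)
    then have "exp (\<mu> * (t - s)) * (exp (- \<mu> * (t - s)) * z t) \<le> exp (\<mu> * (t - s)) * y s"
      by (rule mult_left_mono) simp
    then have "z t \<le> exp (\<mu> * (t - s)) * y s"
      by (simp add: mult.assoc[symmetric] exp_add[symmetric])
    then show ?thesis using yz[of t] s by simp
  qed
  let ?s = "\<lambda>n. t / real (Suc (Suc n))"
  have s0: "?s \<longlonglongrightarrow> 0" using LIMSEQ_Suc[OF LIMSEQ_Suc[OF lim_const_over_n[of t]]] by simp
  have "(\<lambda>n. y (?s n)) \<longlonglongrightarrow> y 0"
    by (rule continuous_on_tendsto_compose[OF c s0]) (use t in auto)
  then have "(\<lambda>n. exp (\<mu> * (t - ?s n)) * y (?s n)) \<longlonglongrightarrow> exp (\<mu> * (t - 0)) * y 0"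
    using s0 by (intro tendsto_intros)
  moreover have "y t \<le> exp (\<mu> * (t - ?s n)) * y (?s n)" for n
    by (rule step) (use t in \<open>auto simp: divide_less_eq\<close>)
  ultimately have "y t \<le> exp (\<mu> * (t - 0)) * y 0"
    by (intro LIMSEQ_le_const) auto
  then show ?thesis by simp
qed

context reaction_diffusion
begin

text \<open>Since h(w) has the sign of w, the monotonicity inequality may be multiplied by the
  nonnegative quotient h(w)/w. The pairing of the lower order terms with h(w), increased by \<mu>/2
  times the integral of |w| |h(w)|, then dominates \<alpha> times that of |w|^(p-1) |h(w)|.\<close>

lemma truncated_energy:
  fixes \<alpha> l \<mu> :: real and h h' \<Psi> :: "real \<Rightarrow> real"
  assumes sol: "solution u01 u1" "solution u02 u2" and ab: "0 < a" "a < b"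
    and h: "smooth h" "\<And>s. (h has_real_derivative h' s) (at s)" "\<And>s. 0 \<le> h' s" "\<And>s. h' s \<le> K"
      "\<And>s. \<bar>h s\<bar> \<le> K" "\<And>s. 0 \<le> h s * s" "h 0 = 0"
    and \<Psi>: "\<And>s. (\<Psi> has_real_derivative h s) (at s)" "\<And>s. 0 \<le> \<Psi> s"
    and mono: "\<And>r s. \<alpha> * \<bar>r - s\<bar> powr p - l * (r - s)\<^sup>2 \<le> (f r - f s) * (r - s)"
    and const: "\<alpha> > 0" "\<mu> \<ge> 0" "l - lam \<le> \<mu> / 2"
  shows "(\<integral>\<^sup>+x. ennreal (\<Psi> (u1 b x - u2 b x)) \<partial>M) +
      ennreal \<alpha> * (\<integral>\<^sup>+\<tau>. (\<integral>\<^sup>+x. ennreal (\<bar>u1 \<tau> x - u2 \<tau> x\<bar> powr (p - 1) * \<bar>h (u1 \<tau> x - u2 \<tau> x)\<bar>) \<partial>M) \<partial>lebesgue_on {a..b})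
    \<le> (\<integral>\<^sup>+x. ennreal (\<Psi> (u1 a x - u2 a x)) \<partial>M) +
      ennreal (\<mu> / 2) * (\<integral>\<^sup>+\<tau>. (\<integral>\<^sup>+x. ennreal (\<bar>u1 \<tau> x - u2 \<tau> x\<bar> * \<bar>h (u1 \<tau> x - u2 \<tau> x)\<bar>) \<partial>M) \<partial>lebesgue_on {a..b})"
proof -
  interpret T: truncated_difference N D p lam \<sigma> f g u01 u02 u1 u2 h h' \<Psi> K a b
    by unfold_locales (fact sol h \<Psi> ab)+
  define w where "w = T.w"
  have w: "u1 t x - u2 t x = w t x" for t x by (simp add: w_def T.w_def)
  have w_cont: "w \<in> cont_L2 M" unfolding w_def by (rule T.w_cont)
  let ?A = "\<lambda>\<tau>. \<integral>\<^sup>+x. ennreal (\<bar>w \<tau> x\<bar> powr (p - 1) * \<bar>h (w \<tau> x)\<bar>) \<partial>M"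
  let ?B = "\<lambda>\<tau>. \<integral>\<^sup>+x. ennreal (\<bar>w \<tau> x\<bar> * \<bar>h (w \<tau> x)\<bar>) \<partial>M"
  have hc: "continuous_on UNIV h" by (rule T.h_cont)
  have Am: "?A \<in> borel_measurable (lebesgue_on {a..b})"
    by (rule cont_L2_nn_integral_measurable[OF w_cont, of "\<lambda>s. \<bar>s\<bar> powr (p - 1) * \<bar>h s\<bar>"])
      (use p_gt_2 ab hc in \<open>auto intro!: continuous_intros continuous_on_powr'\<close>)
  have Bm: "?B \<in> borel_measurable (lebesgue_on {a..b})"
    by (rule cont_L2_nn_integral_measurable[OF w_cont, of "\<lambda>s. \<bar>s\<bar> * \<bar>h s\<bar>"])
      (use ab hc in \<open>auto intro!: continuous_intros\<close>)
  have hb[measurable]: "h \<in> borel_measurable borel" using hc by (rule borel_measurable_continuous_onI)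
  have E: "(\<integral>\<^sup>+x. ennreal (\<Psi> (w t x)) \<partial>M) = ennreal (T.E t)" if "0 \<le> t" for t
    unfolding T.E_def w_def
    by (rule nn_integral_eq_integral[OF lipschitz_comp_integrable[OF cont_L2_Lspace[OF T.w_cont that] T.\<Psi>_lip T.\<Psi>_cont]])
      (use \<Psi>(2) in auto)
  have E0: "0 \<le> T.E t" for t unfolding T.E_def using \<Psi>(2) by (intro Bochner_Integration.integral_nonneg)
  show ?thesis
    unfolding w
  \<comment> \<open>If the last integral is infinite and \<mu> > 0 the bound is trivial. For \<mu> =
    0 that term is 0 also when the integral is infinite, by the convention for extended
    products.\<close>
  proof (cases "(\<integral>\<^sup>+\<tau>. ?B \<tau> \<partial>lebesgue_on {a..b}) = \<infinity> \<and> \<mu> > 0")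
    case True
    then show "(\<integral>\<^sup>+x. ennreal (\<Psi> (w b x)) \<partial>M) + ennreal \<alpha> * (\<integral>\<^sup>+\<tau>. ?A \<tau> \<partial>lebesgue_on {a..b})
      \<le> (\<integral>\<^sup>+x. ennreal (\<Psi> (w a x)) \<partial>M) + ennreal (\<mu> / 2) * (\<integral>\<^sup>+\<tau>. ?B \<tau> \<partial>lebesgue_on {a..b})"
      by (simp add: ennreal_mult_top)
  next
    case False
    \<comment> \<open>Real-valued version of the last term. It agrees with the extended one almost
      everywhere, since the inner integral is finite at almost every time or the coefficient is
      0.\<close>
    define c where "c \<tau> = \<mu> / 2 * enn2real (?B \<tau>)" for \<tau>
    have c_eq: "AE \<tau> in lebesgue_on {a..b}. ennreal (c \<tau>) = ennreal (\<mu> / 2) * ?B \<tau> \<and> T.good \<tau> \<and> (\<mu> > 0 \<longrightarrow> ?B \<tau> \<noteq> \<infinity>)"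
    proof (cases "\<mu> > 0")
      case True
      then have "(\<integral>\<^sup>+\<tau>. ?B \<tau> \<partial>lebesgue_on {a..b}) \<noteq> \<infinity>" using False by blast
      then have "AE \<tau> in lebesgue_on {a..b}. ?B \<tau> \<noteq> \<infinity>" by (rule nn_integral_PInf_AE[OF Bm])
      then show ?thesis using T.AE_good
      proof eventually_elim
        case (elim \<tau>)
        have "ennreal (c \<tau>) = ennreal (\<mu> / 2) * ennreal (enn2real (?B \<tau>))"
          unfolding c_def using const(2) by (intro ennreal_mult) auto
        also have "ennreal (enn2real (?B \<tau>)) = ?B \<tau>"
          using elim(1) by (intro ennreal_enn2real) (simp only: less_top infinity_ennreal_def)
        finally show ?case using elim by blast
      qed
    next
      case False
      then have "\<mu> = 0" using const(2) by simp
      show ?thesis using T.AE_good by eventually_elim (simp add: c_def \<open>\<mu> = 0\<close>)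
    qed
    have c0: "0 \<le> c \<tau>" for \<tau> unfolding c_def using const(2) by simp
    have cm: "c \<in> borel_measurable (lebesgue_on {a..b})" unfolding c_def using Bm by measurable
    have cI: "(\<integral>\<^sup>+\<tau>. ennreal (c \<tau>) \<partial>lebesgue_on {a..b}) = ennreal (\<mu> / 2) * (\<integral>\<^sup>+\<tau>. ?B \<tau> \<partial>lebesgue_on {a..b})"
    proof -
      have "(\<integral>\<^sup>+\<tau>. ennreal (c \<tau>) \<partial>lebesgue_on {a..b}) = (\<integral>\<^sup>+\<tau>. ennreal (\<mu> / 2) * ?B \<tau> \<partial>lebesgue_on {a..b})"
        using c_eq by (intro nn_integral_cong_AE) (auto elim!: eventually_mono)
      then show ?thesis using nn_integral_cmult[OF Bm] by simp
    qed
    have "(\<integral>\<^sup>+\<tau>. ennreal (c \<tau>) \<partial>lebesgue_on {a..b}) < \<infinity>"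
      unfolding cI using False const(2) by (cases "\<mu> > 0") (auto simp: ennreal_mult_less_top less_top)
    then have ci: "integrable (lebesgue_on {a..b}) c"
      using cm c0 by (simp add: integrable_iff_bounded)
    have key: "AE \<tau> in lebesgue_on {a..b}. ennreal \<alpha> * ?A \<tau> \<le> ennreal (T.F \<tau> + c \<tau>) \<and> 0 \<le> T.F \<tau> + c \<tau>"
      using c_eq AE_space
    proof eventually_elim
      case (elim \<tau>)
      have good: "T.good \<tau>" using elim by blast
      have \<tau>0: "0 \<le> \<tau>" using good ab by (auto simp: T.good_def)
      have [measurable]: "w \<tau> \<in> borel_measurable M" using cont_L2_measurable[OF w_cont \<tau>0] .
      have Fi: "integrable M (\<lambda>x. T.\<zeta> \<tau> x * h (w \<tau> x))"
      proof (rule Bochner_Integration.integrable_bound[of _ "\<lambda>x. K * T.\<zeta> \<tau> x"])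
        show "integrable M (\<lambda>x. K * T.\<zeta> \<tau> x)" using T.low_eq(2)[OF good \<tau>0] by simp
        show "(\<lambda>x. T.\<zeta> \<tau> x * h (w \<tau> x)) \<in> borel_measurable M"
          using borel_measurable_integrable[OF T.low_eq(2)[OF good \<tau>0]] by measurable
        show "AE x in M. norm (T.\<zeta> \<tau> x * h (w \<tau> x)) \<le> norm (K * T.\<zeta> \<tau> x)"
        proof (rule AE_I2)
          fix x
          have "\<bar>h (w \<tau> x)\<bar> * \<bar>T.\<zeta> \<tau> x\<bar> \<le> K * \<bar>T.\<zeta> \<tau> x\<bar>" by (intro mult_right_mono h(5)) auto
          then show "norm (T.\<zeta> \<tau> x * h (w \<tau> x)) \<le> norm (K * T.\<zeta> \<tau> x)"
            using T.K_nonneg by (simp add: abs_mult mult.commute)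
        qed
      qed
      have Bi: "integrable M (\<lambda>x. \<bar>w \<tau> x\<bar> * \<bar>h (w \<tau> x)\<bar>)"
      proof (rule Bochner_Integration.integrable_bound[of _ "\<lambda>x. K * w \<tau> x"])
        show "integrable M (\<lambda>x. K * w \<tau> x)"
          using Lspace_2_integrable[OF finite_measure_M cont_L2_Lspace[OF w_cont \<tau>0]] by simp
        show "AE x in M. norm (\<bar>w \<tau> x\<bar> * \<bar>h (w \<tau> x)\<bar>) \<le> norm (K * w \<tau> x)"
        proof (rule AE_I2)
          fix x
          have "\<bar>h (w \<tau> x)\<bar> * \<bar>w \<tau> x\<bar> \<le> K * \<bar>w \<tau> x\<bar>" by (intro mult_right_mono h(5)) auto
          then show "norm (\<bar>w \<tau> x\<bar> * \<bar>h (w \<tau> x)\<bar>) \<le> norm (K * w \<tau> x)"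
            using T.K_nonneg by (simp add: abs_mult mult.commute)
        qed
      qed measurable
      have B_eq: "?B \<tau> = ennreal (LINT x|M. \<bar>w \<tau> x\<bar> * \<bar>h (w \<tau> x)\<bar>)"
        by (rule nn_integral_eq_integral[OF Bi]) simp
      then have c_val: "c \<tau> = (LINT x|M. \<mu> / 2 * (\<bar>w \<tau> x\<bar> * \<bar>h (w \<tau> x)\<bar>))"
        by (simp add: c_def)
      have pw: "\<alpha> * (\<bar>w \<tau> x\<bar> powr (p - 1) * \<bar>h (w \<tau> x)\<bar>) \<le> T.\<zeta> \<tau> x * h (w \<tau> x) + \<mu> / 2 * (\<bar>w \<tau> x\<bar> * \<bar>h (w \<tau> x)\<bar>)" for x
      proof -
        let ?v = "w \<tau> x" and ?d = "f (u1 \<tau> x) - f (u2 \<tau> x)"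
        have m: "\<alpha> * \<bar>?v\<bar> powr p - l * ?v\<^sup>2 \<le> ?d * ?v" using mono[of "u1 \<tau> x" "u2 \<tau> x"] by (simp add: w)
        show ?thesis
        proof (cases "?v = 0")
          case True then show ?thesis using h(7) by simp
        next
          case False
          \<comment> \<open>The quotient h(v)/v, nonnegative because h(v) v is; multiplying the
            inequality for \<open>f\<close> by it replaces one factor v by h(v).\<close>
          define H where "H = \<bar>h ?v\<bar> / \<bar>?v\<bar>"
          have H: "0 \<le> H" by (simp add: H_def)
          have hv: "h ?v = H * ?v"
            using h(6)[of ?v] False unfolding H_def by (cases "?v > 0") (auto simp: zero_le_mult_iff abs_if field_simps)
          have pp: "\<bar>?v\<bar> powr p = \<bar>?v\<bar> powr (p - 1) * \<bar>?v\<bar>" using False by (simp add: powr_diff)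
          have "\<alpha> * (\<bar>?v\<bar> powr (p - 1) * \<bar>h ?v\<bar>) = H * (\<alpha> * \<bar>?v\<bar> powr p)"
            using H unfolding pp hv by (simp add: abs_mult)
          also have "\<dots> \<le> H * (?d * ?v + l * ?v\<^sup>2)" using m H by (intro mult_left_mono) auto
          also have "\<dots> \<le> H * (?d * ?v + (lam + \<mu> / 2) * ?v\<^sup>2)" using const(3) H by (intro mult_left_mono add_left_mono mult_right_mono) auto
          also have "\<dots> = T.\<zeta> \<tau> x * h ?v + \<mu> / 2 * (\<bar>?v\<bar> * \<bar>h ?v\<bar>)"
            using H unfolding T.\<zeta>_def hv w_def[symmetric] by (simp add: abs_mult power2_eq_square algebra_simps)
          finally show ?thesis .
        qed
      qed
      have Fc: "T.F \<tau> + c \<tau> = (LINT x|M. T.\<zeta> \<tau> x * h (w \<tau> x) + \<mu> / 2 * (\<bar>w \<tau> x\<bar> * \<bar>h (w \<tau> x)\<bar>))"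
        unfolding T.F_def c_val w_def[symmetric] using Fi Bi by simp
      have nn: "0 \<le> T.\<zeta> \<tau> x * h (w \<tau> x) + \<mu> / 2 * (\<bar>w \<tau> x\<bar> * \<bar>h (w \<tau> x)\<bar>)" for x
        using pw[of x] const(1) by (intro order_trans[OF _ pw]) auto
      have "ennreal \<alpha> * ?A \<tau> = (\<integral>\<^sup>+x. ennreal (\<alpha> * (\<bar>w \<tau> x\<bar> powr (p - 1) * \<bar>h (w \<tau> x)\<bar>)) \<partial>M)"
        using const(1) by (subst nn_integral_cmult[symmetric]) (auto simp: ennreal_mult)
      also have "\<dots> \<le> (\<integral>\<^sup>+x. ennreal (T.\<zeta> \<tau> x * h (w \<tau> x) + \<mu> / 2 * (\<bar>w \<tau> x\<bar> * \<bar>h (w \<tau> x)\<bar>)) \<partial>M)"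
        using pw by (intro nn_integral_mono ennreal_leI)
      also have "\<dots> = ennreal (T.F \<tau> + c \<tau>)"
        unfolding Fc using Fi Bi nn by (intro nn_integral_eq_integral) auto
      finally have "ennreal \<alpha> * ?A \<tau> \<le> ennreal (T.F \<tau> + c \<tau>)" .
      moreover have "0 \<le> T.F \<tau> + c \<tau>" unfolding Fc using nn by (intro Bochner_Integration.integral_nonneg)
      ultimately show ?case by blast
    qed
    note energy = T.energy_inequality
    have Fci: "integrable (lebesgue_on {a..b}) (\<lambda>\<tau>. T.F \<tau> + c \<tau>)" using energy(1) ci by simp
    have Fc0: "AE \<tau> in lebesgue_on {a..b}. 0 \<le> T.F \<tau> + c \<tau>" using key by eventually_elim blast
    have "ennreal \<alpha> * (\<integral>\<^sup>+\<tau>. ?A \<tau> \<partial>lebesgue_on {a..b}) = (\<integral>\<^sup>+\<tau>. ennreal \<alpha> * ?A \<tau> \<partial>lebesgue_on {a..b})"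
      by (rule nn_integral_cmult[OF Am, symmetric])
    also have "\<dots> \<le> (\<integral>\<^sup>+\<tau>. ennreal (T.F \<tau> + c \<tau>) \<partial>lebesgue_on {a..b})"
      using key by (intro nn_integral_mono_AE) (auto elim!: eventually_mono)
    also have "\<dots> = ennreal (LINT \<tau>|lebesgue_on {a..b}. T.F \<tau> + c \<tau>)"
      by (rule nn_integral_eq_integral[OF Fci Fc0])
    finally have "ennreal (T.E b) + ennreal \<alpha> * (\<integral>\<^sup>+\<tau>. ?A \<tau> \<partial>lebesgue_on {a..b}) \<le> ennreal (T.E b) + ennreal (LINT \<tau>|lebesgue_on {a..b}. T.F \<tau> + c \<tau>)"
      by (rule add_left_mono)
    also have "\<dots> = ennreal (T.E b + (LINT \<tau>|lebesgue_on {a..b}. T.F \<tau> + c \<tau>))"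
      using E0 Fc0 integral_nonneg_AE[OF Fc0] by (simp add: ennreal_plus)
    \<comment> \<open>The energy inequality with the integral of \<open>c\<close> added on both
      sides: the integrand left of the inequality is now nonnegative, which the extended integral
      needs.\<close>
    also have "\<dots> \<le> ennreal (T.E a + (LINT \<tau>|lebesgue_on {a..b}. c \<tau>))"
      using energy ci by (intro ennreal_leI) simp
    also have "\<dots> = ennreal (T.E a) + (\<integral>\<^sup>+\<tau>. ennreal (c \<tau>) \<partial>lebesgue_on {a..b})"
      using E0 c0 by (subst nn_integral_eq_integral[OF ci]) (auto simp: ennreal_plus intro!: Bochner_Integration.integral_nonneg)
    also have "\<dots> = ennreal (T.E a) + ennreal (\<mu> / 2) * (\<integral>\<^sup>+\<tau>. ?B \<tau> \<partial>lebesgue_on {a..b})" by (simp only: cI)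
    finally show "(\<integral>\<^sup>+x. ennreal (\<Psi> (w b x)) \<partial>M) + ennreal \<alpha> * (\<integral>\<^sup>+\<tau>. ?A \<tau> \<partial>lebesgue_on {a..b})
      \<le> (\<integral>\<^sup>+x. ennreal (\<Psi> (w a x)) \<partial>M) + ennreal (\<mu> / 2) * (\<integral>\<^sup>+\<tau>. ?B \<tau> \<partial>lebesgue_on {a..b})"
      using E[of a] E[of b] ab by simp
  qed
qed

text \<open>Fatou's lemma on the left and \<^term>\<open>\<bar>\<Phi> n s\<bar> \<le> \<bar>s\<bar> powr (q - 1)\<close> on the right; none of the integrals is
  assumed to be finite.\<close>

lemma power_energy:
  fixes \<alpha> l \<mu> q :: real
  assumes sol: "solution u01 u1" "solution u02 u2" and ab: "0 < a" "a < b"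
    and mono: "\<And>r s. \<alpha> * \<bar>r - s\<bar> powr p - l * (r - s)\<^sup>2 \<le> (f r - f s) * (r - s)"
    and const: "\<alpha> > 0" "\<mu> \<ge> 0" "l - lam \<le> \<mu> / 2" and q: "q \<ge> 2"
  defines "Y \<equiv> \<lambda>q t. \<integral>\<^sup>+x. ennreal (\<bar>u1 t x - u2 t x\<bar> powr q) \<partial>M"
  shows "Y q b + ennreal (q * \<alpha>) * (\<integral>\<^sup>+\<tau>. Y (q + p - 2) \<tau> \<partial>lebesgue_on {a..b})
    \<le> Y q a + ennreal (q * \<mu> / 2) * (\<integral>\<^sup>+\<tau>. Y q \<tau> \<partial>lebesgue_on {a..b})"
proof -
  obtain \<Phi> \<Psi> \<phi> :: "nat \<Rightarrow> real \<Rightarrow> real" and K :: "nat \<Rightarrow> real" where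
    \<Phi>: "\<And>n. smooth (\<Phi> n)" "\<And>n s. (\<Phi> n has_real_derivative \<phi> n s) (at s)" "\<And>n s. 0 \<le> \<phi> n s"
      "\<And>n s. \<phi> n s \<le> K n" "\<And>n s. \<bar>\<Phi> n s\<bar> \<le> K n" "\<And>n s. 0 \<le> \<Phi> n s * s"
      "\<And>n s. (\<Psi> n has_real_derivative \<Phi> n s) (at s)" "\<And>n s. 0 \<le> \<Psi> n s"
    and \<Phi>_le: "\<And>n s. \<bar>\<Phi> n s\<bar> \<le> \<bar>s\<bar> powr (q - 1)" and \<Psi>_le: "\<And>n s. \<Psi> n s \<le> \<bar>s\<bar> powr q / q"
    and \<Phi>_lim: "\<And>s. (\<lambda>n. \<bar>\<Phi> n s\<bar>) \<longlonglongrightarrow> \<bar>s\<bar> powr (q - 1)" and \<Psi>_lim: "\<And>s. (\<lambda>n. \<Psi> n s) \<longlonglongrightarrow> \<bar>s\<bar> powr q / q"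
    by (rule smooth_power_approximation[OF q], rule that, assumption+)
  have \<Phi>0: "\<Phi> n 0 = 0" for n using \<Phi>_le[of n 0] by simp
  define w where "w t x = u1 t x - u2 t x" for t x
  have w_cont: "w \<in> cont_L2 M"
  proof -
    have "(\<lambda>t x. u1 t x - u2 t x) \<in> cont_L2 M" by (intro cont_L2_diff solution_cont[OF sol(1)] solution_cont[OF sol(2)])
    then show ?thesis unfolding w_def[abs_def] .
  qed
  have wm: "w t \<in> borel_measurable M" if "0 \<le> t" for t using cont_L2_measurable[OF w_cont that] .
  have Y: "Y r t = (\<integral>\<^sup>+x. ennreal (\<bar>w t x\<bar> powr r) \<partial>M)" for r t by (simp add: Y_def w_def)
  have \<Phi>c: "continuous_on UNIV (\<Phi> n)" for n by (rule smooth_continuous_on[OF \<Phi>(1)])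
  have \<Psi>c: "continuous_on UNIV (\<Psi> n)" for n
    using \<Phi>(7) DERIV_isCont continuous_at_imp_continuous_on by blast
  have [measurable]: "\<Phi> n \<in> borel_measurable borel" "\<Psi> n \<in> borel_measurable borel" for n
    using borel_measurable_continuous_onI \<Phi>c \<Psi>c by blast+
  let ?L = "lebesgue_on {a..b}"
  let ?A = "\<lambda>n \<tau>. \<integral>\<^sup>+x. ennreal (\<bar>w \<tau> x\<bar> powr (p - 1) * \<bar>\<Phi> n (w \<tau> x)\<bar>) \<partial>M"
  have Am: "?A n \<in> borel_measurable ?L" for n
    by (rule cont_L2_nn_integral_measurable[OF w_cont, of "\<lambda>s. \<bar>s\<bar> powr (p - 1) * \<bar>\<Phi> n s\<bar>"])
      (use p_gt_2 ab \<Phi>c in \<open>auto intro!: continuous_intros continuous_on_powr'\<close>)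
  have Ym: "Y r \<in> borel_measurable ?L" if "r > 0" for r
    unfolding Y
    by (rule cont_L2_nn_integral_measurable[OF w_cont, of "\<lambda>s. \<bar>s\<bar> powr r"])
      (use that ab in \<open>auto intro!: continuous_intros continuous_on_powr'\<close>)
  have Yq: "(\<integral>\<^sup>+x. ennreal (\<bar>w t x\<bar> powr q / q) \<partial>M) = ennreal (1 / q) * Y q t" if "0 \<le> t" for t
  proof -
    have [measurable]: "w t \<in> borel_measurable M" by (rule wm[OF that])
    have "(\<integral>\<^sup>+x. ennreal (\<bar>w t x\<bar> powr q / q) \<partial>M) = (\<integral>\<^sup>+x. ennreal (1 / q) * ennreal (\<bar>w t x\<bar> powr q) \<partial>M)"
      using q by (intro nn_integral_cong) (simp add: ennreal_mult[symmetric])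
    then show ?thesis unfolding Y by (simp add: nn_integral_cmult)
  qed
  \<comment> \<open>The right-hand side is bounded independently of n, so lower limits on the left
    are admissible.\<close>
  have le: "(\<integral>\<^sup>+x. ennreal (\<Psi> n (w b x)) \<partial>M) + ennreal \<alpha> * (\<integral>\<^sup>+\<tau>. ?A n \<tau> \<partial>?L) \<le>
      ennreal (1 / q) * Y q a + ennreal (\<mu> / 2) * (\<integral>\<^sup>+\<tau>. Y q \<tau> \<partial>?L)" for n
  proof -
    have "(\<integral>\<^sup>+x. ennreal (\<Psi> n (w b x)) \<partial>M) + ennreal \<alpha> * (\<integral>\<^sup>+\<tau>. ?A n \<tau> \<partial>?L) \<le>
      (\<integral>\<^sup>+x. ennreal (\<Psi> n (w a x)) \<partial>M) + ennreal (\<mu> / 2) * (\<integral>\<^sup>+\<tau>. (\<integral>\<^sup>+x. ennreal (\<bar>w \<tau> x\<bar> * \<bar>\<Phi> n (w \<tau> x)\<bar>) \<partial>M) \<partial>?L)"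
      unfolding w_def
      by (rule truncated_energy[OF sol ab \<Phi>(1-6) \<Phi>0 \<Phi>(7,8) mono const])
    also have "\<dots> \<le> (\<integral>\<^sup>+x. ennreal (\<bar>w a x\<bar> powr q / q) \<partial>M) + ennreal (\<mu> / 2) * (\<integral>\<^sup>+\<tau>. Y q \<tau> \<partial>?L)"
    proof (intro add_mono mult_left_mono nn_integral_mono ennreal_leI \<Psi>_le)
      fix \<tau>
      show "(\<integral>\<^sup>+x. ennreal (\<bar>w \<tau> x\<bar> * \<bar>\<Phi> n (w \<tau> x)\<bar>) \<partial>M) \<le> Y q \<tau>"
        unfolding Y
      proof (intro nn_integral_mono ennreal_leI)
        fix x
        have "\<bar>w \<tau> x\<bar> * \<bar>\<Phi> n (w \<tau> x)\<bar> \<le> \<bar>w \<tau> x\<bar> * \<bar>w \<tau> x\<bar> powr (q - 1)" by (intro mult_left_mono \<Phi>_le) auto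
        also have "\<dots> = \<bar>w \<tau> x\<bar> powr q" by (cases "w \<tau> x = 0") (simp_all add: powr_diff)
        finally show "\<bar>w \<tau> x\<bar> * \<bar>\<Phi> n (w \<tau> x)\<bar> \<le> \<bar>w \<tau> x\<bar> powr q" .
      qed
    qed auto
    finally show ?thesis using Yq[of a] ab by simp
  qed
  have "ennreal (1 / q) * Y q b + ennreal \<alpha> * (\<integral>\<^sup>+\<tau>. Y (q + p - 2) \<tau> \<partial>?L) \<le>
      ennreal (1 / q) * Y q a + ennreal (\<mu> / 2) * (\<integral>\<^sup>+\<tau>. Y q \<tau> \<partial>?L)"
  proof (rule ennreal_liminf_add_le[OF _ _ le])
    have [measurable]: "w b \<in> borel_measurable M" using wm ab by simp
    have "ennreal (1 / q) * Y q b = (\<integral>\<^sup>+x. liminf (\<lambda>n. ennreal (\<Psi> n (w b x))) \<partial>M)"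
      using Yq[of b] ab liminf_eq_lim_ennreal[OF \<Psi>_lim] by simp
    also have "\<dots> \<le> liminf (\<lambda>n. \<integral>\<^sup>+x. ennreal (\<Psi> n (w b x)) \<partial>M)"
      by (rule nn_integral_liminf) measurable
    finally show "ennreal (1 / q) * Y q b \<le> liminf (\<lambda>n. \<integral>\<^sup>+x. ennreal (\<Psi> n (w b x)) \<partial>M)" .
    have inner: "Y (q + p - 2) \<tau> \<le> liminf (\<lambda>n. ?A n \<tau>)" if \<tau>: "\<tau> \<in> space ?L" for \<tau>
    proof -
      have [measurable]: "w \<tau> \<in> borel_measurable M" using wm \<tau> ab by simp
      have "Y (q + p - 2) \<tau> = (\<integral>\<^sup>+x. liminf (\<lambda>n. ennreal (\<bar>w \<tau> x\<bar> powr (p - 1) * \<bar>\<Phi> n (w \<tau> x)\<bar>)) \<partial>M)"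
        unfolding Y
      proof (rule nn_integral_cong)
        fix x
        have "(\<lambda>n. \<bar>w \<tau> x\<bar> powr (p - 1) * \<bar>\<Phi> n (w \<tau> x)\<bar>) \<longlonglongrightarrow> \<bar>w \<tau> x\<bar> powr (p - 1) * \<bar>w \<tau> x\<bar> powr (q - 1)"
          by (intro tendsto_mult_left \<Phi>_lim)
        also have "\<bar>w \<tau> x\<bar> powr (p - 1) * \<bar>w \<tau> x\<bar> powr (q - 1) = \<bar>w \<tau> x\<bar> powr (q + p - 2)"
          by (simp add: powr_add[symmetric] algebra_simps)
        finally show "ennreal (\<bar>w \<tau> x\<bar> powr (q + p - 2)) = liminf (\<lambda>n. ennreal (\<bar>w \<tau> x\<bar> powr (p - 1) * \<bar>\<Phi> n (w \<tau> x)\<bar>))"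
          by (rule liminf_eq_lim_ennreal[symmetric])
      qed
      also have "\<dots> \<le> liminf (\<lambda>n. ?A n \<tau>)" by (rule nn_integral_liminf) measurable
      finally show ?thesis .
    qed
    have "ennreal \<alpha> * (\<integral>\<^sup>+\<tau>. Y (q + p - 2) \<tau> \<partial>?L) = (\<integral>\<^sup>+\<tau>. ennreal \<alpha> * Y (q + p - 2) \<tau> \<partial>?L)"
      by (rule nn_integral_cmult[symmetric]) (rule Ym, use q p_gt_2 in simp)
    also have "\<dots> \<le> (\<integral>\<^sup>+\<tau>. liminf (\<lambda>n. ennreal \<alpha> * ?A n \<tau>) \<partial>?L)"
    proof (rule nn_integral_mono)
      fix \<tau> assume \<tau>: "\<tau> \<in> space ?L"
      have "ennreal \<alpha> * Y (q + p - 2) \<tau> \<le> ennreal \<alpha> * liminf (\<lambda>n. ?A n \<tau>)"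
        by (intro mult_left_mono inner \<tau>) simp
      also have "\<dots> \<le> liminf (\<lambda>n. ennreal \<alpha> * ?A n \<tau>)" by (rule ennreal_cmult_liminf_le)
      finally show "ennreal \<alpha> * Y (q + p - 2) \<tau> \<le> liminf (\<lambda>n. ennreal \<alpha> * ?A n \<tau>)" .
    qed
    also have "\<dots> \<le> liminf (\<lambda>n. \<integral>\<^sup>+\<tau>. ennreal \<alpha> * ?A n \<tau> \<partial>?L)"
      by (intro nn_integral_liminf borel_measurable_times_ennreal borel_measurable_const Am)
    also have "(\<lambda>n. \<integral>\<^sup>+\<tau>. ennreal \<alpha> * ?A n \<tau> \<partial>?L) = (\<lambda>n. ennreal \<alpha> * (\<integral>\<^sup>+\<tau>. ?A n \<tau> \<partial>?L))"
      using Am by (intro ext nn_integral_cmult)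
    finally show "ennreal \<alpha> * (\<integral>\<^sup>+\<tau>. Y (q + p - 2) \<tau> \<partial>?L) \<le> liminf (\<lambda>n. ennreal \<alpha> * (\<integral>\<^sup>+\<tau>. ?A n \<tau> \<partial>?L))" .
  qed
  \<comment> \<open>The limit of \<open>\<Psi> n\<close> carries the factor 1/q; clearing it
    produces the coefficients q \<alpha> and q \<mu> / 2.\<close>
  then have "ennreal q * (ennreal (1 / q) * Y q b + ennreal \<alpha> * (\<integral>\<^sup>+\<tau>. Y (q + p - 2) \<tau> \<partial>?L)) \<le>
      ennreal q * (ennreal (1 / q) * Y q a + ennreal (\<mu> / 2) * (\<integral>\<^sup>+\<tau>. Y q \<tau> \<partial>?L))"
    by (rule mult_left_mono) simp
  moreover have "ennreal q * (ennreal (1 / q) * X + ennreal c * Z) = X + ennreal (q * c) * Z" if "c \<ge> 0" for X Z c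
    using q that by (simp add: distrib_left mult.assoc[symmetric] ennreal_mult[symmetric])
  ultimately show ?thesis using const by simp
qed

end

section \<open>The smoothing estimate\<close>

lemma C1_differentiable_has_deriv:
  fixes f :: "real \<Rightarrow> real"
  assumes "f C1_differentiable_on UNIV"
  shows "(f has_real_derivative deriv f s) (at s)"
proof -
  obtain d where "(f has_vector_derivative d s) (at s)"
    using assms unfolding C1_differentiable_on_def by blast
  then have "(f has_real_derivative d s) (at s)"
    by (simp add: has_real_derivative_iff_has_vector_derivative)
  then show ?thesis using DERIV_imp_deriv by metis
qed

text \<open>The derivative of \<open>f2\<close> is at least - l2, so f2 s + l2 s is nondecreasing,
  while \<open>f1\<close> supplies the power. This inequality is all that the iteration learns about
  the nonlinearity, which explains the dependence of the constants on \<alpha>1 and, through \<mu>,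
  on l2 - lam.\<close>

lemma decomposition_monotone:
  assumes p: "p > 2" and dec: "decomposition p \<alpha>1 \<sigma>1 l2 \<kappa>2 \<alpha>2 \<beta>2 \<sigma>2 f f1 f2"
  shows "\<alpha>1 * \<bar>r - s\<bar> powr p - l2 * (r - s)\<^sup>2 \<le> (f r - f s) * (r - s)"
proof -
  have f: "\<And>s. f s = f1 s + f2 s" and m: "monotone_part_conditions p \<alpha>1 \<sigma>1 f1"
    and g: "growth_conditions p l2 \<kappa>2 \<alpha>2 \<beta>2 \<sigma>2 f2" using dec by (auto simp: decomposition_def)
  have f2: "(f2 has_real_derivative deriv f2 s) (at s)" for s
    using g by (intro C1_differentiable_has_deriv) (simp add: growth_conditions_def)
  have d2: "- l2 \<le> deriv f2 s" for s
  proof -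
    have "\<kappa>2 * \<bar>s\<bar> powr (p - 2) - l2 \<le> deriv f2 s" "0 < \<kappa>2" using g by (auto simp: growth_conditions_def)
    moreover have "0 \<le> \<kappa>2 * \<bar>s\<bar> powr (p - 2)" using \<open>0 < \<kappa>2\<close> by simp
    ultimately show ?thesis by linarith
  qed
  let ?h = "\<lambda>s. f2 s + l2 * s"
  have dh: "(?h has_real_derivative deriv f2 s + l2) (at s)" for s
    by (auto intro!: derivative_eq_intros f2)
  have mono: "?h r \<le> ?h s" if "r \<le> s" for r s
  proof (rule DERIV_nonneg_imp_nondecreasing[OF that])
    fix x
    have "0 \<le> deriv f2 x + l2" using d2[of x] by linarith
    then show "\<exists>y. (?h has_real_derivative y) (at x) \<and> 0 \<le> y" using dh by blast
  qed
  have "0 \<le> (?h r - ?h s) * (r - s)"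
    using mono[of r s] mono[of s r] by (cases "r \<le> s") (auto intro: mult_nonneg_nonneg mult_nonpos_nonpos)
  then have "- l2 * (r - s)\<^sup>2 \<le> (f2 r - f2 s) * (r - s)" by (simp add: power2_eq_square algebra_simps)
  moreover have "\<alpha>1 * \<bar>r - s\<bar> powr p \<le> (f1 r - f1 s) * (r - s)"
    using m by (simp add: monotone_part_conditions_def)
  moreover have "(f r - f s) * (r - s) = (f1 r - f1 s) * (r - s) + (f2 r - f2 s) * (r - s)"
    unfolding f by (simp add: algebra_simps)
  ultimately show ?thesis by linarith
qed

lemma reaction_diffusion_intro:
  assumes "p > 2" "bounded_smooth_domain N D" "g \<in> Lspace (leb N D) 2" "growth_conditions p l \<kappa> \<alpha> \<beta> \<sigma> f"
  shows "reaction_diffusion N D p \<sigma> f g"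
proof
  show "openin (RN N) D" "\<exists>R. \<forall>x\<in>D. \<forall>i<N. \<bar>x i\<bar> \<le> R" using assms(2) by (auto simp: bounded_smooth_domain_def)
  show "continuous_on UNIV f"
    using assms(4) C1_differentiable_imp_continuous_on by (auto simp: growth_conditions_def)
qed (use assms in \<open>auto simp: growth_conditions_def\<close>)

context reaction_diffusion
begin

text \<open>The power energy inequality with q = 2: the gained term is dropped and Gronwall's lemma
  applies, because the squared L^2 norm is finite and continuous up to time 0.\<close>

lemma L2_contraction:
  fixes \<alpha> l \<mu> :: real
  assumes sol: "weak_solution N D p lam f g u01 u1" "weak_solution N D p lam f g u02 u2"
    and mono: "\<And>r s. \<alpha> * \<bar>r - s\<bar> powr p - l * (r - s)\<^sup>2 \<le> (f r - f s) * (r - s)"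
    and const: "\<alpha> > 0" "\<mu> \<ge> 0" "l - lam \<le> \<mu> / 2" and t: "t > 0"
  shows "(\<integral>\<^sup>+x. ennreal (\<bar>u1 t x - u2 t x\<bar> powr 2) \<partial>M) \<le> ennreal (exp (\<mu> * t) * (Lnorm M 2 (\<lambda>x. u1 0 x - u2 0 x))\<^sup>2)"
proof -
  define w where "w t x = u1 t x - u2 t x" for t x
  have w_cont: "w \<in> cont_L2 M"
  proof -
    have "(\<lambda>t x. u1 t x - u2 t x) \<in> cont_L2 M" by (intro cont_L2_diff solution_cont[OF sol(1)] solution_cont[OF sol(2)])
    then show ?thesis unfolding w_def[abs_def] .
  qed
  define y where "y t = (Lnorm M 2 (w t))\<^sup>2" for t
  have wL: "w t \<in> Lspace M 2" if "0 \<le> t" for t by (rule cont_L2_Lspace[OF w_cont that])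
  have Y: "(\<integral>\<^sup>+x. ennreal (\<bar>u1 t x - u2 t x\<bar> powr 2) \<partial>M) = ennreal (y t)" if "0 \<le> t" for t
  proof -
    have "(\<integral>\<^sup>+x. ennreal (\<bar>w t x\<bar> powr 2) \<partial>M) = (\<integral>\<^sup>+x. ennreal ((w t x)\<^sup>2) \<partial>M)"
      by (intro nn_integral_cong) (simp add: powr_numeral)
    also have "\<dots> = ennreal (y t)"
      unfolding y_def Lnorm_2_power2 using wL[OF that] by (intro nn_integral_eq_integral) (auto simp: Lspace_2_iff)
    finally show ?thesis by (simp add: w_def)
  qed
  have y0: "0 \<le> y t" for t by (simp add: y_def)
  have Lc: "continuous_on {0..} (\<lambda>t. Lnorm M 2 (w t))"
  proof (rule continuous_on_sequentiallyI)
    fix s :: "nat \<Rightarrow> real" and r assume s: "\<forall>n. s n \<in> {0..}" "r \<in> {0..}" "s \<longlonglongrightarrow> r"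
    have lim: "(\<lambda>n. Lnorm M 2 (\<lambda>x. w r x - w (s n) x)) \<longlonglongrightarrow> 0"
      using cont_L2_sequentially[OF w_cont, of s r] s by simp
    have "(\<lambda>n. Lnorm M 2 (w r) - Lnorm M 2 (w (s n))) \<longlonglongrightarrow> 0"
    proof (rule Lim_null_comparison[OF always_eventually lim], rule allI)
      fix n
      have L: "w r \<in> Lspace M 2" "w (s n) \<in> Lspace M 2" using s by (auto intro: wL)
      have "Lnorm M 2 (w r) \<le> Lnorm M 2 (\<lambda>x. w r x - w (s n) x) + Lnorm M 2 (w (s n))"
        using Lnorm_2_triangle[OF Lspace_2_diff[OF L] L(2)] by simp
      moreover have "Lnorm M 2 (w (s n)) \<le> Lnorm M 2 (\<lambda>x. w (s n) x - w r x) + Lnorm M 2 (w r)"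
        using Lnorm_2_triangle[OF Lspace_2_diff[OF L(2,1)] L(1)] by simp
      ultimately show "norm (Lnorm M 2 (w r) - Lnorm M 2 (w (s n))) \<le> Lnorm M 2 (\<lambda>x. w r x - w (s n) x)"
        using Lnorm_2_diff_commute[of M "w r" "w (s n)"] by (simp add: abs_le_iff)
    qed
    then show "(\<lambda>n. Lnorm M 2 (w (s n))) \<longlonglongrightarrow> Lnorm M 2 (w r)"
      using tendsto_diff[OF tendsto_const[of "Lnorm M 2 (w r)"]] by fastforce
  qed
  have yc: "continuous_on {0..} y" unfolding y_def by (intro continuous_intros Lc)
  have "y t \<le> exp (\<mu> * t) * y 0"
  proof (rule Gronwall_from_0[OF yc const(2) _ t])
    fix s r :: real assume sr: "0 < s" "s < r"
    have ci: "continuous_on {s..r} y" using yc by (rule continuous_on_subset) (use sr in auto)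
    have yi: "integrable (lebesgue_on {s..r}) y" by (rule continuous_imp_integrable_real[OF ci])
    have int: "(\<integral>\<^sup>+\<tau>. (\<integral>\<^sup>+x. ennreal (\<bar>u1 \<tau> x - u2 \<tau> x\<bar> powr 2) \<partial>M) \<partial>lebesgue_on {s..r}) = ennreal (integral {s..r} y)"
    proof -
      have "(\<integral>\<^sup>+\<tau>. (\<integral>\<^sup>+x. ennreal (\<bar>u1 \<tau> x - u2 \<tau> x\<bar> powr 2) \<partial>M) \<partial>lebesgue_on {s..r}) = (\<integral>\<^sup>+\<tau>. ennreal (y \<tau>) \<partial>lebesgue_on {s..r})"
        using sr by (intro nn_integral_cong Y) simp
      also have "\<dots> = ennreal (LINT \<tau>|lebesgue_on {s..r}. y \<tau>)" using y0 by (intro nn_integral_eq_integral yi) auto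
      also have "(LINT \<tau>|lebesgue_on {s..r}. y \<tau>) = integral {s..r} y"
        by (rule lebesgue_integral_eq_integral[OF yi]) simp
      finally show ?thesis .
    qed
    have "ennreal (y r) \<le> ennreal (y s) + ennreal (2 * \<mu> / 2) * ennreal (integral {s..r} y)"
    proof -
      have "ennreal (y r) \<le> ennreal (y r) + ennreal (2 * \<alpha>) * (\<integral>\<^sup>+\<tau>. (\<integral>\<^sup>+x. ennreal (\<bar>u1 \<tau> x - u2 \<tau> x\<bar> powr (2 + p - 2)) \<partial>M) \<partial>lebesgue_on {s..r})" by simp
      also have "\<dots> \<le> ennreal (y s) + ennreal (2 * \<mu> / 2) * ennreal (integral {s..r} y)"
        using power_energy[OF sol sr mono const order_refl] Y[of r] Y[of s] sr unfolding int by simp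
      finally show ?thesis .
    qed
    also have "\<dots> = ennreal (y s + \<mu> * integral {s..r} y)"
    proof -
      have "0 \<le> integral {s..r} y" using y0 by (intro Henstock_Kurzweil_Integration.integral_nonneg integrable_continuous_real ci) auto
      then show ?thesis using y0[of s] const(2) by (simp add: ennreal_mult[symmetric] ennreal_plus[symmetric] del: ennreal_plus)
    qed
    finally have le: "ennreal (y r) \<le> ennreal (y s + \<mu> * integral {s..r} y)" .
    show "y r \<le> y s + \<mu> * integral {s..r} y"
    proof -
      have "0 \<le> integral {s..r} y" using y0 by (intro Henstock_Kurzweil_Integration.integral_nonneg integrable_continuous_real ci) auto
      then have "0 \<le> y s + \<mu> * integral {s..r} y" using y0[of s] const(2) by simp
      then show ?thesis using le by (simp add: ennreal_le_iff)
    qed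
  qed
  then show ?thesis using Y[of t] t unfolding y_def w_def[symmetric] by (simp add: w_def[abs_def] ennreal_leI)
qed

text \<open>Hands the difference of two solutions over to the scalar iteration.
  \<open>max 0 t\<close> provides Borel functions on the whole line and changes nothing at the times
  that occur; \<open>u1 0\<close> and \<open>u2 0\<close> agree with the initial data almost
  everywhere.\<close>

lemma solution_smoothing_scale:
  fixes \<alpha> l \<mu> T :: real
  assumes sol: "weak_solution N D p lam f g u01 u1" "weak_solution N D p lam f g u02 u2"
    and mono: "\<And>r s. \<alpha> * \<bar>r - s\<bar> powr p - l * (r - s)\<^sup>2 \<le> (f r - f s) * (r - s)"
    and const: "\<alpha> > 0" "\<mu> \<ge> 0" "l - lam \<le> \<mu> / 2" and T: "T > 0"
    and u0: "u01 \<in> Lspace M 2" "u02 \<in> Lspace M 2"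
  shows "smoothing_scale (\<lambda>q t. \<integral>\<^sup>+x. ennreal (\<bar>u1 (max 0 t) x - u2 (max 0 t) x\<bar> powr q) \<partial>M) p \<alpha> \<mu> T
    ((Lnorm M 2 (\<lambda>x. u01 x - u02 x))\<^sup>2)"
proof
  let ?Y = "\<lambda>q t. \<integral>\<^sup>+x. ennreal (\<bar>u1 (max 0 t) x - u2 (max 0 t) x\<bar> powr q) \<partial>M"
  have w_cont: "(\<lambda>t x. u1 t x - u2 t x) \<in> cont_L2 M"
    by (intro cont_L2_diff solution_cont[OF sol(1)] solution_cont[OF sol(2)])
  show "?Y q \<in> borel_measurable borel" if "q \<ge> 2" for q
    using cont_L2_nn_integral_borel_measurable[OF w_cont, of "\<lambda>s. \<bar>s\<bar> powr q"] that
    by (simp add: continuous_on_powr' continuous_intros)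
  show "?Y q t + ennreal (q * \<alpha>) * (\<integral>\<^sup>+\<tau>. ?Y (q + p - 2) \<tau> * indicator {s..t} \<tau> \<partial>lborel)
      \<le> ?Y q s + ennreal (q * \<mu> / 2) * (\<integral>\<^sup>+\<tau>. ?Y q \<tau> * indicator {s..t} \<tau> \<partial>lborel)"
    if q: "q \<ge> 2" and st: "0 < s" "s < t" "t \<le> T" for q s t
  proof -
    have eq: "(\<integral>\<^sup>+\<tau>. ?Y r \<tau> * indicator {s..t} \<tau> \<partial>lborel) =
        (\<integral>\<^sup>+\<tau>. (\<integral>\<^sup>+x. ennreal (\<bar>u1 \<tau> x - u2 \<tau> x\<bar> powr r) \<partial>M) \<partial>lebesgue_on {s..t})" for r
      unfolding nn_integral_lebesgue_on_Icc using st by (intro nn_integral_cong) (auto simp: indicator_def)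
    show ?thesis unfolding eq using power_energy[OF sol st(1,2) mono const q] st by simp
  qed
  show "?Y 2 t \<le> ennreal (exp (\<mu> * T) * (Lnorm M 2 (\<lambda>x. u01 x - u02 x))\<^sup>2)" if t: "0 < t" "t \<le> T" for t
  proof -
    have init: "AE x in M. u1 0 x = u01 x" "AE x in M. u2 0 x = u02 x"
      using sol by (auto simp: weak_solution_def)
    have "Lnorm M 2 (\<lambda>x. u1 0 x - u2 0 x) = Lnorm M 2 (\<lambda>x. u01 x - u02 x)"
    proof (rule Lnorm_2_cong_AE)
      show "(\<lambda>x. u1 0 x - u2 0 x) \<in> borel_measurable M" by (rule cont_L2_measurable[OF w_cont]) simp
      show "(\<lambda>x. u01 x - u02 x) \<in> borel_measurable M" by (rule Lspace_2_measurable[OF Lspace_2_diff[OF u0]])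
      show "AE x in M. u1 0 x - u2 0 x = u01 x - u02 x" using init by eventually_elim simp
    qed
    then have "?Y 2 t \<le> ennreal (exp (\<mu> * t) * (Lnorm M 2 (\<lambda>x. u01 x - u02 x))\<^sup>2)"
      using L2_contraction[OF sol mono const t(1)] t by simp
    also have "\<dots> \<le> ennreal (exp (\<mu> * T) * (Lnorm M 2 (\<lambda>x. u01 x - u02 x))\<^sup>2)"
      using t const(2) by (intro ennreal_leI mult_right_mono) (auto intro: mult_left_mono)
    finally show ?thesis .
  qed
qed (use p_gt_2 const T in auto)

end

section \<open>Exponents, weights and constants of the final estimate\<close>

lemma a_seq_qexp: "p > 0 \<Longrightarrow> p * a_seq p (Suc k) = qexp p (Suc k)"
proof (induction k)
  case (Suc k)
  have "p * a_seq p (Suc (Suc k)) = p * a_seq p (Suc k) + (p - 2)"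
    using Suc.prems by (simp add: distrib_left)
  then show ?case using Suc qexp_Suc[of p "Suc k"] by simp
qed (simp add: qexp_def)

text \<open>The recursion for b_k says that a_(k+1) b_(k+1) = a_k b_k + 2/p. Hence the total weight
  b_k p a_k starts at p and grows by 2 in each step.\<close>

lemma b_seq_qexp:
  assumes "p > 2"
  shows "b_seq p (Suc k) * qexp p (Suc k) = p + 2 * real k"
proof (induction k)
  case 0
  then show ?case by (simp add: qexp_def)
next
  case (Suc k)
  have a: "a_seq p (Suc k) = qexp p (Suc k) / p" "a_seq p (Suc (Suc k)) = qexp p (Suc (Suc k)) / p"
    using a_seq_qexp[of p k] a_seq_qexp[of p "Suc k"] assms
    by (simp_all only: eq_divide_eq mult.commute[of p]) auto
  have q: "qexp p (Suc (Suc k)) \<noteq> 0" using qexp_ge_2[OF assms, of "Suc (Suc k)"] by linarith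
  have "b_seq p (Suc (Suc k)) * qexp p (Suc (Suc k)) = b_seq p (Suc k) * qexp p (Suc k) + 2"
    unfolding b_seq.simps a using q assms by (simp add: field_simps)
  then show ?case using Suc.IH by simp
qed

lemma Lspace_cmult:
  assumes "v \<in> Lspace M q"
  shows "(\<lambda>x. c * v x) \<in> Lspace M q"
proof -
  have [measurable]: "v \<in> borel_measurable M" and int: "integrable M (\<lambda>x. \<bar>v x\<bar> powr q)"
    using assms by (auto simp: Lspace_def)
  have "integrable M (\<lambda>x. \<bar>c * v x\<bar> powr q)"
    using integrable_mult_right[OF int, of "\<bar>c\<bar> powr q"] by (simp add: abs_mult powr_mult)
  then show ?thesis unfolding Lspace_def by simp
qed

lemma Lnorm_scaled_powr:
  assumes "q > 0" "s \<ge> 0"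
  shows "Lnorm M q (\<lambda>x. s powr b * v x) powr q = s powr (b * q) * (LINT x|M. \<bar>v x\<bar> powr q)"
proof -
  have "Lnorm M q (\<lambda>x. s powr b * v x) powr q = (LINT x|M. \<bar>s powr b * v x\<bar> powr q)"
    using assms(1) by (simp add: Lnorm_def powr_powr)
  also have "\<dots> = (LINT x|M. s powr (b * q) * \<bar>v x\<bar> powr q)"
    by (simp add: abs_mult powr_mult powr_powr)
  finally show ?thesis by simp
qed

text \<open>The 1 secures positivity; the other two terms bound the integral and the pointwise
  estimate. The powers of T absorb the surplus weights s^(p+k) over s^k and t^(p+k-1) over t^k, and
  2^k undoes the halving of t. The index k - 1 appears because the pointwise bound at exponent
  number k uses the weighted integral of the preceding step.\<close>

definition difference_const :: "real \<Rightarrow> real \<Rightarrow> real \<Rightarrow> real \<Rightarrow> nat \<Rightarrow> real" where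
  "difference_const p \<alpha> \<mu> T k = 1 + smoothing_const p \<alpha> \<mu> T k * T powr (p + real k) +
     2 ^ k * ((1 + qexp p k * \<mu> / 2 * T) * smoothing_const p \<alpha> \<mu> T (k - 1)) * T powr (p + real k - 1)"

lemma difference_const_bounds:
  assumes "p > 2" "\<alpha> > 0" "\<mu> \<ge> 0" "T > 0"
  shows "0 < difference_const p \<alpha> \<mu> T k"
    "smoothing_const p \<alpha> \<mu> T k * T powr (p + real k) \<le> difference_const p \<alpha> \<mu> T k"
    "2 ^ k * ((1 + qexp p k * \<mu> / 2 * T) * smoothing_const p \<alpha> \<mu> T (k - 1)) * T powr (p + real k - 1) \<le> difference_const p \<alpha> \<mu> T k"
proof -
  have "0 \<le> smoothing_const p \<alpha> \<mu> T k * T powr (p + real k)"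
    using smoothing_const_nonneg[OF assms] by simp
  moreover have "0 \<le> 2 ^ k * ((1 + qexp p k * \<mu> / 2 * T) * smoothing_const p \<alpha> \<mu> T (k - 1)) * T powr (p + real k - 1)"
    using smoothing_const_nonneg[OF assms, of "k - 1"] qexp_ge_2[OF assms(1), of k] assms by simp
  ultimately show "0 < difference_const p \<alpha> \<mu> T k"
    "smoothing_const p \<alpha> \<mu> T k * T powr (p + real k) \<le> difference_const p \<alpha> \<mu> T k"
    "2 ^ k * ((1 + qexp p k * \<mu> / 2 * T) * smoothing_const p \<alpha> \<mu> T (k - 1)) * T powr (p + real k - 1) \<le> difference_const p \<alpha> \<mu> T k"
    unfolding difference_const_def by linarith+
qed

context reaction_diffusion
begin

text \<open>Translation of the extended estimates into real integrals. The pointwise bound holds at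
  every time in (0, T], so membership in the L^q space holds there as well; \<open>c\<close> is the
  surplus exponent of the weight in the time integral.\<close>

lemma difference_estimates:
  fixes \<alpha> l \<mu> T :: real
  assumes sol: "weak_solution N D p lam f g u01 u1" "weak_solution N D p lam f g u02 u2"
    and mono: "\<And>r s. \<alpha> * \<bar>r - s\<bar> powr p - l * (r - s)\<^sup>2 \<le> (f r - f s) * (r - s)"
    and const: "\<alpha> > 0" "\<mu> \<ge> 0" "l - lam \<le> \<mu> / 2" and T: "T > 0"
    and u0: "u01 \<in> Lspace M 2" "u02 \<in> Lspace M 2"
  defines "y0 \<equiv> (Lnorm M 2 (\<lambda>x. u01 x - u02 x))\<^sup>2"
  shows "0 < t \<Longrightarrow> t \<le> T \<Longrightarrow> (\<lambda>x. u1 t x - u2 t x) \<in> Lspace M (qexp p (Suc j)) \<and>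
      t ^ Suc j * (LINT x|M. \<bar>u1 t x - u2 t x\<bar> powr qexp p (Suc j)) \<le>
        2 ^ Suc j * ((1 + qexp p (Suc j) * \<mu> / 2 * T) * smoothing_const p \<alpha> \<mu> T j) * y0"
    and "0 \<le> c \<Longrightarrow> integrable (lebesgue_on {0..T}) (\<lambda>s. s powr (c + real k) * (LINT x|M. \<bar>u1 s x - u2 s x\<bar> powr qexp p (Suc k))) \<and>
      (LINT s|lebesgue_on {0..T}. s powr (c + real k) * (LINT x|M. \<bar>u1 s x - u2 s x\<bar> powr qexp p (Suc k))) \<le>
        T powr c * smoothing_const p \<alpha> \<mu> T k * y0"
proof -
  let ?Y = "\<lambda>q t. \<integral>\<^sup>+x. ennreal (\<bar>u1 (max 0 t) x - u2 (max 0 t) x\<bar> powr q) \<partial>M"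
  interpret S: smoothing_scale ?Y p \<alpha> \<mu> T y0
    unfolding y0_def by (rule solution_smoothing_scale[OF sol mono const T u0])
  have w_cont: "(\<lambda>t x. u1 t x - u2 t x) \<in> cont_L2 M"
    by (intro cont_L2_diff solution_cont[OF sol(1)] solution_cont[OF sol(2)])
  have wm: "(\<lambda>x. u1 t x - u2 t x) \<in> borel_measurable M" if "0 \<le> t" for t
    using cont_L2_measurable[OF w_cont that] .
  have Y_real: "enn2real (?Y q t) = (LINT x|M. \<bar>u1 t x - u2 t x\<bar> powr q)" if "0 \<le> t" for q t
  proof -
    have [measurable]: "(\<lambda>x. u1 t x - u2 t x) \<in> borel_measurable M" by (rule wm[OF that])
    have "(LINT x|M. \<bar>u1 t x - u2 t x\<bar> powr q) = enn2real (\<integral>\<^sup>+x. ennreal (\<bar>u1 t x - u2 t x\<bar> powr q) \<partial>M)"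
      by (rule integral_eq_nn_integral) auto
    then show ?thesis using that by simp
  qed
  show "(\<lambda>x. u1 t x - u2 t x) \<in> Lspace M (qexp p (Suc j)) \<and>
      t ^ Suc j * (LINT x|M. \<bar>u1 t x - u2 t x\<bar> powr qexp p (Suc j)) \<le>
        2 ^ Suc j * ((1 + qexp p (Suc j) * \<mu> / 2 * T) * smoothing_const p \<alpha> \<mu> T j) * y0"
    if t: "0 < t" "t \<le> T"
  proof -
    let ?q = "qexp p (Suc j)"
    let ?C = "(1 + ?q * \<mu> / 2 * T) * smoothing_const p \<alpha> \<mu> T j * y0"
    have C0: "0 \<le> ?C"
      using qexp_ge_2[OF p_gt_2, of "Suc j"] const(2) T S.A_nonneg[of j] S.y0 by simp
    have b: "ennreal ((t / 2) ^ Suc j) * ?Y ?q t \<le> ennreal ?C" by (rule S.pointwise_bound[OF t])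
    have pos: "(t / 2) ^ Suc j > 0" using t by simp
    have Yb: "?Y ?q t \<le> ennreal (?C / (t / 2) ^ Suc j)" by (rule ennreal_cmult_le_iff_divide[OF pos C0 b])
    have [measurable]: "(\<lambda>x. u1 t x - u2 t x) \<in> borel_measurable M" by (rule wm) (use t in simp)
    have "(\<integral>\<^sup>+x. ennreal (norm (\<bar>u1 t x - u2 t x\<bar> powr ?q)) \<partial>M) < \<infinity>"
      using Yb t by (simp add: order_le_less_trans)
    then have "(\<lambda>x. u1 t x - u2 t x) \<in> Lspace M ?q"
      unfolding Lspace_def by (auto simp: integrable_iff_bounded)
    moreover have "enn2real (?Y ?q t) \<le> ?C / (t / 2) ^ Suc j"
      using Yb C0 pos by (intro enn2real_leI) auto
    then have "(LINT x|M. \<bar>u1 t x - u2 t x\<bar> powr ?q) \<le> ?C / (t / 2) ^ Suc j"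
      using Y_real[of t ?q] t by simp
    then have "(t / 2) ^ Suc j * (LINT x|M. \<bar>u1 t x - u2 t x\<bar> powr ?q) \<le> ?C"
      using pos by (simp only: pos_le_divide_eq mult.commute)
    then have "2 ^ Suc j * ((t / 2) ^ Suc j * (LINT x|M. \<bar>u1 t x - u2 t x\<bar> powr ?q)) \<le> 2 ^ Suc j * ?C"
      by (rule mult_left_mono) simp
    then have "t ^ Suc j * (LINT x|M. \<bar>u1 t x - u2 t x\<bar> powr ?q) \<le> 2 ^ Suc j * ?C"
      by (simp only: power_divide mult.assoc[symmetric]) simp
    ultimately show ?thesis by (simp only: mult.assoc)
  qed
  show "integrable (lebesgue_on {0..T}) (\<lambda>s. s powr (c + real k) * (LINT x|M. \<bar>u1 s x - u2 s x\<bar> powr qexp p (Suc k))) \<and>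
      (LINT s|lebesgue_on {0..T}. s powr (c + real k) * (LINT x|M. \<bar>u1 s x - u2 s x\<bar> powr qexp p (Suc k))) \<le>
        T powr c * smoothing_const p \<alpha> \<mu> T k * y0"
    if c: "0 \<le> c"
  proof -
    let ?q = "qexp p (Suc k)" and ?L = "lebesgue_on {0..T}"
    let ?G = "\<lambda>s. s powr (c + real k) * (LINT x|M. \<bar>u1 s x - u2 s x\<bar> powr ?q)"
    have G0: "0 \<le> ?G s" for s by (intro mult_nonneg_nonneg Bochner_Integration.integral_nonneg) auto
    have "(\<lambda>s. s powr (c + real k) * enn2real (?Y ?q s)) \<in> borel_measurable borel"
      using S.Y_qexp_measurable[of "Suc k"] by measurable
    then have "(\<lambda>s. s powr (c + real k) * enn2real (?Y ?q s)) \<in> borel_measurable ?L"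
      by (intro measurable_restrict_space1 measurable_completion) simp
    then have Gm: "?G \<in> borel_measurable ?L"
    proof (rule measurable_cong[THEN iffD1, rotated])
      fix s assume "s \<in> space ?L"
      then have "0 \<le> s" by simp
      show "s powr (c + real k) * enn2real (?Y ?q s) = ?G s" unfolding Y_real[OF \<open>0 \<le> s\<close>] ..
    qed
    have "(\<integral>\<^sup>+s. ennreal (?G s) \<partial>?L) \<le> (\<integral>\<^sup>+s. ennreal (T powr c) * (ennreal (s ^ k) * ?Y ?q s) \<partial>?L)"
    proof (rule nn_integral_mono)
      fix s assume "s \<in> space ?L"
      then have s: "0 \<le> s" "s \<le> T" by auto
      have "s powr (c + real k) \<le> T powr c * s ^ k"
      proof (cases "s = 0")
        case False
        then have "s powr (c + real k) = s powr c * s ^ k" using s by (simp add: powr_add powr_realpow)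
        also have "\<dots> \<le> T powr c * s ^ k" using s c by (intro mult_right_mono powr_mono2) auto
        finally show ?thesis .
      qed simp
      then have "ennreal (?G s) \<le> ennreal (T powr c * s ^ k * (LINT x|M. \<bar>u1 s x - u2 s x\<bar> powr ?q))"
        by (intro ennreal_leI mult_right_mono Bochner_Integration.integral_nonneg) auto
      also have "\<dots> = ennreal (T powr c) * (ennreal (s ^ k) * ennreal (enn2real (?Y ?q s)))"
        unfolding Y_real[OF s(1)] using s by (simp add: ennreal_mult mult.assoc)
      \<comment> \<open>The real integral is 0 where the extended one is infinite, so only an
        inequality holds here, and it is the direction required.\<close>
      also have "\<dots> \<le> ennreal (T powr c) * (ennreal (s ^ k) * ?Y ?q s)"
        by (intro mult_left_mono) (auto simp: ennreal_enn2real_if)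
      finally show "ennreal (?G s) \<le> ennreal (T powr c) * (ennreal (s ^ k) * ?Y ?q s)" .
    qed
    also have "\<dots> = (\<integral>\<^sup>+s. ennreal (T powr c) * (ennreal (s ^ k) * ?Y ?q s * indicator {0..T} s) \<partial>lborel)"
      unfolding nn_integral_lebesgue_on_Icc by (simp only: mult.assoc)
    also have "\<dots> = ennreal (T powr c) * (\<integral>\<^sup>+s. ennreal (s ^ k) * ?Y ?q s * indicator {0..T} s \<partial>lborel)"
      using S.Y_qexp_measurable[of "Suc k"] by (intro nn_integral_cmult) measurable
    also have "\<dots> \<le> ennreal (T powr c) * ennreal (smoothing_const p \<alpha> \<mu> T k * y0)"
      by (intro mult_left_mono S.weighted_integral_bound) simp
    also have "\<dots> = ennreal (T powr c * smoothing_const p \<alpha> \<mu> T k * y0)"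
      using S.A_nonneg[of k] S.y0 by (simp add: ennreal_mult[symmetric] mult.assoc)
    finally have le: "(\<integral>\<^sup>+s. ennreal (?G s) \<partial>?L) \<le> ennreal (T powr c * smoothing_const p \<alpha> \<mu> T k * y0)" .
    then have Gi: "integrable ?L ?G"
      using Gm G0 by (auto simp: integrable_iff_bounded order_le_less_trans[OF le] simp del: ennreal_mult'')
    have "ennreal (LINT s|?L. ?G s) = (\<integral>\<^sup>+s. ennreal (?G s) \<partial>?L)"
      using G0 by (intro nn_integral_eq_integral[symmetric] Gi) auto
    then have "ennreal (LINT s|?L. ?G s) \<le> ennreal (T powr c * smoothing_const p \<alpha> \<mu> T k * y0)" using le by simp
    then have "(LINT s|?L. ?G s) \<le> T powr c * smoothing_const p \<alpha> \<mu> T k * y0"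
      using S.A_nonneg[of k] S.y0 by (subst (asm) ennreal_le_iff) auto
    then show ?thesis using Gi by blast
  qed
qed

end

theorem theorem3p4:
  fixes p \<alpha>1 \<mu> T :: real
  assumes "p > 2" and "\<alpha>1 > 0" and "T > 0"
  shows "\<exists>C :: nat \<Rightarrow> real. (\<forall>k\<ge>1. C k > 0) \<and>
    (\<forall>(N::nat) D lam g f l \<kappa> \<alpha> \<beta> \<sigma> f1 f2 \<sigma>1 l2 \<kappa>2 \<alpha>2 \<beta>2 \<sigma>2 u01 u02 u1 u2.
       N \<ge> 1 \<longrightarrow> bounded_smooth_domain N D \<longrightarrow> lam > 0 \<longrightarrow> g \<in> Lspace (leb N D) 2 \<longrightarrow>
       growth_conditions p l \<kappa> \<alpha> \<beta> \<sigma> f \<longrightarrow>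
       decomposition p \<alpha>1 \<sigma>1 l2 \<kappa>2 \<alpha>2 \<beta>2 \<sigma>2 f f1 f2 \<longrightarrow>
       \<mu> = max (2 * (l2 - lam)) 1 \<longrightarrow>
       u01 \<in> Lspace (leb N D) 2 \<longrightarrow> u02 \<in> Lspace (leb N D) 2 \<longrightarrow>
       weak_solution N D p lam f g u01 u1 \<longrightarrow> weak_solution N D p lam f g u02 u2 \<longrightarrow>
       (\<forall>k\<ge>1.
          (\<forall>t\<in>{0<..T}.
             (\<lambda>x. t powr b_seq p k * (u1 t x - u2 t x)) \<in> Lspace (leb N D) (p * a_seq p k) \<and>
             t * Lnorm (leb N D) (p * a_seq p k) (\<lambda>x. t powr b_seq p k * (u1 t x - u2 t x))
                   powr (p * a_seq p k)
               \<le> C k * (Lnorm (leb N D) 2 (\<lambda>x. u01 x - u02 x))\<^sup>2) \<and>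
          integrable (lebesgue_on {0..T})
            (\<lambda>s. Lnorm (leb N D) (p * a_seq p (k + 1))
                   (\<lambda>x. s powr b_seq p (k + 1) * (u1 s x - u2 s x)) powr (p * a_seq p (k + 1))) \<and>
          (LINT s|lebesgue_on {0..T}.
              Lnorm (leb N D) (p * a_seq p (k + 1))
                (\<lambda>x. s powr b_seq p (k + 1) * (u1 s x - u2 s x)) powr (p * a_seq p (k + 1)))
            \<le> C k * (Lnorm (leb N D) 2 (\<lambda>x. u01 x - u02 x))\<^sup>2))"
proof (intro exI[of _ "difference_const p \<alpha>1 (max \<mu> 0) T"] conjI allI impI)
  fix k :: nat
  \<comment> \<open>Positivity is asked for before \<open>\<mu>\<close> is linked to the data, hence
    the constant is formed with \<open>max \<mu> 0\<close>.\<close>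
  show "0 < difference_const p \<alpha>1 (max \<mu> 0) T k"
    using assms by (intro difference_const_bounds) auto
next
  fix N :: nat and D lam g f l \<kappa> \<alpha> \<beta> \<sigma> f1 f2 \<sigma>1 l2 \<kappa>2 \<alpha>2 \<beta>2 \<sigma>2 u01 u02 u1 u2 and k :: nat
  assume D: "bounded_smooth_domain N D" and g: "g \<in> Lspace (leb N D) 2"
    and gc: "growth_conditions p l \<kappa> \<alpha> \<beta> \<sigma> f" and dec: "decomposition p \<alpha>1 \<sigma>1 l2 \<kappa>2 \<alpha>2 \<beta>2 \<sigma>2 f f1 f2"
    and mu: "\<mu> = max (2 * (l2 - lam)) 1"
    and u0: "u01 \<in> Lspace (leb N D) 2" "u02 \<in> Lspace (leb N D) 2"
    and sol: "weak_solution N D p lam f g u01 u1" "weak_solution N D p lam f g u02 u2" and k: "1 \<le> k"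
  interpret reaction_diffusion N D p lam \<sigma> f g
    by (rule reaction_diffusion_intro[OF assms(1) D g gc])
  \<comment> \<open>With \<mu> equal to the maximum in the hypothesis it is at least 1, so the
    truncation at 0 has no effect from here on.\<close>
  have \<mu>: "max \<mu> 0 = \<mu>" "\<mu> \<ge> 0" "l2 - lam \<le> \<mu> / 2" using mu by auto
  let ?y0 = "(Lnorm (leb N D) 2 (\<lambda>x. u01 x - u02 x))\<^sup>2"
  let ?C = "difference_const p \<alpha>1 \<mu> T"
  note est = difference_estimates[OF sol decomposition_monotone[OF assms(1) dec] assms(2) \<mu>(2,3) assms(3) u0]
  note C = difference_const_bounds[OF assms(1,2) \<mu>(2) assms(3)]
  obtain j where j: "k = Suc j" using k by (cases k) auto
  have q: "p * a_seq p k = qexp p k" "p * a_seq p (k + 1) = qexp p (Suc k)"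
    using a_seq_qexp[of p j] a_seq_qexp[of p k] assms(1) j by auto
  have q0: "qexp p r > 0" for r using qexp_ge_2[OF assms(1), of r] by linarith
  have b: "b_seq p k * qexp p k = p + 2 * real j" "b_seq p (k + 1) * qexp p (Suc k) = p + 2 * real k"
    using b_seq_qexp[OF assms(1), of j] b_seq_qexp[OF assms(1), of k] j by auto
  show "\<forall>t\<in>{0<..T}. (\<lambda>x. t powr b_seq p k * (u1 t x - u2 t x)) \<in> Lspace (leb N D) (p * a_seq p k) \<and>
     t * Lnorm (leb N D) (p * a_seq p k) (\<lambda>x. t powr b_seq p k * (u1 t x - u2 t x)) powr (p * a_seq p k)
       \<le> difference_const p \<alpha>1 (max \<mu> 0) T k * ?y0"
  proof
    fix t assume "t \<in> {0<..T}"
    then have t': "0 < t" "t \<le> T" by auto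
    let ?I = "LINT x|leb N D. \<bar>u1 t x - u2 t x\<bar> powr qexp p k"
    have e: "(\<lambda>x. u1 t x - u2 t x) \<in> Lspace (leb N D) (qexp p k)"
      "t ^ k * ?I \<le> 2 ^ k * ((1 + qexp p k * \<mu> / 2 * T) * smoothing_const p \<alpha>1 \<mu> T (k - 1)) * ?y0"
      using est(1)[OF t', of j] j by auto
    have I0: "0 \<le> ?I" by (intro Bochner_Integration.integral_nonneg) simp
    have mem: "(\<lambda>x. t powr b_seq p k * (u1 t x - u2 t x)) \<in> Lspace (leb N D) (qexp p k)"
      by (rule Lspace_cmult[OF e(1)])
    have "t * Lnorm (leb N D) (qexp p k) (\<lambda>x. t powr b_seq p k * (u1 t x - u2 t x)) powr qexp p k = t * (t powr (p + 2 * real j) * ?I)"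
      using Lnorm_scaled_powr[OF q0, of t "leb N D" k] t' by (simp add: b)
    \<comment> \<open>With k = j + 1 the total power is 1 + p + 2j = (p + k - 1) + k: the last k
      powers belong to the pointwise bound, the others are at most a power of T.\<close>
    also have "t * (t powr (p + 2 * real j) * ?I) = t powr (p + real k - 1) * (t ^ k * ?I)"
    proof -
      have "t * t powr (p + 2 * real j) = t powr (p + real k - 1) * t ^ k"
        using t' j by (simp add: powr_realpow[symmetric] powr_add[symmetric] powr_mult_base add_ac del: power_Suc)
      then show ?thesis by (simp add: mult.assoc[symmetric])
    qed
    also have "\<dots> \<le> T powr (p + real k - 1) * (t ^ k * ?I)"
      using t' assms(1) I0 by (intro mult_right_mono powr_mono2) auto
    also have "\<dots> \<le> T powr (p + real k - 1) * (2 ^ k * ((1 + qexp p k * \<mu> / 2 * T) * smoothing_const p \<alpha>1 \<mu> T (k - 1)) * ?y0)"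
      using e(2) by (rule mult_left_mono) simp
    also have "\<dots> = (2 ^ k * ((1 + qexp p k * \<mu> / 2 * T) * smoothing_const p \<alpha>1 \<mu> T (k - 1)) * T powr (p + real k - 1)) * ?y0"
      by (simp only: mult_ac)
    also have "\<dots> \<le> ?C k * ?y0" by (rule mult_right_mono[OF C(3)]) simp
    finally show "(\<lambda>x. t powr b_seq p k * (u1 t x - u2 t x)) \<in> Lspace (leb N D) (p * a_seq p k) \<and>
      t * Lnorm (leb N D) (p * a_seq p k) (\<lambda>x. t powr b_seq p k * (u1 t x - u2 t x)) powr (p * a_seq p k)
        \<le> difference_const p \<alpha>1 (max \<mu> 0) T k * ?y0"
      using mem unfolding q \<mu>(1) by blast
  qed
  let ?G = "\<lambda>s. Lnorm (leb N D) (p * a_seq p (k + 1)) (\<lambda>x. s powr b_seq p (k + 1) * (u1 s x - u2 s x)) powr (p * a_seq p (k + 1))"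
  \<comment> \<open>The weight p + 2k is written as (p + k) + k: the surplus p + k plays the role of
    \<open>c\<close> in \<open>difference_estimates\<close>.\<close>
  let ?H = "\<lambda>s. s powr ((p + real k) + real k) * (LINT x|leb N D. \<bar>u1 s x - u2 s x\<bar> powr qexp p (Suc k))"
  have GH: "?G s = ?H s" if "s \<in> space (lebesgue_on {0..T})" for s
    using Lnorm_scaled_powr[OF q0, of s "leb N D" "Suc k"] that unfolding q by (simp add: b(2)[simplified] add.assoc)
  have pk: "0 \<le> p + real k" using assms(1) by simp
  have "integrable (lebesgue_on {0..T}) ?G = integrable (lebesgue_on {0..T}) ?H"
    by (rule Bochner_Integration.integrable_cong[OF refl GH])
  then show "integrable (lebesgue_on {0..T}) ?G" using est(2)[OF pk, of k] by blast
  have "(LINT s|lebesgue_on {0..T}. ?G s) = (LINT s|lebesgue_on {0..T}. ?H s)"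
    by (rule Bochner_Integration.integral_cong[OF refl GH])
  also have "\<dots> \<le> T powr (p + real k) * smoothing_const p \<alpha>1 \<mu> T k * ?y0" using est(2)[OF pk, of k] by blast
  also have "\<dots> = (smoothing_const p \<alpha>1 \<mu> T k * T powr (p + real k)) * ?y0" by (simp only: mult_ac)
  also have "\<dots> \<le> ?C k * ?y0" by (rule mult_right_mono[OF C(2)]) simp
  finally show "(LINT s|lebesgue_on {0..T}. ?G s) \<le> difference_const p \<alpha>1 (max \<mu> 0) T k * ?y0" unfolding \<mu>(1) .
qed

end
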